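(* Let $\Xi=(\mathbb X,\rho,\mu^*,\{\lambda_j\},\{\phi_j\})$ be a data-defined space with exponent $q$. Let $\{Y_n\}_{n\ge1}$ be a sequence of finite subsets $Y_n=\{y_{j,n}\}_{j=1}^{M_n}\subset\mathbb X$ with minimal separation $\eta_n=\min_{x,y\in Y_n,\ x\ne y}\rho(x,y)$. Let $1\le p\le\infty$, let $L_1,\dots,L_R$ be linear operators satisfying assumptions (i)–(iv) of the context for $Y=Y_n$ (with orders $q_1,\dots,q_R\ge0$), let $\beta>\max_{1\le k\le R}q_k+q/p$, and let $b$ be a mask of type $\beta$. Then there exist an integer $N^*$ with $N^*\sim\eta_n^{-1}$ and a mapping $\mathbf P^*:W_{p,b}\to\Pi_{N^*}$ such that for every $f\in W_{p,b}$, $$L_k(\mathbf P^*(f))(y_{j,n})=L_k(f)(y_{j,n}),\qquad j=1,\dots,M_n,\ k=1,\dots,R,$$ and $$\|f-\mathbf P^*(f)\|_{W_{p,b}}\le c\,\inf\{\|f-T\|_{W_{p,b}}: T\in\Pi_{N^*}\}.$$ In particular, there exists $\mathbf P=\mathbf P_n:W_{p,b}\to\Pi_{N^*}$, with $\mathbf P(f)$ a solution of the following minimization problem, such that $$\|\mathbf P(f)\|_{W_{p,b}}=\min\{\|P\|_{W_{p,b}}: P\in\Pi_{N^*},\ L_k(P)(y_{\ell,n})=L_k(f)(y_{\ell,n}),\ \ell=1,\dots,M_n,\ k=1,\dots,R\}.$$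
   Context: Data-defined space: $\mathbb X$ is a non-empty set with a metric $\rho$; $\mu^*$ is a complete positive Borel measure with $\mu^*(\mathbb X)=1$; $0=\lambda_0\le\lambda_1\le\cdots$ with $\lambda_k\uparrow\infty$; $\{\phi_k\}_{k\ge0}$ are real-valued, continuous, bounded, integrable functions on $\mathbb X$, orthonormal with respect to $\mu^*$, with $\phi_0\equiv1$. Write $\mathbb B(x,r)=\{y\in\mathbb X:\rho(x,y)<r\}$. It is assumed that: (1) for each $x\in\mathbb X$, $r>0$, the ball $\mathbb B(x,r)$ is compact; (2) there are $q>0$, $\kappa_2>0$ with $\mu^*(\mathbb B(x,r))\le\kappa_2r^q$ for all $x\in\mathbb X$, $r>0$; (3) the series $K_t(x,y)=\sum_{k=0}^\infty \exp(-\lambda_k^2t)\phi_k(x)\phi_k(y)$ converges for all $t\in(0,1]$, $x,y\in\mathbb X$, and there are $\kappa_3,\kappa_4>0$ with $|K_t(x,y)|\le\kappa_3t^{-q/2}\exp(-\kappa_4\rho(x,y)^2/t)$ for $x,y\in\mathbb X$, $0<t\le1$. $L^p=L^p(\mu^* )$ with norm $\|\cdot\|_p$; $\hat f(k)=\int_{\mathbb X}f\phi_k\,d\mu^*$; $\Pi_n=\mathrm{span}\{\phi_k:\lambda_k<n\}$ for $n>0$. Mask of type $\beta\in\mathbb R$: an even function $b:\mathbb R\to\mathbb R$, $S+1$ times continuously differentiable (for some fixed integer $S>q$), such that for $t>0$, $b(t)=(1+t)^{-\beta}F_b(\log t)$ for some $F_b:\mathbb R\to\mathbb R$ with $|F_b^{(k)}(t)|\le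 c(b)$, $t\in\mathbb R$, $k=0,\dots,S+1$, and $F_b(t)\ge c_1(b)$, $t\in\mathbb R$, where $c(b),c_1(b)$ are positive constants. Sobolev class: for a mask $b$, $f\in L^p$ belongs to $W_{p,b}$ if there is $f^{(b)}\in L^p$ with $b(\lambda_k)\widehat{f^{(b)}}(k)=\hat f(k)$ for all $k\ge0$; $\|f\|_{W_{p,b}}=\|f^{(b)}\|_p$. Assumptions on linear operators $L_1,\dots,L_R$ relative to a finite set $Y=\{y_1,\dots,y_M\}\subset\mathbb X$ with minimal separation $\eta$ (notation: $L_{k,1}F(x,y)=(L_k(F(\cdot,y)))(x)$): (i) $L_k$ is closed: if $f_m\to f$ in $L^p$ and $L_k(f_m)\to g$ in $L^p$, then $f$ is in the domain of $L_k$ and $L_k(f)=g$. (ii) $L_k$ is local: if $f(x)=0$ for almost all $x$ in an open set $U\subset\mathbb X$, then $L_k(f)(x)=0$ for almost all $x\in U$. (iii) There is $q_k\ge0$ with $|L_{k,1}K_t(x,y)|\le c\,t^{-(q+q_k)/2}\exp(-c_1\rho(x,y)^2/t)$ for $x,y\in\mathbb X$, $0<t\le1$. (iv) For each $k=1,\dots,R$, $j=1,\dots,M$ there is $\phi_{k,j}\in W_{p,b}$ such that: (a) $L_i(\phi_{k,j})=0$ for $i\ne k$, $i=1,\dots,R$; (b) for $i=1,\dots,R$, $\ell=1,\dots,M$, $L_i(\phi_{k,j})(y_\ell)=1$ if $i=k$, $j=\ell$, and $=0$ otherwise; (c) $\phi_{k,j}$ and $\phi_{k,j}^{(b)}$ are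 both supported on a neighborhood of $y_j$ with diameter $\le\eta/3$; (d) $\|\phi_{k,j}^{(b)}\|_\infty\le c\,\eta^{q_k-\beta}$. Constants: $c,c_1,\dots$ are generic positive constants, independent of obvious variables such as $n$, $\eta_n$ and the target function $f$, with values possibly different at different occurrences; $A\sim B$ means $c_1A\le B\le c_2A$. *)

theory Defs
  imports "HOL-Probability.Probability"
begin

section \<open>\<open>L\<^sup>p\<close>-spaces, \<open>1 \<le> p \<le> \<infinity>\<close>\<close>

text \<open>
  Members of \<open>L\<^sup>p\<close> are represented by measurable functions; everything below that is meant for
  classes is invariant under changes on null sets.
\<close>

definition Lp_space :: "'a measure \<Rightarrow> ereal \<Rightarrow> ('a \<Rightarrow> real) set" where
  "Lp_space M p =
     {f \<in> borel_measurable M.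
        if p = \<infinity> then esssup M (\<lambda>x. ereal \<bar>f x\<bar>) < \<infinity>
        else integrable M (\<lambda>x. \<bar>f x\<bar> powr real_of_ereal p)}"

text \<open>Meaningful on \<^const>\<open>Lp_space\<close> only: outside of it the value is a junk real number.\<close>

definition Lp_norm :: "'a measure \<Rightarrow> ereal \<Rightarrow> ('a \<Rightarrow> real) \<Rightarrow> real" where
  "Lp_norm M p f =
     (if p = \<infinity> then real_of_ereal (esssup M (\<lambda>x. ereal \<bar>f x\<bar>))
      else (\<integral>x. \<bar>f x\<bar> powr real_of_ereal p \<partial>M) powr (1 / real_of_ereal p))"


section \<open>Data-defined spaces\<close>

definition heat_kernel :: "(nat \<Rightarrow> real) \<Rightarrow> (nat \<Rightarrow> 'a \<Rightarrow> real) \<Rightarrow> real \<Rightarrow> 'a \<Rightarrow> 'a \<Rightarrow> real" where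
  "heat_kernel lam \<phi> t x y = (\<Sum>k. exp (- (lam k)\<^sup>2 * t) * \<phi> k x * \<phi> k y)"

text \<open>
  A complete Borel measure is read as the completion of a measure on the Borel sets. Completeness
  alone would also admit proper extensions beyond the completion, with classes in \<open>L\<^sup>p\<close> that contain
  no Borel function. Compactness of balls is required of their closures. This is implied by
  compactness of the open balls themselves, a condition which fails for connected spaces
  such as manifolds; it amounts to compactness of all closed balls.
\<close>

locale data_defined_space = prob_space M
  for M :: "'a::metric_space measure"
    and lam :: "nat \<Rightarrow> real"
    and \<phi> :: "nat \<Rightarrow> 'a \<Rightarrow> real"
    and q :: real +
  assumes complete_borel: "\<exists>N. sets N = sets borel \<and> M = completion N"
    and lam_0: "lam 0 = 0"
    and lam_mono: "mono lam"
    and lam_unbounded: "filterlim lam at_top sequentially"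
    and phi_continuous: "\<And>k. continuous_on UNIV (\<phi> k)"
    and phi_bounded: "\<And>k. bounded (range (\<phi> k))"
    and phi_integrable: "\<And>k. integrable M (\<phi> k)"
    and phi_orthonormal: "\<And>j k. (\<integral>x. \<phi> j x * \<phi> k x \<partial>M) = (if j = k then 1 else 0)"
    and phi_0: "\<And>x. \<phi> 0 x = 1"
    and balls_compact: "\<And>(x::'a) r. 0 < r \<Longrightarrow> compact (closure (ball x r))"
    and q_pos: "0 < q"
    and ball_measure: "\<exists>\<kappa>\<^sub>2>0. \<forall>x. \<forall>r>0. measure M (ball x r) \<le> \<kappa>\<^sub>2 * r powr q"
    and heat_kernel_summable:
      "\<And>t x y. 0 < t \<Longrightarrow> t \<le> 1 \<Longrightarrow> summable (\<lambda>k. exp (- (lam k)\<^sup>2 * t) * \<phi> k x * \<phi> k y)"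
    and heat_kernel_bound:
      "\<exists>\<kappa>\<^sub>3>0. \<exists>\<kappa>\<^sub>4>0. \<forall>x y. \<forall>t. 0 < t \<and> t \<le> 1 \<longrightarrow>
         \<bar>heat_kernel lam \<phi> t x y\<bar> \<le> \<kappa>\<^sub>3 * t powr (- q / 2) * exp (- \<kappa>\<^sub>4 * (dist x y)\<^sup>2 / t)"

definition fourier_coeff :: "'a measure \<Rightarrow> (nat \<Rightarrow> 'a \<Rightarrow> real) \<Rightarrow> ('a \<Rightarrow> real) \<Rightarrow> nat \<Rightarrow> real" where
  "fourier_coeff M \<phi> f k = (\<integral>x. f x * \<phi> k x \<partial>M)"

text \<open>The space \<open>\<Pi>\<^sub>n = span {\<phi>\<^sub>k. \<lambda>\<^sub>k < n}\<close>; the index set is finite because \<open>\<lambda>\<^sub>k \<rightarrow> \<infinity>\<close>.\<close>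

definition diffusion_polys :: "(nat \<Rightarrow> real) \<Rightarrow> (nat \<Rightarrow> 'a \<Rightarrow> real) \<Rightarrow> real \<Rightarrow> ('a \<Rightarrow> real) set" where
  "diffusion_polys lam \<phi> n = {\<lambda>x. \<Sum>k | lam k < n. a k * \<phi> k x | a. True}"


section \<open>Masks and Sobolev classes\<close>

definition cont_diff :: "nat \<Rightarrow> (real \<Rightarrow> real) \<Rightarrow> bool" where
  "cont_diff m f \<longleftrightarrow>
     (\<forall>k<m. \<forall>x. ((deriv ^^ k) f) differentiable (at x)) \<and> continuous_on UNIV ((deriv ^^ m) f)"

definition mask_of_type :: "nat \<Rightarrow> real \<Rightarrow> (real \<Rightarrow> real) \<Rightarrow> bool" where
  "mask_of_type S \<beta> b \<longleftrightarrow>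
     (\<forall>t. b (- t) = b t) \<and> cont_diff (S + 1) b \<and>
     (\<exists>F. (\<forall>t>0. b t = (1 + t) powr (- \<beta>) * F (ln t)) \<and> cont_diff (S + 1) F \<and>
          (\<exists>c>0. \<forall>k\<le>S + 1. \<forall>t. \<bar>(deriv ^^ k) F t\<bar> \<le> c) \<and>
          (\<exists>c\<^sub>1>0. \<forall>t. c\<^sub>1 \<le> F t))"

definition is_sobolev_deriv ::
  "'a measure \<Rightarrow> (nat \<Rightarrow> real) \<Rightarrow> (nat \<Rightarrow> 'a \<Rightarrow> real) \<Rightarrow> ereal \<Rightarrow> (real \<Rightarrow> real)
    \<Rightarrow> ('a \<Rightarrow> real) \<Rightarrow> ('a \<Rightarrow> real) \<Rightarrow> bool" where
  "is_sobolev_deriv M lam \<phi> p b f g \<longleftrightarrow>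
     g \<in> Lp_space M p \<and>
     (\<forall>k. b (lam k) * fourier_coeff M \<phi> g k = fourier_coeff M \<phi> f k)"

definition sobolev_space ::
  "'a measure \<Rightarrow> (nat \<Rightarrow> real) \<Rightarrow> (nat \<Rightarrow> 'a \<Rightarrow> real) \<Rightarrow> ereal \<Rightarrow> (real \<Rightarrow> real) \<Rightarrow> ('a \<Rightarrow> real) set" where
  "sobolev_space M lam \<phi> p b =
     {f \<in> Lp_space M p. \<exists>g. is_sobolev_deriv M lam \<phi> p b f g}"

text \<open>
  The function \<open>f\<^sup>(\<^sup>b\<^sup>)\<close>. A mask does not vanish on the \<open>\<lambda>\<^sub>k\<close> and, in a data-defined space, a function
  in \<open>L\<^sup>1\<close> is determined almost everywhere by its coefficients, so the choice is unique up to a null set.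
\<close>

definition sobolev_deriv ::
  "'a measure \<Rightarrow> (nat \<Rightarrow> real) \<Rightarrow> (nat \<Rightarrow> 'a \<Rightarrow> real) \<Rightarrow> ereal \<Rightarrow> (real \<Rightarrow> real)
    \<Rightarrow> ('a \<Rightarrow> real) \<Rightarrow> ('a \<Rightarrow> real)" where
  "sobolev_deriv M lam \<phi> p b f = (SOME g. is_sobolev_deriv M lam \<phi> p b f g)"

definition sobolev_norm ::
  "'a measure \<Rightarrow> (nat \<Rightarrow> real) \<Rightarrow> (nat \<Rightarrow> 'a \<Rightarrow> real) \<Rightarrow> ereal \<Rightarrow> (real \<Rightarrow> real)
    \<Rightarrow> ('a \<Rightarrow> real) \<Rightarrow> real" where
  "sobolev_norm M lam \<phi> p b f = Lp_norm M p (sobolev_deriv M lam \<phi> p b f)"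


section \<open>Operators\<close>

text \<open>
  An operator is a pair of a domain \<open>D\<close> and a map \<open>L\<close>, which acts on classes of functions.
\<close>

definition Lp_linear_operator ::
  "'a measure \<Rightarrow> ereal \<Rightarrow> ('a \<Rightarrow> real) set \<Rightarrow> (('a \<Rightarrow> real) \<Rightarrow> 'a \<Rightarrow> real) \<Rightarrow> bool" where
  "Lp_linear_operator M p D L \<longleftrightarrow>
     D \<subseteq> Lp_space M p \<and> (\<forall>f\<in>D. L f \<in> Lp_space M p) \<and>
     (\<lambda>x. 0) \<in> D \<and>
     (\<forall>f\<in>D. \<forall>g\<in>D. \<forall>a c. (\<lambda>x. a * f x + c * g x) \<in> D \<and>
        (AE x in M. L (\<lambda>x. a * f x + c * g x) x = a * L f x + c * L g x)) \<and>
     (\<forall>f\<in>D. \<forall>g\<in>Lp_space M p. (AE x in M. f x = g x) \<longrightarrow>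
        g \<in> D \<and> (AE x in M. L f x = L g x))"

definition closed_operator ::
  "'a measure \<Rightarrow> ereal \<Rightarrow> ('a \<Rightarrow> real) set \<Rightarrow> (('a \<Rightarrow> real) \<Rightarrow> 'a \<Rightarrow> real) \<Rightarrow> bool" where
  "closed_operator M p D L \<longleftrightarrow>
     (\<forall>F. \<forall>f\<in>Lp_space M p. \<forall>g\<in>Lp_space M p.
        (\<forall>m::nat. F m \<in> D) \<and>
        (\<lambda>m. Lp_norm M p (\<lambda>x. F m x - f x)) \<longlonglongrightarrow> 0 \<and>
        (\<lambda>m. Lp_norm M p (\<lambda>x. L (F m) x - g x)) \<longlonglongrightarrow> 0
        \<longrightarrow> f \<in> D \<and> (AE x in M. L f x = g x))"

definition local_operator ::
  "'a::topological_space measure \<Rightarrow> ('a \<Rightarrow> real) set \<Rightarrow> (('a \<Rightarrow> real) \<Rightarrow> 'a \<Rightarrow> real) \<Rightarrow> bool" where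
  "local_operator M D L \<longleftrightarrow>
     (\<forall>f\<in>D. \<forall>U. open U \<and> (AE x in M. x \<in> U \<longrightarrow> f x = 0) \<longrightarrow> (AE x in M. x \<in> U \<longrightarrow> L f x = 0))"

text \<open>
  The value \<open>v\<close> at the point \<open>x\<close> of a class \<open>h\<close> is that of its continuous representative. The latter
  is unique in a data-defined space, as all balls have positive measure: \<open>\<phi>\<^sub>0 = 1\<close> gives
  \<open>\<integral> K\<^sub>t(x,y) d\<mu>(y) = 1\<close>, whereas the Gaussian bound would make this integral tend to 0
  if some ball around \<open>x\<close> were a null set.
\<close>

definition has_value_at :: "'a::topological_space measure \<Rightarrow> ('a \<Rightarrow> real) \<Rightarrow> 'a \<Rightarrow> real \<Rightarrow> bool" where
  "has_value_at M h x v \<longleftrightarrow>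
     (\<exists>g. continuous_on UNIV g \<and> (AE z in M. h z = g z) \<and> g x = v)"

definition kernel_bound_operator ::
  "'a::metric_space measure \<Rightarrow> (nat \<Rightarrow> real) \<Rightarrow> (nat \<Rightarrow> 'a \<Rightarrow> real) \<Rightarrow> real
    \<Rightarrow> ('a \<Rightarrow> real) set \<Rightarrow> (('a \<Rightarrow> real) \<Rightarrow> 'a \<Rightarrow> real) \<Rightarrow> real \<Rightarrow> bool" where
  "kernel_bound_operator M lam \<phi> q D L r \<longleftrightarrow>
     (\<exists>c>0. \<exists>c\<^sub>1>0. \<forall>t y. 0 < t \<and> t \<le> 1 \<longrightarrow>
        (\<lambda>z. heat_kernel lam \<phi> t z y) \<in> D \<and>
        (\<forall>x. \<exists>v. has_value_at M (L (\<lambda>z. heat_kernel lam \<phi> t z y)) x v \<and>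
           \<bar>v\<bar> \<le> c * t powr (- (q + r) / 2) * exp (- c\<^sub>1 * (dist x y)\<^sup>2 / t)))"

definition min_separation :: "'a::metric_space set \<Rightarrow> real" where
  "min_separation Y = Min {dist x y | x y. x \<in> Y \<and> y \<in> Y \<and> x \<noteq> y}"

text \<open>
  Assumption (iv) for the finite set \<open>Y\<close>, with \<open>\<psi> k y\<close> in place of \<open>\<phi>\<^bsub>k,j\<^esub>\<close> for \<open>y = y\<^sub>j\<close>. The constant
  \<open>c\<close> is a parameter, to be chosen uniformly along a sequence of sets.
\<close>

definition bump_functions ::
  "'a::metric_space measure \<Rightarrow> (nat \<Rightarrow> real) \<Rightarrow> (nat \<Rightarrow> 'a \<Rightarrow> real) \<Rightarrow> ereal \<Rightarrow> real \<Rightarrow> (real \<Rightarrow> real)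
    \<Rightarrow> nat \<Rightarrow> (nat \<Rightarrow> ('a \<Rightarrow> real) set) \<Rightarrow> (nat \<Rightarrow> ('a \<Rightarrow> real) \<Rightarrow> 'a \<Rightarrow> real) \<Rightarrow> (nat \<Rightarrow> real)
    \<Rightarrow> 'a set \<Rightarrow> real \<Rightarrow> bool" where
  "bump_functions M lam \<phi> p \<beta> b R D L ord Y c \<longleftrightarrow>
     (\<exists>\<psi>. \<forall>k\<in>{1..R}. \<forall>y\<in>Y.
        \<psi> k y \<in> sobolev_space M lam \<phi> p b \<and>
        (\<forall>i\<in>{1..R}. \<psi> k y \<in> D i) \<and>
        (\<forall>i\<in>{1..R}. i \<noteq> k \<longrightarrow> (AE x in M. L i (\<psi> k y) x = 0)) \<and>
        (\<forall>i\<in>{1..R}. \<forall>z\<in>Y. has_value_at M (L i (\<psi> k y)) z (if i = k \<and> z = y then 1 else 0)) \<and>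
        (\<exists>V. y \<in> interior V \<and> bounded V \<and> diameter V \<le> min_separation Y / 3 \<and>
           (AE x in M. x \<notin> V \<longrightarrow> \<psi> k y x = 0) \<and>
           (AE x in M. x \<notin> V \<longrightarrow> sobolev_deriv M lam \<phi> p b (\<psi> k y) x = 0)) \<and>
        sobolev_deriv M lam \<phi> p b (\<psi> k y) \<in> Lp_space M \<infinity> \<and>
        Lp_norm M \<infinity> (sobolev_deriv M lam \<phi> p b (\<psi> k y)) \<le> c * min_separation Y powr (ord k - \<beta>))"

text \<open>
  The conditions \<open>L\<^sub>k(P)(y) = L\<^sub>k(f)(y)\<close>, including that both sides are meaningful.
\<close>

definition interpolates ::
  "'a::topological_space measure \<Rightarrow> nat \<Rightarrow> (nat \<Rightarrow> ('a \<Rightarrow> real) set)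
    \<Rightarrow> (nat \<Rightarrow> ('a \<Rightarrow> real) \<Rightarrow> 'a \<Rightarrow> real) \<Rightarrow> 'a set \<Rightarrow> ('a \<Rightarrow> real) \<Rightarrow> ('a \<Rightarrow> real) \<Rightarrow> bool" where
  "interpolates M R D L Y f P \<longleftrightarrow>
     (\<forall>k\<in>{1..R}. P \<in> D k \<and> f \<in> D k \<and>
        (\<forall>y\<in>Y. \<exists>v. has_value_at M (L k P) y v \<and> has_value_at M (L k f) y v))"

text \<open>Maps from a set of classes of functions into a set of functions.\<close>

definition class_map :: "'a measure \<Rightarrow> ('a \<Rightarrow> real) set \<Rightarrow> ('a \<Rightarrow> real) set
    \<Rightarrow> (('a \<Rightarrow> real) \<Rightarrow> ('a \<Rightarrow> real)) \<Rightarrow> bool" where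
  "class_map M A B P \<longleftrightarrow>
     P \<in> A \<rightarrow> B \<and> (\<forall>f\<in>A. \<forall>g\<in>A. (AE x in M. f x = g x) \<longrightarrow> P f = P g)"

end

(*
  Let T_t be the smoothing operator with multiplier H(lambda^2 t), H a smooth cutoff. The difference
  f - T_t f is a sum of dyadic pieces, each of which is the heat kernel applied to a multiplier of the
  derivative of f, and the heat kernel bound of the operators L_k controls the values of L_k on it.
  Interpolating these values by bump functions therefore costs at most C (sqrt t / eta)^delta times the
  norm of f. For t a small multiple of eta^2 this factor is below 1/2: alternating between smoothing
  and bump functions yields a polynomial that interpolates f and has norm at most a constant times that of f.
  It corrects a best approximation of f. Multipliers are bounded on L^p since a smooth even multiplier
  is a rapidly convergent cosine series in a variable for which the exponentials are heat kernels.
*)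
theory Submission
  imports Defs "HOL-Real_Asymp.Real_Asymp" "HOL-Analysis.Function_Metric"
begin

section \<open>Lebesgue norms\<close>

text \<open>The factor (sqrt t / eta)^delta is a count of powers. At frequencies of order t^(-1/2)
  the mask contributes t^(beta/2); a kernel of order r, paired with a function in L^p, costs t^(-(r
  + q/p)/2); the derivative of a bump function has size eta^(r - beta) and lives on a ball of
  measure at most of order eta^q. Together this is sqrt t / eta to the power beta - r - q/p, and
  \<open>\<delta>\<close> is the least of these exponents. The multipliers have to be built from
  Gaussian bounds alone. With exp(-s) = cos theta, cos(j theta) is the Chebyshev polynomial
  T_j(exp(-s)), a combination of heat kernels, but the sum of its coefficients is only bounded by
  3^j. This bound has Gaussian decay, whereas |T_j| <= 1 gives a bound without decay; a geometric
  mean of the two loses only j^q, which the smoothness S > q of the mask pays for. Since the heat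
  kernel has integral 1, balls have measure at least of order r^q. Hence the space is bounded and
  therefore compact, which gives uniqueness of point values, finite nets and the Arzela-Ascoli
  theorem.\<close>

definition recip :: "ereal \<Rightarrow> real" where
  "recip p = (if p = \<infinity> then 0 else 1 / real_of_ereal p)"

text \<open>A norm bound and membership in \<open>Lp_space\<close> in one predicate, for c >= 0. The
  nonnegative integral of the p-th power asks for no integrability and no root, which suits the
  estimates below.\<close>

definition Lp_bounded :: "'a measure \<Rightarrow> ereal \<Rightarrow> real \<Rightarrow> ('a \<Rightarrow> real) \<Rightarrow> bool" where
  "Lp_bounded M p c f \<longleftrightarrow> f \<in> borel_measurable M \<and>
     (if p = \<infinity> then AE x in M. \<bar>f x\<bar> \<le> c
      else (\<integral>\<^sup>+x. ennreal (\<bar>f x\<bar> powr real_of_ereal p) \<partial>M) \<le> ennreal (c powr real_of_ereal p))"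

text \<open>Convexity of the power, used on the open half line; the boundary point x = 0 lies
  outside of it and is computed directly.\<close>

lemma powr_above_tangent:
  fixes x z r :: real
  assumes "0 \<le> x" "0 < z" "1 \<le> r"
  shows "z powr r + r * z powr (r - 1) * (x - z) \<le> x powr r"
proof (cases "x = 0")
  case True
  have "z powr r = z powr (r - 1) * z" using assms by (simp add: powr_mult_base mult.commute)
  then show ?thesis using assms True by (simp add: algebra_simps mult_right_mono)
next
  case False
  have "x powr r - z powr r \<ge> r * z powr (r - 1) * (x - z)"
  proof (rule convex_on_imp_above_tangent[of "{0<..}"])
    show "convex_on {0<..} (\<lambda>x. x powr r)" using assms powr_convex by blast
    show "((\<lambda>x. x powr r) has_real_derivative r * z powr (r - 1)) (at z within {0<..})"
      using assms by (auto intro!: derivative_eq_intros)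
  qed (use assms False in \<open>auto simp: interior_open\<close>)
  then show ?thesis by simp
qed

text \<open>The tangent at z = a x + b y is evaluated at x and at y; in the weighted sum the linear
  terms cancel.\<close>

lemma powr_convex_combination:
  fixes x y a b r :: real
  assumes "0 \<le> x" "0 \<le> y" "0 < a" "0 < b" "a + b = 1" "1 \<le> r"
  shows "(a * x + b * y) powr r \<le> a * x powr r + b * y powr r"
proof (cases "a * x + b * y = 0")
  case True
  then show ?thesis using assms by simp
next
  case False
  define z where "z = a * x + b * y"
  have z: "z > 0" using False assms z_def by (smt (verit) mult_nonneg_nonneg)
  have "a * (z powr r + r * z powr (r - 1) * (x - z)) + b * (z powr r + r * z powr (r - 1) * (y - z))
     \<le> a * x powr r + b * y powr r"
    using powr_above_tangent[OF assms(1) z assms(6)] powr_above_tangent[OF assms(2) z assms(6)] assms(3,4)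
    by (intro add_mono mult_left_mono) auto
  moreover have "a * (z powr r + r * z powr (r - 1) * (x - z)) + b * (z powr r + r * z powr (r - 1) * (y - z))
    = (a + b) * z powr r + r * z powr (r - 1) * (a * x + b * y - (a + b) * z)"
    by (simp add: algebra_simps)
  ultimately show ?thesis using assms(5) z_def by simp
qed

lemma exponent_cases:
  assumes "1 \<le> p"
  obtains "p = \<infinity>" "recip p = 0" | r where "p = ereal r" "1 \<le> r" "recip p = 1 / r" "p \<noteq> \<infinity>"
  using assms by (cases p) (auto simp: recip_def one_ereal_def)

lemma recip_bounds: "1 \<le> p \<Longrightarrow> 0 \<le> recip p \<and> recip p \<le> 1"
  by (erule exponent_cases) auto

section \<open>Minkowski, Hoelder and Schur inequalities on a probability space\<close>

context prob_space
begin

text \<open>On a probability space the constant 0 has essential supremum 0. The essential supremum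
  of an absolute value is therefore nonnegative and, when finite, is faithfully represented by
  \<open>real_of_ereal\<close>.\<close>

lemma Lp_bounded_iff:
  assumes p: "1 \<le> p" and c: "0 \<le> c"
  shows "Lp_bounded M p c f \<longleftrightarrow> f \<in> Lp_space M p \<and> Lp_norm M p f \<le> c"
  using p
proof (cases rule: exponent_cases)
  case 1
  show ?thesis
  proof
    assume L: "Lp_bounded M p c f"
    then have m[measurable]: "f \<in> borel_measurable M" and ae: "AE x in M. \<bar>f x\<bar> \<le> c" using 1 by (auto simp: Lp_bounded_def)
    have le: "esssup M (\<lambda>x. ereal \<bar>f x\<bar>) \<le> ereal c" using ae by (intro esssup_I) auto
    have "esssup M (\<lambda>x. 0::ereal) \<le> esssup M (\<lambda>x. ereal \<bar>f x\<bar>)" by (intro esssup_mono) auto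
    then have "0 \<le> esssup M (\<lambda>x. ereal \<bar>f x\<bar>)" by (simp add: esssup_const emeasure_space_1)
    then show "f \<in> Lp_space M p \<and> Lp_norm M p f \<le> c"
      using 1 le by (cases "esssup M (\<lambda>x. ereal \<bar>f x\<bar>)") (auto simp: Lp_space_def Lp_norm_def)
  next
    assume R: "f \<in> Lp_space M p \<and> Lp_norm M p f \<le> c"
    then have m[measurable]: "f \<in> borel_measurable M" and f: "esssup M (\<lambda>x. ereal \<bar>f x\<bar>) < \<infinity>"
       "real_of_ereal (esssup M (\<lambda>x. ereal \<bar>f x\<bar>)) \<le> c"
      using 1 by (auto simp: Lp_space_def Lp_norm_def)
    have "esssup M (\<lambda>x. 0::ereal) \<le> esssup M (\<lambda>x. ereal \<bar>f x\<bar>)" by (intro esssup_mono) auto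
    then have "0 \<le> esssup M (\<lambda>x. ereal \<bar>f x\<bar>)" by (simp add: esssup_const emeasure_space_1)
    then have e: "esssup M (\<lambda>x. ereal \<bar>f x\<bar>) \<le> ereal c"
      using f by (cases "esssup M (\<lambda>x. ereal \<bar>f x\<bar>)") auto
    have "AE x in M. ereal \<bar>f x\<bar> \<le> esssup M (\<lambda>x. ereal \<bar>f x\<bar>)" by (rule esssup_AE)
    then have "AE x in M. \<bar>f x\<bar> \<le> c"
      by (rule eventually_mono) (use e in \<open>metis ereal_less_eq(3) order_trans\<close>)
    then show "Lp_bounded M p c f" using m 1 by (auto simp: Lp_bounded_def)
  qed
next
  case (2 r)
  have int: "integrable M (\<lambda>x. \<bar>f x\<bar> powr r) \<longleftrightarrow> (\<integral>\<^sup>+x. ennreal (\<bar>f x\<bar> powr r) \<partial>M) < \<infinity>"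
    if [measurable]: "f \<in> borel_measurable M"
    by (subst integrable_iff_bounded) (auto intro!: that)
  have key: "(\<integral>x. \<bar>f x\<bar> powr r \<partial>M) powr (1 / r) \<le> c \<longleftrightarrow> (\<integral>x. \<bar>f x\<bar> powr r \<partial>M) \<le> c powr r"
  proof -
    define I where "I = (\<integral>x. \<bar>f x\<bar> powr r \<partial>M)"
    have I: "0 \<le> I" unfolding I_def by simp
    have "I powr (1 / r) \<le> c \<longleftrightarrow> (I powr (1/r)) powr r \<le> c powr r"
      using 2 c by (smt (verit) powr_ge_zero powr_less_mono2 powr_mono2)
    also have "(I powr (1/r)) powr r = I" using I 2 by (simp add: powr_powr)
    finally show ?thesis unfolding I_def .
  qed
  have key2: "(\<integral>\<^sup>+x. ennreal (\<bar>f x\<bar> powr r) \<partial>M) = ennreal (\<integral>x. \<bar>f x\<bar> powr r \<partial>M)"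
    if "integrable M (\<lambda>x. \<bar>f x\<bar> powr r)" using that by (intro nn_integral_eq_integral) auto
  show ?thesis
    using int key key2 2
    by (auto simp: Lp_bounded_def Lp_space_def Lp_norm_def)
       (metis ennreal_le_iff powr_ge_zero less_top ennreal_less_top le_less_trans top.extremum_strict)+
qed

text \<open>Minkowski's inequality: (|f| + |g|) / (a + b) is a convex combination of |f| / a and |g|
  / b with weights a / (a + b) and b / (a + b), to which convexity of the power applies pointwise.
  Positive bounds keep the divisions meaningful.\<close>

lemma Lp_bounded_add:
  assumes p: "1 \<le> p" and a: "0 < a" and b: "0 < b"
    and f: "Lp_bounded M p a f" and g: "Lp_bounded M p b g"
  shows "Lp_bounded M p (a + b) (\<lambda>x. f x + g x)"
  using p
proof (cases rule: exponent_cases)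
  case 1
  have "AE x in M. \<bar>f x\<bar> \<le> a" "AE x in M. \<bar>g x\<bar> \<le> b" using f g 1 by (auto simp: Lp_bounded_def)
  then have "AE x in M. \<bar>f x + g x\<bar> \<le> a + b" by eventually_elim linarith
  then show ?thesis using f g 1 by (auto simp: Lp_bounded_def)
next
  case (2 r)
  have [measurable]: "f \<in> borel_measurable M" "g \<in> borel_measurable M"
    using f g by (auto simp: Lp_bounded_def)
  have fI: "(\<integral>\<^sup>+x. ennreal (\<bar>f x\<bar> powr r) \<partial>M) \<le> ennreal (a powr r)"
    and gI: "(\<integral>\<^sup>+x. ennreal (\<bar>g x\<bar> powr r) \<partial>M) \<le> ennreal (b powr r)"
    using f g 2 by (auto simp: Lp_bounded_def)
  define u where "u = a / (a + b)" define v where "v = b / (a + b)"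
  define al where "al = (a + b) powr r * (u / a powr r)"
  define be where "be = (a + b) powr r * (v / b powr r)"
  have uv: "0 < u" "0 < v" "u + v = 1" using a b by (auto simp: u_def v_def add_divide_distrib[symmetric])
  have albe: "0 \<le> al" "0 \<le> be" using uv by (auto simp: al_def be_def)
  have pw: "\<bar>f x + g x\<bar> powr r \<le> al * \<bar>f x\<bar> powr r + be * \<bar>g x\<bar> powr r" for x
  proof -
    have "(a + b) * u = a" "(a + b) * v = b" using a b by (auto simp: u_def v_def)
    then have "(a + b) * (u * (\<bar>f x\<bar> / a) + v * (\<bar>g x\<bar> / b)) = a * (\<bar>f x\<bar> / a) + b * (\<bar>g x\<bar> / b)"
      by (simp only: distrib_left mult.assoc[symmetric])
    then have "\<bar>f x + g x\<bar> \<le> (a + b) * (u * (\<bar>f x\<bar> / a) + v * (\<bar>g x\<bar> / b))"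
      using a b by simp
    then have "\<bar>f x + g x\<bar> powr r \<le> ((a + b) * (u * (\<bar>f x\<bar> / a) + v * (\<bar>g x\<bar> / b))) powr r"
      using 2 by (intro powr_mono2) auto
    also have "\<dots> = (a + b) powr r * (u * (\<bar>f x\<bar> / a) + v * (\<bar>g x\<bar> / b)) powr r"
      by (rule powr_mult)
    also have "\<dots> \<le> (a + b) powr r * (u * (\<bar>f x\<bar> / a) powr r + v * (\<bar>g x\<bar> / b) powr r)"
      using a b uv 2 by (intro mult_left_mono powr_convex_combination) auto
    also have "\<dots> = al * \<bar>f x\<bar> powr r + be * \<bar>g x\<bar> powr r"
      using a b by (simp add: al_def be_def powr_divide algebra_simps)
    finally show ?thesis .
  qed
  have "(\<integral>\<^sup>+x. ennreal (\<bar>f x + g x\<bar> powr r) \<partial>M)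
     \<le> (\<integral>\<^sup>+x. ennreal al * ennreal (\<bar>f x\<bar> powr r) + ennreal be * ennreal (\<bar>g x\<bar> powr r) \<partial>M)"
    using pw albe by (intro nn_integral_mono) (simp add: ennreal_mult[symmetric] flip: ennreal_plus)
  also have "\<dots> = ennreal al * (\<integral>\<^sup>+x. ennreal (\<bar>f x\<bar> powr r) \<partial>M) + ennreal be * (\<integral>\<^sup>+x. ennreal (\<bar>g x\<bar> powr r) \<partial>M)"
    by (simp add: nn_integral_add nn_integral_cmult)
  also have "\<dots> \<le> ennreal al * ennreal (a powr r) + ennreal be * ennreal (b powr r)"
    using fI gI by (intro add_mono mult_left_mono) auto
  also have "\<dots> = ennreal (al * a powr r + be * b powr r)"
    using albe by (simp add: ennreal_mult[symmetric] flip: ennreal_plus)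
  also have "al * a powr r + be * b powr r = (a + b) powr r * (u + v)"
    using a b by (simp add: al_def be_def algebra_simps)
  finally show ?thesis using 2 uv by (simp add: Lp_bounded_def)
qed

lemma Lp_bounded_mono:
  assumes p: "1 \<le> p" and f: "Lp_bounded M p a f" and [measurable]: "g \<in> borel_measurable M"
    and le: "AE x in M. \<bar>g x\<bar> \<le> \<bar>f x\<bar>" and ab: "0 \<le> a" "a \<le> b"
  shows "Lp_bounded M p b g"
  using p
proof (cases rule: exponent_cases)
  case 1
  have "AE x in M. \<bar>f x\<bar> \<le> a" using f 1 by (auto simp: Lp_bounded_def)
  then have "AE x in M. \<bar>g x\<bar> \<le> b" using le by eventually_elim (use ab in linarith)
  then show ?thesis using 1 by (auto simp: Lp_bounded_def)
next
  case (2 r)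
  have "(\<integral>\<^sup>+x. ennreal (\<bar>g x\<bar> powr r) \<partial>M) \<le> (\<integral>\<^sup>+x. ennreal (\<bar>f x\<bar> powr r) \<partial>M)"
    using le 2 by (intro nn_integral_mono_AE) (auto elim!: eventually_mono intro!: ennreal_leI powr_mono2)
  also have "\<dots> \<le> ennreal (a powr r)" using f 2 by (auto simp: Lp_bounded_def)
  also have "\<dots> \<le> ennreal (b powr r)" using ab 2 by (auto intro!: ennreal_leI powr_mono2)
  finally show ?thesis using 2 by (auto simp: Lp_bounded_def)
qed

lemma Lp_bounded_cmult:
  assumes p: "1 \<le> p" and f: "Lp_bounded M p a f" and a: "0 \<le> a"
  shows "Lp_bounded M p (\<bar>s\<bar> * a) (\<lambda>x. s * f x)"
  using p
proof (cases rule: exponent_cases)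
  case 1
  have "AE x in M. \<bar>f x\<bar> \<le> a" using f 1 by (auto simp: Lp_bounded_def)
  then have "AE x in M. \<bar>s * f x\<bar> \<le> \<bar>s\<bar> * a" by eventually_elim (simp add: abs_mult mult_left_mono)
  then show ?thesis using f 1 by (auto simp: Lp_bounded_def)
next
  case (2 r)
  have [measurable]: "f \<in> borel_measurable M" using f by (auto simp: Lp_bounded_def)
  have "(\<integral>\<^sup>+x. ennreal (\<bar>s * f x\<bar> powr r) \<partial>M) = (\<integral>\<^sup>+x. ennreal (\<bar>s\<bar> powr r) * ennreal (\<bar>f x\<bar> powr r) \<partial>M)"
    by (intro nn_integral_cong) (simp add: abs_mult powr_mult ennreal_mult)
  also have "\<dots> = ennreal (\<bar>s\<bar> powr r) * (\<integral>\<^sup>+x. ennreal (\<bar>f x\<bar> powr r) \<partial>M)"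
    by (simp add: nn_integral_cmult)
  also have "\<dots> \<le> ennreal (\<bar>s\<bar> powr r) * ennreal (a powr r)"
    using f 2 by (intro mult_left_mono) (auto simp: Lp_bounded_def)
  also have "\<dots> = ennreal ((\<bar>s\<bar> * a) powr r)" using a by (simp add: powr_mult ennreal_mult)
  finally show ?thesis using 2 by (auto simp: Lp_bounded_def)
qed

lemma Lp_norm_nonneg:
  assumes "1 \<le> p" "f \<in> Lp_space M p" shows "0 \<le> Lp_norm M p f"
proof (cases "p = \<infinity>")
  case True
  have "esssup M (\<lambda>x. 0::ereal) \<le> esssup M (\<lambda>x. ereal \<bar>f x\<bar>)"
    using assms by (intro esssup_mono) (auto simp: Lp_space_def)
  then show ?thesis using True by (simp add: esssup_const emeasure_space_1 Lp_norm_def real_of_ereal_pos)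
qed (simp add: Lp_norm_def)

lemma Lp_bounded_norm: "1 \<le> p \<Longrightarrow> f \<in> Lp_space M p \<Longrightarrow> Lp_bounded M p (Lp_norm M p f) f"
  by (simp add: Lp_bounded_iff Lp_norm_nonneg)

lemma Lp_add:
  assumes p: "1 \<le> p" and f: "f \<in> Lp_space M p" and g: "g \<in> Lp_space M p"
  shows "(\<lambda>x. f x + g x) \<in> Lp_space M p"
    and "Lp_norm M p (\<lambda>x. f x + g x) \<le> Lp_norm M p f + Lp_norm M p g"
proof -
  \<comment> \<open>The norms themselves may be 0, whereas \<open>Lp_bounded_add\<close> takes
    positive bounds; hence the slack e.\<close>
  have bd: "Lp_bounded M p (Lp_norm M p f + e + (Lp_norm M p g + e)) (\<lambda>x. f x + g x)" if "e > 0" for e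
    using that Lp_norm_nonneg[OF p f] Lp_norm_nonneg[OF p g] f g p
    by (intro Lp_bounded_add) (auto simp: Lp_bounded_iff)
  show "(\<lambda>x. f x + g x) \<in> Lp_space M p"
    using bd[of 1] Lp_norm_nonneg[OF p f] Lp_norm_nonneg[OF p g] p by (simp add: Lp_bounded_iff)
  show "Lp_norm M p (\<lambda>x. f x + g x) \<le> Lp_norm M p f + Lp_norm M p g"
  proof (rule field_le_epsilon)
    fix e :: real assume "e > 0"
    then show "Lp_norm M p (\<lambda>x. f x + g x) \<le> Lp_norm M p f + Lp_norm M p g + e"
      using bd[of "e/2"] Lp_norm_nonneg[OF p f] Lp_norm_nonneg[OF p g] p by (simp add: Lp_bounded_iff)
  qed
qed

lemma Lp_cmult:
  assumes p: "1 \<le> p" and f: "f \<in> Lp_space M p"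
  shows "(\<lambda>x. s * f x) \<in> Lp_space M p"
    and "Lp_norm M p (\<lambda>x. s * f x) \<le> \<bar>s\<bar> * Lp_norm M p f"
  using Lp_bounded_cmult[OF p Lp_bounded_norm[OF p f] Lp_norm_nonneg[OF p f], of s] Lp_norm_nonneg[OF p f] p
  by (auto simp: Lp_bounded_iff)

lemma Lp_diff:
  assumes p: "1 \<le> p" and f: "f \<in> Lp_space M p" and g: "g \<in> Lp_space M p"
  shows "(\<lambda>x. f x - g x) \<in> Lp_space M p"
    and "Lp_norm M p (\<lambda>x. f x - g x) \<le> Lp_norm M p f + Lp_norm M p g"
  using Lp_add[OF p f Lp_cmult(1)[OF p g, of "-1"]] Lp_cmult(2)[OF p g, of "-1"] by auto

lemma Lp_sum:
  assumes p: "1 \<le> p" and fin: "finite I" and f: "\<And>i. i \<in> I \<Longrightarrow> f i \<in> Lp_space M p"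
  shows "(\<lambda>x. \<Sum>i\<in>I. f i x) \<in> Lp_space M p \<and>
         Lp_norm M p (\<lambda>x. \<Sum>i\<in>I. f i x) \<le> (\<Sum>i\<in>I. Lp_norm M p (f i))"
  using fin f
proof (induction I)
  case empty
  have "Lp_bounded M p 0 (\<lambda>x. 0)" by (simp add: Lp_bounded_def)
  then show ?case using p by (simp add: Lp_bounded_iff)
next
  case (insert i I)
  then show ?case using Lp_add[OF p, of "f i" "\<lambda>x. \<Sum>i\<in>I. f i x"] by (auto intro: order_trans)
qed

lemma Lp_bounded_const:
  assumes p: "1 \<le> p" and [measurable]: "f \<in> borel_measurable M" and f: "AE x in M. \<bar>f x\<bar> \<le> c" and c: "0 \<le> c"
  shows "Lp_bounded M p c f"
  using p
proof (cases rule: exponent_cases)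
  case 1
  then show ?thesis using f by (auto simp: Lp_bounded_def)
next
  case (2 r)
  have "(\<integral>\<^sup>+x. ennreal (\<bar>f x\<bar> powr r) \<partial>M) \<le> (\<integral>\<^sup>+x. ennreal (c powr r) \<partial>M)"
    using f 2 by (intro nn_integral_mono_AE) (auto elim!: eventually_mono intro!: ennreal_leI powr_mono2)
  then show ?thesis using 2 by (simp add: emeasure_space_1 Lp_bounded_def)
qed

lemma Lp_bound:
  assumes p: "1 \<le> p" and f: "f \<in> borel_measurable M" "AE x in M. \<bar>f x\<bar> \<le> c" "0 \<le> c"
  shows "f \<in> Lp_space M p" "Lp_norm M p f \<le> c"
  using Lp_bounded_const[OF p f] f(3) p by (auto simp: Lp_bounded_iff)

lemma Lp_cong_AE:
  assumes p: "1 \<le> p" and f: "f \<in> Lp_space M p" and g: "g \<in> borel_measurable M" and fg: "AE x in M. f x = g x"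
  shows "g \<in> Lp_space M p" "Lp_norm M p g = Lp_norm M p f"
proof -
  have le: "AE x in M. \<bar>g x\<bar> \<le> \<bar>f x\<bar>" "AE x in M. \<bar>f x\<bar> \<le> \<bar>g x\<bar>" using fg by auto
  have fm: "f \<in> borel_measurable M" using f by (auto simp: Lp_space_def)
  have a: "Lp_bounded M p (Lp_norm M p f) g"
    using Lp_bounded_mono[OF p Lp_bounded_norm[OF p f] g le(1) Lp_norm_nonneg[OF p f] order_refl] .
  then show gL: "g \<in> Lp_space M p" using p Lp_norm_nonneg[OF p f] by (simp add: Lp_bounded_iff)
  have b: "Lp_bounded M p (Lp_norm M p g) f"
    using Lp_bounded_mono[OF p Lp_bounded_norm[OF p gL] fm le(2) Lp_norm_nonneg[OF p gL] order_refl] .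
  show "Lp_norm M p g = Lp_norm M p f"
    using a b p Lp_norm_nonneg[OF p f] Lp_norm_nonneg[OF p gL] by (simp add: Lp_bounded_iff)
qed

lemma Lp_measurable: "f \<in> Lp_space M p \<Longrightarrow> f \<in> borel_measurable M"
  by (simp add: Lp_space_def)

text \<open>Jensen's inequality for a weight of mass at most A. The number a only lies below the
  integral of w |h|, so no finiteness of that integral enters.\<close>

lemma weighted_power_mean:
  assumes r: "1 \<le> r" and A: "0 < A" and [measurable]: "w \<in> borel_measurable M" "h \<in> borel_measurable M"
    and w: "\<And>y. 0 \<le> w y" and wA: "(\<integral>\<^sup>+y. ennreal (w y) \<partial>M) \<le> ennreal A"
    and a: "0 \<le> a" "ennreal a \<le> (\<integral>\<^sup>+y. ennreal (w y * \<bar>h y\<bar>) \<partial>M)"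
  shows "ennreal (a powr r) \<le> ennreal (A powr (r - 1)) * (\<integral>\<^sup>+y. ennreal (w y * \<bar>h y\<bar> powr r) \<partial>M)"
proof (cases "(\<integral>\<^sup>+y. ennreal (w y * \<bar>h y\<bar> powr r) \<partial>M) = \<infinity>")
  case True
  then show ?thesis using A by (simp add: ennreal_mult_top)
next
  case False
  then obtain i where i: "(\<integral>\<^sup>+y. ennreal (w y * \<bar>h y\<bar> powr r) \<partial>M) = ennreal i" "0 \<le> i"
    by (metis ennreal_enn2real_if enn2real_nonneg infinity_ennreal_def)
  \<comment> \<open>Young's inequality: the tangent to the power at a level l bounds x by u x^r + v.
    The level stays free and is optimized below.\<close>
  have *: "a \<le> l powr (1 - r) / r * i + (1 - 1 / r) * l * A" if l: "0 < l" for l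
  proof -
    define u where "u = l powr (1 - r) / r"
    define v where "v = (1 - 1 / r) * l"
    have uv: "0 \<le> u" "0 \<le> v" using r l by (auto simp: u_def v_def field_simps)
    have pw: "x \<le> u * x powr r + v" if "0 \<le> x" for x
    proof -
      have "u * (l powr r + r * l powr (r - 1) * (x - l)) \<le> u * x powr r"
        using powr_above_tangent[OF that l r] uv by (intro mult_left_mono) auto
      moreover have "l powr (1 - r) * l powr r = l" "l powr (1 - r) * l powr (r - 1) = 1"
        using l by (simp_all add: powr_add[symmetric])
      then have "u * (l powr r + r * l powr (r - 1) * (x - l)) = l / r + (x - l)"
        using r by (simp add: u_def field_simps)
      moreover have "v = l - l / r" by (simp add: v_def left_diff_distrib)
      ultimately show ?thesis by linarith
    qed
    have "ennreal a \<le> (\<integral>\<^sup>+y. ennreal u * ennreal (w y * \<bar>h y\<bar> powr r) + ennreal v * ennreal (w y) \<partial>M)"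
    proof (rule order_trans[OF a(2)], rule nn_integral_mono)
      fix y
      have "w y * \<bar>h y\<bar> \<le> w y * (u * \<bar>h y\<bar> powr r + v)" using w pw by (intro mult_left_mono) auto
      then have "ennreal (w y * \<bar>h y\<bar>) \<le> ennreal (u * (w y * \<bar>h y\<bar> powr r) + v * w y)"
        by (intro ennreal_leI) (simp add: algebra_simps)
      then show "ennreal (w y * \<bar>h y\<bar>) \<le> ennreal u * ennreal (w y * \<bar>h y\<bar> powr r) + ennreal v * ennreal (w y)"
        using uv w by (simp add: ennreal_mult[symmetric] flip: ennreal_plus)
    qed
    also have "\<dots> = ennreal u * ennreal i + ennreal v * (\<integral>\<^sup>+y. ennreal (w y) \<partial>M)"
      by (simp add: nn_integral_add nn_integral_cmult i)
    also have "\<dots> \<le> ennreal u * ennreal i + ennreal v * ennreal A"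
      using wA by (intro add_left_mono mult_left_mono) auto
    also have "\<dots> = ennreal (u * i + v * A)" using uv i A by (simp add: ennreal_mult[symmetric] flip: ennreal_plus)
    finally have "a \<le> u * i + v * A" using uv i A by (subst (asm) ennreal_le_iff) auto
    then show ?thesis by (simp add: u_def v_def)
  qed
  have "a powr r \<le> A powr (r - 1) * i"
  proof (cases "i = 0")
    case True
    have "a \<le> 0"
    proof (rule field_le_epsilon)
      fix e :: real assume e: "e > 0"
      \<comment> \<open>For i = 0 only the second term of the bound survives, and it vanishes as the
        level tends to 0.\<close>
      have "a \<le> (1 - 1 / r) * (e / A) * A" using *[of "e / A"] e A True by simp
      also have "\<dots> \<le> e" using r A e by (simp add: field_simps)
      finally show "a \<le> 0 + e" by simp
    qed
    then show ?thesis using a True r by simp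
  next
    case False
    then have i0: "0 < i" using i by simp
    \<comment> \<open>With l^r = i / A the two terms of the bound become l A / r and (1 - 1 / r) l
      A, which add up to l A.\<close>
    define l where "l = (i / A) powr (1 / r)"
    have l: "0 < l" using i0 A by (simp add: l_def)
    have lr: "l powr r = i / A" using i0 A r by (simp add: l_def powr_powr)
    have "l powr (1 - r) * i = l * (l powr (- r) * i)" using l by (simp add: powr_diff powr_minus field_simps)
    also have "\<dots> = l * A" using lr l i0 A by (simp add: powr_minus field_simps)
    finally have "a \<le> l * A / r + (1 - 1 / r) * l * A" using *[OF l] by (simp add: field_simps)
    also have "\<dots> = l * A" using r by (simp add: field_simps)
    finally have "a powr r \<le> (l * A) powr r" using a r by (intro powr_mono2) auto
    also have "\<dots> = i / A * A powr r" using l A lr by (simp add: powr_mult)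
    also have "\<dots> = A powr (r - 1) * i" using A by (simp add: powr_diff)
    finally show ?thesis .
  qed
  then show ?thesis using i by (simp add: ennreal_mult[symmetric] ennreal_leI)
qed

text \<open>Hoelder's inequality, in which the norm of w in the conjugate exponent is interpolated
  between its mass A and its maximum B.\<close>

lemma weighted_integral_le:
  assumes p: "1 \<le> p" and A: "0 < A" and B: "0 < B" and [measurable]: "w \<in> borel_measurable M"
    and w: "\<And>y. 0 \<le> w y" "\<And>y. w y \<le> B" and wA: "(\<integral>\<^sup>+y. ennreal (w y) \<partial>M) \<le> ennreal A"
    and h: "Lp_bounded M p c h" and c: "0 \<le> c"
    and a: "0 \<le> a" "ennreal a \<le> (\<integral>\<^sup>+y. ennreal (w y * \<bar>h y\<bar>) \<partial>M)"
  shows "a \<le> A powr (1 - recip p) * B powr recip p * c"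
  using p
proof (cases rule: exponent_cases)
  case 1
  have [measurable]: "h \<in> borel_measurable M" using h by (simp add: Lp_bounded_def)
  have "AE x in M. \<bar>h x\<bar> \<le> c" using h 1 by (auto simp: Lp_bounded_def)
  then have "(\<integral>\<^sup>+y. ennreal (w y * \<bar>h y\<bar>) \<partial>M) \<le> (\<integral>\<^sup>+y. ennreal (w y) * ennreal c \<partial>M)"
    by (intro nn_integral_mono_AE)
       (use c w in \<open>auto elim!: eventually_mono simp: ennreal_mult[symmetric] intro!: ennreal_leI mult_left_mono\<close>)
  also have "\<dots> \<le> ennreal A * ennreal c" using wA by (simp add: nn_integral_multc mult_right_mono)
  finally have "ennreal a \<le> ennreal A * ennreal c" using a(2) order_trans by blast
  then have "a \<le> A * c" using c A by (simp add: ennreal_mult[symmetric])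
  then show ?thesis using 1 A B by simp
next
  case (2 r)
  have [measurable]: "h \<in> borel_measurable M" using h by (simp add: Lp_bounded_def)
  have "(\<integral>\<^sup>+y. ennreal (w y * \<bar>h y\<bar> powr r) \<partial>M) \<le> (\<integral>\<^sup>+y. ennreal B * ennreal (\<bar>h y\<bar> powr r) \<partial>M)"
    using w B by (intro nn_integral_mono) (auto simp: ennreal_mult[symmetric] intro!: ennreal_leI mult_right_mono)
  also have "\<dots> \<le> ennreal B * ennreal (c powr r)"
    using h 2 by (simp add: nn_integral_cmult Lp_bounded_def mult_left_mono)
  finally have "ennreal (A powr (r - 1)) * (\<integral>\<^sup>+y. ennreal (w y * \<bar>h y\<bar> powr r) \<partial>M) \<le> ennreal (A powr (r-1)) * (ennreal B * ennreal (c powr r))"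
    by (intro mult_left_mono) auto
  with weighted_power_mean[OF 2(2) A _ _ w(1) wA a]
  have "ennreal (a powr r) \<le> ennreal (A powr (r-1) * (B * c powr r))"
    using B by (simp add: ennreal_mult)
  then have "a powr r \<le> A powr (r-1) * (B * c powr r)" using B by simp
  then have "(a powr r) powr (1/r) \<le> (A powr (r-1) * (B * c powr r)) powr (1/r)"
    using 2 by (intro powr_mono2) auto
  moreover have "(a powr r) powr (1/r) = a" using a 2 by (simp add: powr_powr)
  moreover have "(A powr (r-1) * (B * c powr r)) powr (1/r) = A powr (1 - 1/r) * (B powr (1/r) * c)"
    using A B c 2 by (simp add: powr_mult powr_powr diff_divide_distrib)
  ultimately show ?thesis using 2 by simp
qed

text \<open>For finite p, the power mean in y for each z, followed by an exchange of integrals. The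
  function f is only dominated pointwise by the kernel; this covers sums of bump functions, which
  are not integrals against a kernel themselves.\<close>

lemma Schur_test:
  assumes p: "1 \<le> p" and A: "0 < A" and B: "0 < B"
    and [measurable]: "(\<lambda>(z, y). k z y) \<in> borel_measurable (M \<Otimes>\<^sub>M M)" "f \<in> borel_measurable M"
    and k: "\<And>z y. 0 \<le> k z y"
    and kA: "\<And>z. z \<in> space M \<Longrightarrow> (\<integral>\<^sup>+y. ennreal (k z y) \<partial>M) \<le> ennreal A"
    and kB: "\<And>y. y \<in> space M \<Longrightarrow> (\<integral>\<^sup>+z. ennreal (k z y) \<partial>M) \<le> ennreal B"
    and h: "Lp_bounded M p c h" and c: "0 \<le> c"
    and f: "AE z in M. ennreal \<bar>f z\<bar> \<le> (\<integral>\<^sup>+y. ennreal (k z y * \<bar>h y\<bar>) \<partial>M)"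
  shows "Lp_bounded M p (A powr (1 - recip p) * B powr recip p * c) f"
  using p
proof (cases rule: exponent_cases)
  case 1
  have [measurable]: "h \<in> borel_measurable M" using h by (simp add: Lp_bounded_def)
  have ae: "AE x in M. \<bar>h x\<bar> \<le> c" using h 1 by (auto simp: Lp_bounded_def)
  have "AE z in M. \<bar>f z\<bar> \<le> A * c"
    using f AE_space
  proof eventually_elim
    case (elim z)
    note [measurable] = elim(2)
    have "(\<integral>\<^sup>+y. ennreal (k z y * \<bar>h y\<bar>) \<partial>M) \<le> (\<integral>\<^sup>+y. ennreal (k z y) * ennreal c \<partial>M)"
      using ae by (intro nn_integral_mono_AE)
         (use c k in \<open>auto elim!: eventually_mono simp: ennreal_mult[symmetric] intro!: ennreal_leI mult_left_mono\<close>)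
    also have "\<dots> \<le> ennreal A * ennreal c" using kA[OF elim(2)] by (simp add: nn_integral_multc mult_right_mono)
    finally have "ennreal \<bar>f z\<bar> \<le> ennreal A * ennreal c" using elim(1) order_trans by blast
    then show ?case using c A by (simp add: ennreal_mult[symmetric])
  qed
  then show ?thesis using 1 A B by (simp add: Lp_bounded_def mult.commute)
next
  case (2 r)
  have [measurable]: "h \<in> borel_measurable M" using h by (simp add: Lp_bounded_def)
  interpret P: pair_sigma_finite M M ..
  have "(\<integral>\<^sup>+z. ennreal (\<bar>f z\<bar> powr r) \<partial>M)
      \<le> (\<integral>\<^sup>+z. ennreal (A powr (r - 1)) * (\<integral>\<^sup>+y. ennreal (k z y * \<bar>h y\<bar> powr r) \<partial>M) \<partial>M)"
  proof (rule nn_integral_mono_AE, use f AE_space in eventually_elim)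
    case (elim z)
    note [measurable] = elim(2)
    show ?case using kA[OF elim(2)] k elim 2 A by (intro weighted_power_mean) auto
  qed
  also have "\<dots> = ennreal (A powr (r - 1)) * (\<integral>\<^sup>+z. (\<integral>\<^sup>+y. ennreal (k z y * \<bar>h y\<bar> powr r) \<partial>M) \<partial>M)"
    by (intro nn_integral_cmult) measurable
  also have "(\<integral>\<^sup>+z. (\<integral>\<^sup>+y. ennreal (k z y * \<bar>h y\<bar> powr r) \<partial>M) \<partial>M) = (\<integral>\<^sup>+y. (\<integral>\<^sup>+z. ennreal (k z y * \<bar>h y\<bar> powr r) \<partial>M) \<partial>M)"
    by (rule P.Fubini') measurable
  also have "\<dots> \<le> (\<integral>\<^sup>+y. ennreal B * ennreal (\<bar>h y\<bar> powr r) \<partial>M)"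
  proof (rule nn_integral_mono)
    fix y assume y[measurable]: "y \<in> space M"
    have "(\<integral>\<^sup>+z. ennreal (k z y * \<bar>h y\<bar> powr r) \<partial>M) = (\<integral>\<^sup>+z. ennreal (k z y) \<partial>M) * ennreal (\<bar>h y\<bar> powr r)"
      using k by (simp add: ennreal_mult nn_integral_multc)
    also have "\<dots> \<le> ennreal B * ennreal (\<bar>h y\<bar> powr r)" using kB[OF y] by (intro mult_right_mono) auto
    finally show "(\<integral>\<^sup>+z. ennreal (k z y * \<bar>h y\<bar> powr r) \<partial>M) \<le> ennreal B * ennreal (\<bar>h y\<bar> powr r)" .
  qed
  also have "\<dots> \<le> ennreal B * ennreal (c powr r)"
    using h 2 by (simp add: nn_integral_cmult Lp_bounded_def mult_left_mono)
  finally have "(\<integral>\<^sup>+z. ennreal (\<bar>f z\<bar> powr r) \<partial>M) \<le> ennreal (A powr (r - 1)) * (ennreal B * ennreal (c powr r))"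
    by (simp add: mult_left_mono)
  also have "\<dots> = ennreal (A powr (r - 1) * (B * c powr r))" using B by (simp add: ennreal_mult)
  also have "A powr (r-1) * (B * c powr r) = (A powr (1 - 1/r) * B powr (1/r) * c) powr r"
    using A B c 2 by (simp add: powr_mult powr_powr left_diff_distrib)
  finally show ?thesis using 2 by (simp add: Lp_bounded_def)
qed

lemma Lp_integrable:
  assumes p: "1 \<le> p" and f: "f \<in> Lp_space M p"
  shows "integrable M f" "(\<integral>x. \<bar>f x\<bar> \<partial>M) \<le> Lp_norm M p f"
proof -
  have [measurable]: "f \<in> borel_measurable M" using f by (simp add: Lp_measurable)
  have bd: "(\<integral>\<^sup>+x. ennreal \<bar>f x\<bar> \<partial>M) \<le> ennreal (Lp_norm M p f)"
  proof (rule ccontr)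
    assume "\<not> ?thesis"
    then have "ennreal (Lp_norm M p f) < (\<integral>\<^sup>+x. ennreal \<bar>f x\<bar> \<partial>M)" by simp
    \<comment> \<open>The weighted bound speaks of real numbers; a value strictly below a possibly
      infinite integral suffices to contradict it.\<close>
    then obtain a where "ennreal (Lp_norm M p f) < a" "a < (\<integral>\<^sup>+x. ennreal \<bar>f x\<bar> \<partial>M)" using dense by blast
    then obtain a' where a: "a = ennreal a'" "0 \<le> a'" by (cases a) auto
    have "a' \<le> 1 powr (1 - recip p) * 1 powr recip p * Lp_norm M p f"
      using p \<open>a < _\<close> a
      by (intro weighted_integral_le[where w = "\<lambda>_. 1" and h = f])
         (auto simp: emeasure_space_1 Lp_bounded_norm f Lp_norm_nonneg)
    then show False using \<open>ennreal (Lp_norm M p f) < a\<close> a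
      by (metis ennreal_leI leD mult.commute mult_1 powr_one_eq_one)
  qed
  show i: "integrable M f"
    using bd by (intro integrableI_bounded) (auto intro: le_less_trans)
  have "(\<integral>\<^sup>+x. ennreal \<bar>f x\<bar> \<partial>M) = ennreal (\<integral>x. \<bar>f x\<bar> \<partial>M)"
    using i by (intro nn_integral_eq_integral) auto
  then show "(\<integral>x. \<bar>f x\<bar> \<partial>M) \<le> Lp_norm M p f" using bd Lp_norm_nonneg[OF p f] by simp
qed

end

section \<open>Functions with bounded derivatives\<close>

text \<open>One constant bounds f and n successive derivatives on I. The derivatives are two-sided,
  so I is meant to be open, and the last one is merely bounded, not continuous. Quantifying over the
  derivative avoids the total function \<open>deriv\<close> with its junk values.\<close>

primrec bounded_derivs :: "nat \<Rightarrow> real set \<Rightarrow> real \<Rightarrow> (real \<Rightarrow> real) \<Rightarrow> bool" where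
  "bounded_derivs 0 I C f \<longleftrightarrow> (\<forall>x\<in>I. \<bar>f x\<bar> \<le> C)"
| "bounded_derivs (Suc n) I C f \<longleftrightarrow> (\<forall>x\<in>I. \<bar>f x\<bar> \<le> C) \<and>
     (\<exists>f'. (\<forall>x\<in>I. (f has_real_derivative f' x) (at x)) \<and> bounded_derivs n I C f')"

lemma bounded_derivs_bound: "bounded_derivs n I C f \<Longrightarrow> x \<in> I \<Longrightarrow> \<bar>f x\<bar> \<le> C"
  by (cases n) auto

lemma bounded_derivs_SucI:
  "(\<And>x. x \<in> I \<Longrightarrow> \<bar>f x\<bar> \<le> C) \<Longrightarrow> (\<And>x. x \<in> I \<Longrightarrow> (f has_real_derivative f' x) (at x)) \<Longrightarrow>
   bounded_derivs n I C f' \<Longrightarrow> bounded_derivs (Suc n) I C f"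
  by auto

lemma bounded_derivs_mono:
  "bounded_derivs n I C f \<Longrightarrow> C \<le> C' \<Longrightarrow> I' \<subseteq> I \<Longrightarrow> bounded_derivs n I' C' f"
proof (induction n arbitrary: f)
  case (Suc n)
  from Suc.prems(1) obtain f' where "\<forall>x\<in>I. (f has_real_derivative f' x) (at x)" "bounded_derivs n I C f'" by auto
  with Suc show ?case by (intro bounded_derivs_SucI[where f' = f']) (auto intro: order_trans)
qed (auto intro: order_trans)

lemma bounded_derivs_SucE:
  assumes "bounded_derivs (Suc n) I C f"
  obtains f' where "\<And>x. x \<in> I \<Longrightarrow> (f has_real_derivative f' x) (at x)" "bounded_derivs n I C f'"
  using assms by auto

lemma bounded_derivs_lower: "bounded_derivs (Suc n) I C f \<Longrightarrow> bounded_derivs n I C f"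
  by (induction n arbitrary: f) auto

lemma bounded_derivs_continuous: "bounded_derivs (Suc n) I C f \<Longrightarrow> continuous_on I f"
  by (metis bounded_derivs_SucE continuous_at_imp_continuous_on DERIV_isCont)

lemma bounded_derivs_zero: "0 \<le> C \<Longrightarrow> bounded_derivs n I C (\<lambda>x. 0)"
  by (induction n) (auto intro!: exI[of _ "\<lambda>_. 0"])

lemma bounded_derivs_const: "bounded_derivs n I \<bar>a\<bar> (\<lambda>x. a)"
  by (cases n) (auto intro!: exI[of _ "\<lambda>_. 0"] bounded_derivs_zero)

lemma bounded_derivs_add:
  "bounded_derivs n I A f \<Longrightarrow> bounded_derivs n I B g \<Longrightarrow> bounded_derivs n I (A + B) (\<lambda>x. f x + g x)"
proof (induction n arbitrary: f g)
  case 0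
  then show ?case by (auto intro: order_trans[OF abs_triangle_ineq] add_mono)
next
  case (Suc n)
  from Suc.prems(1) obtain f' where f': "\<And>x. x \<in> I \<Longrightarrow> (f has_real_derivative f' x) (at x)" "bounded_derivs n I A f'"
    by (rule bounded_derivs_SucE) blast
  from Suc.prems(2) obtain g' where g': "\<And>x. x \<in> I \<Longrightarrow> (g has_real_derivative g' x) (at x)" "bounded_derivs n I B g'"
    by (rule bounded_derivs_SucE) blast
  have "\<bar>f x + g x\<bar> \<le> A + B" if "x \<in> I" for x
    using bounded_derivs_bound[OF Suc.prems(1) that] bounded_derivs_bound[OF Suc.prems(2) that] by linarith
  with f' g' Suc.IH show ?case
    by (intro bounded_derivs_SucI[where f' = "\<lambda>x. f' x + g' x"]) (auto intro!: derivative_eq_intros)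
qed

text \<open>Leibniz's rule doubles the number of terms with each derivative, whence the factor
  2^n.\<close>

lemma bounded_derivs_mult:
  "bounded_derivs n I A f \<Longrightarrow> bounded_derivs n I B g \<Longrightarrow> 0 \<le> A \<Longrightarrow> 0 \<le> B \<Longrightarrow>
   bounded_derivs n I (2 ^ n * A * B) (\<lambda>x. f x * g x)"
proof (induction n arbitrary: f g)
  case 0
  then show ?case by (auto simp: abs_mult intro: mult_mono)
next
  case (Suc n)
  from Suc.prems(1) obtain f' where f': "\<And>x. x \<in> I \<Longrightarrow> (f has_real_derivative f' x) (at x)" "bounded_derivs n I A f'"
    by (rule bounded_derivs_SucE) blast
  from Suc.prems(2) obtain g' where g': "\<And>x. x \<in> I \<Longrightarrow> (g has_real_derivative g' x) (at x)" "bounded_derivs n I B g'"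
    by (rule bounded_derivs_SucE) blast
  note fg = f' g'
  have "bounded_derivs n I (2 ^ n * A * B + 2 ^ n * A * B) (\<lambda>x. f' x * g x + f x * g' x)"
    using Suc fg bounded_derivs_lower by (intro bounded_derivs_add Suc.IH) blast+
  then have b: "bounded_derivs n I (2 ^ Suc n * A * B) (\<lambda>x. f' x * g x + f x * g' x)"
    by (rule bounded_derivs_mono) (auto simp: mult.assoc)
  have "\<bar>f x * g x\<bar> \<le> 2 ^ Suc n * A * B" if "x \<in> I" for x
  proof -
    have "\<bar>f x * g x\<bar> \<le> A * B" using bounded_derivs_bound[OF Suc.prems(1) that] bounded_derivs_bound[OF Suc.prems(2) that]
      by (auto simp: abs_mult intro: mult_mono)
    also have "A * B = 1 * (A * B)" by simp
    also have "\<dots> \<le> 2 ^ Suc n * (A * B)" using Suc.prems(3,4)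
      by (intro mult_right_mono one_le_power) auto
    finally show ?thesis by (simp add: mult.assoc)
  qed
  with b fg show ?case
    by (intro bounded_derivs_SucI[where f' = "\<lambda>x. f' x * g x + f x * g' x"])
       (auto intro!: derivative_eq_intros simp: mult.commute)
qed

text \<open>The factor K' is fixed before g and C: a change of variables has a fixed cost over whole
  families of functions. The uniformity of the multiplier bounds in the time t rests on
  this.\<close>

lemma bounded_derivs_compose:
  assumes "\<And>x. x \<in> I \<Longrightarrow> \<phi> x \<in> J" "\<And>x. x \<in> I \<Longrightarrow> (\<phi> has_real_derivative \<psi> x) (at x)" "bounded_derivs n I K \<psi>" "0 \<le> K"
  shows "\<exists>K'\<ge>0. \<forall>g C. 0 \<le> C \<longrightarrow> bounded_derivs n J C g \<longrightarrow> bounded_derivs n I (K' * C) (\<lambda>x. g (\<phi> x))"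
  using assms(3)
proof (induction n)
  case 0
  then show ?case using assms(1) by (intro exI[of _ 1]) auto
next
  case (Suc n)
  then obtain K' where K': "0 \<le> K'"
    "\<And>g C. 0 \<le> C \<Longrightarrow> bounded_derivs n J C g \<Longrightarrow> bounded_derivs n I (K' * C) (\<lambda>x. g (\<phi> x))"
    using bounded_derivs_lower by blast
  define L where "L = 1 + 2 ^ n * K' * K"
  have L: "0 \<le> L" "1 \<le> L" using K'(1) assms(4) by (auto simp: L_def)
  show ?case
  proof (intro exI[of _ L] conjI allI impI)
    fix g C assume C: "0 \<le> (C::real)" and g: "bounded_derivs (Suc n) J C g"
    then obtain g' where g': "\<And>x. x \<in> J \<Longrightarrow> (g has_real_derivative g' x) (at x)" "bounded_derivs n J C g'" by auto
    have "bounded_derivs n I (2 ^ n * (K' * C) * K) (\<lambda>x. g' (\<phi> x) * \<psi> x)"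
      using g' C K' Suc.prems assms(4) bounded_derivs_lower by (intro bounded_derivs_mult) auto
    then have b: "bounded_derivs n I (L * C) (\<lambda>x. g' (\<phi> x) * \<psi> x)"
      by (rule bounded_derivs_mono) (use C in \<open>auto simp: L_def algebra_simps\<close>)
    have "\<bar>g (\<phi> x)\<bar> \<le> L * C" if "x \<in> I" for x
    proof -
      have "\<bar>g (\<phi> x)\<bar> \<le> C" using bounded_derivs_bound[OF g] assms(1) that by auto
      also have "\<dots> \<le> L * C" using mult_right_mono[OF L(2) C] by simp
      finally show ?thesis .
    qed
    then show "bounded_derivs (Suc n) I (L * C) (\<lambda>x. g (\<phi> x))"
    proof (rule bounded_derivs_SucI[OF _ _ b])
      fix x assume "x \<in> I"
      then show "((\<lambda>x. g (\<phi> x)) has_real_derivative g' (\<phi> x) * \<psi> x) (at x)"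
        using assms(1,2) g'(1) by (intro DERIV_chain2) auto
    qed
  qed (rule L)
qed

lemma bounded_derivs_cong:
  assumes "bounded_derivs n I C f" "open I" "\<And>x. x \<in> I \<Longrightarrow> f x = g x"
  shows "bounded_derivs n I C g"
proof (cases n)
  case 0
  then show ?thesis using assms by auto
next
  case (Suc m)
  then obtain f' where f': "\<And>x. x \<in> I \<Longrightarrow> (f has_real_derivative f' x) (at x)" "bounded_derivs m I C f'"
    using assms by auto
  have "(g has_real_derivative f' x) (at x)" if "x \<in> I" for x
    by (rule has_field_derivative_transform_within_open[OF f'(1)[OF that] assms(2) that assms(3)])
  then show ?thesis using f'(2) assms(1,3) bounded_derivs_bound[OF assms(1)] unfolding Suc
    by (intro bounded_derivs_SucI) auto
qed

text \<open>Off the closed set K the derivative is 0 by locality, inside I it is the given one, and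
  on the overlap the two agree by uniqueness. The derivative so defined again vanishes off K, which
  carries the induction.\<close>

lemma bounded_derivs_extend:
  assumes "bounded_derivs n I C f" "open I" "closed K" "K \<subseteq> I" "\<And>x. x \<notin> K \<Longrightarrow> f x = 0" "0 \<le> C"
  shows "bounded_derivs n UNIV C f"
  using assms(1,5)
proof (induction n arbitrary: f)
  case 0
  then show ?case using assms(4,6) by (auto) (metis abs_zero subsetD)
next
  case (Suc n)
  from Suc.prems(1) obtain f' where f': "\<And>x. x \<in> I \<Longrightarrow> (f has_real_derivative f' x) (at x)" "bounded_derivs n I C f'"
    by (rule bounded_derivs_SucE) blast
  define f'' where "f'' = (\<lambda>x. if x \<in> I then f' x else 0)"
  have zero: "(f has_real_derivative 0) (at x)" if "x \<notin> K" for x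
  proof -
    have "((\<lambda>x. 0) has_real_derivative 0) (at x)" by simp
    then show ?thesis
      by (rule has_field_derivative_transform_within_open[where S = "- K"])
         (use assms(3) Suc.prems that in auto)
  qed
  have d: "(f has_real_derivative f'' x) (at x)" for x
    using f'(1) zero assms(4) by (cases "x \<in> I") (auto simp: f''_def)
  have "f'' x = 0" if "x \<notin> K" for x using DERIV_unique[OF d zero[OF that]] .
  moreover have "bounded_derivs n I C f''"
    by (rule bounded_derivs_cong[OF f'(2) assms(2)]) (simp add: f''_def)
  ultimately have "bounded_derivs n UNIV C f''" by (rule Suc.IH[rotated])
  moreover have "\<bar>f x\<bar> \<le> C" for x
    using bounded_derivs_bound[OF Suc.prems(1)] Suc.prems(2) assms(4,6) by (metis abs_zero subsetD)
  ultimately show ?case using d by (intro bounded_derivs_SucI) auto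
qed

section \<open>Elementary functions with bounded derivatives and a smooth cutoff\<close>

lemma bounded_derivs_powr:
  assumes "0 < lo" shows "\<exists>C\<ge>0. bounded_derivs n {lo<..<hi} C (\<lambda>x. x powr a)"
proof (induction n arbitrary: a)
  case 0
  have "\<bar>x powr a\<bar> \<le> lo powr a + hi powr a" if "x \<in> {lo<..<hi}" for x
  proof (cases "a \<ge> 0")
    case True
    then have "x powr a \<le> hi powr a" using that assms by (intro powr_mono2) auto
    then show ?thesis by (simp add: add_increasing)
  next
    case False
    then have "x powr a \<le> lo powr a" using that assms by (intro powr_mono2') auto
    then show ?thesis by (simp add: add_increasing2)
  qed
  then show ?case by (intro exI[of _ "lo powr a + hi powr a"]) auto
next
  case (Suc n)
  obtain C where C: "0 \<le> C" "bounded_derivs n {lo<..<hi} C (\<lambda>x. x powr a)" using Suc by blast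
  obtain D where D: "0 \<le> D" "bounded_derivs n {lo<..<hi} D (\<lambda>x. x powr (a - 1))" using Suc by blast
  have "bounded_derivs n {lo<..<hi} (2 ^ n * \<bar>a\<bar> * D) (\<lambda>x. a * x powr (a - 1))"
    using D by (intro bounded_derivs_mult bounded_derivs_const) auto
  then have "bounded_derivs n {lo<..<hi} (C + 2 ^ n * \<bar>a\<bar> * D) (\<lambda>x. a * x powr (a - 1))"
    by (rule bounded_derivs_mono) (use C in auto)
  then have "bounded_derivs (Suc n) {lo<..<hi} (C + 2 ^ n * \<bar>a\<bar> * D) (\<lambda>x. x powr a)"
  proof (rule bounded_derivs_SucI[rotated -1])
    fix x assume x: "x \<in> {lo<..<hi}"
    show "\<bar>x powr a\<bar> \<le> C + 2 ^ n * \<bar>a\<bar> * D" using bounded_derivs_bound[OF C(2) x] D(1) by (simp add: add_increasing2)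
    show "((\<lambda>x. x powr a) has_real_derivative a * x powr (a - 1)) (at x)"
      using x assms by (auto intro!: derivative_eq_intros)
  qed
  then show ?case using C(1) D(1) by (intro exI[of _ "C + 2 ^ n * \<bar>a\<bar> * D"]) auto
qed

lemma bounded_derivs_exp: "\<exists>C\<ge>0. bounded_derivs n {lo<..<hi} C (\<lambda>x. exp (a * x :: real))"
proof (induction n)
  case 0
  have "\<bar>exp (a * x)\<bar> \<le> exp (\<bar>a\<bar> * (\<bar>lo\<bar> + \<bar>hi\<bar>))" if "x \<in> {lo<..<hi}" for x
  proof -
    have "a * x \<le> \<bar>a\<bar> * \<bar>x\<bar>" by (metis abs_ge_self abs_mult)
    also have "\<dots> \<le> \<bar>a\<bar> * (\<bar>lo\<bar> + \<bar>hi\<bar>)" using that by (intro mult_left_mono) auto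
    finally show ?thesis by simp
  qed
  then show ?case by (intro exI[of _ "exp (\<bar>a\<bar> * (\<bar>lo\<bar> + \<bar>hi\<bar>))"]) auto
next
  case (Suc n)
  then obtain C where C: "0 \<le> C" "bounded_derivs n {lo<..<hi} C (\<lambda>x. exp (a * x))" by blast
  have "bounded_derivs n {lo<..<hi} (2 ^ n * \<bar>a\<bar> * C) (\<lambda>x. a * exp (a * x))"
    using C by (intro bounded_derivs_mult bounded_derivs_const) auto
  then have "bounded_derivs n {lo<..<hi} (C + 2 ^ n * \<bar>a\<bar> * C) (\<lambda>x. a * exp (a * x))"
    by (rule bounded_derivs_mono) (use C in auto)
  then have "bounded_derivs (Suc n) {lo<..<hi} (C + 2 ^ n * \<bar>a\<bar> * C) (\<lambda>x. exp (a * x))"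
  proof (rule bounded_derivs_SucI[rotated -1])
    fix x assume x: "x \<in> {lo<..<hi}"
    show "\<bar>exp (a * x)\<bar> \<le> C + 2 ^ n * \<bar>a\<bar> * C" using bounded_derivs_bound[OF C(2) x] C(1) by (simp add: add_increasing2)
    show "((\<lambda>x. exp (a * x)) has_real_derivative a * exp (a * x)) (at x)"
      by (auto intro!: derivative_eq_intros)
  qed
  then show ?case using C(1) by (intro exI[of _ "C + 2 ^ n * \<bar>a\<bar> * C"]) auto
qed

lemma bounded_derivs_tan:
  assumes "0 < \<theta>" "\<theta> < pi / 2"
  shows "\<exists>C\<ge>0. bounded_derivs n {-\<theta><..<\<theta>} C tan"
proof (induction n)
  case 0
  have "\<bar>tan x\<bar> \<le> tan \<theta>" if "x \<in> {-\<theta><..<\<theta>}" for x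
    using tan_monotone[of x \<theta>] tan_monotone[of "-\<theta>" x] that assms by (auto simp: abs_le_iff)
  moreover have "0 \<le> tan \<theta>" using assms tan_gt_zero[of \<theta>] by simp
  ultimately show ?case by auto
next
  case (Suc n)
  then obtain C where C: "0 \<le> C" "bounded_derivs n {-\<theta><..<\<theta>} C tan" by blast
  have "bounded_derivs n {-\<theta><..<\<theta>} (\<bar>1\<bar> + 2 ^ n * C * C) (\<lambda>x. 1 + tan x * tan x)"
    using C by (intro bounded_derivs_mult bounded_derivs_add bounded_derivs_const) auto
  then have "bounded_derivs n {-\<theta><..<\<theta>} (C + 1 + 2 ^ n * C * C) (\<lambda>x. 1 + tan x * tan x)"
    by (rule bounded_derivs_mono) (use C in auto)
  then have "bounded_derivs (Suc n) {-\<theta><..<\<theta>} (C + 1 + 2 ^ n * C * C) tan"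
  proof (rule bounded_derivs_SucI[rotated -1])
    fix x assume x: "x \<in> {-\<theta><..<\<theta>}"
    show "\<bar>tan x\<bar> \<le> C + 1 + 2 ^ n * C * C" using bounded_derivs_bound[OF C(2) x] C(1) by (smt (verit) mult_nonneg_nonneg zero_le_power)
    have c: "cos x > 0" using x assms by (intro cos_gt_zero_pi) auto
    have "inverse ((cos x)\<^sup>2) = 1 + tan x * tan x"
      using c tan_sec[of x] by (simp add: power2_eq_square)
    then show "(tan has_real_derivative 1 + tan x * tan x) (at x)"
      using DERIV_tan[of x] c by simp
  qed
  then show ?case using C(1) by (intro exI[of _ "C + 1 + 2 ^ n * C * C"]) auto
qed

text \<open>At 0 the difference quotient is at most |h|^(m - 1) in absolute value. This tends to 0
  because m >= 2 whenever a derivative is taken.\<close>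

lemma bounded_derivs_pos_part:
  "n < m \<Longrightarrow> 0 \<le> B \<Longrightarrow> \<exists>C\<ge>0. bounded_derivs n {-B<..<B} C (\<lambda>x. (max 0 x) ^ m)"
proof (induction n arbitrary: m)
  case 0
  have "\<bar>(max 0 x) ^ m\<bar> \<le> B ^ m" if "x \<in> {-B<..<B}" for x
    using that by (auto simp: power_abs intro!: power_mono)
  then show ?case using 0 by (intro exI[of _ "B ^ m"]) auto
next
  case (Suc n)
  obtain C where C: "0 \<le> C" "bounded_derivs n {-B<..<B} C (\<lambda>x. (max 0 x) ^ m)"
    using Suc.IH[of m] Suc.prems by auto
  obtain D where D: "0 \<le> D" "bounded_derivs n {-B<..<B} D (\<lambda>x. (max 0 x) ^ (m - 1))"
    using Suc.IH[of "m - 1"] Suc.prems(1,2) less_diff_conv by (metis Suc_eq_plus1)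
  have "bounded_derivs n {-B<..<B} (2 ^ n * \<bar>real m\<bar> * D) (\<lambda>x. real m * (max 0 x) ^ (m - 1))"
    using D by (intro bounded_derivs_mult bounded_derivs_const) auto
  then have "bounded_derivs n {-B<..<B} (C + 2 ^ n * \<bar>real m\<bar> * D) (\<lambda>x. real m * (max 0 x) ^ (m - 1))"
    by (rule bounded_derivs_mono) (use C in auto)
  then have "bounded_derivs (Suc n) {-B<..<B} (C + 2 ^ n * \<bar>real m\<bar> * D) (\<lambda>x. (max 0 x) ^ m)"
  proof (rule bounded_derivs_SucI[rotated -1])
    fix x assume x: "x \<in> {-B<..<B}"
    show "\<bar>(max 0 x) ^ m\<bar> \<le> C + 2 ^ n * \<bar>real m\<bar> * D" using bounded_derivs_bound[OF C(2) x] D(1) by (simp add: add_increasing2)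
    consider "x < 0" | "x > 0" | "x = 0" by linarith
    then show "((\<lambda>x. (max 0 x) ^ m) has_real_derivative real m * (max 0 x) ^ (m - 1)) (at x)"
    proof cases
      case 1
      have "((\<lambda>x. 0) has_real_derivative 0) (at x)" by simp
      then have "((\<lambda>x. (max 0 x) ^ m) has_real_derivative 0) (at x)"
        by (rule has_field_derivative_transform_within_open[where S = "{..<0}"]) (use 1 Suc.prems in auto)
      then show ?thesis using 1 Suc.prems by (simp add: power_0_left)
    next
      case 2
      have "((\<lambda>x. x ^ m) has_real_derivative real m * x ^ (m - 1)) (at x)" by (auto intro!: derivative_eq_intros)
      then have "((\<lambda>x. (max 0 x) ^ m) has_real_derivative real m * x ^ (m - 1)) (at x)"
        by (rule has_field_derivative_transform_within_open[where S = "{0<..}"]) (use 2 in auto)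
      then show ?thesis using 2 by simp
    next
      case 3
      have "((\<lambda>h::real. (max 0 h) ^ m / h) \<longlongrightarrow> 0) (at 0)"
      proof (rule Lim_null_comparison)
        show "\<forall>\<^sub>F h in at 0. norm ((max 0 h) ^ m / h) \<le> \<bar>h\<bar> ^ (m - 1)"
        proof (rule always_eventually, rule allI)
          fix h :: real
          have "m = Suc (m - 1)" using Suc.prems by simp
          then have "\<bar>h\<bar> ^ m = \<bar>h\<bar> * \<bar>h\<bar> ^ (m - 1)" by (metis power_Suc)
          moreover have "\<bar>max 0 h\<bar> ^ m \<le> \<bar>h\<bar> ^ m" by (intro power_mono) auto
          ultimately show "norm ((max 0 h) ^ m / h) \<le> \<bar>h\<bar> ^ (m - 1)"
            by (cases "h = 0") (simp_all add: divide_le_eq power_abs mult.commute)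
        qed
        have z: "\<bar>0::real\<bar> ^ (m - 1) = 0" using Suc.prems by (simp add: power_0_left)
        have "((\<lambda>h::real. \<bar>h\<bar> ^ (m - 1)) \<longlongrightarrow> \<bar>0\<bar> ^ (m - 1)) (at 0)" by (intro tendsto_intros)
        then show "((\<lambda>h::real. \<bar>h\<bar> ^ (m - 1)) \<longlongrightarrow> 0) (at 0)" unfolding z .
      qed
      then show ?thesis using 3 Suc.prems by (simp add: has_field_derivative_iff power_0_left)
    qed
  qed
  then show ?case using C(1) D(1) by (intro exI[of _ "C + 2 ^ n * \<bar>real m\<bar> * D"]) auto
qed

lemma bounded_derivs_affine:
  assumes "bounded_derivs n J C g" "\<And>x. x \<in> I \<Longrightarrow> a * x + b \<in> J" "0 \<le> C"
  shows "\<exists>C'\<ge>0. bounded_derivs n I C' (\<lambda>x. g (a * x + b))"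
proof -
  have "\<And>x. x \<in> I \<Longrightarrow> ((\<lambda>x. a * x + b) has_real_derivative a) (at x)" by (auto intro!: derivative_eq_intros)
  then have "\<exists>K'\<ge>0. \<forall>g C. 0 \<le> C \<longrightarrow> bounded_derivs n J C g \<longrightarrow> bounded_derivs n I (K' * C) (\<lambda>x. g (a * x + b))"
    using assms(2) by (intro bounded_derivs_compose[OF _ _ bounded_derivs_const abs_ge_zero]) auto
  then obtain K' where "K' \<ge> 0" "bounded_derivs n I (K' * C) (\<lambda>x. g (a * x + b))"
    using assms(1,3) by blast
  then show ?thesis using assms(3) by (intro exI[of _ "K' * C"]) auto
qed

text \<open>One minus the normalized primitive of a bump on [1/4, 1/2]. The interval (-5, 5)
  contains 4 s for all s in (-1, 1), so that both terms of the later difference H(s) - H(4 s) are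
  controlled.\<close>

lemma cutoff_exists:
  "\<exists>H C. 0 \<le> C \<and> bounded_derivs n {-5<..<5} C H \<and> (\<forall>s\<in>{-5<..1/4}. H s = (1::real)) \<and> (\<forall>s\<ge>1/2. H s = 0)"
proof -
  \<comment> \<open>Positive exactly on (1/4, 1/2); the power n + 1 provides n bounded derivatives
    at the end points.\<close>
  define w where "w = (\<lambda>x::real. (max 0 (1 * x + (- 1/4))) ^ Suc n * (max 0 ((-1) * x + 1/2)) ^ Suc n)"
  obtain C0 where C0: "0 \<le> C0" "bounded_derivs n {-20<..<20} C0 (\<lambda>x. (max 0 x) ^ Suc n)"
    using bounded_derivs_pos_part[of n "Suc n" 20] by auto
  obtain A where A: "0 \<le> A" "bounded_derivs n {-6<..<6} A (\<lambda>x. (max 0 (1 * x + (- 1/4))) ^ Suc n)"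
    using bounded_derivs_affine[OF C0(2) _ C0(1), of "{-6<..<6}" 1 "-1/4"] by auto
  obtain B where B: "0 \<le> B" "bounded_derivs n {-6<..<6} B (\<lambda>x. (max 0 ((-1) * x + 1/2)) ^ Suc n)"
    using bounded_derivs_affine[OF C0(2) _ C0(1), of "{-6<..<6}" "-1" "1/2"] by auto
  have w: "bounded_derivs n {-6<..<6} (2 ^ n * A * B) w"
    unfolding w_def using A B by (intro bounded_derivs_mult) auto
  have cw: "continuous_on S w" for S unfolding w_def by (intro continuous_intros)
  have w0: "0 \<le> w x" for x unfolding w_def by simp
  define I where "I = integral {-5..1/2} w"
  have intw: "w integrable_on {a..b}" for a b using cw by (rule integrable_continuous_interval)
  have I: "0 < I"
  proof -
    have "0 \<le> I" unfolding I_def using w0 by (intro integral_nonneg intw) auto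
    moreover have "I \<noteq> 0"
    proof
      assume "I = 0"
      then have "(w has_integral 0) (cbox (-5) (1/2))"
        using intw[of "-5" "1/2"] by (metis I_def box_real(2) has_integral_integral)
      then have "w (3/8) = 0"
        by (intro has_integral_0_cbox_imp_0[OF _ _ _ , of "-5" "1/2" w]) (use cw w0 in \<open>auto simp: box_real\<close>)
      then show False by (simp add: w_def)
    qed
    ultimately show ?thesis by simp
  qed
  \<comment> \<open>The primitive is used only on (-5, 5); the constant 0 from 5 on extends the
    vanishing to all s >= 1/2.\<close>
  define H where "H = (\<lambda>s. if s \<le> -5 then 1 else if s \<ge> 5 then 0 else 1 + (- 1 / I) * integral {-5..s} w)"
  have H1: "H s = 1" if "s \<in> {-5<..1/4}" for s
  proof -
    have "integral {-5..s} w = integral {-5..s} (\<lambda>x. 0)"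
      using that by (intro integral_cong) (auto simp: w_def)
    then show ?thesis using that by (simp add: H_def)
  qed
  have H2: "H s = 0" if "s \<ge> 1/2" for s
  proof (cases "s \<ge> 5")
    case False
    have "integral {-5..1/2} w + integral {1/2..s} w = integral {-5..s} w"
      using that intw by (intro Henstock_Kurzweil_Integration.integral_combine) auto
    moreover have "integral {1/2..s} w = integral {1/2..s} (\<lambda>x. 0)"
      by (intro integral_cong) (auto simp: w_def)
    ultimately have "integral {-5..s} w = I" by (simp add: I_def)
    then show ?thesis using that False I by (simp add: H_def)
  qed (use that in \<open>simp add: H_def\<close>)
  have dH: "(H has_real_derivative (- 1 / I) * w s) (at s)" if s: "s \<in> {-5<..<5}" for s
  proof -
    have "((\<lambda>u. integral {-5..u} w) has_real_derivative w s) (at s within {-5..5})"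
      using s cw by (intro integral_has_real_derivative) auto
    then have "((\<lambda>u. integral {-5..u} w) has_real_derivative w s) (at s)"
      using s by (simp add: at_within_interior[of s "{-5..5}"])
    then have "((\<lambda>u. 1 + (- 1 / I) * integral {-5..u} w) has_real_derivative (- 1 / I) * w s) (at s)"
      by (intro DERIV_add[OF DERIV_const, of _ _ _ _ 1, simplified add_0] DERIV_cmult)
    then show ?thesis
      by (rule has_field_derivative_transform_within_open[where S = "{-5<..<5}"]) (use s in \<open>auto simp: H_def\<close>)
  qed
  have "continuous_on {-5..5} (\<lambda>u. 1 + (- 1 / I) * integral {-5..u} w)"
    by (intro continuous_intros indefinite_integral_continuous_1 intw)
  then have "bounded ((\<lambda>u. 1 + (- 1 / I) * integral {-5..u} w) ` {-5..5})"
    by (intro compact_imp_bounded compact_continuous_image) auto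
  then obtain b where b: "\<And>u. u \<in> {-5..5} \<Longrightarrow> \<bar>1 + (- 1 / I) * integral {-5..u} w\<bar> \<le> b"
    unfolding bounded_iff by fastforce
  have b0: "0 \<le> b" using b[of 0] by (auto intro: order_trans[OF abs_ge_zero])
  define C where "C = b + 2 ^ n * \<bar>- 1 / I\<bar> * (2 ^ n * A * B)"
  have C: "0 \<le> C" using b0 A B by (simp add: C_def)
  have w5: "bounded_derivs n {-5<..<5} (2 ^ n * A * B) w" by (rule bounded_derivs_mono[OF w order_refl]) auto
  have "bounded_derivs n {-5<..<5} (2 ^ n * \<bar>- 1 / I\<bar> * (2 ^ n * A * B)) (\<lambda>s. (- 1 / I) * w s)"
    using A B by (intro bounded_derivs_mult bounded_derivs_const w5) simp_all
  then have "bounded_derivs n {-5<..<5} C (\<lambda>s. (- 1 / I) * w s)"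
    by (rule bounded_derivs_mono) (use b0 in \<open>auto simp: C_def\<close>)
  moreover have "\<bar>H s\<bar> \<le> C" if "s \<in> {-5<..<5}" for s
  proof -
    have "\<bar>H s\<bar> \<le> b" using b[of s] that by (auto simp: H_def)
    then show ?thesis using A B by (simp add: C_def add_increasing2)
  qed
  ultimately have "bounded_derivs (Suc n) {-5<..<5} C H" using dH by (intro bounded_derivs_SucI)
  then show ?thesis using bounded_derivs_lower C H1 H2 by blast
qed

lemma bounded_derivs_iterated_deriv:
  assumes "\<And>k x. k < n \<Longrightarrow> (deriv ^^ k) F differentiable (at x)" "\<And>k x. k \<le> n \<Longrightarrow> \<bar>(deriv ^^ k) F x\<bar> \<le> c"
  shows "bounded_derivs n UNIV c F"
  using assms
proof (induction n arbitrary: F)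
  case 0
  then show ?case by (auto dest: spec[of _ 0])
next
  case (Suc n)
  have "bounded_derivs n UNIV c (deriv F)"
  proof (rule Suc.IH)
    fix k x
    show "(deriv ^^ k) (deriv F) differentiable (at x)" if "k < n"
      using Suc.prems(1)[of "Suc k" x] that by (simp add: funpow_swap1)
    show "\<bar>(deriv ^^ k) (deriv F) x\<bar> \<le> c" if "k \<le> n"
      using Suc.prems(2)[of "Suc k" x] that by (simp add: funpow_swap1)
  qed
  moreover have "(F has_real_derivative deriv F x) (at x)" for x
    using Suc.prems(1)[of 0 x] by (simp add: DERIV_deriv_iff_real_differentiable)
  moreover have "\<bar>F x\<bar> \<le> c" for x using Suc.prems(2)[of 0 x] by simp
  ultimately show ?case by (intro bounded_derivs_SucI) auto
qed

section \<open>Cosine expansions\<close>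

text \<open>\<open>cheb n i\<close> is the coefficient of u^i in the Chebyshev polynomial T_n of the
  first kind, by T_(n+2) = 2 u T_(n+1) - T_n; the case distinction shifts coefficients for the
  product with u.\<close>

fun cheb :: "nat \<Rightarrow> nat \<Rightarrow> real" where
  "cheb 0 i = (if i = 0 then 1 else 0)"
| "cheb (Suc 0) i = (if i = 1 then 1 else 0)"
| "cheb (Suc (Suc n)) i = 2 * (case i of 0 \<Rightarrow> 0 | Suc j \<Rightarrow> cheb (Suc n) j) - cheb n i"

lemma cheb_sum_Suc_Suc:
  "(\<Sum>i\<le>Suc N. cheb (Suc (Suc n)) i * u ^ i) =
     2 * u * (\<Sum>i\<le>N. cheb (Suc n) i * u ^ i) - (\<Sum>i\<le>Suc N. cheb n i * u ^ i)"
proof -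
  have "(\<Sum>i\<le>Suc N. (case i of 0 \<Rightarrow> 0 | Suc j \<Rightarrow> cheb (Suc n) j) * u ^ i) = u * (\<Sum>i\<le>N. cheb (Suc n) i * u ^ i)"
    by (simp add: sum.atMost_Suc_shift sum_distrib_left mult_ac del: sum.atMost_Suc)
  then show ?thesis
    by (simp add: left_diff_distrib sum_subtractf sum_distrib_left[symmetric] mult.assoc del: sum.atMost_Suc)
qed

text \<open>The recursion is that of cos(n theta), from the addition theorem. Summing up to an
  arbitrary N >= n leaves room for the shifted and the unshifted sum in the recursion; the
  coefficients beyond n contribute nothing.\<close>

lemma cheb_cos: "n \<le> N \<Longrightarrow> (\<Sum>i\<le>N. cheb n i * cos \<theta> ^ i) = cos (real n * \<theta>)"
proof (induction n arbitrary: N rule: less_induct)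
  case (less n)
  consider "n = 0" | "n = Suc 0" | m where "n = Suc (Suc m)" by (metis not0_implies_Suc)
  then show ?case
  proof cases
    case 1
    have "(\<Sum>i\<le>N. cheb 0 i * cos \<theta> ^ i) = (\<Sum>i\<le>N. if i = 0 then 1 else 0)" by (intro sum.cong) auto
    then show ?thesis using 1 by simp
  next
    case 2
    have "(\<Sum>i\<le>N. cheb (Suc 0) i * cos \<theta> ^ i) = (\<Sum>i\<le>N. if i = 1 then cos \<theta> else 0)" by (intro sum.cong) auto
    then show ?thesis using 2 less.prems by simp
  next
    case 3
    then obtain N' where N: "N = Suc N'" "Suc m \<le> N'" using less.prems by (cases N) auto
    have "cos (real (Suc (Suc m)) * \<theta>) + cos (real m * \<theta>) = 2 * cos \<theta> * cos (real (Suc m) * \<theta>)"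
      using cos_add[of "real (Suc m) * \<theta>" \<theta>] cos_diff[of "real (Suc m) * \<theta>" \<theta>] by (simp add: algebra_simps)
    then show ?thesis using less.IH[of "Suc m" N'] less.IH[of m "Suc N'"] N 3
      by (simp add: cheb_sum_Suc_Suc del: sum.atMost_Suc cheb.simps)
  qed
qed

text \<open>The recursion gives at most 2 * 3^(m + 1) + 3^m = 7 * 3^m, which is below 3^(m +
  2).\<close>

lemma cheb_abs_sum: "(\<Sum>i\<le>N. \<bar>cheb n i\<bar>) \<le> 3 ^ n"
proof (induction n arbitrary: N rule: less_induct)
  case (less n)
  consider "n = 0" | "n = Suc 0" | m where "n = Suc (Suc m)" by (metis not0_implies_Suc)
  then show ?case
  proof cases
    case 1
    have "(\<Sum>i\<le>N. \<bar>cheb 0 i\<bar>) = (\<Sum>i\<le>N. if i = 0 then 1 else 0)" by (intro sum.cong) auto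
    then show ?thesis using 1 by simp
  next
    case 2
    have "(\<Sum>i\<le>N. \<bar>cheb (Suc 0) i\<bar>) = (\<Sum>i\<le>N. if i = 1 then 1 else 0)" by (intro sum.cong) auto
    then show ?thesis using 2 by (simp split: if_splits)
  next
    case 3
    have "(\<Sum>i\<le>N. \<bar>cheb n i\<bar>) \<le> (\<Sum>i\<le>Suc N. \<bar>cheb n i\<bar>)" by simp
    also have "\<dots> \<le> (\<Sum>i\<le>Suc N. 2 * \<bar>case i of 0 \<Rightarrow> 0 | Suc j \<Rightarrow> cheb (Suc m) j\<bar> + \<bar>cheb m i\<bar>)"
      using 3 by (intro sum_mono) (auto intro: order_trans[OF abs_triangle_ineq4])
    also have "\<dots> = 2 * (\<Sum>i\<le>N. \<bar>cheb (Suc m) i\<bar>) + (\<Sum>i\<le>Suc N. \<bar>cheb m i\<bar>)"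
      by (simp add: sum.distrib sum_distrib_left[symmetric] del: sum.atMost_Suc)
         (simp add: sum.atMost_Suc_shift del: sum.atMost_Suc)
    also have "\<dots> \<le> 2 * 3 ^ Suc m + 3 ^ m"
      using less.IH[of "Suc m" N] less.IH[of m "Suc N"] 3 by linarith
    also have "\<dots> \<le> 3 ^ n" using 3 by simp
    finally show ?thesis .
  qed
qed

text \<open>Integration by parts, n times. The boundary terms vanish since F is 0 near the end
  points; cosine and sine are carried together because each step turns one into the other.\<close>

lemma fourier_coeff_decay:
  assumes "bounded_derivs n UNIV C F" "\<And>\<theta>. \<theta>1 < \<bar>\<theta>\<bar> \<Longrightarrow> F \<theta> = 0" "\<theta>1 < pi" "0 \<le> C" "1 \<le> j"
  shows "\<bar>integral {-pi..pi} (\<lambda>\<theta>. F \<theta> * cos (real j * \<theta>))\<bar> \<le> 2 * pi * C / real j ^ n \<and>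
         \<bar>integral {-pi..pi} (\<lambda>\<theta>. F \<theta> * sin (real j * \<theta>))\<bar> \<le> 2 * pi * C / real j ^ n"
  using assms(1,2)
proof (induction n arbitrary: F)
  case 0
  have b: "\<bar>integral {-pi..pi} (\<lambda>\<theta>. F \<theta> * w \<theta>)\<bar> \<le> 2 * pi * C" if "\<And>\<theta>. \<bar>w \<theta>\<bar> \<le> 1" for w :: "real \<Rightarrow> real"
  proof (cases "(\<lambda>\<theta>. F \<theta> * w \<theta>) integrable_on {-pi..pi}")
    case True
    have "\<bar>F \<theta> * w \<theta>\<bar> \<le> C" for \<theta>
      using mult_mono[of "\<bar>F \<theta>\<bar>" C "\<bar>w \<theta>\<bar>" 1] 0 that[of \<theta>] assms(4) by (auto simp: abs_mult)
    then have "norm (integral {-pi..pi} (\<lambda>\<theta>. F \<theta> * w \<theta>)) \<le> C * measure lborel (cbox (-pi) pi)"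
      using integrable_integral[OF True] assms(4) by (intro has_integral_bound[where f = "\<lambda>\<theta>. F \<theta> * w \<theta>"]) (auto simp: box_real)
    then show ?thesis by (simp add: mult.commute)
  next
    case False
    \<comment> \<open>A function that is not integrable has integral 0 by convention, so the bound
      holds for every bounded F.\<close>
    then show ?thesis using assms(4) by (simp add: not_integrable_integral)
  qed
  show ?case using b[of "\<lambda>\<theta>. cos (real j * \<theta>)"] b[of "\<lambda>\<theta>. sin (real j * \<theta>)"] by simp
next
  case (Suc n)
  from Suc.prems(1) obtain F' where F': "\<And>x. (F has_real_derivative F' x) (at x)" "bounded_derivs n UNIV C F'"
    by (rule bounded_derivs_SucE) blast
  have F'0: "F' \<theta> = 0" if "\<theta>1 < \<bar>\<theta>\<bar>" for \<theta>
  proof -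
    have "open {x::real. \<theta>1 < \<bar>x\<bar>}" by (intro open_Collect_less continuous_intros)
    moreover have "((\<lambda>x. 0) has_real_derivative 0) (at \<theta>)" by simp
    ultimately have "(F has_real_derivative 0) (at \<theta>)"
      using that Suc.prems(2) by (elim has_field_derivative_transform_within_open) auto
    then show ?thesis using F'(1) DERIV_unique by blast
  qed
  note IH = Suc.IH[OF F'(2) F'0]
  have Fpi: "F pi = 0" "F (-pi) = 0" using Suc.prems(2) assms(3) by auto
  have cF: "continuous_on S F" for S using F'(1) by (intro continuous_at_imp_continuous_on) (auto intro: DERIV_isCont)
  define j' where "j' = real j"
  have j': "0 < j'" using assms(5) by (simp add: j'_def)
  have ci: "(\<lambda>\<theta>. F \<theta> * cos (j' * \<theta>)) integrable_on {-pi..pi}" "(\<lambda>\<theta>. F \<theta> * sin (j' * \<theta>)) integrable_on {-pi..pi}"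
    by (intro integrable_continuous_interval continuous_intros cF)+
  \<comment> \<open>The fundamental theorem for the gauge integral asks nothing of F', which is not
    known to be continuous when it is the last derivative.\<close>
  have 1: "((\<lambda>\<theta>. F' \<theta> * sin (j' * \<theta>) + F \<theta> * (cos (j' * \<theta>) * j')) has_integral
          (F pi * sin (j' * pi) - F (-pi) * sin (j' * (-pi)))) {-pi..pi}"
    by (intro fundamental_theorem_of_calculus)
       (auto simp: has_real_derivative_iff_has_vector_derivative[symmetric] intro!: derivative_eq_intros DERIV_subset[OF F'(1)])
  have "((\<lambda>\<theta>. F' \<theta> * sin (j' * \<theta>) + F \<theta> * (cos (j' * \<theta>) * j') - j' * (F \<theta> * cos (j' * \<theta>)))
      has_integral (0 - j' * integral {-pi..pi} (\<lambda>\<theta>. F \<theta> * cos (j' * \<theta>)))) {-pi..pi}"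
    using 1 Fpi ci by (intro has_integral_diff has_integral_mult_right integrable_integral) auto
  then have i1: "integral {-pi..pi} (\<lambda>\<theta>. F' \<theta> * sin (j' * \<theta>)) = - j' * integral {-pi..pi} (\<lambda>\<theta>. F \<theta> * cos (j' * \<theta>))"
    by (intro integral_unique) (simp add: algebra_simps)
  have 2: "((\<lambda>\<theta>. F' \<theta> * cos (j' * \<theta>) + F \<theta> * (- sin (j' * \<theta>) * j')) has_integral
          (F pi * cos (j' * pi) - F (-pi) * cos (j' * (-pi)))) {-pi..pi}"
    by (intro fundamental_theorem_of_calculus)
       (auto simp: has_real_derivative_iff_has_vector_derivative[symmetric] intro!: derivative_eq_intros DERIV_subset[OF F'(1)])
  have "((\<lambda>\<theta>. F' \<theta> * cos (j' * \<theta>) + F \<theta> * (- sin (j' * \<theta>) * j') + j' * (F \<theta> * sin (j' * \<theta>)))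
      has_integral (0 + j' * integral {-pi..pi} (\<lambda>\<theta>. F \<theta> * sin (j' * \<theta>)))) {-pi..pi}"
    using 2 Fpi ci by (intro has_integral_add has_integral_mult_right integrable_integral) auto
  then have i2: "integral {-pi..pi} (\<lambda>\<theta>. F' \<theta> * cos (j' * \<theta>)) = j' * integral {-pi..pi} (\<lambda>\<theta>. F \<theta> * sin (j' * \<theta>))"
    by (intro integral_unique) (simp add: algebra_simps)
  have "j' * \<bar>integral {-pi..pi} (\<lambda>\<theta>. F \<theta> * cos (j' * \<theta>))\<bar> \<le> 2 * pi * C / j' ^ n"
     "j' * \<bar>integral {-pi..pi} (\<lambda>\<theta>. F \<theta> * sin (j' * \<theta>))\<bar> \<le> 2 * pi * C / j' ^ n"
    using IH i1 i2 j' unfolding j'_def[symmetric] by (simp_all add: abs_mult)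
  then show ?case using j' unfolding j'_def[symmetric] by (simp add: field_simps)
qed

section \<open>Orthogonality and completeness of the cosines\<close>

lemma integral_cos_multiple: "integral {-pi..pi} (\<lambda>\<theta>. cos (of_int m * \<theta>)) = (if m = 0 then 2 * pi else 0)"
proof (cases "m = 0")
  case False
  have "((\<lambda>\<theta>. cos (of_int m * \<theta>)) has_integral (sin (of_int m * pi) / of_int m - sin (of_int m * (-pi)) / of_int m)) {-pi..pi}"
    using False by (intro fundamental_theorem_of_calculus)
       (auto simp: has_real_derivative_iff_has_vector_derivative[symmetric] intro!: derivative_eq_intros)
  then show ?thesis using False by (simp add: integral_unique sin_integer_2pi mult.commute[of _ pi] sin_npi_int)
qed simp

lemma integral_cos_cos:
  "integral {-pi..pi} (\<lambda>\<theta>. cos (real j * \<theta>) * cos (real k * \<theta>)) =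
     (if j = k then if j = 0 then 2 * pi else pi else 0)"
proof -
  have "(\<lambda>\<theta>. cos (real j * \<theta>) * cos (real k * \<theta>)) =
     (\<lambda>\<theta>. (1/2) * (cos (of_int (int j - int k) * \<theta>) + cos (of_int (int j + int k) * \<theta>)))"
    by (rule ext) (simp add: cos_times_cos algebra_simps)
  moreover have "(\<lambda>\<theta>. cos (of_int m * \<theta>)) integrable_on {-pi..pi}" for m
    by (intro integrable_continuous_interval continuous_intros)
  ultimately have "integral {-pi..pi} (\<lambda>\<theta>. cos (real j * \<theta>) * cos (real k * \<theta>)) =
     (1/2) * (integral {-pi..pi} (\<lambda>\<theta>. cos (of_int (int j - int k) * \<theta>)) + integral {-pi..pi} (\<lambda>\<theta>. cos (of_int (int j + int k) * \<theta>)))"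
    by (simp only: integral_mult_right integral_add)
  then show ?thesis unfolding integral_cos_multiple by auto
qed

text \<open>By the product formula, orthogonality to all cos(k theta) persists after multiplication
  by powers of cos theta, hence D is orthogonal to polynomials in cos theta. An even D is itself a
  continuous function of cos theta, so by Weierstrass approximation the integral of D^2 is
  0.\<close>

lemma even_orthogonal_imp_zero:
  assumes D: "continuous_on {-pi..pi} D" "\<And>\<theta>. D (- \<theta>) = D \<theta>"
    and orth: "\<And>k. integral {-pi..pi} (\<lambda>\<theta>. D \<theta> * cos (real k * \<theta>)) = 0"
    and \<theta>: "\<theta> \<in> {-pi..pi}"
  shows "D \<theta> = (0::real)"
proof -
  have int: "(\<lambda>\<theta>. D \<theta> * w \<theta>) integrable_on {-pi..pi}" if "continuous_on {-pi..pi} w" for w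
    using D(1) that by (intro integrable_continuous_interval continuous_intros)
  have pow: "integral {-pi..pi} (\<lambda>\<theta>. D \<theta> * (cos (real k * \<theta>) * cos \<theta> ^ i)) = 0" for i k
  proof (induction i arbitrary: k)
    case 0
    then show ?case using orth by simp
  next
    case (Suc i)
    show ?case
    proof (cases k)
      case 0
      then show ?thesis using Suc.IH[of 1] by simp
    next
      case (Suc k')
      have *: "cos (real k * \<theta>) * cos \<theta> = (1/2) * (cos (real (k + 1) * \<theta>) + cos (real k' * \<theta>))" for \<theta>
        using Suc by (simp add: cos_times_cos algebra_simps)
      have "(\<lambda>\<theta>. D \<theta> * (cos (real k * \<theta>) * cos \<theta> ^ Suc i)) =
         (\<lambda>\<theta>. (1/2) * (D \<theta> * (cos (real (k + 1) * \<theta>) * cos \<theta> ^ i) + D \<theta> * (cos (real k' * \<theta>) * cos \<theta> ^ i)))"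
      proof
        fix \<theta>
        have "cos (real k * \<theta>) * cos \<theta> ^ Suc i = (cos (real k * \<theta>) * cos \<theta>) * cos \<theta> ^ i" by simp
        also have "\<dots> = (1/2) * (cos (real (k + 1) * \<theta>) + cos (real k' * \<theta>)) * cos \<theta> ^ i" by (simp only: *)
        finally have e: "cos (real k * \<theta>) * cos \<theta> ^ Suc i = (1/2) * (cos (real (k + 1) * \<theta>) + cos (real k' * \<theta>)) * cos \<theta> ^ i" .
        show "D \<theta> * (cos (real k * \<theta>) * cos \<theta> ^ Suc i) =
          (1/2) * (D \<theta> * (cos (real (k + 1) * \<theta>) * cos \<theta> ^ i) + D \<theta> * (cos (real k' * \<theta>) * cos \<theta> ^ i))"
          unfolding e by (simp add: distrib_left distrib_right mult_ac)
      qed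
      moreover have "(\<lambda>\<theta>. D \<theta> * (cos (real l * \<theta>) * cos \<theta> ^ i)) integrable_on {-pi..pi}" for l
        by (intro int continuous_intros)
      ultimately show ?thesis using Suc.IH[of "k + 1"] Suc.IH[of k'] by (simp only: integral_mult_right integral_add) simp
    qed
  qed
  have poly: "integral {-pi..pi} (\<lambda>\<theta>. D \<theta> * P (cos \<theta>)) = 0" if P0: "real_polynomial_function P" for P
  proof -
    obtain a n where P: "P = (\<lambda>x. \<Sum>i\<le>n. a i * x ^ i)" using P0 real_polynomial_function_iff_sum by blast
    have "integral {-pi..pi} (\<lambda>\<theta>. D \<theta> * P (cos \<theta>)) = integral {-pi..pi} (\<lambda>\<theta>. \<Sum>i\<le>n. a i * (D \<theta> * (cos (real 0 * \<theta>) * cos \<theta> ^ i)))"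
      by (simp add: P sum_distrib_left mult.left_commute)
    also have "\<dots> = (\<Sum>i\<le>n. integral {-pi..pi} (\<lambda>\<theta>. a i * (D \<theta> * (cos (real 0 * \<theta>) * cos \<theta> ^ i))))"
      by (intro integral_sum integrable_on_mult_right int continuous_intros) auto
    also have "\<dots> = 0" by (intro sum.neutral ballI) (simp only: integral_mult_right pow mult_zero_right)
    finally show ?thesis .
  qed
  have "bounded (D ` {-pi..pi})" using D(1) by (intro compact_imp_bounded compact_continuous_image) auto
  then obtain B where B: "\<And>\<theta>. \<theta> \<in> {-pi..pi} \<Longrightarrow> \<bar>D \<theta>\<bar> \<le> B" unfolding bounded_iff by fastforce
  have B0: "0 \<le> B" using B[of 0] by (auto intro: order_trans[OF abs_ge_zero])
  have cD: "continuous_on {-1..1} (\<lambda>u. D (arccos u))"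
    by (rule continuous_on_compose2[OF D(1)]) (auto intro!: continuous_intros arccos_ubound order_trans[OF _ arccos_lbound])
  \<comment> \<open>The function \<open>arccos\<close> returns angles in [0, pi]; evenness of D
    covers the negative ones.\<close>
  have eqD: "D (arccos (cos x)) = D x" if "x \<in> {-pi..pi}" for x
  proof (cases "0 \<le> x")
    case True then show ?thesis using that by (simp add: arccos_cos)
  next
    case False
    then have "arccos (cos (- x)) = - x" using that by (intro arccos_cos) auto
    then show ?thesis using D(2)[of x] by simp
  qed
  have "integral {-pi..pi} (\<lambda>\<theta>. D \<theta> * D \<theta>) \<le> 0"
  proof (rule field_le_epsilon)
    fix e :: real assume e: "0 < e"
    \<comment> \<open>Normalized so that e' times the bound B + 1 of D, integrated over an interval
      of length 2 pi, equals e.\<close>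
    define e' where "e' = e / (2 * pi * (B + 1))"
    have e': "0 < e'" using e B0 by (simp add: e'_def)
    obtain P where P: "real_polynomial_function P" "\<And>u. u \<in> {-1..1} \<Longrightarrow> \<bar>D (arccos u) - P u\<bar> < e'"
      using Stone_Weierstrass_real_polynomial_function[OF _ cD e'] by auto
    have cP: "continuous_on {-pi..pi} (\<lambda>\<theta>. P (cos \<theta>))"
    proof (rule continuous_on_compose2[of UNIV P])
      show "continuous_on UNIV P"
        using P(1) by (simp add: continuous_on_polymonial_function real_polynomial_function_eq)
    qed (auto intro!: continuous_intros)
    have "integral {-pi..pi} (\<lambda>\<theta>. D \<theta> * D \<theta>) = integral {-pi..pi} (\<lambda>\<theta>. D \<theta> * D \<theta>) - integral {-pi..pi} (\<lambda>\<theta>. D \<theta> * P (cos \<theta>))"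
      using poly[OF P(1)] by simp
    also have "\<dots> = integral {-pi..pi} (\<lambda>\<theta>. D \<theta> * D \<theta> - D \<theta> * P (cos \<theta>))"
      by (intro integral_diff[symmetric] int D cP)
    also have "\<dots> \<le> integral {-pi..pi} (\<lambda>\<theta>. (B + 1) * e')"
    proof (intro integral_le)
      show "(\<lambda>\<theta>. D \<theta> * D \<theta> - D \<theta> * P (cos \<theta>)) integrable_on {-pi..pi}" by (intro integrable_diff int D cP)
      fix x assume x: "x \<in> {-pi..pi}"
      have "D x * D x - D x * P (cos x) = D x * (D (arccos (cos x)) - P (cos x))"
        using eqD[OF x] by (simp add: algebra_simps)
      also have "\<dots> \<le> \<bar>D x\<bar> * \<bar>D (arccos (cos x)) - P (cos x)\<bar>" by (metis abs_ge_self abs_mult)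
      also have "\<dots> \<le> (B + 1) * e'"
      proof (rule mult_mono)
        show "\<bar>D x\<bar> \<le> B + 1" using B[OF x] by simp
        show "\<bar>D (arccos (cos x)) - P (cos x)\<bar> \<le> e'" using P(2)[of "cos x"] by simp
      qed (use B0 in auto)
      finally show "D x * D x - D x * P (cos x) \<le> (B + 1) * e'" .
    qed auto
    also have "\<dots> = (2 * pi) * ((B + 1) * e')" by simp
    also have "\<dots> = ((2 * pi * (B + 1)) * e) / (2 * pi * (B + 1))" by (simp add: e'_def)
    also have "\<dots> = e" using B0 by (intro nonzero_mult_div_cancel_left) auto
    finally show "integral {-pi..pi} (\<lambda>\<theta>. D \<theta> * D \<theta>) \<le> 0 + e" by simp
  qed
  moreover have "0 \<le> integral {-pi..pi} (\<lambda>\<theta>. D \<theta> * D \<theta>)" by (intro integral_nonneg int D) auto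
  ultimately have "integral (cbox (-pi) pi) (\<lambda>\<theta>. D \<theta> * D \<theta>) = 0" by (simp add: box_real)
  moreover have "(\<lambda>\<theta>. D \<theta> * D \<theta>) integrable_on cbox (-pi) pi" using int[OF D(1)] by (simp add: box_real)
  ultimately have h1: "((\<lambda>\<theta>. D \<theta> * D \<theta>) has_integral 0) (cbox (-pi) pi)" by (metis has_integral_integral)
  have c1: "continuous_on (cbox (-pi) pi) (\<lambda>\<theta>. D \<theta> * D \<theta>)"
    unfolding box_real by (intro continuous_intros D(1))
  have "D \<theta> * D \<theta> = 0"
  proof (rule has_integral_0_cbox_imp_0[OF c1 _ h1])
    show "box (-pi) pi \<noteq> {}" unfolding box_real greaterThanLessThan_empty_iff using pi_gt_zero by linarith
    show "\<theta> \<in> cbox (-pi) pi" using \<theta> by (simp only: box_real)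
  qed simp
  then show ?thesis by simp
qed

text \<open>As n >= 2, the series converges uniformly. Its sum has the cosine coefficients of F, and
  even continuous functions are determined by these. The constant combines 2 pi C from integration
  by parts with the normalization 1 / pi; the maximum with 1 takes care of j = 0.\<close>

lemma cosine_expansion:
  assumes F: "bounded_derivs n UNIV C F" "\<And>\<theta>. \<theta>1 < \<bar>\<theta>\<bar> \<Longrightarrow> F \<theta> = 0" "\<theta>1 < pi" "0 \<le> C" "2 \<le> n"
    and even: "\<And>\<theta>. F (- \<theta>) = F \<theta>"
  obtains c where "\<And>j. \<bar>c j\<bar> \<le> 2 * C / real (max 1 j) ^ n"
    "\<And>\<theta>. \<theta> \<in> {-pi..pi} \<Longrightarrow> (\<lambda>j. c j * cos (real j * \<theta>)) sums F \<theta>"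
proof -
  define c where "c = (\<lambda>j. integral {-pi..pi} (\<lambda>\<theta>. F \<theta> * cos (real j * \<theta>)) / (if j = 0 then 2 * pi else pi))"
  obtain n' where n': "n = Suc n'" using F(5) by (cases n) auto
  have cF: "continuous_on S F" for S
    using bounded_derivs_continuous[of n' UNIV C F] F(1) unfolding n' by (metis continuous_on_subset top_greatest)
  have cbd: "\<bar>c j\<bar> \<le> 2 * C / real (max 1 j) ^ n" for j
  proof (cases "j = 0")
    case True
    have "norm (integral {-pi..pi} F) \<le> C * measure lborel (cbox (-pi) pi)"
      using integrable_integral[OF integrable_continuous_interval[OF cF]] F(4) bounded_derivs_bound[OF F(1)]
      by (intro has_integral_bound[where f = F]) (auto simp: box_real)
    then have "\<bar>integral {-pi..pi} F\<bar> \<le> C * (2 * pi)" by simp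
    then have "\<bar>c j\<bar> \<le> C" using True by (simp add: c_def divide_le_eq)
    then show ?thesis using True F(4) by simp
  next
    case False
    have "\<bar>integral {-pi..pi} (\<lambda>\<theta>. F \<theta> * cos (real j * \<theta>))\<bar> \<le> 2 * pi * C / real j ^ n"
      using fourier_coeff_decay[OF F(1-4), of j] False by auto
    then have "\<bar>integral {-pi..pi} (\<lambda>\<theta>. F \<theta> * cos (real j * \<theta>))\<bar> / pi \<le> 2 * pi * C / real j ^ n / pi"
      by (intro divide_right_mono) auto
    then show ?thesis using False by (simp add: c_def max_def)
  qed
  have summ: "summable (\<lambda>j. 2 * C / real (max 1 j) ^ n)"
  proof (rule summable_comparison_test'[where N = 1])
    show "summable (\<lambda>j. 2 * C * (1 / real j ^ n))"
      using inverse_power_summable[of n, where 'a = real] F(5) by (intro summable_mult) (simp add: inverse_eq_divide)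
    show "norm (2 * C / real (max 1 j) ^ n) \<le> 2 * C * (1 / real j ^ n)" if "1 \<le> j" for j
      using that F(4) by (simp add: max_def)
  qed
  have unif: "uniform_limit UNIV (\<lambda>N \<theta>. \<Sum>j<N. c j * cos (real j * \<theta>)) (\<lambda>\<theta>. \<Sum>j. c j * cos (real j * \<theta>)) sequentially"
  proof (rule Weierstrass_m_test[OF _ summ])
    fix j and \<theta> :: real
    have "\<bar>c j * cos (real j * \<theta>)\<bar> \<le> \<bar>c j\<bar> * 1" unfolding abs_mult by (intro mult_left_mono) auto
    then show "norm (c j * cos (real j * \<theta>)) \<le> 2 * C / real (max 1 j) ^ n" using cbd[of j] by simp
  qed
  define G where "G = (\<lambda>\<theta>. \<Sum>j. c j * cos (real j * \<theta>))"
  have cG: "continuous_on {-pi..pi} G"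
    unfolding G_def using uniform_limit_on_subset[OF unif]
    by (rule uniform_limit_theorem[rotated]) (auto intro!: always_eventually continuous_intros)
  have pk: "integral {-pi..pi} (\<lambda>\<theta>. G \<theta> * cos (real k * \<theta>)) = integral {-pi..pi} (\<lambda>\<theta>. F \<theta> * cos (real k * \<theta>))" for k
  proof -
    have u: "uniform_limit {-pi..pi} (\<lambda>N \<theta>. (\<Sum>j<N. c j * cos (real j * \<theta>)) * cos (real k * \<theta>)) (\<lambda>\<theta>. G \<theta> * cos (real k * \<theta>)) sequentially"
    proof (rule uniform_lim_mult)
      show "uniform_limit {-pi..pi} (\<lambda>N \<theta>. \<Sum>j<N. c j * cos (real j * \<theta>)) G sequentially"
        unfolding G_def using uniform_limit_on_subset[OF unif] by simp
      show "bounded (G ` {-pi..pi})" using cG by (intro compact_imp_bounded compact_continuous_image) auto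
      show "bounded ((\<lambda>\<theta>. cos (real k * \<theta>)) ` {-pi..pi})" by (intro boundedI[of _ 1]) auto
    qed (auto intro: uniform_limit_const)
    obtain I J where IJ: "\<And>N. ((\<lambda>\<theta>. (\<Sum>j<N. c j * cos (real j * \<theta>)) * cos (real k * \<theta>)) has_integral I N) {-pi..pi}"
      "((\<lambda>\<theta>. G \<theta> * cos (real k * \<theta>)) has_integral J) {-pi..pi}" "I \<longlonglongrightarrow> J"
      by (rule uniform_limit_integral[OF u]) (auto intro!: continuous_intros)
    have IN: "I N = c k * (if k = 0 then 2 * pi else pi)" if "k < N" for N
    proof -
      have "I N = integral {-pi..pi} (\<lambda>\<theta>. \<Sum>j<N. c j * (cos (real j * \<theta>) * cos (real k * \<theta>)))"
        using integral_unique[OF IJ(1)] by (simp add: sum_distrib_right mult.assoc)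
      also have "\<dots> = (\<Sum>j<N. integral {-pi..pi} (\<lambda>\<theta>. c j * (cos (real j * \<theta>) * cos (real k * \<theta>))))"
        by (intro integral_sum integrable_on_mult_right integrable_continuous_interval continuous_intros) auto
      also have "\<dots> = (\<Sum>j<N. if j = k then c k * (if k = 0 then 2 * pi else pi) else 0)"
        by (intro sum.cong) (auto simp: integral_cos_cos)
      finally show ?thesis using that by simp
    qed
    have "I \<longlonglongrightarrow> c k * (if k = 0 then 2 * pi else pi)"
    proof (rule tendsto_eventually)
      show "\<forall>\<^sub>F N in sequentially. I N = c k * (if k = 0 then 2 * pi else pi)"
        using eventually_gt_at_top[of k] by eventually_elim (rule IN)
    qed
    then have "J = c k * (if k = 0 then 2 * pi else pi)" using IJ(3) LIMSEQ_unique by blast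
    then show ?thesis using integral_unique[OF IJ(2)] by (simp add: c_def)
  qed
  have "F \<theta> - G \<theta> = 0" if "\<theta> \<in> {-pi..pi}" for \<theta>
  proof (rule even_orthogonal_imp_zero[OF _ _ _ that])
    show "continuous_on {-pi..pi} (\<lambda>\<theta>. F \<theta> - G \<theta>)" using cF cG by (intro continuous_intros)
    show "F (- \<theta>) - G (- \<theta>) = F \<theta> - G \<theta>" for \<theta> using even by (simp add: G_def)
    show "integral {-pi..pi} (\<lambda>\<theta>. (F \<theta> - G \<theta>) * cos (real k * \<theta>)) = 0" for k
    proof -
      have "integral {-pi..pi} (\<lambda>\<theta>. F \<theta> * cos (real k * \<theta>) - G \<theta> * cos (real k * \<theta>)) = 0"
        using pk[of k] cF cG by (subst integral_diff) (auto intro!: integrable_continuous_interval continuous_intros)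
      then show ?thesis by (simp add: left_diff_distrib)
    qed
  qed
  moreover have "summable (\<lambda>j. c j * cos (real j * \<theta>))" for \<theta>
  proof (rule summable_comparison_test'[OF summ])
    fix j
    have "\<bar>c j * cos (real j * \<theta>)\<bar> \<le> \<bar>c j\<bar> * 1" unfolding abs_mult by (intro mult_left_mono) auto
    then show "norm (c j * cos (real j * \<theta>)) \<le> 2 * C / real (max 1 j) ^ n" using cbd[of j] by simp
  qed
  ultimately have "(\<lambda>j. c j * cos (real j * \<theta>)) sums F \<theta>" if "\<theta> \<in> {-pi..pi}" for \<theta>
    using that summable_sums[of "\<lambda>j. c j * cos (real j * \<theta>)"] by (simp add: G_def)
  with cbd that show ?thesis by blast
qed

section \<open>Data-defined spaces\<close>

lemma summable_gauss_weight:
  assumes "0 < c" shows "summable (\<lambda>i. exp (- c * (real i)\<^sup>2) * (real i + 1) powr q)"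
proof (rule summable_comparison_test_bigo)
  show "summable (\<lambda>i. norm (1 / real i ^ 2))"
    using inverse_power_summable[of 2, where 'a = real] by (simp add: inverse_eq_divide)
  show "(\<lambda>i. exp (- c * (real i)\<^sup>2) * (real i + 1) powr q) \<in> O(\<lambda>i. 1 / real i ^ 2)"
    using assms by real_asymp
qed

context data_defined_space
begin

section \<open>Measurability and Gaussian integrals\<close>

lemma borel_measurable_M: "f \<in> borel_measurable borel \<Longrightarrow> f \<in> borel_measurable M"
proof -
  assume f: "f \<in> borel_measurable borel"
  obtain N where N: "sets N = sets borel" "M = completion N" using complete_borel by blast
  have "f \<in> borel_measurable N" using f measurable_cong_sets[OF N(1) refl] by blast
  then show ?thesis using N by (simp add: measurable_completion)
qed

lemma space_M [simp]: "space M = UNIV"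
proof -
  obtain N where N: "sets N = sets borel" "M = completion N" using complete_borel by blast
  then show ?thesis using sets_eq_imp_space_eq[OF N(1)] by simp
qed

lemma prob_UNIV [simp]: "measure M UNIV = 1"
  using prob_space by simp

lemma borel_sets_M: "A \<in> sets borel \<Longrightarrow> A \<in> sets M"
proof -
  assume A: "A \<in> sets borel"
  obtain N where N: "sets N = sets borel" "M = completion N" using complete_borel by blast
  then show ?thesis using A by (simp add: sets_completionI_sets)
qed

lemma continuous_measurable: "continuous_on UNIV f \<Longrightarrow> f \<in> borel_measurable M"
  by (intro borel_measurable_M borel_measurable_continuous_onI)

lemma ball_sets [measurable]: "ball x r \<in> sets M"
  by (intro borel_sets_M) simp

lemma phi_measurable [measurable]: "\<phi> k \<in> borel_measurable M"
  by (intro continuous_measurable phi_continuous)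

lemma dist_measurable [measurable]: "(\<lambda>y. dist x y) \<in> borel_measurable M"
  by (intro continuous_measurable continuous_intros)

lemma continuous_phi: "continuous_on S (\<phi> k)"
  using phi_continuous continuous_on_subset by blast

text \<open>Decomposition into annuli of width sqrt t: on the i-th one the Gaussian is at most
  exp(-c i^2), and it lies in a ball of measure at most of order ((i + 1) sqrt t)^q. The resulting
  series converges, with t^(q/2) in front.\<close>

lemma gauss_integral:
  assumes c: "0 < c"
  shows "\<exists>C>0. \<forall>x t. 0 < t \<longrightarrow> (\<integral>\<^sup>+y. ennreal (exp (- c * (dist x y)\<^sup>2 / t)) \<partial>M) \<le> ennreal (C * t powr (q / 2))"
proof -
  obtain k2 where k2: "0 < k2" "\<And>x r. 0 < r \<Longrightarrow> measure M (ball x r) \<le> k2 * r powr q"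
    using ball_measure by blast
  define a where "a = (\<lambda>i. exp (- c * (real i)\<^sup>2) * (real i + 1) powr q)"
  have sa: "summable a" unfolding a_def by (rule summable_gauss_weight[OF c])
  have a0: "0 \<le> a i" for i by (simp add: a_def)
  define C where "C = k2 * suminf a"
  have "0 < suminf a" by (rule suminf_pos2[OF sa a0, of 0]) (simp add: a_def)
  then have C: "0 < C" using k2 by (simp add: C_def)
  show ?thesis
  proof (intro exI[of _ C] conjI C allI impI)
    fix x :: 'a and t :: real assume t: "0 < t"
    define s where "s = sqrt t"
    have s: "0 < s" "s\<^sup>2 = t" using t by (auto simp: s_def)
    have pw: "ennreal (exp (- c * (dist x y)\<^sup>2 / t)) \<le>
        (\<Sum>i. ennreal (exp (- c * (real i)\<^sup>2)) * indicator (ball x ((real i + 1) * s)) y)" for y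
    proof -
      define i where "i = nat \<lfloor>dist x y / s\<rfloor>"
      have i: "real i \<le> dist x y / s" "dist x y / s < real i + 1"
        unfolding i_def using s by (auto simp: le_nat_floor of_nat_floor)
      have "y \<in> ball x ((real i + 1) * s)" using i s by (simp add: pos_divide_less_eq)
      moreover have "(real i)\<^sup>2 \<le> (dist x y / s)\<^sup>2" using i by (intro power_mono) auto
      then have "c * (real i)\<^sup>2 \<le> c * ((dist x y)\<^sup>2 / t)"
        using c s by (intro mult_left_mono) (auto simp: power_divide)
      then have "exp (- c * (dist x y)\<^sup>2 / t) \<le> exp (- c * (real i)\<^sup>2)" by simp
      ultimately have "ennreal (exp (- c * (dist x y)\<^sup>2 / t)) \<le>
          ennreal (exp (- c * (real i)\<^sup>2)) * indicator (ball x ((real i + 1) * s)) y"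
        by (simp add: ennreal_leI)
      also have "\<dots> = (\<Sum>j\<in>{i}. ennreal (exp (- c * (real j)\<^sup>2)) * indicator (ball x ((real j + 1) * s)) y)"
        by (simp only: sum.insert finite.emptyI empty_iff not_False_eq_True sum.empty add_0_right)
      also have "\<dots> \<le> (\<Sum>i. ennreal (exp (- c * (real i)\<^sup>2)) * indicator (ball x ((real i + 1) * s)) y)"
        by (rule sum_le_suminf) auto
      finally show ?thesis .
    qed
    have "(\<integral>\<^sup>+y. ennreal (exp (- c * (dist x y)\<^sup>2 / t)) \<partial>M)
        \<le> (\<integral>\<^sup>+y. (\<Sum>i. ennreal (exp (- c * (real i)\<^sup>2)) * indicator (ball x ((real i + 1) * s)) y) \<partial>M)"
      by (rule nn_integral_mono) (rule pw)
    also have "\<dots> = (\<Sum>i. \<integral>\<^sup>+y. ennreal (exp (- c * (real i)\<^sup>2)) * indicator (ball x ((real i + 1) * s)) y \<partial>M)"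
      by (intro nn_integral_suminf) measurable
    also have "\<dots> = (\<Sum>i. ennreal (exp (- c * (real i)\<^sup>2)) * emeasure M (ball x ((real i + 1) * s)))"
      by (intro arg_cong[where f = suminf] ext nn_integral_cmult_indicator) measurable
    also have "\<dots> \<le> (\<Sum>i. ennreal (k2 * t powr (q / 2) * a i))"
    proof (intro suminf_le)
      fix i
      have "measure M (ball x ((real i + 1) * s)) \<le> k2 * ((real i + 1) * s) powr q" using s by (intro k2) auto
      also have "\<dots> = k2 * ((real i + 1) powr q * t powr (q / 2))"
        using s t by (simp add: powr_mult s_def powr_half_sqrt[symmetric] powr_powr)
      finally have "exp (- c * (real i)\<^sup>2) * measure M (ball x ((real i + 1) * s)) \<le> k2 * t powr (q / 2) * a i"
        by (simp add: a_def mult_left_mono mult_ac)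
      then show "ennreal (exp (- c * (real i)\<^sup>2)) * emeasure M (ball x ((real i + 1) * s)) \<le> ennreal (k2 * t powr (q / 2) * a i)"
        by (simp add: emeasure_eq_measure ennreal_mult[symmetric] ennreal_leI)
    qed auto
    also have "\<dots> = ennreal (\<Sum>i. k2 * t powr (q / 2) * a i)"
      using sa a0 k2 by (intro suminf_ennreal2 summable_mult) auto
    also have "(\<Sum>i. k2 * t powr (q / 2) * a i) = C * t powr (q / 2)"
      using suminf_mult[OF sa, of "k2 * t powr (q / 2)"] by (simp add: C_def mult_ac)
    finally show "(\<integral>\<^sup>+y. ennreal (exp (- c * (dist x y)\<^sup>2 / t)) \<partial>M) \<le> ennreal (C * t powr (q / 2))" .
  qed
qed

section \<open>The heat kernel as an absolutely convergent series\<close>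

abbreviation K :: "real \<Rightarrow> 'a \<Rightarrow> 'a \<Rightarrow> real" where "K \<equiv> heat_kernel lam \<phi>"

definition decay :: "real \<Rightarrow> nat \<Rightarrow> real" where
  "decay t k = exp (- (lam k)\<^sup>2 * t)"

lemma decay_pos [simp]: "0 < decay t k" "0 \<le> decay t k"
  by (auto simp: decay_def)

lemma decay_add: "decay (s + t) k = decay s k * decay t k"
  by (simp add: decay_def distrib_left mult_exp_exp)

lemma decay_antimono: "s \<le> t \<Longrightarrow> decay t k \<le> decay s k"
  by (simp add: decay_def mult_left_mono)

lemma decay_le_1: "0 \<le> t \<Longrightarrow> decay t k \<le> 1"
  by (simp add: decay_def)

lemma K_decay: "K t x y = (\<Sum>k. decay t k * \<phi> k x * \<phi> k y)"
  by (simp add: heat_kernel_def decay_def)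

lemma lam_nonneg: "0 \<le> lam k"
  using lam_mono lam_0 by (metis le0 monoD)

lemma phi_product_integrable [simp]: "integrable M (\<lambda>x. \<phi> j x * \<phi> k x)"
proof -
  obtain B where B: "\<And>x. \<bar>\<phi> k x\<bar> \<le> B" using phi_bounded[of k] unfolding bounded_iff by auto
  show ?thesis
    by (rule Bochner_Integration.integrable_bound[of _ "\<lambda>x. \<phi> j x * B"])
       (use phi_integrable in \<open>auto simp: abs_mult intro!: AE_I2 mult_left_mono order_trans[OF B abs_ge_self]\<close>)
qed

lemma heat_kernel_bound':
  obtains \<kappa>3 \<kappa>4 where "0 < \<kappa>3" "0 < \<kappa>4"
    "\<And>x y t. 0 < t \<Longrightarrow> t \<le> 1 \<Longrightarrow> \<bar>K t x y\<bar> \<le> \<kappa>3 * t powr (- q / 2) * exp (- \<kappa>4 * (dist x y)\<^sup>2 / t)"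
  using heat_kernel_bound by blast

lemma diagonal_summable: "0 < t \<Longrightarrow> t \<le> 1 \<Longrightarrow> summable (\<lambda>k. decay t k * (\<phi> k x)\<^sup>2)"
  using heat_kernel_summable[of t x x] by (simp add: decay_def power2_eq_square mult.assoc)

lemma diagonal_sum: "(\<Sum>k. decay t k * (\<phi> k x)\<^sup>2) = K t x x"
  by (simp add: K_decay power2_eq_square mult.assoc)

text \<open>Integrating the diagonal of the kernel: by orthonormality the k-th term contributes
  \<open>decay s k\<close>, and the kernel bound at equal points controls the partial sums. Times
  above 1 are compared with time 1.\<close>

lemma decay_summable:
  assumes t: "0 < t" shows "summable (decay t)"
proof -
  obtain \<kappa>3 \<kappa>4 where k: "0 < \<kappa>3" "0 < \<kappa>4"
    "\<And>x y t. 0 < t \<Longrightarrow> t \<le> 1 \<Longrightarrow> \<bar>K t x y\<bar> \<le> \<kappa>3 * t powr (- q / 2) * exp (- \<kappa>4 * (dist x y)\<^sup>2 / t)"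
    using heat_kernel_bound' by blast
  define s where "s = min t 1"
  have s: "0 < s" "s \<le> 1" "s \<le> t" using t by (auto simp: s_def)
  have "summable (decay s)"
  proof (rule summableI_nonneg_bounded)
    fix n
    have "(\<Sum>k<n. decay s k) = (\<Sum>k<n. \<integral>x. decay s k * (\<phi> k x * \<phi> k x) \<partial>M)"
      by (simp add: phi_orthonormal)
    also have "\<dots> = (\<integral>x. (\<Sum>k<n. decay s k * (\<phi> k x)\<^sup>2) \<partial>M)"
      by (subst Bochner_Integration.integral_sum) (auto simp: power2_eq_square)
    also have "\<dots> \<le> (\<integral>x. \<kappa>3 * s powr (- q / 2) \<partial>M)"
    proof (rule integral_mono)
      show "integrable M (\<lambda>x. \<Sum>k<n. decay s k * (\<phi> k x)\<^sup>2)" by (simp add: power2_eq_square)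
      fix x
      have "(\<Sum>k<n. decay s k * (\<phi> k x)\<^sup>2) \<le> (\<Sum>k. decay s k * (\<phi> k x)\<^sup>2)"
        using s by (intro sum_le_suminf diagonal_summable) auto
      also have "\<dots> \<le> \<kappa>3 * s powr (- q / 2)" using k(3)[OF s(1,2), of x x] by (simp add: diagonal_sum)
      finally show "(\<Sum>k<n. decay s k * (\<phi> k x)\<^sup>2) \<le> \<kappa>3 * s powr (- q / 2)" .
    qed auto
    finally show "(\<Sum>k<n. decay s k) \<le> \<kappa>3 * s powr (- q / 2)" by (simp add: prob_space)
  qed auto
  then show ?thesis
    by (rule summable_comparison_test'[where N = 0]) (use s decay_antimono in auto)
qed

text \<open>Half of the decay controls the eigenfunctions, uniformly on the space, the other half is summable.\<close>

lemma kernel_majorant: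
  assumes t: "0 < t"
  obtains A where "summable A" "\<And>k x y. decay t k * \<bar>\<phi> k x\<bar> * \<bar>\<phi> k y\<bar> \<le> A k"
proof -
  obtain \<kappa>3 \<kappa>4 where k: "0 < \<kappa>3" "0 < \<kappa>4"
    "\<And>x y t. 0 < t \<Longrightarrow> t \<le> 1 \<Longrightarrow> \<bar>K t x y\<bar> \<le> \<kappa>3 * t powr (- q / 2) * exp (- \<kappa>4 * (dist x y)\<^sup>2 / t)"
    using heat_kernel_bound' by blast
  define s where "s = min (t / 2) 1"
  have s: "0 < s" "s \<le> 1" "s + s \<le> t" using t by (auto simp: s_def)
  define B where "B = \<kappa>3 * s powr (- q / 2)"
  have diag: "decay s k * (\<phi> k x)\<^sup>2 \<le> B" for k x
  proof -
    have "decay s k * (\<phi> k x)\<^sup>2 = (\<Sum>j\<in>{k}. decay s j * (\<phi> j x)\<^sup>2)" by simp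
    also have "\<dots> \<le> (\<Sum>k. decay s k * (\<phi> k x)\<^sup>2)"
      using s by (intro sum_le_suminf diagonal_summable) auto
    also have "\<dots> \<le> B" using k(3)[OF s(1,2), of x x] by (simp add: diagonal_sum B_def)
    finally show ?thesis .
  qed
  show ?thesis
  proof (rule that[of "\<lambda>k. decay s k * B"])
    show "summable (\<lambda>k. decay s k * B)" by (intro summable_mult2 decay_summable s)
    fix k x y
    have "decay t k * \<bar>\<phi> k x\<bar> * \<bar>\<phi> k y\<bar> \<le> decay s k * (decay s k * (\<bar>\<phi> k x\<bar> * \<bar>\<phi> k y\<bar>))"
      using decay_antimono[OF s(3), of k] unfolding decay_add by (simp add: mult.assoc[symmetric] mult_right_mono)
    also have "\<bar>\<phi> k x\<bar> * \<bar>\<phi> k y\<bar> \<le> ((\<phi> k x)\<^sup>2 + (\<phi> k y)\<^sup>2) / 2"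
      using sum_squares_bound[of "\<bar>\<phi> k x\<bar>" "\<bar>\<phi> k y\<bar>"] by simp
    also have "decay s k * (((\<phi> k x)\<^sup>2 + (\<phi> k y)\<^sup>2) / 2) \<le> B"
      using diag[of k x] diag[of k y] by (simp add: algebra_simps)
    finally show "decay t k * \<bar>\<phi> k x\<bar> * \<bar>\<phi> k y\<bar> \<le> decay s k * B" by (simp add: mult_left_mono)
  qed
qed

lemma kernel_summable:
  assumes "0 < t" shows "summable (\<lambda>k. decay t k * \<bar>\<phi> k x\<bar> * \<bar>\<phi> k y\<bar>)"
proof -
  obtain A where A: "summable A" "\<And>k x y. decay t k * \<bar>\<phi> k x\<bar> * \<bar>\<phi> k y\<bar> \<le> A k"
    using kernel_majorant[OF assms] by blast
  show ?thesis by (rule summable_comparison_test'[OF A(1)]) (use A(2) in auto)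
qed

lemma K_sums: "0 < t \<Longrightarrow> (\<lambda>k. decay t k * \<phi> k x * \<phi> k y) sums K t x y"
  unfolding K_decay using kernel_summable[of t x y]
  by (intro summable_sums, rule_tac summable_rabs_cancel) (simp add: abs_mult)

lemma K_sym: "K t x y = K t y x"
  by (simp add: heat_kernel_def mult_ac)

lemma K_continuous:
  assumes "0 < t" shows "continuous_on UNIV (\<lambda>(x, y). K t x y)"
proof -
  obtain A where A: "summable A" "\<And>k x y. decay t k * \<bar>\<phi> k x\<bar> * \<bar>\<phi> k y\<bar> \<le> A k"
    using kernel_majorant[OF assms] by blast
  have "uniform_limit UNIV (\<lambda>n z. \<Sum>k<n. decay t k * \<phi> k (fst z) * \<phi> k (snd z)) (\<lambda>z. \<Sum>k. decay t k * \<phi> k (fst z) * \<phi> k (snd z)) sequentially"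
    by (rule Weierstrass_m_test[OF _ A(1)]) (use A(2) in \<open>simp add: abs_mult\<close>)
  then have "continuous_on UNIV (\<lambda>z. \<Sum>k. decay t k * \<phi> k (fst z) * \<phi> k (snd z))"
    by (rule uniform_limit_theorem[rotated])
       (auto intro!: always_eventually continuous_intros continuous_on_compose2[OF phi_continuous])
  then show ?thesis by (simp add: K_decay case_prod_beta)
qed

lemma K_continuous1: "0 < t \<Longrightarrow> continuous_on UNIV (\<lambda>x. K t x y)"
  by (rule continuous_on_compose2[OF K_continuous, of t UNIV "\<lambda>x. (x, y)", simplified]) (auto intro!: continuous_intros)

lemma K_continuous2: "0 < t \<Longrightarrow> continuous_on UNIV (K t x)"
  using K_continuous1[of t x] by (subst (asm) K_sym) simp

lemma K_measurable: "0 < t \<Longrightarrow> K t x \<in> borel_measurable M"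
  by (intro continuous_measurable K_continuous2)

lemma phi_mult_integrable:
  assumes "integrable M h" shows "integrable M (\<lambda>y. h y * \<phi> k y)"
proof -
  obtain B where B: "\<And>x. \<bar>\<phi> k x\<bar> \<le> B" using phi_bounded[of k] unfolding bounded_iff by auto
  have [measurable]: "h \<in> borel_measurable M" using assms by simp
  show ?thesis
    by (rule Bochner_Integration.integrable_bound[of _ "\<lambda>x. h x * B"])
       (use assms in \<open>auto simp: abs_mult intro!: AE_I2 mult_left_mono order_trans[OF B abs_ge_self]\<close>)
qed

text \<open>Termwise integration, dominated by a summable majorant that does not depend on the
  points, times |h|.\<close>

lemma K_integral_sums:
  assumes t: "0 < t" and h: "integrable M h"
  shows "(\<lambda>k. decay t k * \<phi> k x * fourier_coeff M \<phi> h k) sums (\<integral>y. K t x y * h y \<partial>M)"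
    and "integrable M (\<lambda>y. K t x y * h y)"
    and "summable (\<lambda>k. \<bar>decay t k * \<phi> k x * fourier_coeff M \<phi> h k\<bar>)"
proof -
  obtain A where A: "summable A" "\<And>k x y. decay t k * \<bar>\<phi> k x\<bar> * \<bar>\<phi> k y\<bar> \<le> A k"
    using kernel_majorant[OF t] by blast
  have i1: "integrable M (\<lambda>y. decay t k * \<phi> k x * \<phi> k y * h y)" for k
    using integrable_mult_right[OF phi_mult_integrable[OF h, of k], of "decay t k * \<phi> k x"] by (simp add: mult_ac)
  have bd: "\<bar>decay t k * \<phi> k x * \<phi> k y * h y\<bar> \<le> A k * \<bar>h y\<bar>" for k y
    unfolding abs_mult using A(2)[of k x y] by (intro mult_right_mono) auto
  have s2: "summable (\<lambda>k. \<integral>y. norm (decay t k * \<phi> k x * \<phi> k y * h y) \<partial>M)"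
  proof (rule summable_comparison_test'[where N = 0])
    show "summable (\<lambda>k. A k * (\<integral>y. \<bar>h y\<bar> \<partial>M))" by (intro summable_mult2 A)
    fix k
    have "(\<integral>y. norm (decay t k * \<phi> k x * \<phi> k y * h y) \<partial>M) \<le> (\<integral>y. A k * \<bar>h y\<bar> \<partial>M)"
      using bd h i1 by (intro integral_mono) auto
    then show "norm (\<integral>y. norm (decay t k * \<phi> k x * \<phi> k y * h y) \<partial>M) \<le> A k * (\<integral>y. \<bar>h y\<bar> \<partial>M)" by simp
  qed
  have s1: "AE y in M. summable (\<lambda>k. norm (decay t k * \<phi> k x * \<phi> k y * h y))"
  proof (rule AE_I2)
    fix y
    show "summable (\<lambda>k. norm (decay t k * \<phi> k x * \<phi> k y * h y))"
      by (rule summable_comparison_test'[where N = 0, OF summable_mult2[OF A(1), of "\<bar>h y\<bar>"]]) (use bd in auto)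
  qed
  have eq: "(\<Sum>k. decay t k * \<phi> k x * \<phi> k y * h y) = K t x y * h y" for y
    using sums_mult2[OF K_sums[OF t, of x y], of "h y"] by (simp add: sums_iff)
  have eq2: "(\<integral>y. decay t k * \<phi> k x * \<phi> k y * h y \<partial>M) = decay t k * \<phi> k x * fourier_coeff M \<phi> h k" for k
  proof -
    have "(\<integral>y. decay t k * \<phi> k x * \<phi> k y * h y \<partial>M) = (\<integral>y. (decay t k * \<phi> k x) * (h y * \<phi> k y) \<partial>M)"
      by (simp add: mult_ac)
    then show ?thesis by (simp only: integral_mult_right_zero fourier_coeff_def)
  qed
  show "(\<lambda>k. decay t k * \<phi> k x * fourier_coeff M \<phi> h k) sums (\<integral>y. K t x y * h y \<partial>M)"
    using sums_integral[OF i1 s1 s2] by (simp only: eq eq2)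
  show "integrable M (\<lambda>y. K t x y * h y)"
    using integrable_suminf[OF i1 s1 s2] by (simp only: eq)
  show "summable (\<lambda>k. \<bar>decay t k * \<phi> k x * fourier_coeff M \<phi> h k\<bar>)"
    by (rule summable_comparison_test'[where N = 0, OF s2]) (simp add: eq2[symmetric])
qed

lemma phi_coeff: "fourier_coeff M \<phi> (\<phi> j) k = (if j = k then 1 else 0)"
  by (simp add: fourier_coeff_def phi_orthonormal)

lemma K_integral_phi:
  assumes "0 < t" shows "(\<integral>y. K t x y * \<phi> j y \<partial>M) = decay t j * \<phi> j x"
proof -
  have "(\<lambda>k. if k = j then decay t j * \<phi> j x else 0) sums (\<integral>y. K t x y * \<phi> j y \<partial>M)"
    using K_integral_sums(1)[OF assms phi_integrable[of j], of x]
    by (rule sums_cong[THEN iffD1, rotated]) (auto simp: phi_coeff)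
  then show ?thesis using sums_single[of j "\<lambda>_. decay t j * \<phi> j x"] sums_unique2 by (metis (mono_tags, lifting))
qed

lemma K_integral_1: "0 < t \<Longrightarrow> (\<integral>y. K t x y \<partial>M) = 1"
  using K_integral_phi[of t x 0] by (simp add: phi_0 lam_0 decay_def)

lemma K_integrable: "0 < t \<Longrightarrow> integrable M (K t x)"
  using K_integral_sums(2)[of t "\<lambda>_. 1" x] by simp

text \<open>Conservation of mass: the kernel has integral 1, while its Gaussian bound leaves at most
  1/2 outside of a ball whose radius is a large multiple of sqrt t. The part inside, at least 1/2,
  is at most the bound t^(-q/2) times the measure of the ball.\<close>

lemma ball_lower_bound: "\<exists>c>0. \<forall>x r. 0 < r \<and> r \<le> 1 \<longrightarrow> c * r powr q \<le> measure M (ball x r)"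
proof -
  obtain \<kappa>3 \<kappa>4 where k: "0 < \<kappa>3" "0 < \<kappa>4"
    "\<And>x y t. 0 < t \<Longrightarrow> t \<le> 1 \<Longrightarrow> \<bar>K t x y\<bar> \<le> \<kappa>3 * t powr (- q / 2) * exp (- \<kappa>4 * (dist x y)\<^sup>2 / t)"
    using heat_kernel_bound' by blast
  obtain C where C: "0 < C" "\<And>x t. 0 < t \<Longrightarrow> (\<integral>\<^sup>+y. ennreal (exp (- (\<kappa>4/2) * (dist x y)\<^sup>2 / t)) \<partial>M) \<le> ennreal (C * t powr (q / 2))"
    using gauss_integral[of "\<kappa>4/2"] k(2) by auto
  \<comment> \<open>Half of the Gaussian exponent is spent on integrability. The other half, at
    distances from r = sqrt (A t) on, gives exp(-\<open>\<kappa>4\<close> A / 2), and A is chosen to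
    push the outer mass below 1/2.\<close>
  define A where "A = max 1 (2 / \<kappa>4 * ln (2 * \<kappa>3 * C))"
  have A: "1 \<le> A" by (simp add: A_def)
  have A2: "\<kappa>3 * C * exp (- \<kappa>4 * A / 2) \<le> 1 / 2"
  proof -
    have "2 / \<kappa>4 * ln (2 * \<kappa>3 * C) \<le> A" by (simp add: A_def)
    then have "ln (2 * \<kappa>3 * C) \<le> \<kappa>4 * A / 2" using k(2) by (simp add: field_simps)
    then have "2 * \<kappa>3 * C \<le> exp (\<kappa>4 * A / 2)" using k C by (metis exp_le_cancel_iff exp_ln mult_pos_pos zero_less_numeral)
    then show ?thesis by (simp add: exp_minus field_simps)
  qed
  define c where "c = 1 / (2 * \<kappa>3) * A powr (- q / 2)"
  have c: "0 < c" using k A by (simp add: c_def)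
  show ?thesis
  proof (intro exI[of _ c] conjI c allI impI)
    fix x :: 'a and r :: real assume r: "0 < r \<and> r \<le> 1"
    define t where "t = r\<^sup>2 / A"
    have t: "0 < t" "t \<le> 1" using r A by (auto simp: t_def divide_le_eq power_le_one intro: order_trans[OF power_le_one])
    have rt: "r\<^sup>2 / t = A" using r A by (simp add: t_def)
    define T where "T = t powr (- q / 2)"
    have T: "0 < T" using t by (simp add: T_def)
    have "ennreal 1 = ennreal (\<integral>y. K t x y \<partial>M)" using K_integral_1[OF t(1)] by simp
    also have "\<dots> \<le> (\<integral>\<^sup>+y. ennreal (norm (K t x y)) \<partial>M)"
      using integral_norm_bound_ennreal[OF K_integrable[OF t(1), of x]] K_integral_1[OF t(1), of x] by simp
    also have "\<dots> \<le> (\<integral>\<^sup>+y. ennreal (\<kappa>3 * T) * indicator (ball x r) y +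
         ennreal (\<kappa>3 * T * exp (- \<kappa>4 * A / 2)) * ennreal (exp (- (\<kappa>4/2) * (dist x y)\<^sup>2 / t)) \<partial>M)"
    proof (rule nn_integral_mono)
      fix y
      have b: "\<bar>K t x y\<bar> \<le> \<kappa>3 * T * exp (- \<kappa>4 * (dist x y)\<^sup>2 / t)" using k(3)[OF t] by (simp add: T_def)
      show "ennreal (norm (K t x y)) \<le> ennreal (\<kappa>3 * T) * indicator (ball x r) y +
         ennreal (\<kappa>3 * T * exp (- \<kappa>4 * A / 2)) * ennreal (exp (- (\<kappa>4/2) * (dist x y)\<^sup>2 / t))"
      proof (cases "y \<in> ball x r")
        case True
        have "\<kappa>3 * T * exp (- \<kappa>4 * (dist x y)\<^sup>2 / t) \<le> \<kappa>3 * T"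
          using k T t by (intro mult_left_le) (auto intro!: divide_nonneg_pos)
        then have "ennreal (norm (K t x y)) \<le> ennreal (\<kappa>3 * T)" using b by (intro ennreal_leI) auto
        then show ?thesis using True by (simp add: add_increasing2)
      next
        case False
        then have "r\<^sup>2 \<le> (dist x y)\<^sup>2" using r by (intro power_mono) auto
        then have "A \<le> (dist x y)\<^sup>2 / t" using t rt by (metis divide_right_mono less_imp_le)
        then have "\<kappa>4 / 2 * A \<le> \<kappa>4 / 2 * ((dist x y)\<^sup>2 / t)" using k(2) by (intro mult_left_mono) auto
        then have "- \<kappa>4 * (dist x y)\<^sup>2 / t \<le> - \<kappa>4 * A / 2 + - (\<kappa>4/2) * (dist x y)\<^sup>2 / t" by (simp add: field_simps)
        then have "exp (- \<kappa>4 * (dist x y)\<^sup>2 / t) \<le> exp (- \<kappa>4 * A / 2) * exp (- (\<kappa>4/2) * (dist x y)\<^sup>2 / t)"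
          unfolding mult_exp_exp by simp
        then have "\<kappa>3 * T * exp (- \<kappa>4 * (dist x y)\<^sup>2 / t) \<le> \<kappa>3 * T * exp (- \<kappa>4 * A / 2) * exp (- (\<kappa>4/2) * (dist x y)\<^sup>2 / t)"
          using k T by (simp add: mult.assoc)
        then have "ennreal (norm (K t x y)) \<le> ennreal (\<kappa>3 * T * exp (- \<kappa>4 * A / 2) * exp (- (\<kappa>4/2) * (dist x y)\<^sup>2 / t))"
          using b by (intro ennreal_leI) auto
        then show ?thesis using False k T by (simp add: ennreal_mult)
      qed
    qed
    also have "\<dots> = ennreal (\<kappa>3 * T) * emeasure M (ball x r) + ennreal (\<kappa>3 * T * exp (- \<kappa>4 * A / 2)) * (\<integral>\<^sup>+y. ennreal (exp (- (\<kappa>4/2) * (dist x y)\<^sup>2 / t)) \<partial>M)"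
      by (subst nn_integral_add) (auto simp: nn_integral_cmult)
    also have "\<dots> \<le> ennreal (\<kappa>3 * T) * ennreal (measure M (ball x r)) + ennreal (\<kappa>3 * T * exp (- \<kappa>4 * A / 2)) * ennreal (C * t powr (q / 2))"
      using C(2)[OF t(1)] by (intro add_mono mult_left_mono) (auto simp: emeasure_eq_measure)
    also have "\<dots> = ennreal (\<kappa>3 * T * measure M (ball x r) + \<kappa>3 * T * exp (- \<kappa>4 * A / 2) * (C * t powr (q / 2)))"
      using k T C by (simp add: ennreal_mult[symmetric] flip: ennreal_plus)
    also have "\<kappa>3 * T * exp (- \<kappa>4 * A / 2) * (C * t powr (q / 2)) = \<kappa>3 * C * exp (- \<kappa>4 * A / 2)"
      using t by (simp add: T_def powr_minus field_simps)
    finally have "1 \<le> \<kappa>3 * T * measure M (ball x r) + \<kappa>3 * C * exp (- \<kappa>4 * A / 2)"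
      using k T C by (subst (asm) ennreal_le_iff) auto
    then have "1 / 2 \<le> \<kappa>3 * T * measure M (ball x r)" using A2 by linarith
    then have "1 / (2 * \<kappa>3) * (1 / T) \<le> measure M (ball x r)" using k T by (simp add: field_simps)
    moreover have "1 / T = r powr q * A powr (- q / 2)"
    proof -
      have "1 / T = t powr (q / 2)" by (simp add: T_def powr_minus_divide)
      also have "\<dots> = (r powr 2) powr (q / 2) / A powr (q / 2)" using r A by (simp add: t_def powr_divide)
      also have "\<dots> = r powr q * A powr (- q / 2)" by (simp add: powr_powr powr_minus_divide)
      finally show ?thesis .
    qed
    ultimately show "c * r powr q \<le> measure M (ball x r)" by (simp add: c_def mult_ac)
  qed
qed

text \<open>Balls of radius 1 have measure at least c. A ball of measure above 1 - c therefore
  leaves no room for a disjoint one, and every point is within a fixed distance of its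
  centre.\<close>

lemma bounded_space: obtains R where "0 < R" "\<And>x y :: 'a. dist x y \<le> R"
proof -
  obtain c where c: "0 < c" "\<And>x r. 0 < r \<Longrightarrow> r \<le> 1 \<Longrightarrow> c * r powr q \<le> measure M (ball x r)"
    using ball_lower_bound by blast
  obtain x0 :: 'a where True by simp
  have "(\<Union>n. ball x0 (real n)) = UNIV" by (auto intro: reals_Archimedean2)
  moreover have "(\<lambda>n. measure M (ball x0 (real n))) \<longlonglongrightarrow> measure M (\<Union>n. ball x0 (real n))"
    by (intro finite_Lim_measure_incseq) (auto simp: incseq_def)
  ultimately have "(\<lambda>n. measure M (ball x0 (real n))) \<longlonglongrightarrow> 1" using prob_space by simp
  then have "\<forall>\<^sub>F n in sequentially. 1 - c < measure M (ball x0 (real n))"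
    using c(1) by (intro order_tendstoD) auto
  then obtain n where n: "1 - c < measure M (ball x0 (real n))" by (auto simp: eventually_sequentially)
  have "dist x0 y \<le> real n + 1" for y
  proof (rule ccontr)
    assume "\<not> ?thesis"
    then have disj: "ball y 1 \<inter> ball x0 (real n) = {}"
      by (auto simp: disjoint_iff) (smt (verit) dist_commute dist_triangle2)
    have "measure M (ball y 1) + measure M (ball x0 (real n)) = measure M (ball y 1 \<union> ball x0 (real n))"
      by (intro finite_measure_Union[symmetric] disj) auto
    also have "\<dots> \<le> 1" by simp
    finally show False using n c(2)[of 1 y] by simp
  qed
  then have "dist x y \<le> 2 * real n + 2" for x y :: 'a
    using dist_triangle3[of x y x0] by (smt (verit))
  then show ?thesis by (intro that[of "2 * real n + 2"]) auto
qed

text \<open>A bounded space is a single ball, whose closure is compact by assumption.\<close>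

lemma compact_space: "compact (UNIV :: 'a set)"
proof -
  obtain R where R: "0 < R" "\<And>x y :: 'a. dist x y \<le> R" using bounded_space by blast
  obtain x0 :: 'a where True by simp
  have "ball x0 (R + 1) = UNIV" by (auto intro!: le_less_trans[OF R(2)])
  then have "closure (ball x0 (R + 1)) = UNIV" by (metis closure_UNIV)
  moreover have "0 < R + 1" using R by simp
  ultimately show ?thesis using balls_compact[of "R + 1" x0] by simp
qed

lemma continuous_bounded:
  assumes "continuous_on UNIV (f :: 'a \<Rightarrow> real)" obtains B where "0 \<le> B" "\<And>x. \<bar>f x\<bar> \<le> B"
proof -
  have "bounded (range f)" using compact_space assms by (intro compact_imp_bounded compact_continuous_image)
  then obtain B where "\<And>x. \<bar>f x\<bar> \<le> B" unfolding bounded_iff by auto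
  then show ?thesis using that[of "\<bar>B\<bar>"] by (meson abs_ge_self abs_ge_zero order_trans)
qed

lemma continuous_integrable: "continuous_on UNIV (f :: 'a \<Rightarrow> real) \<Longrightarrow> integrable M f"
proof -
  assume f: "continuous_on UNIV f"
  obtain B where "0 \<le> B" "\<And>x. \<bar>f x\<bar> \<le> B" using continuous_bounded[OF f] by blast
  then show ?thesis by (intro integrable_const_bound[of _ B] continuous_measurable f) auto
qed

text \<open>The set where the functions differ is open; if it were nonempty it would contain a ball,
  and balls have positive measure.\<close>

lemma AE_continuous_eq:
  assumes "AE x in M. f x = (g x :: real)" "continuous_on UNIV f" "continuous_on UNIV g"
  shows "f = g"
proof (rule ext, rule ccontr)
  fix x assume "f x \<noteq> g x"
  then have "open {x. f x \<noteq> g x}" "x \<in> {x. f x \<noteq> g x}"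
    using assms(2,3) by (auto intro: open_Collect_neq)
  then obtain r where r: "0 < r" "ball x r \<subseteq> {x. f x \<noteq> g x}" by (metis open_contains_ball)
  obtain c where c: "0 < c" "\<And>x r. 0 < r \<Longrightarrow> r \<le> 1 \<Longrightarrow> c * r powr q \<le> measure M (ball x r)"
    using ball_lower_bound by blast
  define s where "s = min r 1"
  have s: "0 < s" "s \<le> 1" "ball x s \<subseteq> {x. f x \<noteq> g x}" using r by (auto simp: s_def)
  have "AE z in M. z \<notin> ball x s" using assms(1) by eventually_elim (use s in auto)
  then have "measure M (ball x s) = 0"
    by (subst (asm) AE_iff_measurable[of "ball x s"]) (auto simp: measure_def)
  moreover have "0 < c * s powr q" using c s by simp
  ultimately show False using c(2)[OF s(1,2), of x] by simp
qed

lemma has_value_at_unique: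
  assumes "has_value_at M h x u" "has_value_at M h x v" shows "u = v"
proof -
  obtain g g' where "continuous_on UNIV g" "AE z in M. h z = g z" "g x = u"
    "continuous_on UNIV g'" "AE z in M. h z = g' z" "g' x = v"
    using assms unfolding has_value_at_def by blast
  moreover from this have "AE z in M. g z = g' z" by (auto elim!: eventually_elim2)
  ultimately show ?thesis using AE_continuous_eq[of g g'] by blast
qed

end

section \<open>Sums over separated points, small times, completeness of the eigenfunctions\<close>

context data_defined_space
begin

text \<open>The Gaussian at y is dominated by the average of a wider Gaussian over the ball of
  radius sqrt t / 2 around y. These balls are disjoint because sqrt t <= eta, and their measure is
  at least of order t^(q/2); the sum is thus bounded by one Gaussian integral over the
  space.\<close>

lemma separated_sum_bound:
  assumes c: "0 < c"
  shows "\<exists>C>0. \<forall>(Y :: 'a set) \<eta> t w. finite Y \<longrightarrow> (\<forall>x\<in>Y. \<forall>y\<in>Y. x \<noteq> y \<longrightarrow> \<eta> \<le> dist x y) \<longrightarrow>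
     0 < t \<longrightarrow> t \<le> 1 \<longrightarrow> sqrt t \<le> \<eta> \<longrightarrow> (\<Sum>y\<in>Y. exp (- c * (dist y w)\<^sup>2 / t)) \<le> C"
proof -
  obtain m where m: "0 < m" "\<And>x r. 0 < r \<Longrightarrow> r \<le> 1 \<Longrightarrow> m * r powr q \<le> measure M (ball x r)"
    using ball_lower_bound by blast
  obtain C where C: "0 < C" "\<And>x t. 0 < t \<Longrightarrow> (\<integral>\<^sup>+y. ennreal (exp (- (c/2) * (dist x y)\<^sup>2 / t)) \<partial>M) \<le> ennreal (C * t powr (q / 2))"
    using gauss_integral[of "c/2"] c by auto
  \<comment> \<open>exp (c / 4) is the cost of moving from y to a point of its ball, m (1/2)^q
    t^(q/2) bounds the measure of the ball from below, and C t^(q/2) is the Gaussian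
    integral.\<close>
  define D where "D = exp (c / 4) * C / (m * (1/2) powr q)"
  have D: "0 < D" using C m by (simp add: D_def)
  show ?thesis
  proof (intro exI[of _ D] conjI D allI impI)
    fix Y :: "'a set" and \<eta> t :: real and w :: 'a
    assume Y: "finite Y" "\<forall>x\<in>Y. \<forall>y\<in>Y. x \<noteq> y \<longrightarrow> \<eta> \<le> dist x y" and t: "0 < t" "t \<le> 1" and \<eta>: "sqrt t \<le> \<eta>"
    define r where "r = sqrt t / 2"
    have r: "0 < r" "r \<le> 1" "2 * r \<le> \<eta>" "r\<^sup>2 = t / 4"
      using t \<eta> real_sqrt_le_1_iff[of t] by (auto simp: r_def power_divide simp del: real_sqrt_le_1_iff)
    have disj: "ball x r \<inter> ball y r = {}" if "x \<in> Y" "y \<in> Y" "x \<noteq> y" for x y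
    proof (rule ccontr)
      assume "ball x r \<inter> ball y r \<noteq> {}"
      then obtain z where "dist x z < r" "dist y z < r" by auto
      then have "dist x y < 2 * r" using dist_triangle2[of x y z] by linarith
      then show False using Y(2) that r(3) by fastforce
    qed
    define g where "g = (\<lambda>z. exp (- (c/2) * (dist w z)\<^sup>2 / t))"
    \<comment> \<open>From (u + v)^2 <= 2 u^2 + 2 v^2; halving c absorbs the factor 2.\<close>
    have pw: "exp (- c * (dist y w)\<^sup>2 / t) \<le> exp (c / 4) * g z" if "z \<in> ball y r" for y z
    proof -
      have "dist w z \<le> dist y w + r" using that dist_triangle[of w z y] by (simp add: dist_commute)
      then have "(dist w z)\<^sup>2 \<le> (dist y w + r)\<^sup>2" by (intro power_mono) auto
      also have "\<dots> \<le> 2 * (dist y w)\<^sup>2 + 2 * r\<^sup>2" using sum_squares_bound[of "dist y w" r] by (simp add: power2_sum)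
      finally have "(dist w z)\<^sup>2 \<le> 2 * (dist y w)\<^sup>2 + t / 2" using r(4) by simp
      then have "(c / (2 * t)) * (dist w z)\<^sup>2 \<le> (c / (2 * t)) * (2 * (dist y w)\<^sup>2 + t / 2)"
        using c t by (intro mult_left_mono) auto
      then have "- c * (dist y w)\<^sup>2 / t \<le> c / 4 + - (c/2) * (dist w z)\<^sup>2 / t" using t by (simp add: field_simps)
      then show ?thesis by (simp add: g_def mult_exp_exp)
    qed
    have gm[measurable]: "g \<in> borel_measurable M" unfolding g_def by measurable
    define \<mu> where "\<mu> = m * r powr q"
    have \<mu>: "0 < \<mu>" using m r by (simp add: \<mu>_def)
    have "ennreal (\<mu> * (\<Sum>y\<in>Y. exp (- c * (dist y w)\<^sup>2 / t))) = (\<Sum>y\<in>Y. ennreal (\<mu> * exp (- c * (dist y w)\<^sup>2 / t)))"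
      using \<mu> by (subst sum_ennreal) (auto simp: sum_distrib_left)
    also have "\<dots> \<le> (\<Sum>y\<in>Y. \<integral>\<^sup>+z. ennreal (exp (c/4) * g z) * indicator (ball y r) z \<partial>M)"
    proof (rule sum_mono)
      fix y
      have "ennreal (\<mu> * exp (- c * (dist y w)\<^sup>2 / t)) \<le> ennreal (exp (- c * (dist y w)\<^sup>2 / t)) * emeasure M (ball y r)"
        using m(2)[OF r(1,2), of y] by (simp add: \<mu>_def emeasure_eq_measure ennreal_mult[symmetric] ennreal_leI mult.commute mult_left_mono)
      also have "\<dots> = (\<integral>\<^sup>+z. ennreal (exp (- c * (dist y w)\<^sup>2 / t)) * indicator (ball y r) z \<partial>M)"
        by (intro nn_integral_cmult_indicator[symmetric]) measurable
      also have "\<dots> \<le> (\<integral>\<^sup>+z. ennreal (exp (c/4) * g z) * indicator (ball y r) z \<partial>M)"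
        using pw by (intro nn_integral_mono) (auto split: split_indicator intro!: ennreal_leI)
      finally show "ennreal (\<mu> * exp (- c * (dist y w)\<^sup>2 / t)) \<le> (\<integral>\<^sup>+z. ennreal (exp (c/4) * g z) * indicator (ball y r) z \<partial>M)" .
    qed
    also have "\<dots> = (\<integral>\<^sup>+z. (\<Sum>y\<in>Y. ennreal (exp (c/4) * g z) * indicator (ball y r) z) \<partial>M)"
      by (intro nn_integral_sum[symmetric]) measurable
    also have "\<dots> \<le> (\<integral>\<^sup>+z. ennreal (exp (c/4)) * ennreal (g z) \<partial>M)"
    proof (rule nn_integral_mono)
      fix z
      have "(\<Sum>y\<in>Y. indicator (ball y r) z :: ennreal) \<le> 1"
      proof (cases "\<exists>y\<in>Y. z \<in> ball y r")
        case True
        then obtain y where y: "y \<in> Y" "z \<in> ball y r" by blast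
        have "(\<Sum>x\<in>Y. indicator (ball x r) z :: ennreal) = (\<Sum>x\<in>Y. if x = y then 1 else 0)"
        proof (intro sum.cong refl)
          fix x assume "x \<in> Y"
          then have "z \<in> ball x r \<longleftrightarrow> x = y" using disj[OF y(1)] y by blast
          then show "(indicator (ball x r) z :: ennreal) = (if x = y then 1 else 0)" by (simp only: indicator_def of_bool_def)
        qed
        then show ?thesis using Y(1) by simp
      next
        case False
        then have "(\<Sum>x\<in>Y. indicator (ball x r) z :: ennreal) = (\<Sum>x\<in>Y. 0)"
          by (intro sum.cong) (auto simp: indicator_def)
        then show ?thesis by simp
      qed
      then have "ennreal (exp (c/4) * g z) * (\<Sum>y\<in>Y. indicator (ball y r) z) \<le> ennreal (exp (c/4) * g z) * 1"
        by (intro mult_left_mono) auto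
      then show "(\<Sum>y\<in>Y. ennreal (exp (c/4) * g z) * indicator (ball y r) z) \<le> ennreal (exp (c/4)) * ennreal (g z)"
        by (simp only: sum_distrib_left[symmetric] mult_1_right) (simp add: ennreal_mult g_def)
    qed
    also have "\<dots> \<le> ennreal (exp (c/4)) * ennreal (C * t powr (q / 2))"
      using C(2)[OF t(1), of w] by (simp add: nn_integral_cmult g_def mult_left_mono)
    also have "\<dots> = ennreal (exp (c/4) * (C * t powr (q / 2)))" using C(1) by (simp add: ennreal_mult)
    finally have "\<mu> * (\<Sum>y\<in>Y. exp (- c * (dist y w)\<^sup>2 / t)) \<le> exp (c/4) * (C * t powr (q / 2))"
      using C by (subst (asm) ennreal_le_iff) auto
    then have "(\<Sum>y\<in>Y. exp (- c * (dist y w)\<^sup>2 / t)) \<le> exp (c/4) * (C * t powr (q / 2)) / \<mu>"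
      using \<mu> by (simp add: pos_le_divide_eq mult.commute)
    also have "\<mu> = m * (1/2) powr q * t powr (q / 2)"
      using t by (simp add: \<mu>_def r_def powr_divide powr_half_sqrt[symmetric] powr_powr)
    also have "exp (c/4) * (C * t powr (q / 2)) / (m * (1/2) powr q * t powr (q / 2)) = D"
      using t by (simp add: D_def)
    finally show "(\<Sum>y\<in>Y. exp (- c * (dist y w)\<^sup>2 / t)) \<le> D" .
  qed
qed

text \<open>Times beyond 1 are covered because the space is bounded.\<close>

lemma heat_kernel_all_times:
  "\<exists>k3>0. \<exists>k4>0. \<forall>x y t s. 0 < t \<longrightarrow> t \<le> 1 \<longrightarrow> t \<le> s \<longrightarrow> \<bar>K s x y\<bar> \<le> k3 * t powr (- q / 2) * exp (- k4 * (dist x y)\<^sup>2 / s)"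
proof -
  obtain k3 k4 where k: "0 < k3" "0 < k4"
    "\<And>x y t. 0 < t \<Longrightarrow> t \<le> 1 \<Longrightarrow> \<bar>K t x y\<bar> \<le> k3 * t powr (- q / 2) * exp (- k4 * (dist x y)\<^sup>2 / t)"
    using heat_kernel_bound' by blast
  obtain R where R: "0 < R" "\<And>x y :: 'a. dist x y \<le> R" using bounded_space by blast
  \<comment> \<open>At times s above 1 the Gaussian factor is at least exp(-k4 R^2), since squared
    distances divided by s are at most R^2; the added factor compensates for it.\<close>
  define k3' where "k3' = k3 * exp (k4 * R\<^sup>2)"
  have k3': "0 < k3'" "k3 \<le> k3'" using k by (auto simp: k3'_def)
  show ?thesis
  proof (rule exI[of _ k3'], intro conjI k3'(1), rule exI[of _ k4], intro conjI k(2) allI impI)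
    fix x y :: 'a and t s :: real assume t: "0 < t" "t \<le> 1" and ts: "t \<le> s"
    show "\<bar>K s x y\<bar> \<le> k3' * t powr (- q / 2) * exp (- k4 * (dist x y)\<^sup>2 / s)"
    proof (cases "s \<le> 1")
      case True
      have "\<bar>K s x y\<bar> \<le> k3 * s powr (- q / 2) * exp (- k4 * (dist x y)\<^sup>2 / s)" using k(3) t ts True by simp
      also have "\<dots> \<le> k3' * t powr (- q / 2) * exp (- k4 * (dist x y)\<^sup>2 / s)"
        using k k3' t ts q_pos by (intro mult_right_mono mult_mono powr_mono2') auto
      finally show ?thesis .
    next
      case False
      have s: "0 < s" using t ts by simp
      have d: "decay s k * \<bar>\<phi> k x\<bar> * \<bar>\<phi> k y\<bar> \<le> (decay 1 k * (\<phi> k x)\<^sup>2 + decay 1 k * (\<phi> k y)\<^sup>2) / 2" for k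
      proof -
        have "decay s k * (\<bar>\<phi> k x\<bar> * \<bar>\<phi> k y\<bar>) \<le> decay 1 k * (((\<phi> k x)\<^sup>2 + (\<phi> k y)\<^sup>2) / 2)"
          using False decay_antimono[of 1 s k] sum_squares_bound[of "\<bar>\<phi> k x\<bar>" "\<bar>\<phi> k y\<bar>"]
          by (intro mult_mono) auto
        then show ?thesis by (simp add: algebra_simps)
      qed
      have sm: "summable (\<lambda>k. (decay 1 k * (\<phi> k x)\<^sup>2 + decay 1 k * (\<phi> k y)\<^sup>2) / 2)"
        by (intro summable_divide summable_add diagonal_summable) auto
      have "\<bar>K s x y\<bar> \<le> (\<Sum>k. \<bar>decay s k * \<phi> k x * \<phi> k y\<bar>)"
        unfolding K_decay using kernel_summable[OF s, of x y] by (intro summable_rabs) (simp add: abs_mult)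
      also have "\<dots> \<le> (\<Sum>k. (decay 1 k * (\<phi> k x)\<^sup>2 + decay 1 k * (\<phi> k y)\<^sup>2) / 2)"
        using d sm kernel_summable[OF s, of x y] by (intro suminf_le) (auto simp: abs_mult)
      also have "\<dots> = (K 1 x x + K 1 y y) / 2"
        unfolding diagonal_sum[symmetric]
        by (intro sums_unique[symmetric] sums_divide sums_add summable_sums diagonal_summable) auto
      also have "\<dots> \<le> k3" using k(3)[of 1 x x] k(3)[of 1 y y] by simp
      also have "k3 * 1 * 1 \<le> k3 * t powr (- q / 2) * (exp (k4 * R\<^sup>2) * exp (- k4 * (dist x y)\<^sup>2 / s))"
      proof (intro mult_mono)
        show "1 \<le> t powr (- q / 2)" using t q_pos powr_mono2'[of "-q/2" t 1] by simp
        have "(dist x y)\<^sup>2 / s \<le> R\<^sup>2"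
          using R False power_mono[OF R(2)[of x y], of 2]
          by (auto simp: divide_le_eq intro: order_trans[OF _ mult_left_mono[of 1 s "R\<^sup>2", simplified]])
        then have "k4 * ((dist x y)\<^sup>2 / s) \<le> k4 * R\<^sup>2" using k by (intro mult_left_mono) auto
        then show "1 \<le> exp (k4 * R\<^sup>2) * exp (- k4 * (dist x y)\<^sup>2 / s)" by (simp add: mult_exp_exp)
      qed (use k in auto)
      finally show ?thesis by (simp add: k3'_def mult_ac)
    qed
  qed
qed

lemma K_L1_bound: "\<exists>C>0. \<forall>x t. 0 < t \<longrightarrow> t \<le> 1 \<longrightarrow> (\<integral>\<^sup>+y. ennreal \<bar>K t x y\<bar> \<partial>M) \<le> ennreal C"
proof -
  obtain k3 k4 where k: "0 < k3" "0 < k4"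
    "\<And>x y t. 0 < t \<Longrightarrow> t \<le> 1 \<Longrightarrow> \<bar>K t x y\<bar> \<le> k3 * t powr (- q / 2) * exp (- k4 * (dist x y)\<^sup>2 / t)"
    using heat_kernel_bound' by blast
  obtain C where C: "0 < C" "\<And>x t. 0 < t \<Longrightarrow> (\<integral>\<^sup>+y. ennreal (exp (- k4 * (dist x y)\<^sup>2 / t)) \<partial>M) \<le> ennreal (C * t powr (q / 2))"
    using gauss_integral[of k4] k by auto
  show ?thesis
  proof (intro exI[of _ "k3 * C"] conjI allI impI)
    fix x :: 'a and t :: real assume t: "0 < t" "t \<le> 1"
    have "(\<integral>\<^sup>+y. ennreal \<bar>K t x y\<bar> \<partial>M) \<le> (\<integral>\<^sup>+y. ennreal (k3 * t powr (- q / 2)) * ennreal (exp (- k4 * (dist x y)\<^sup>2 / t)) \<partial>M)"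
      using k t by (intro nn_integral_mono) (simp add: ennreal_mult[symmetric] ennreal_leI)
    also have "\<dots> = ennreal (k3 * t powr (- q / 2)) * (\<integral>\<^sup>+y. ennreal (exp (- k4 * (dist x y)\<^sup>2 / t)) \<partial>M)"
      by (intro nn_integral_cmult) measurable
    also have "\<dots> \<le> ennreal (k3 * t powr (- q / 2)) * ennreal (C * t powr (q / 2))"
      using C(2)[OF t(1), of x] by (intro mult_left_mono) auto
    also have "\<dots> = ennreal (k3 * C)" using k C t by (simp add: ennreal_mult[symmetric] powr_minus_divide)
    finally show "(\<integral>\<^sup>+y. ennreal \<bar>K t x y\<bar> \<partial>M) \<le> ennreal (k3 * C)" .
  qed (use k C in simp)
qed

text \<open>An approximate identity: the kernel has integral 1 and its absolute integral is bounded
  uniformly in time. Points within d of x are handled by continuity of \<open>\<psi>\<close>, all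
  others by the Gaussian, which beats t^(-q/2) as t tends to 0.\<close>

lemma heat_semigroup_tendsto:
  assumes \<psi>: "continuous_on UNIV \<psi>" and \<psi>B: "\<And>x. \<bar>\<psi> x\<bar> \<le> B"
  shows "(\<lambda>n. \<integral>y. K (inverse (real (Suc n))) x y * \<psi> y \<partial>M) \<longlonglongrightarrow> \<psi> x"
proof -
  obtain k3 k4 where k: "0 < k3" "0 < k4"
    "\<And>x y t. 0 < t \<Longrightarrow> t \<le> 1 \<Longrightarrow> \<bar>K t x y\<bar> \<le> k3 * t powr (- q / 2) * exp (- k4 * (dist x y)\<^sup>2 / t)"
    using heat_kernel_bound' by blast
  obtain C1 where C1: "0 < C1" "\<And>x t. 0 < t \<Longrightarrow> t \<le> 1 \<Longrightarrow> (\<integral>\<^sup>+y. ennreal \<bar>K t x y\<bar> \<partial>M) \<le> ennreal C1"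
    using K_L1_bound by blast
  have B: "0 \<le> B" using \<psi>B[of x] by (rule order_trans[OF abs_ge_zero])
  show ?thesis
  proof (rule LIMSEQ_I)
    fix e :: real assume e: "0 < e"
    obtain d where d: "0 < d" "\<And>y. dist y x < d \<Longrightarrow> \<bar>\<psi> y - \<psi> x\<bar> < e / (2 * C1)"
      using \<psi> e C1(1) unfolding continuous_on_iff dist_real_def by (metis UNIV_I divide_pos_pos mult_pos_pos zero_less_numeral)
    have "(\<lambda>n. 2 * B * (k3 * inverse (real (Suc n)) powr (- q / 2) * exp (- k4 * d\<^sup>2 / inverse (real (Suc n))))) \<longlonglongrightarrow> 0"
      using k d(1) by real_asymp
    from order_tendstoD(2)[OF this, of "e/2"]
    have "\<forall>\<^sub>F n in sequentially. 2 * B * (k3 * inverse (real (Suc n)) powr (- q / 2) * exp (- k4 * d\<^sup>2 / inverse (real (Suc n)))) < e / 2"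
      using e by simp
    then obtain n0 where n0: "\<And>n. n0 \<le> n \<Longrightarrow> 2 * B * (k3 * inverse (real (Suc n)) powr (- q / 2) * exp (- k4 * d\<^sup>2 / inverse (real (Suc n)))) < e / 2"
      unfolding eventually_sequentially by blast
    show "\<exists>n0. \<forall>n\<ge>n0. norm ((\<integral>y. K (inverse (real (Suc n))) x y * \<psi> y \<partial>M) - \<psi> x) < e"
    proof (intro exI[of _ n0] allI impI)
      fix n assume n: "n0 \<le> n"
      define t where "t = inverse (real (Suc n))"
      have t: "0 < t" "t \<le> 1" by (auto simp: t_def inverse_le_1_iff)
      define T where "T = k3 * t powr (- q / 2) * exp (- k4 * d\<^sup>2 / t)"
      have T: "0 \<le> T" "2 * B * T < e / 2" using k n0[OF n] by (auto simp: T_def t_def)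
      have i\<psi>: "integrable M (\<lambda>y. K t x y * \<psi> y)" by (intro K_integral_sums(2) t continuous_integrable \<psi>)
      have iK: "integrable M (K t x)" by (rule K_integrable[OF t(1)])
      have "(\<integral>y. K t x y * \<psi> y \<partial>M) - \<psi> x = (\<integral>y. K t x y * \<psi> y \<partial>M) - (\<integral>y. K t x y * \<psi> x \<partial>M)"
        using K_integral_1[OF t(1), of x] by simp
      also have "\<dots> = (\<integral>y. K t x y * (\<psi> y - \<psi> x) \<partial>M)"
        using i\<psi> iK by (subst Bochner_Integration.integral_diff[symmetric]) (auto simp: right_diff_distrib)
      finally have "norm ((\<integral>y. K t x y * \<psi> y \<partial>M) - \<psi> x) \<le> (\<integral>y. norm (K t x y * (\<psi> y - \<psi> x)) \<partial>M)"
        using integral_norm_bound by metis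
      also have "\<dots> \<le> (\<integral>y. e / (2 * C1) * \<bar>K t x y\<bar> + 2 * B * T \<partial>M)"
      proof (rule integral_mono)
        show "integrable M (\<lambda>y. norm (K t x y * (\<psi> y - \<psi> x)))"
          using i\<psi> iK by (auto simp: right_diff_distrib)
        show "integrable M (\<lambda>y. e / (2 * C1) * \<bar>K t x y\<bar> + 2 * B * T)" using iK by auto
        fix y
        show "norm (K t x y * (\<psi> y - \<psi> x)) \<le> e / (2 * C1) * \<bar>K t x y\<bar> + 2 * B * T"
        proof (cases "dist y x < d")
          case True
          have "\<bar>K t x y\<bar> * \<bar>\<psi> y - \<psi> x\<bar> \<le> \<bar>K t x y\<bar> * (e / (2 * C1))" using d(2)[OF True] by (intro mult_left_mono) auto
          moreover have "0 \<le> 2 * B * T" using B T by simp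
          ultimately show ?thesis unfolding real_norm_def abs_mult by (subst mult.commute[of "e / (2 * C1)"]) linarith
        next
          case False
          have "d\<^sup>2 \<le> (dist x y)\<^sup>2" using False d(1) by (intro power_mono) (auto simp: dist_commute)
          then have "- k4 * (dist x y)\<^sup>2 / t \<le> - k4 * d\<^sup>2 / t"
            using k t by (intro divide_right_mono) auto
          then have "\<bar>K t x y\<bar> \<le> T"
            unfolding T_def using k t by (intro order_trans[OF k(3)[OF t]] mult_left_mono) auto
          moreover have "\<bar>\<psi> y - \<psi> x\<bar> \<le> 2 * B" using \<psi>B[of x] \<psi>B[of y] by linarith
          ultimately have "\<bar>K t x y\<bar> * \<bar>\<psi> y - \<psi> x\<bar> \<le> T * (2 * B)" using T by (intro mult_mono) auto
          moreover have "0 \<le> e / (2 * C1) * \<bar>K t x y\<bar>" using e C1 by simp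
          ultimately show ?thesis unfolding real_norm_def abs_mult by (simp only: mult.commute[of T])
        qed
      qed
      also have "\<dots> = e / (2 * C1) * (\<integral>y. \<bar>K t x y\<bar> \<partial>M) + 2 * B * T"
        using iK by (subst Bochner_Integration.integral_add) auto
      also have "\<dots> \<le> e / (2 * C1) * C1 + 2 * B * T"
      proof (intro add_right_mono mult_left_mono)
        show "(\<integral>y. \<bar>K t x y\<bar> \<partial>M) \<le> C1"
          using C1(2)[OF t, of x] iK C1(1) by (subst (asm) nn_integral_eq_integral) auto
      qed (use e C1 in auto)
      also have "\<dots> < e" using T C1(1) by simp
      finally show "norm ((\<integral>y. K (inverse (real (Suc n))) x y * \<psi> y \<partial>M) - \<psi> x) < e" by (simp add: t_def)
    qed
  qed
qed

text \<open>The smoothed test function P n is a series in the eigenfunctions, so f is orthogonal to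
  it term by term. As the time tends to 0 it converges to \<open>\<psi>\<close> pointwise and
  boundedly.\<close>

lemma coefficients_zero_continuous:
  assumes f: "integrable M f" and f0: "\<And>k. fourier_coeff M \<phi> f k = 0"
    and \<psi>: "continuous_on UNIV \<psi>"
  shows "(\<integral>x. f x * \<psi> x \<partial>M) = 0"
proof -
  obtain B where B: "0 \<le> B" "\<And>x. \<bar>\<psi> x\<bar> \<le> B" using continuous_bounded[OF \<psi>] by blast
  obtain C1 where C1: "0 < C1" "\<And>x t. 0 < t \<Longrightarrow> t \<le> 1 \<Longrightarrow> (\<integral>\<^sup>+y. ennreal \<bar>K t x y\<bar> \<partial>M) \<le> ennreal C1"
    using K_L1_bound by blast
  have i\<psi>: "integrable M \<psi>" using continuous_integrable[OF \<psi>] .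
  have [measurable]: "f \<in> borel_measurable M" using f by simp
  define t where "t = (\<lambda>n. inverse (real (Suc n)))"
  have t: "0 < t n" "t n \<le> 1" for n by (auto simp: t_def inverse_le_1_iff)
  define P where "P = (\<lambda>n x. \<integral>y. K (t n) x y * \<psi> y \<partial>M)"
  have PB: "\<bar>P n x\<bar> \<le> C1 * B" for n x
  proof -
    have iK: "integrable M (K (t n) x)" by (rule K_integrable[OF t(1)])
    have "\<bar>P n x\<bar> \<le> (\<integral>y. \<bar>K (t n) x y * \<psi> y\<bar> \<partial>M)" unfolding P_def using integral_norm_bound[of M "\<lambda>y. K (t n) x y * \<psi> y"] by simp
    also have "\<dots> \<le> (\<integral>y. \<bar>K (t n) x y\<bar> * B \<partial>M)"
    proof (rule integral_mono)
      show "integrable M (\<lambda>y. \<bar>K (t n) x y * \<psi> y\<bar>)" by (intro integrable_abs K_integral_sums(2)[OF t(1) i\<psi>])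
      show "integrable M (\<lambda>y. \<bar>K (t n) x y\<bar> * B)" using iK by simp
      show "\<bar>K (t n) x y * \<psi> y\<bar> \<le> \<bar>K (t n) x y\<bar> * B" for y using B by (simp add: abs_mult mult_left_mono)
    qed
    also have "\<dots> = (\<integral>y. \<bar>K (t n) x y\<bar> \<partial>M) * B" by simp
    also have "(\<integral>y. \<bar>K (t n) x y\<bar> \<partial>M) \<le> C1"
      using C1(2)[OF t, of n x] iK C1(1) by (subst (asm) nn_integral_eq_integral) auto
    finally show ?thesis using B by (simp add: mult_right_mono)
  qed
  have Psum: "(\<lambda>k. decay (t n) k * \<phi> k x * fourier_coeff M \<phi> \<psi> k) sums P n x" for n x
    unfolding P_def by (rule K_integral_sums(1)[OF t(1) i\<psi>])
  have Pm[measurable]: "P n \<in> borel_measurable M" for n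
  proof -
    have "P n = (\<lambda>x. \<Sum>k. decay (t n) k * \<phi> k x * fourier_coeff M \<phi> \<psi> k)" using Psum sums_unique by blast
    then show ?thesis by simp
  qed
  have zero: "(\<integral>x. f x * P n x \<partial>M) = 0" for n
  proof -
    obtain A where A: "summable A" "\<And>k x y. decay (t n) k * \<bar>\<phi> k x\<bar> * \<bar>\<phi> k y\<bar> \<le> A k"
      using kernel_majorant[OF t(1)] by blast
    have cb: "\<bar>decay (t n) k * \<phi> k x * fourier_coeff M \<phi> \<psi> k\<bar> \<le> A k * B" for k x
    proof -
      have "\<bar>decay (t n) k * \<phi> k x * fourier_coeff M \<phi> \<psi> k\<bar> = \<bar>\<integral>y. decay (t n) k * \<phi> k x * (\<psi> y * \<phi> k y) \<partial>M\<bar>"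
        by (simp only: integral_mult_right_zero fourier_coeff_def)
      also have "\<dots> \<le> (\<integral>y. \<bar>decay (t n) k * \<phi> k x * (\<psi> y * \<phi> k y)\<bar> \<partial>M)"
        using integral_norm_bound[of M "\<lambda>y. decay (t n) k * \<phi> k x * (\<psi> y * \<phi> k y)"] by simp
      also have "\<dots> \<le> (\<integral>y. A k * B \<partial>M)"
      proof (rule integral_mono)
        show "integrable M (\<lambda>y. \<bar>decay (t n) k * \<phi> k x * (\<psi> y * \<phi> k y)\<bar>)"
          using phi_mult_integrable[OF i\<psi>] by simp
        fix y
        have "\<bar>decay (t n) k * \<phi> k x * (\<psi> y * \<phi> k y)\<bar> = (decay (t n) k * \<bar>\<phi> k x\<bar> * \<bar>\<phi> k y\<bar>) * \<bar>\<psi> y\<bar>" by (simp add: abs_mult mult_ac)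
        also have "\<dots> \<le> A k * B" using A(2) B order_trans[OF _ A(2)] by (intro mult_mono) auto
        finally show "\<bar>decay (t n) k * \<phi> k x * (\<psi> y * \<phi> k y)\<bar> \<le> A k * B" .
      qed auto
      finally show ?thesis by simp
    qed
    have "(\<lambda>k. \<integral>x. f x * (decay (t n) k * \<phi> k x * fourier_coeff M \<phi> \<psi> k) \<partial>M) sums (\<integral>x. (\<Sum>k. f x * (decay (t n) k * \<phi> k x * fourier_coeff M \<phi> \<psi> k)) \<partial>M)"
    proof (rule sums_integral)
      have eq: "f x * (decay (t n) k * \<phi> k x * fourier_coeff M \<phi> \<psi> k) = (decay (t n) k * fourier_coeff M \<phi> \<psi> k) * (f x * \<phi> k x)" for k x by simp
      show i: "integrable M (\<lambda>x. f x * (decay (t n) k * \<phi> k x * fourier_coeff M \<phi> \<psi> k))" for k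
        unfolding eq by (intro integrable_mult_right phi_mult_integrable f)
      show "AE x in M. summable (\<lambda>k. norm (f x * (decay (t n) k * \<phi> k x * fourier_coeff M \<phi> \<psi> k)))"
      proof (rule AE_I2)
        fix x
        show "summable (\<lambda>k. norm (f x * (decay (t n) k * \<phi> k x * fourier_coeff M \<phi> \<psi> k)))"
          by (rule summable_comparison_test'[where N = 0, OF summable_mult[OF summable_mult2[OF A(1), of B], of "\<bar>f x\<bar>"]])
             (use cb in \<open>auto simp: abs_mult intro!: mult_left_mono\<close>)
      qed
      show "summable (\<lambda>k. \<integral>x. norm (f x * (decay (t n) k * \<phi> k x * fourier_coeff M \<phi> \<psi> k)) \<partial>M)"
      proof (rule summable_comparison_test'[where N = 0])
        show "summable (\<lambda>k. (A k * B) * (\<integral>x. \<bar>f x\<bar> \<partial>M))" by (intro summable_mult2 A)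
        fix k
        have "(\<integral>x. norm (f x * (decay (t n) k * \<phi> k x * fourier_coeff M \<phi> \<psi> k)) \<partial>M) \<le> (\<integral>x. (A k * B) * \<bar>f x\<bar> \<partial>M)"
        proof (rule integral_mono)
          show "norm (f x * (decay (t n) k * \<phi> k x * fourier_coeff M \<phi> \<psi> k)) \<le> (A k * B) * \<bar>f x\<bar>" for x
            using mult_right_mono[OF cb[of k x], of "\<bar>f x\<bar>"] by (simp add: abs_mult mult_ac)
        qed (use i f in auto)
        then show "norm (\<integral>x. norm (f x * (decay (t n) k * \<phi> k x * fourier_coeff M \<phi> \<psi> k)) \<partial>M) \<le> (A k * B) * (\<integral>x. \<bar>f x\<bar> \<partial>M)" by simp
      qed
    qed
    moreover have "(\<integral>x. f x * (decay (t n) k * \<phi> k x * fourier_coeff M \<phi> \<psi> k) \<partial>M) = 0" for k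
    proof -
      have "(\<integral>x. f x * (decay (t n) k * \<phi> k x * fourier_coeff M \<phi> \<psi> k) \<partial>M) = (\<integral>x. (decay (t n) k * fourier_coeff M \<phi> \<psi> k) * (f x * \<phi> k x) \<partial>M)"
        by (simp add: mult_ac)
      also have "\<dots> = (decay (t n) k * fourier_coeff M \<phi> \<psi> k) * fourier_coeff M \<phi> f k"
        by (simp only: integral_mult_right_zero fourier_coeff_def)
      finally show ?thesis using f0 by simp
    qed
    moreover have "(\<Sum>k. f x * (decay (t n) k * \<phi> k x * fourier_coeff M \<phi> \<psi> k)) = f x * P n x" for x
      using sums_mult[OF Psum[of n x], of "f x"] by (simp add: sums_iff)
    ultimately show ?thesis using sums_unique2[OF _ sums_zero] by simp
  qed
  have "(\<lambda>n. \<integral>x. f x * P n x \<partial>M) \<longlonglongrightarrow> (\<integral>x. f x * \<psi> x \<partial>M)"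
  proof (rule integral_dominated_convergence[where w = "\<lambda>x. \<bar>f x\<bar> * (C1 * B)"])
    show "AE x in M. (\<lambda>n. f x * P n x) \<longlonglongrightarrow> f x * \<psi> x"
      using heat_semigroup_tendsto[OF \<psi> B(2)] unfolding P_def t_def by (intro AE_I2 tendsto_mult_left)
    show "AE x in M. norm (f x * P n x) \<le> \<bar>f x\<bar> * (C1 * B)" for n
      using PB by (intro AE_I2) (auto simp: abs_mult intro!: mult_left_mono)
  qed (use f continuous_measurable[OF \<psi>] in auto)
  then show ?thesis using zero LIMSEQ_unique[OF _ tendsto_const] by simp
qed

text \<open>Integrals of f over open sets vanish, since indicators of open sets are limits of
  continuous functions; a Dynkin argument gives Borel sets. The completion only adds sets that
  differ from Borel sets by null sets.\<close>

lemma coefficients_zero: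
  assumes f: "integrable M f" and f0: "\<And>k. fourier_coeff M \<phi> f k = 0"
  shows "AE x in M. f x = 0"
proof (rule density_zero[OF f])
  have si: "set_integrable M A f" if "A \<in> sets borel" for A
    unfolding set_integrable_def by (intro integrable_mult_indicator f borel_sets_M that)
  have fm[measurable]: "f \<in> borel_measurable M" using f by simp
  have op: "set_lebesgue_integral M U f = 0" if U: "open U" for U
  \<comment> \<open>The distance to the empty set is 0 by convention, so for U = UNIV the functions
    that approximate the indicator would all be 0.\<close>
  proof (cases "U = UNIV")
    case True
    then show ?thesis using coefficients_zero_continuous[OF f f0, of "\<lambda>_. 1"] by (simp add: set_lebesgue_integral_def)
  next
    case False
    define \<psi> where "\<psi> = (\<lambda>n x. min 1 (real n * infdist x (- U)))"
    have \<psi>c: "continuous_on UNIV (\<psi> n)" for n unfolding \<psi>_def by (intro continuous_intros)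
    have ind: "(\<lambda>n. \<psi> n x) \<longlonglongrightarrow> indicator U x" for x
    proof (cases "x \<in> U")
      case True
      then have "0 < infdist x (- U)" using True False by (intro infdist_pos_not_in_closed closed_Compl U) auto
      then obtain n0 where n0: "1 < real n0 * infdist x (- U)" using reals_Archimedean3 by blast
      have "\<psi> n x = 1" if "n0 \<le> n" for n
      proof -
        have "real n0 * infdist x (- U) \<le> real n * infdist x (- U)" using that infdist_nonneg by (intro mult_right_mono) auto
        then show ?thesis using n0 by (simp add: \<psi>_def)
      qed
      then have "\<forall>\<^sub>F n in sequentially. \<psi> n x = 1" unfolding eventually_sequentially by blast
      then show ?thesis using True by (simp add: tendsto_eventually)
    next
      case False
      then show ?thesis by (simp add: \<psi>_def)
    qed
    have "(\<lambda>n. \<integral>x. f x * \<psi> n x \<partial>M) \<longlonglongrightarrow> (\<integral>x. f x * indicator U x \<partial>M)"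
    proof (rule integral_dominated_convergence[where w = "\<lambda>x. \<bar>f x\<bar>"])
      show "AE x in M. (\<lambda>n. f x * \<psi> n x) \<longlonglongrightarrow> f x * indicator U x" using ind by (intro AE_I2 tendsto_mult_left)
      show "AE x in M. norm (f x * \<psi> n x) \<le> \<bar>f x\<bar>" for n
        by (intro AE_I2) (auto simp: abs_mult \<psi>_def infdist_nonneg intro!: mult_left_le)
      show "(\<lambda>x. f x * indicator U x) \<in> borel_measurable M" using borel_sets_M[OF borel_open[OF U]] by measurable
      show "(\<lambda>x. f x * \<psi> n x) \<in> borel_measurable M" for n using continuous_measurable[OF \<psi>c] by measurable
    qed (use f in auto)
    moreover have "(\<integral>x. f x * \<psi> n x \<partial>M) = 0" for n by (rule coefficients_zero_continuous[OF f f0 \<psi>c])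
    ultimately have "(\<integral>x. f x * indicator U x \<partial>M) = 0" using LIMSEQ_unique[OF _ tendsto_const] by simp
    then show ?thesis by (simp add: set_lebesgue_integral_def mult.commute)
  qed
  have bor: "set_lebesgue_integral M A f = 0" if "A \<in> sets borel" for A
  proof -
    have ist: "Int_stable {S :: 'a set. open S}" and pow: "{S :: 'a set. open S} \<subseteq> Pow UNIV" by (auto simp: Int_stable_def)
    have "A \<in> sigma_sets UNIV {S. open S}" using that by (simp add: borel_def)
    from ist pow this show ?thesis
    proof (induction rule: sigma_sets_induct_disjoint)
      case (basic A)
      then show ?case using op by simp
    next
      case empty
      then show ?case by (simp add: set_lebesgue_integral_def)
    next
      case (compl A)
      have A: "A \<in> sets borel" using compl(1) by (simp add: borel_def)
      have "set_lebesgue_integral M (A \<union> (UNIV - A)) f = set_lebesgue_integral M A f + set_lebesgue_integral M (UNIV - A) f"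
        using A by (intro set_integral_Un si) auto
      then show ?case using compl(2) op[of UNIV] by simp
    next
      case (union A)
      have A: "A i \<in> sets borel" for i using union(2) by (auto simp: borel_def)
      have "set_lebesgue_integral M (\<Union>i. A i) f = (\<Sum>i. set_lebesgue_integral M (A i) f)"
        using A borel_sets_M union(1) by (intro lebesgue_integral_countable_add si) (auto simp: disjoint_family_on_def)
      then show ?case using union(3) by simp
    qed
  qed
  fix A assume A: "A \<in> sets M"
  obtain N where N: "sets N = sets borel" "M = completion N" using complete_borel by blast
  have A': "main_part N A \<in> sets borel" using A N by (metis main_part_sets)
  have "AE x in M. x \<in> A \<longleftrightarrow> x \<in> main_part N A"
  proof -
    obtain N0 where N0: "N0 \<in> null_sets N" "null_part N A \<subseteq> N0" using A N null_part by metis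
    have "AE x in N. x \<notin> N0" using N0(1) by (rule AE_not_in)
    then have "AE x in M. x \<notin> N0" using N(2) AE_completion by metis
    then have n: "AE x in M. x \<notin> null_part N A" by (rule eventually_mono) (use N0(2) in blast)
    have "A = main_part N A \<union> null_part N A" using A N main_part_null_part_Un by metis
    then have "x \<in> A \<longleftrightarrow> x \<in> main_part N A" if "x \<notin> null_part N A" for x using that by blast
    with n show ?thesis by (auto elim!: eventually_mono)
  qed
  then have "set_lebesgue_integral M A f = set_lebesgue_integral M (main_part N A) f"
    unfolding set_lebesgue_integral_def using A borel_sets_M[OF A']
    by (intro integral_cong_AE) (auto elim!: eventually_mono simp: indicator_def)
  then show "set_lebesgue_integral M A f = 0" using bor[OF A'] by simp
qed

end

section \<open>Spectral multipliers\<close>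

text \<open>The substitution exp(-s) = cos theta turns cos(j theta) into the Chebyshev polynomial of
  exp(-s), and s = -ln(cos theta) is smooth and even for |theta| < pi/2. The factor exp(2 s) is
  expanded along with g; dividing it out later leaves exp(-2 s) in every term, hence heat kernels at
  times at least 2 t.\<close>

lemma chebyshev_expansion:
  assumes n: "2 \<le> n"
  shows "\<exists>K\<ge>0. \<forall>g C. 0 \<le> C \<longrightarrow> bounded_derivs n {-1<..<1} C g \<longrightarrow> (\<forall>s\<ge>1/2. g s = 0) \<longrightarrow>
     (\<exists>c. (\<forall>j. \<bar>c j\<bar> \<le> K * C / real (max 1 j) ^ n) \<and>
          (\<forall>s\<ge>0. (\<lambda>j. c j * (\<Sum>i\<le>j. cheb j i * exp (- s) ^ i)) sums (g s * exp (2 * s))))"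
proof -
  \<comment> \<open>The angle \<open>\<theta>2\<close> corresponds to s = 1, up to which derivatives
    of g are controlled, and \<open>\<theta>1\<close> to s = 1/2, from which on g vanishes.\<close>
  define \<theta>2 where "\<theta>2 = arccos (exp (-1))"
  define \<theta>1 where "\<theta>1 = arccos (exp (-(1/2)))"
  have e: "0 < exp (-1::real)" "exp (-1::real) < exp (-(1/2))" "exp (-(1/2)::real) < 1" "exp (-1::real) < 1" by auto
  have e1: "- 1 \<le> exp x" for x :: real by (rule order_trans[of _ 0]) auto
  have \<theta>2: "0 < \<theta>2" "\<theta>2 < pi / 2" "cos \<theta>2 = exp (-1)"
    using arccos_less_arccos[of 0 "exp (-1)"] arccos_less_arccos[of "exp (-1)" 1] e e1 by (auto simp: \<theta>2_def cos_arccos)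
  have \<theta>1: "0 < \<theta>1" "\<theta>1 < \<theta>2" "cos \<theta>1 = exp (-(1/2))"
    using arccos_less_arccos[of "exp (-1)" "exp (-(1/2))"] arccos_less_arccos[of "exp (-(1/2))" 1] e e1 by (auto simp: \<theta>1_def \<theta>2_def cos_arccos)
  define I where "I = {-\<theta>2<..<\<theta>2}"
  have cosI: "exp (-1) < cos \<theta>" if "\<theta> \<in> I" for \<theta>
  proof -
    have "cos \<theta>2 < cos \<bar>\<theta>\<bar>" using that \<theta>2 by (intro cos_monotone_0_pi) (auto simp: I_def)
    then show ?thesis using \<theta>2(3) by (simp add: cos_abs_real)
  qed
  have maps: "- ln (cos \<theta>) \<in> {-1<..<1}" if "\<theta> \<in> I" for \<theta>
  proof -
    have c: "exp (-1) < cos \<theta>" by (rule cosI[OF that])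
    then have "0 < cos \<theta>" using e(1) by linarith
    then have "ln (exp (-1)) < ln (cos \<theta>)" "ln (cos \<theta>) \<le> 0" using c by (auto simp del: ln_exp)
    then show ?thesis by simp
  qed
  have der: "((\<lambda>\<theta>. - ln (cos \<theta>)) has_real_derivative tan \<theta>) (at \<theta>)" if "\<theta> \<in> I" for \<theta>
  proof -
    have "0 < cos \<theta>" using cosI[OF that] e(1) by linarith
    then show ?thesis by (auto intro!: derivative_eq_intros simp: tan_def)
  qed
  obtain Ct where Ct: "0 \<le> Ct" "bounded_derivs n I Ct tan" using bounded_derivs_tan[OF \<theta>2(1,2)] unfolding I_def by blast
  obtain K' where K': "0 \<le> K'" "\<And>g C. 0 \<le> C \<Longrightarrow> bounded_derivs n {-1<..<1} C g \<Longrightarrow> bounded_derivs n I (K' * C) (\<lambda>\<theta>. g (- ln (cos \<theta>)))"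
    using bounded_derivs_compose[of I "\<lambda>\<theta>. - ln (cos \<theta>)" "{-1<..<1}", OF maps der Ct(2,1)] by blast
  obtain Ce where Ce: "0 \<le> Ce" "bounded_derivs n {-1<..<1} Ce (\<lambda>s. exp (2 * s :: real))" using bounded_derivs_exp by blast
  define K where "K = 2 * (K' * (2 ^ n * Ce))"
  show ?thesis
  proof (intro exI[of _ K] conjI allI impI)
    show "0 \<le> K" using K' Ce by (simp add: K_def)
    fix g C assume C: "0 \<le> (C :: real)" and g: "bounded_derivs n {-1<..<1} C g" and g0: "\<forall>s\<ge>1/2. g s = 0"
    define h where "h = (\<lambda>s. g s * exp (2 * s))"
    define C' where "C' = K' * (2 ^ n * C * Ce)"
    have C': "0 \<le> C'" using C K' Ce by (simp add: C'_def)
    have "bounded_derivs n {-1<..<1} (2 ^ n * C * Ce) h" unfolding h_def using g Ce C by (intro bounded_derivs_mult) auto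
    then have "bounded_derivs n I C' (\<lambda>\<theta>. h (- ln (cos \<theta>)))" unfolding C'_def using K' C Ce by auto
    define F where "F = (\<lambda>\<theta>. if \<bar>\<theta>\<bar> < \<theta>2 then h (- ln (cos \<theta>)) else 0)"
    have "bounded_derivs n I C' F"
      by (rule bounded_derivs_cong[OF \<open>bounded_derivs n I C' _\<close>]) (auto simp: F_def I_def)
    moreover have F0: "F \<theta> = 0" if "\<theta>1 < \<bar>\<theta>\<bar>" for \<theta>
    proof (cases "\<bar>\<theta>\<bar> < \<theta>2")
      case True
      have "cos \<bar>\<theta>\<bar> < cos \<theta>1" using that True \<theta>1 \<theta>2 by (intro cos_monotone_0_pi) auto
      then have "cos \<theta> < exp (-(1/2))" using \<theta>1(3) by (simp add: cos_abs_real)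
      moreover have "exp (-1) < cos \<theta>" using True by (intro cosI) (auto simp: I_def)
      then have "0 < cos \<theta>" using e(1) by linarith
      ultimately have "ln (cos \<theta>) < ln (exp (-(1/2)))" by (simp del: ln_exp)
      then show ?thesis using g0 by (simp add: F_def h_def)
    qed (simp add: F_def)
    ultimately have bF: "bounded_derivs n UNIV C' F"
      by (intro bounded_derivs_extend[of n I C' F "{-\<theta>1..\<theta>1}"]) (use \<theta>1 C' in \<open>auto simp: I_def\<close>)
    have ev: "F (- \<theta>) = F \<theta>" for \<theta> by (simp add: F_def)
    have "\<theta>1 < pi" using \<theta>1 \<theta>2 by simp
    from cosine_expansion[OF bF F0 this C' n ev]
    obtain c where c: "\<And>j. \<bar>c j\<bar> \<le> 2 * C' / real (max 1 j) ^ n"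
      "\<And>\<theta>. \<theta> \<in> {-pi..pi} \<Longrightarrow> (\<lambda>j. c j * cos (real j * \<theta>)) sums F \<theta>" by blast
    show "\<exists>c. (\<forall>j. \<bar>c j\<bar> \<le> K * C / real (max 1 j) ^ n) \<and>
          (\<forall>s\<ge>0. (\<lambda>j. c j * (\<Sum>i\<le>j. cheb j i * exp (- s) ^ i)) sums (g s * exp (2 * s)))"
    proof (intro exI[of _ c] conjI allI impI)
      show "\<bar>c j\<bar> \<le> K * C / real (max 1 j) ^ n" for j using c(1)[of j] by (simp add: K_def C'_def mult_ac)
      fix s :: real assume s: "0 \<le> s"
      define \<theta> where "\<theta> = arccos (exp (- s))"
      have es: "- 1 \<le> exp (- s)" "exp (- s) \<le> 1" using s order_trans[of "-1" 0 "exp (- s)"] by auto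
      have \<theta>: "cos \<theta> = exp (- s)" "0 \<le> \<theta>" "\<theta> \<le> pi"
        using es by (auto simp: \<theta>_def arccos_lbound arccos_ubound)
      have "F \<theta> = g s * exp (2 * s)"
      proof (cases "\<theta> < \<theta>2")
        case True
        then show ?thesis using \<theta> by (simp add: F_def h_def)
      next
        case False
        have "cos \<theta> \<le> cos \<theta>2" using False \<theta> \<theta>2 by (intro cos_monotone_0_pi_le) auto
        then have "1 \<le> s" using \<theta> \<theta>2 by simp
        then show ?thesis using g0 \<theta> False by (simp add: F_def)
      qed
      then show "(\<lambda>j. c j * (\<Sum>i\<le>j. cheb j i * exp (- s) ^ i)) sums (g s * exp (2 * s))"
        using c(2)[of \<theta>] \<theta> cheb_cos[OF order_refl, of _ \<theta>] by simp
    qed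
  qed
qed

text \<open>The terms are of order j^(q - S - 1), and S > q puts the exponent below -1.\<close>

lemma summable_multiplier_weight:
  assumes "q < real S" "0 \<le> q"
  shows "summable (\<lambda>j. real (j + 2) powr q / real (max 1 j) ^ (S + 1))"
proof (rule summable_comparison_test'[where N = 1])
  show "summable (\<lambda>j. 3 powr q * real j powr (q - real (S + 1)))"
    using assms by (intro summable_mult) (simp add: summable_real_powr_iff)
  fix j :: nat assume j: "1 \<le> j"
  have "real (j + 2) powr q \<le> (3 * real j) powr q" using j assms by (intro powr_mono2) auto
  then have "real (j + 2) powr q / real j ^ (S + 1) \<le> 3 powr q * real j powr q / real j ^ (S + 1)"
    using j by (intro divide_right_mono) (auto simp: powr_mult)
  also have "\<dots> = 3 powr q * real j powr (q - real (S + 1))"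
    using j by (simp only: powr_diff) (simp add: powr_realpow[symmetric] powr_add)
  finally show "norm (real (j + 2) powr q / real (max 1 j) ^ (S + 1)) \<le> 3 powr q * real j powr (q - real (S + 1))"
    using j by (simp add: max_def)
qed

context data_defined_space
begin

section \<open>Finite spectral sums and the integrals of their kernels\<close>

lemma finite_low_frequencies: "finite {k. lam k < c}"
proof -
  have "\<forall>\<^sub>F k in sequentially. c \<le> lam k" using lam_unbounded by (simp add: filterlim_at_top)
  then obtain n where n: "\<And>k. n \<le> k \<Longrightarrow> c \<le> lam k" by (auto simp: eventually_sequentially)
  have "{k. lam k < c} \<subseteq> {..<n}" using n by (auto simp: not_le[symmetric])
  then show ?thesis by (rule finite_subset) simp
qed

lemma finite_low_squares: "0 < t \<Longrightarrow> finite {k. (lam k)\<^sup>2 * t < c}"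
proof -
  assume t: "0 < t"
  have "lam k < sqrt (\<bar>c\<bar> / t) + 1" if "(lam k)\<^sup>2 * t < c" for k
  proof -
    have "(lam k)\<^sup>2 \<le> \<bar>c\<bar> / t" using that t by (simp add: pos_le_divide_eq)
    then show ?thesis using real_le_rsqrt by fastforce
  qed
  then have "{k. (lam k)\<^sup>2 * t < c} \<subseteq> {k. lam k < sqrt (\<bar>c\<bar> / t) + 1}" by blast
  then show ?thesis using finite_low_frequencies finite_subset by blast
qed

text \<open>The kernel of the operator that multiplies the k-th coefficient by g((lam k)^2 t). The
  truncation makes the sum finite for every g, and changes nothing for those that vanish from 1/2
  on.\<close>

definition multiplier_kernel :: "(real \<Rightarrow> real) \<Rightarrow> real \<Rightarrow> 'a \<Rightarrow> 'a \<Rightarrow> real" where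
  "multiplier_kernel g t x y = (\<Sum>k | (lam k)\<^sup>2 * t < 1/2. g ((lam k)\<^sup>2 * t) * \<phi> k x * \<phi> k y)"

definition multiplier :: "(real \<Rightarrow> real) \<Rightarrow> real \<Rightarrow> ('a \<Rightarrow> real) \<Rightarrow> 'a \<Rightarrow> real" where
  "multiplier g t h x = (\<Sum>k | (lam k)\<^sup>2 * t < 1/2. g ((lam k)\<^sup>2 * t) * fourier_coeff M \<phi> h k * \<phi> k x)"

lemma abs_kernel_sum:
  "\<exists>k3>0. \<forall>x y t. 0 < t \<longrightarrow> t \<le> 1 \<longrightarrow> (\<Sum>k. decay t k * \<bar>\<phi> k x\<bar> * \<bar>\<phi> k y\<bar>) \<le> k3 * t powr (- q / 2)"
proof -
  obtain k3 k4 where k: "0 < k3" "0 < k4"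
    "\<And>x y t. 0 < t \<Longrightarrow> t \<le> 1 \<Longrightarrow> \<bar>K t x y\<bar> \<le> k3 * t powr (- q / 2) * exp (- k4 * (dist x y)\<^sup>2 / t)"
    using heat_kernel_bound' by blast
  have "(\<Sum>k. decay t k * \<bar>\<phi> k x\<bar> * \<bar>\<phi> k y\<bar>) \<le> k3 * t powr (- q / 2)" if t: "0 < t" "t \<le> 1" for x y t
  proof -
    have d: "decay t k * \<bar>\<phi> k x\<bar> * \<bar>\<phi> k y\<bar> \<le> (decay t k * (\<phi> k x)\<^sup>2 + decay t k * (\<phi> k y)\<^sup>2) / 2" for k
    proof -
      have "decay t k * (\<bar>\<phi> k x\<bar> * \<bar>\<phi> k y\<bar>) \<le> decay t k * (((\<phi> k x)\<^sup>2 + (\<phi> k y)\<^sup>2) / 2)"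
        using sum_squares_bound[of "\<bar>\<phi> k x\<bar>" "\<bar>\<phi> k y\<bar>"] by (intro mult_left_mono) auto
      then show ?thesis by (simp add: algebra_simps)
    qed
    have s: "(\<lambda>k. (decay t k * (\<phi> k x)\<^sup>2 + decay t k * (\<phi> k y)\<^sup>2) / 2) sums ((K t x x + K t y y) / 2)"
      unfolding diagonal_sum[symmetric] using t by (intro sums_divide sums_add summable_sums diagonal_summable)
    have "(\<Sum>k. decay t k * \<bar>\<phi> k x\<bar> * \<bar>\<phi> k y\<bar>) \<le> (K t x x + K t y y) / 2"
      unfolding sums_unique[OF s] using d sums_summable[OF s] kernel_summable[OF t(1)] by (intro suminf_le) auto
    also have "\<dots> \<le> k3 * t powr (- q / 2)" using k(3)[OF t, of x x] k(3)[OF t, of y y] by simp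
    finally show ?thesis .
  qed
  then show ?thesis using k(1) by blast
qed

lemma cheb_le_1:
  assumes "0 \<le> u" "u \<le> 1" shows "\<bar>\<Sum>i\<le>j. cheb j i * u ^ i\<bar> \<le> 1"
proof -
  have "cos (arccos u) = u" using assms by simp
  then show ?thesis using cheb_cos[OF order_refl, of j "arccos u"] by simp
qed

text \<open>The kernel belongs to T_j(exp(-s)) exp(-2 s) with s = (lam k)^2 t. From |T_j| <= 1 it is
  of order t^(-q/2), without decay; from the sum of the coefficients it has Gaussian decay, with a
  factor 3^j. A weighted geometric mean of the two decays on the scale (j + 2) sqrt t and has no
  exponential factor left, so its integral is of order (j + 2)^q.\<close>

lemma chebyshev_kernel_bound:
  "\<exists>B>0. \<forall>j t x. 0 < t \<longrightarrow> t \<le> 1 \<longrightarrow>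
     (\<forall>y. (\<lambda>k. (\<Sum>i\<le>j. cheb j i * decay t k ^ i) * (decay t k)\<^sup>2 * \<phi> k x * \<phi> k y) sums (\<Sum>i\<le>j. cheb j i * K (real (i + 2) * t) x y)) \<and>
     (\<forall>y. \<bar>\<Sum>i\<le>j. cheb j i * K (real (i + 2) * t) x y\<bar> \<le> B * t powr (- q / 2)) \<and>
     (\<integral>\<^sup>+y. ennreal \<bar>\<Sum>i\<le>j. cheb j i * K (real (i + 2) * t) x y\<bar> \<partial>M) \<le> ennreal (B * real (j + 2) powr q)"
proof -
  obtain a3 where a3: "0 < a3" "\<And>x y t. 0 < t \<Longrightarrow> t \<le> 1 \<Longrightarrow> (\<Sum>k. decay t k * \<bar>\<phi> k x\<bar> * \<bar>\<phi> k y\<bar>) \<le> a3 * t powr (- q / 2)"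
    using abs_kernel_sum by blast
  obtain b3 k4 where k: "0 < b3" "0 < k4"
    "\<And>x y t s. 0 < t \<Longrightarrow> t \<le> 1 \<Longrightarrow> t \<le> s \<Longrightarrow> \<bar>K s x y\<bar> \<le> b3 * t powr (- q / 2) * exp (- k4 * (dist x y)\<^sup>2 / s)"
    using heat_kernel_all_times by blast
  obtain C where C: "0 < C" "\<And>x t. 0 < t \<Longrightarrow> (\<integral>\<^sup>+y. ennreal (exp (- k4 * (dist x y)\<^sup>2 / t)) \<partial>M) \<le> ennreal (C * t powr (q / 2))"
    using gauss_integral[OF k(2)] by blast
  define A where "A = a3 + b3"
  define B where "B = A + 3 * A * C"
  have A: "0 < A" "a3 \<le> A" "b3 \<le> A" using a3 k by (auto simp: A_def)
  have B: "0 < B" "A \<le> B" "3 * A * C \<le> B" using A C by (auto simp: B_def intro!: add_pos_nonneg)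
  show ?thesis
  proof (rule exI[of _ B], intro conjI allI impI B(1))
    fix j and t :: real and x :: 'a assume t: "0 < t" "t \<le> 1"
    define Q where "Q = (\<lambda>y. \<Sum>i\<le>j. cheb j i * K (real (i + 2) * t) x y)"
    have dk: "decay (real (i + 2) * t) k = decay t k ^ i * (decay t k)\<^sup>2" for i k
    proof -
      have "decay (real (i + 2) * t) k = exp (real (i + 2) * (- (lam k)\<^sup>2 * t))" by (simp add: decay_def algebra_simps)
      then show ?thesis unfolding exp_of_nat_mult decay_def by (simp only: power_add)
    qed
    show Qs: "(\<lambda>k. (\<Sum>i\<le>j. cheb j i * decay t k ^ i) * (decay t k)\<^sup>2 * \<phi> k x * \<phi> k y) sums (\<Sum>i\<le>j. cheb j i * K (real (i + 2) * t) x y)" for y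
    proof -
      have "(\<lambda>k. \<Sum>i\<le>j. cheb j i * (decay (real (i + 2) * t) k * \<phi> k x * \<phi> k y)) sums (\<Sum>i\<le>j. cheb j i * K (real (i + 2) * t) x y)"
        using t by (intro sums_sum sums_mult K_sums) auto
      then show ?thesis unfolding dk sum_distrib_right by (simp only: mult.assoc)
    qed
    have Q1: "\<bar>Q y\<bar> \<le> A * t powr (- q / 2)" for y
    proof -
      have le: "\<bar>(\<Sum>i\<le>j. cheb j i * decay t k ^ i) * (decay t k)\<^sup>2 * \<phi> k x * \<phi> k y\<bar> \<le> decay t k * \<bar>\<phi> k x\<bar> * \<bar>\<phi> k y\<bar>" for k
      proof -
        have u: "0 \<le> decay t k" "decay t k \<le> 1" using t decay_le_1[of t k] by auto
        have "\<bar>\<Sum>i\<le>j. cheb j i * decay t k ^ i\<bar> * (decay t k)\<^sup>2 \<le> 1 * decay t k"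
          using cheb_le_1[OF u] u by (intro mult_mono) (auto simp: power2_eq_square mult_left_le)
        then show ?thesis by (simp add: abs_mult mult_right_mono)
      qed
      have sm: "summable (\<lambda>k. \<bar>(\<Sum>i\<le>j. cheb j i * decay t k ^ i) * (decay t k)\<^sup>2 * \<phi> k x * \<phi> k y\<bar>)"
        by (rule summable_comparison_test'[where N = 0, OF kernel_summable[OF t(1), of x y]]) (use le in auto)
      have "\<bar>Q y\<bar> \<le> (\<Sum>k. \<bar>(\<Sum>i\<le>j. cheb j i * decay t k ^ i) * (decay t k)\<^sup>2 * \<phi> k x * \<phi> k y\<bar>)"
        unfolding Q_def sums_unique[OF Qs] by (rule summable_rabs[OF sm])
      also have "\<dots> \<le> (\<Sum>k. decay t k * \<bar>\<phi> k x\<bar> * \<bar>\<phi> k y\<bar>)"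
        by (rule suminf_le[OF le sm kernel_summable[OF t(1)]])
      also have "\<dots> \<le> a3 * t powr (- q / 2)" by (rule a3(2)[OF t])
      also have "\<dots> \<le> A * t powr (- q / 2)" using A by (intro mult_right_mono) auto
      finally show ?thesis .
    qed
    have Q2: "\<bar>Q y\<bar> \<le> A * t powr (- q / 2) * (3 ^ j * exp (- k4 * (dist x y)\<^sup>2 / (real (j + 2) * t)))" for y
    proof -
      have "\<bar>Q y\<bar> \<le> (\<Sum>i\<le>j. \<bar>cheb j i\<bar> * (A * t powr (- q / 2) * exp (- k4 * (dist x y)\<^sup>2 / (real (j + 2) * t))))"
        unfolding Q_def
      proof (rule order_trans[OF sum_abs], rule sum_mono)
        fix i assume i: "i \<in> {..j}"
        have ti: "t \<le> real (i + 2) * t" using t by simp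
        have "\<bar>K (real (i + 2) * t) x y\<bar> \<le> b3 * t powr (- q / 2) * exp (- k4 * (dist x y)\<^sup>2 / (real (i + 2) * t))"
          by (rule k(3)[OF t ti])
        also have "\<dots> \<le> A * t powr (- q / 2) * exp (- k4 * (dist x y)\<^sup>2 / (real (j + 2) * t))"
        proof (intro mult_mono)
          have "k4 * (dist x y)\<^sup>2 / (real (j + 2) * t) \<le> k4 * (dist x y)\<^sup>2 / (real (i + 2) * t)"
            using i t k by (intro divide_left_mono mult_right_mono) auto
          then show "exp (- k4 * (dist x y)\<^sup>2 / (real (i + 2) * t)) \<le> exp (- k4 * (dist x y)\<^sup>2 / (real (j + 2) * t))" by simp
        qed (use A in auto)
        finally show "\<bar>cheb j i * K (real (i + 2) * t) x y\<bar> \<le> \<bar>cheb j i\<bar> * (A * t powr (- q / 2) * exp (- k4 * (dist x y)\<^sup>2 / (real (j + 2) * t)))"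
          unfolding abs_mult by (intro mult_left_mono) auto
      qed
      also have "\<dots> \<le> 3 ^ j * (A * t powr (- q / 2) * exp (- k4 * (dist x y)\<^sup>2 / (real (j + 2) * t)))"
        unfolding sum_distrib_right[symmetric] using A by (intro mult_right_mono cheb_abs_sum) auto
      finally show ?thesis by (simp add: mult_ac)
    qed
    have Q3: "\<bar>Q y\<bar> \<le> 3 * A * t powr (- q / 2) * exp (- k4 * (dist x y)\<^sup>2 / ((real (j + 2))\<^sup>2 * t))" for y
    proof -
      define z where "z = 3 ^ j * exp (- k4 * (dist x y)\<^sup>2 / (real (j + 2) * t))"
      \<comment> \<open>The exponent 1 / (j + 2) reduces 3^j to at most 3 and multiplies the squared
        width of the Gaussian by j + 2. Since \<open>Q\<close> obeys the bound with 1 and the bound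
        with z, it obeys the one with z^\<alpha>.\<close>
      define \<alpha> where "\<alpha> = 1 / real (j + 2)"
      have z: "0 < z" by (simp add: z_def)
      have \<alpha>: "0 \<le> \<alpha>" "\<alpha> \<le> 1" by (auto simp: \<alpha>_def)
      have "\<bar>Q y\<bar> \<le> A * t powr (- q / 2) * z powr \<alpha>"
      proof (cases "1 \<le> z")
        case True
        then have "1 \<le> z powr \<alpha>" using \<alpha> by (simp add: ge_one_powr_ge_zero)
        then have "A * t powr (- q / 2) * 1 \<le> A * t powr (- q / 2) * z powr \<alpha>" using A by (intro mult_left_mono) auto
        then show ?thesis using Q1[of y] by simp
      next
        case False
        then have "z powr 1 \<le> z powr \<alpha>" using \<alpha> z by (intro powr_mono') auto
        then have "A * t powr (- q / 2) * z \<le> A * t powr (- q / 2) * z powr \<alpha>" using A z by (intro mult_left_mono) auto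
        then show ?thesis using Q2[of y] unfolding z_def by simp
      qed
      also have "z powr \<alpha> = (3 ^ j) powr \<alpha> * exp (- k4 * (dist x y)\<^sup>2 / ((real (j + 2))\<^sup>2 * t))"
        unfolding z_def powr_mult
        by (simp add: powr_def \<alpha>_def power2_eq_square mult_ac)
      also have "A * t powr (- q / 2) * ((3 ^ j) powr \<alpha> * exp (- k4 * (dist x y)\<^sup>2 / ((real (j + 2))\<^sup>2 * t)))
          \<le> A * t powr (- q / 2) * (3 * exp (- k4 * (dist x y)\<^sup>2 / ((real (j + 2))\<^sup>2 * t)))"
      proof (intro mult_left_mono mult_right_mono)
        have "(3 ^ j :: real) powr \<alpha> = 3 powr (real j * \<alpha>)" by (simp add: powr_realpow[symmetric] powr_powr)
        also have "\<dots> \<le> 3 powr 1" by (intro powr_mono) (auto simp: \<alpha>_def)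
        finally show "(3 ^ j :: real) powr \<alpha> \<le> 3" by simp
      qed (use A in auto)
      finally show ?thesis by (simp add: mult_ac)
    qed
    show "\<bar>\<Sum>i\<le>j. cheb j i * K (real (i + 2) * t) x y\<bar> \<le> B * t powr (- q / 2)" for y
      using Q1[of y] B mult_right_mono[OF B(2), of "t powr (- q / 2)"] unfolding Q_def by simp
    have "(\<integral>\<^sup>+y. ennreal \<bar>Q y\<bar> \<partial>M) \<le> (\<integral>\<^sup>+y. ennreal (3 * A * t powr (- q / 2)) * ennreal (exp (- k4 * (dist x y)\<^sup>2 / ((real (j + 2))\<^sup>2 * t))) \<partial>M)"
      using Q3 A by (intro nn_integral_mono) (simp add: ennreal_mult[symmetric] ennreal_leI)
    also have "\<dots> = ennreal (3 * A * t powr (- q / 2)) * (\<integral>\<^sup>+y. ennreal (exp (- k4 * (dist x y)\<^sup>2 / ((real (j + 2))\<^sup>2 * t))) \<partial>M)"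
      by (intro nn_integral_cmult) measurable
    also have "\<dots> \<le> ennreal (3 * A * t powr (- q / 2)) * ennreal (C * ((real (j + 2))\<^sup>2 * t) powr (q / 2))"
      using t by (intro mult_left_mono C(2)) auto
    also have "\<dots> = ennreal (3 * A * t powr (- q / 2) * (C * ((real (j + 2))\<^sup>2 * t) powr (q / 2)))"
      using A C by (simp add: ennreal_mult[symmetric])
    also have "((real (j + 2))\<^sup>2 * t) powr (q / 2) = real (j + 2) powr q * t powr (q / 2)"
    proof -
      have "((real (j + 2))\<^sup>2) powr (q / 2) = (real (j + 2) powr 2) powr (q / 2)" by simp
      also have "\<dots> = real (j + 2) powr q" by (simp only: powr_powr) simp
      finally show ?thesis by (simp only: powr_mult)
    qed
    also have "3 * A * t powr (- q / 2) * (C * (real (j + 2) powr q * t powr (q / 2))) = 3 * A * C * real (j + 2) powr q"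
      using t by (simp add: powr_minus_divide)
    also have "ennreal (3 * A * C * real (j + 2) powr q) \<le> ennreal (B * real (j + 2) powr q)"
      using B by (intro ennreal_leI mult_right_mono) auto
    finally show "(\<integral>\<^sup>+y. ennreal \<bar>\<Sum>i\<le>j. cheb j i * K (real (i + 2) * t) x y\<bar> \<partial>M) \<le> ennreal (B * real (j + 2) powr q)"
      by (simp add: Q_def)
  qed
qed

text \<open>The Chebyshev series of g converges uniformly over the frequencies, since |T_j| <= 1 and
  the coefficients are summable, and so do the kernels. The coefficients decay like j^(-S - 1), the
  integrals of the kernels grow like j^q, and the products are summable.\<close>

lemma multiplier_kernel_bound:
  assumes S: "q < real S"
  shows "\<exists>B>0. \<forall>g C t x. 0 \<le> C \<longrightarrow> 0 < t \<longrightarrow> t \<le> 1 \<longrightarrow> bounded_derivs (S + 1) {-1<..<1} C g \<longrightarrow> (\<forall>s\<ge>1/2. g s = 0) \<longrightarrow>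
     (\<integral>\<^sup>+y. ennreal \<bar>multiplier_kernel g t x y\<bar> \<partial>M) \<le> ennreal (B * C)"
proof -
  define n where "n = S + 1"
  have n: "2 \<le> n" using S q_pos by (cases S) (auto simp: n_def)
  obtain K0 where K0: "0 \<le> K0" "\<And>g C. 0 \<le> C \<Longrightarrow> bounded_derivs n {-1<..<1} C g \<Longrightarrow> \<forall>s\<ge>1/2. g s = 0 \<Longrightarrow>
     (\<exists>c. (\<forall>j. \<bar>c j\<bar> \<le> K0 * C / real (max 1 j) ^ n) \<and>
          (\<forall>s\<ge>0. (\<lambda>j. c j * (\<Sum>i\<le>j. cheb j i * exp (- s) ^ i)) sums (g s * exp (2 * s))))"
    using chebyshev_expansion[OF n] by blast
  define QQ where "QQ = (\<lambda>j t x y. \<Sum>i\<le>j. cheb j i * K (real (i + 2) * t) x y)"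
  obtain B where B: "0 < B"
    "\<And>j t x y. 0 < t \<Longrightarrow> t \<le> 1 \<Longrightarrow> (\<lambda>k. (\<Sum>i\<le>j. cheb j i * decay t k ^ i) * (decay t k)\<^sup>2 * \<phi> k x * \<phi> k y) sums QQ j t x y"
    "\<And>j t x y. 0 < t \<Longrightarrow> t \<le> 1 \<Longrightarrow> \<bar>QQ j t x y\<bar> \<le> B * t powr (- q / 2)"
    "\<And>j t x. 0 < t \<Longrightarrow> t \<le> 1 \<Longrightarrow> (\<integral>\<^sup>+y. ennreal \<bar>QQ j t x y\<bar> \<partial>M) \<le> ennreal (B * real (j + 2) powr q)"
    using chebyshev_kernel_bound unfolding QQ_def by blast
  define W where "W = (\<lambda>j. real (j + 2) powr q / real (max 1 j) ^ n)"
  have W: "summable W" unfolding W_def n_def using S q_pos by (intro summable_multiplier_weight) auto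
  have W0: "0 \<le> W j" for j by (simp add: W_def)
  define BB where "BB = K0 * B * suminf W + 1"
  have BB: "0 < BB" "K0 * B * suminf W \<le> BB" using K0 B suminf_nonneg[OF W W0] by (auto simp: BB_def add_nonneg_pos)
  show ?thesis
  proof (rule exI[of _ BB], intro conjI allI impI BB(1))
    fix g and C t :: real and x :: 'a
    assume C: "0 \<le> (C :: real)" and t: "0 < t" "t \<le> 1" and g: "bounded_derivs (S + 1) {-1<..<1} C g" and g0: "\<forall>s\<ge>1/2. g s = 0"
    obtain c where c: "\<And>j. \<bar>c j\<bar> \<le> K0 * C / real (max 1 j) ^ n"
      "\<And>s. 0 \<le> s \<Longrightarrow> (\<lambda>j. c j * (\<Sum>i\<le>j. cheb j i * exp (- s) ^ i)) sums (g s * exp (2 * s))"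
      using K0(2)[OF C _ g0] g unfolding n_def by blast
    define T where "T = (\<lambda>j k. \<Sum>i\<le>j. cheb j i * decay t k ^ i)"
    define G where "G = (\<lambda>k. g ((lam k)\<^sup>2 * t) * exp (2 * ((lam k)\<^sup>2 * t)))"
    have Ts: "(\<lambda>j. c j * T j k) sums G k" for k
      using c(2)[of "(lam k)\<^sup>2 * t"] t by (simp add: T_def G_def decay_def)
    have T1: "\<bar>T j k\<bar> \<le> 1" for j k unfolding T_def using t decay_le_1[of t k] by (intro cheb_le_1) auto
    have W1: "1 / real (max 1 j) ^ n \<le> W j" for j
      unfolding W_def using q_pos by (intro divide_right_mono) (auto simp: ge_one_powr_ge_zero)
    have cW: "\<bar>c j\<bar> \<le> K0 * C * W j" for j
      using c(1)[of j] mult_left_mono[OF W1[of j], of "K0 * C"] K0 C by simp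
    have sc: "summable (\<lambda>j. \<bar>c j\<bar>)"
      by (rule summable_comparison_test'[where N = 0, OF summable_mult[OF W, of "K0 * C"]]) (use cW in auto)
    have Qm[measurable]: "QQ j t x \<in> borel_measurable M" for j
      unfolding QQ_def using t by (intro borel_measurable_sum borel_measurable_times borel_measurable_const K_measurable) auto
    have sums: "(\<lambda>j. c j * QQ j t x y) sums multiplier_kernel g t x y" for y
    proof -
      have F: "(\<lambda>k. G k * (decay t k)\<^sup>2 * \<phi> k x * \<phi> k y) sums multiplier_kernel g t x y"
      proof -
        have eq: "G k * (decay t k)\<^sup>2 = g ((lam k)\<^sup>2 * t)" for k
          by (simp add: G_def decay_def power2_eq_square mult_exp_exp)
        have "(\<lambda>k. g ((lam k)\<^sup>2 * t) * \<phi> k x * \<phi> k y) sums (\<Sum>k | (lam k)\<^sup>2 * t < 1/2. g ((lam k)\<^sup>2 * t) * \<phi> k x * \<phi> k y)"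
          by (rule sums_finite[OF finite_low_squares[OF t(1)]]) (use g0 in auto)
        then show ?thesis unfolding eq multiplier_kernel_def .
      qed
      define S0 where "S0 = (\<Sum>k. decay t k * \<bar>\<phi> k x\<bar> * \<bar>\<phi> k y\<bar>)"
      \<comment> \<open>The truncated series differs from \<open>G\<close> by at most the tail of
        the coefficients, uniformly in k; a remaining factor \<open>decay t k\<close> makes the sum
        over k converge absolutely.\<close>
      have diff: "\<bar>multiplier_kernel g t x y - (\<Sum>j<J. c j * QQ j t x y)\<bar> \<le> ((\<Sum>j. \<bar>c j\<bar>) - (\<Sum>j<J. \<bar>c j\<bar>)) * S0" for J
      proof -
        define r where "r = (\<lambda>k. G k - (\<Sum>j<J. c j * T j k))"
        define tail where "tail = (\<Sum>j. \<bar>c j\<bar>) - (\<Sum>j<J. \<bar>c j\<bar>)"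
        have "(\<lambda>k. \<Sum>j<J. c j * (T j k * (decay t k)\<^sup>2 * \<phi> k x * \<phi> k y)) sums (\<Sum>j<J. c j * QQ j t x y)"
          using B(2)[OF t] unfolding T_def by (intro sums_sum sums_mult) auto
        from sums_diff[OF F this]
        have rs: "(\<lambda>k. r k * (decay t k)\<^sup>2 * \<phi> k x * \<phi> k y) sums (multiplier_kernel g t x y - (\<Sum>j<J. c j * QQ j t x y))"
          by (simp add: r_def left_diff_distrib sum_distrib_right mult.assoc)
        have rt: "\<bar>r k\<bar> \<le> tail" for k
        proof -
          have s1: "summable (\<lambda>j. \<bar>c j * T j k\<bar>)"
            by (rule summable_comparison_test'[where N = 0, OF sc]) (use T1 in \<open>auto simp: abs_mult intro!: mult_left_le\<close>)
          have "r k = (\<Sum>j. c (j + J) * T (j + J) k)"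
            using suminf_minus_initial_segment[OF sums_summable[OF Ts[of k]], of J] sums_unique[OF Ts[of k]] by (simp add: r_def)
          also have "\<bar>\<dots>\<bar> \<le> (\<Sum>j. \<bar>c (j + J) * T (j + J) k\<bar>)"
            by (rule summable_rabs) (use s1 summable_iff_shift[of "\<lambda>j. \<bar>c j * T j k\<bar>" J] in simp)
          also have "\<dots> \<le> (\<Sum>j. \<bar>c (j + J)\<bar>)"
            using s1 sc summable_iff_shift[of "\<lambda>j. \<bar>c j * T j k\<bar>" J] summable_iff_shift[of "\<lambda>j. \<bar>c j\<bar>" J] T1
            by (intro suminf_le) (auto simp: abs_mult intro!: mult_left_le)
          also have "\<dots> = tail" using suminf_minus_initial_segment[OF sc, of J] by (simp add: tail_def)
          finally show ?thesis .
        qed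
        have tail0: "0 \<le> tail" using rt[of 0] by (rule order_trans[OF abs_ge_zero])
        have le: "\<bar>r k * (decay t k)\<^sup>2 * \<phi> k x * \<phi> k y\<bar> \<le> tail * (decay t k * \<bar>\<phi> k x\<bar> * \<bar>\<phi> k y\<bar>)" for k
        proof -
          have "(decay t k)\<^sup>2 \<le> decay t k" using t decay_le_1[of t k] by (simp add: power2_eq_square mult_left_le)
          then have "\<bar>r k\<bar> * (decay t k)\<^sup>2 * (\<bar>\<phi> k x\<bar> * \<bar>\<phi> k y\<bar>) \<le> tail * decay t k * (\<bar>\<phi> k x\<bar> * \<bar>\<phi> k y\<bar>)"
            using rt tail0 by (intro mult_right_mono mult_mono) auto
          then show ?thesis by (simp add: abs_mult mult.assoc)
        qed
        have sm: "summable (\<lambda>k. tail * (decay t k * \<bar>\<phi> k x\<bar> * \<bar>\<phi> k y\<bar>))" by (intro summable_mult kernel_summable t)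
        have sa: "summable (\<lambda>k. \<bar>r k * (decay t k)\<^sup>2 * \<phi> k x * \<phi> k y\<bar>)"
          by (rule summable_comparison_test'[where N = 0, OF sm]) (use le in auto)
        have "\<bar>multiplier_kernel g t x y - (\<Sum>j<J. c j * QQ j t x y)\<bar> \<le> (\<Sum>k. \<bar>r k * (decay t k)\<^sup>2 * \<phi> k x * \<phi> k y\<bar>)"
          unfolding sums_unique[OF rs] by (rule summable_rabs[OF sa])
        also have "\<dots> \<le> (\<Sum>k. tail * (decay t k * \<bar>\<phi> k x\<bar> * \<bar>\<phi> k y\<bar>))" by (rule suminf_le[OF le sa sm])
        also have "\<dots> = tail * S0" unfolding S0_def by (intro suminf_mult kernel_summable t)
        finally show ?thesis by (simp add: tail_def)
      qed
      have "(\<lambda>J. ((\<Sum>j. \<bar>c j\<bar>) - (\<Sum>j<J. \<bar>c j\<bar>)) * S0) \<longlonglongrightarrow> ((\<Sum>j. \<bar>c j\<bar>) - (\<Sum>j. \<bar>c j\<bar>)) * S0"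
        by (intro tendsto_intros summable_LIMSEQ sc)
      then have z: "(\<lambda>J. ((\<Sum>j. \<bar>c j\<bar>) - (\<Sum>j<J. \<bar>c j\<bar>)) * S0) \<longlonglongrightarrow> 0" by simp
      have "(\<lambda>J. multiplier_kernel g t x y - (\<Sum>j<J. c j * QQ j t x y)) \<longlonglongrightarrow> 0"
        by (rule Lim_null_comparison[OF _ z]) (use diff in \<open>auto intro!: always_eventually\<close>)
      then have "(\<lambda>J. multiplier_kernel g t x y - (multiplier_kernel g t x y - (\<Sum>j<J. c j * QQ j t x y))) \<longlonglongrightarrow> multiplier_kernel g t x y - 0"
        by (intro tendsto_diff tendsto_const)
      then show ?thesis by (simp add: sums_def)
    qed
    have pw: "ennreal \<bar>multiplier_kernel g t x y\<bar> \<le> (\<Sum>j. ennreal \<bar>c j\<bar> * ennreal \<bar>QQ j t x y\<bar>)" for y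
    proof -
      have sa: "summable (\<lambda>j. \<bar>c j * QQ j t x y\<bar>)"
        by (rule summable_comparison_test'[where N = 0, OF summable_mult2[OF sc, of "B * t powr (- q / 2)"]])
           (use B(3)[OF t] in \<open>auto simp: abs_mult intro!: mult_left_mono\<close>)
      have "\<bar>multiplier_kernel g t x y\<bar> \<le> (\<Sum>j. \<bar>c j * QQ j t x y\<bar>)"
        unfolding sums_unique[OF sums] by (rule summable_rabs[OF sa])
      then have "ennreal \<bar>multiplier_kernel g t x y\<bar> \<le> (\<Sum>j. ennreal \<bar>c j * QQ j t x y\<bar>)"
        using sa by (subst suminf_ennreal2) (auto intro: ennreal_leI)
      then show ?thesis by (simp add: abs_mult ennreal_mult)
    qed
    have "(\<integral>\<^sup>+y. ennreal \<bar>multiplier_kernel g t x y\<bar> \<partial>M) \<le> (\<integral>\<^sup>+y. (\<Sum>j. ennreal \<bar>c j\<bar> * ennreal \<bar>QQ j t x y\<bar>) \<partial>M)"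
      by (intro nn_integral_mono pw)
    also have "\<dots> = (\<Sum>j. ennreal \<bar>c j\<bar> * (\<integral>\<^sup>+y. ennreal \<bar>QQ j t x y\<bar> \<partial>M))"
      by (subst nn_integral_suminf) (auto simp: nn_integral_cmult)
    also have "\<dots> \<le> (\<Sum>j. ennreal (K0 * C * B * W j))"
    proof (intro suminf_le)
      fix j
      have "ennreal \<bar>c j\<bar> * (\<integral>\<^sup>+y. ennreal \<bar>QQ j t x y\<bar> \<partial>M) \<le> ennreal (K0 * C / real (max 1 j) ^ n) * ennreal (B * real (j + 2) powr q)"
        by (intro mult_mono ennreal_leI c(1) B(4)[OF t]) auto
      also have "\<dots> = ennreal (K0 * C * B * W j)"
        using K0 C B by (subst ennreal_mult[symmetric]) (auto simp: W_def)
      finally show "ennreal \<bar>c j\<bar> * (\<integral>\<^sup>+y. ennreal \<bar>QQ j t x y\<bar> \<partial>M) \<le> ennreal (K0 * C * B * W j)" .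
    qed auto
    also have "\<dots> = ennreal (\<Sum>j. K0 * C * B * W j)"
      using K0 C B W W0 by (intro suminf_ennreal2 summable_mult) auto
    also have "(\<Sum>j. K0 * C * B * W j) = K0 * B * suminf W * C" using suminf_mult[OF W, of "K0 * C * B"] by (simp add: mult_ac)
    also have "ennreal (K0 * B * suminf W * C) \<le> ennreal (BB * C)" using BB C by (intro ennreal_leI mult_right_mono) auto
    finally show "(\<integral>\<^sup>+y. ennreal \<bar>multiplier_kernel g t x y\<bar> \<partial>M) \<le> ennreal (BB * C)" .
  qed
qed

lemma multiplier_continuous: "continuous_on UNIV (multiplier g t h)"
  unfolding multiplier_def by (intro continuous_intros continuous_phi)

lemma multiplier_kernel_mult:
  "multiplier_kernel g t x y * h y = (\<Sum>k | (lam k)\<^sup>2 * t < 1/2. (g ((lam k)\<^sup>2 * t) * \<phi> k x) * (h y * \<phi> k y))"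
  unfolding multiplier_kernel_def sum_distrib_right by (intro sum.cong refl) (simp add: mult_ac)

lemma multiplier_integral:
  assumes "integrable M h"
  shows "multiplier g t h x = (\<integral>y. multiplier_kernel g t x y * h y \<partial>M)"
proof -
  have "(\<integral>y. multiplier_kernel g t x y * h y \<partial>M) = (\<integral>y. (\<Sum>k | (lam k)\<^sup>2 * t < 1/2. (g ((lam k)\<^sup>2 * t) * \<phi> k x) * (h y * \<phi> k y)) \<partial>M)"
    by (simp only: multiplier_kernel_mult)
  also have "\<dots> = (\<Sum>k | (lam k)\<^sup>2 * t < 1/2. \<integral>y. (g ((lam k)\<^sup>2 * t) * \<phi> k x) * (h y * \<phi> k y) \<partial>M)"
    by (intro Bochner_Integration.integral_sum integrable_mult_right phi_mult_integrable assms)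
  also have "\<dots> = multiplier g t h x"
    unfolding multiplier_def by (intro sum.cong refl, subst integral_mult_right_zero) (simp add: fourier_coeff_def)
  finally show ?thesis by simp
qed

text \<open>The kernel is symmetric, so rows and columns have the same bound and Schur's test gives
  the constant B C for every p.\<close>

lemma multiplier_Lp_bound:
  assumes S: "q < real S"
  shows "\<exists>B>0. \<forall>p g C t h. 1 \<le> p \<longrightarrow> 0 < C \<longrightarrow> 0 < t \<longrightarrow> t \<le> 1 \<longrightarrow> bounded_derivs (S + 1) {-1<..<1} C g \<longrightarrow> (\<forall>s\<ge>1/2. g s = 0) \<longrightarrow>
     h \<in> Lp_space M p \<longrightarrow> multiplier g t h \<in> Lp_space M p \<and> Lp_norm M p (multiplier g t h) \<le> B * C * Lp_norm M p h"
proof -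
  obtain B where B: "0 < B" "\<And>g C t x. 0 \<le> C \<Longrightarrow> 0 < t \<Longrightarrow> t \<le> 1 \<Longrightarrow> bounded_derivs (S + 1) {-1<..<1} C g \<Longrightarrow> \<forall>s\<ge>1/2. g s = 0 \<Longrightarrow>
     (\<integral>\<^sup>+y. ennreal \<bar>multiplier_kernel g t x y\<bar> \<partial>M) \<le> ennreal (B * C)"
    using multiplier_kernel_bound[OF S] by blast
  show ?thesis
  proof (rule exI[of _ B], rule conjI[OF B(1)], intro allI impI)
    fix p :: ereal and g and C t :: real and h
    assume p: "1 \<le> p" and C: "0 < C" and t: "0 < t" "t \<le> 1" and g: "bounded_derivs (S + 1) {-1<..<1} C g" "\<forall>s\<ge>1/2. g s = 0"
      and h: "h \<in> Lp_space M p"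
    have ih: "integrable M h" by (rule Lp_integrable[OF p h])
    have sym: "multiplier_kernel g t x y = multiplier_kernel g t y x" for x y
      by (simp add: multiplier_kernel_def mult_ac)
    have L: "Lp_bounded M p ((B * C) powr (1 - recip p) * (B * C) powr recip p * Lp_norm M p h) (multiplier g t h)"
    proof (rule Schur_test[OF p, where k = "\<lambda>z y. \<bar>multiplier_kernel g t z y\<bar>"])
      show "(\<lambda>(z, y). \<bar>multiplier_kernel g t z y\<bar>) \<in> borel_measurable (M \<Otimes>\<^sub>M M)"
        unfolding multiplier_kernel_def by measurable
      show "multiplier g t h \<in> borel_measurable M" by (intro continuous_measurable multiplier_continuous)
      show "(\<integral>\<^sup>+y. ennreal \<bar>multiplier_kernel g t z y\<bar> \<partial>M) \<le> ennreal (B * C)" for z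
        using B(2) C t g by simp
      show "(\<integral>\<^sup>+z. ennreal \<bar>multiplier_kernel g t z y\<bar> \<partial>M) \<le> ennreal (B * C)" for y
        using B(2) C t g by (subst sym) simp
      show "AE z in M. ennreal \<bar>multiplier g t h z\<bar> \<le> (\<integral>\<^sup>+y. ennreal (\<bar>multiplier_kernel g t z y\<bar> * \<bar>h y\<bar>) \<partial>M)"
      proof (rule AE_I2)
        fix z
        have "integrable M (\<lambda>y. multiplier_kernel g t z y * h y)"
        proof -
          have "(\<lambda>y. multiplier_kernel g t z y * h y) = (\<lambda>y. \<Sum>k | (lam k)\<^sup>2 * t < 1/2. (g ((lam k)\<^sup>2 * t) * \<phi> k z) * (h y * \<phi> k y))"
            by (rule ext) (rule multiplier_kernel_mult)
          then show ?thesis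
            by (simp only:) (intro Bochner_Integration.integrable_sum integrable_mult_right phi_mult_integrable ih)
        qed
        from integral_norm_bound_ennreal[OF this]
        show "ennreal \<bar>multiplier g t h z\<bar> \<le> (\<integral>\<^sup>+y. ennreal (\<bar>multiplier_kernel g t z y\<bar> * \<bar>h y\<bar>) \<partial>M)"
          unfolding multiplier_integral[OF ih] by (simp add: abs_mult)
      qed
    qed (use B C Lp_bounded_norm[OF p h] Lp_norm_nonneg[OF p h] in auto)
    have "(B * C) powr (1 - recip p) * (B * C) powr recip p = B * C"
      using B C by (simp add: powr_add[symmetric])
    with L show "multiplier g t h \<in> Lp_space M p \<and> Lp_norm M p (multiplier g t h) \<le> B * C * Lp_norm M p h"
      using p B C Lp_norm_nonneg[OF p h] by (simp add: Lp_bounded_iff)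
  qed
qed

end

section \<open>Operators applied to the heat kernel\<close>

context data_defined_space
begin

lemma Lp_norm_uniform_tendsto:
  assumes p: "1 \<le> p" and F: "\<And>n. F n \<in> borel_measurable M" and f: "f \<in> borel_measurable M"
    and G: "\<And>n. AE x in M. F n x = G n x" and lim: "uniform_limit UNIV G f sequentially"
  shows "(\<lambda>n. Lp_norm M p (\<lambda>x. F n x - f x)) \<longlonglongrightarrow> 0"
proof (rule LIMSEQ_I)
  fix e :: real assume e: "0 < e"
  obtain n0 where n0: "\<And>n x. n0 \<le> n \<Longrightarrow> dist (G n x) (f x) < e / 2"
    using uniform_limitD[OF lim, of "e/2"] e unfolding eventually_sequentially by auto
  have "norm (Lp_norm M p (\<lambda>x. F n x - f x) - 0) < e" if n: "n0 \<le> n" for n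
  proof -
    have "AE x in M. \<bar>F n x - f x\<bar> \<le> e / 2"
      using G[of n] by eventually_elim (use n0[OF n] in \<open>auto simp: dist_real_def less_imp_le\<close>)
    moreover have "(\<lambda>x. F n x - f x) \<in> borel_measurable M" using F f by simp
    ultimately have "(\<lambda>x. F n x - f x) \<in> Lp_space M p" "Lp_norm M p (\<lambda>x. F n x - f x) \<le> e / 2"
      using Lp_bound[OF p, of "\<lambda>x. F n x - f x" "e / 2"] e by simp_all
    then show ?thesis using Lp_norm_nonneg[OF p] e by fastforce
  qed
  then show "\<exists>n0. \<forall>n\<ge>n0. norm (Lp_norm M p (\<lambda>x. F n x - f x) - 0) < e" by blast
qed

lemma continuous_Lp: "1 \<le> p \<Longrightarrow> continuous_on UNIV f \<Longrightarrow> f \<in> Lp_space M p"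
  by (rule continuous_bounded[of f]) (auto intro!: Lp_bound(1) continuous_measurable)

text \<open>On a probability space uniform convergence implies convergence in L^p for all p,
  including infinity, so closedness applies. The uniform limit of the continuous representatives is
  continuous and supplies point values of the image.\<close>

lemma closed_operator_uniform:
  assumes p: "1 \<le> p" and lin: "Lp_linear_operator M p D L" and cl: "closed_operator M p D L"
    and F: "\<And>n. F n \<in> D" and f: "f \<in> Lp_space M p" "\<And>n. AE x in M. F n x = F' n x" "uniform_limit UNIV F' f sequentially"
    and G: "\<And>n. continuous_on UNIV (G n)" "\<And>n. AE x in M. L (F n) x = G n x" "uniform_limit UNIV G g sequentially"
  shows "f \<in> D" "AE x in M. L f x = g x" "continuous_on UNIV g"
proof -
  have FL: "F n \<in> Lp_space M p" "L (F n) \<in> Lp_space M p" for n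
    using lin F unfolding Lp_linear_operator_def by blast+
  show gc: "continuous_on UNIV g"
    by (rule uniform_limit_theorem[OF _ G(3)]) (auto intro: always_eventually G(1))
  have gL: "g \<in> Lp_space M p" by (rule continuous_Lp[OF p gc])
  have "(\<lambda>n. Lp_norm M p (\<lambda>x. F n x - f x)) \<longlonglongrightarrow> 0"
    by (rule Lp_norm_uniform_tendsto[OF p _ _ f(2,3)]) (use FL f Lp_measurable in blast)+
  moreover have "(\<lambda>n. Lp_norm M p (\<lambda>x. L (F n) x - g x)) \<longlonglongrightarrow> 0"
    by (rule Lp_norm_uniform_tendsto[OF p _ _ G(2,3)]) (use FL gL Lp_measurable in blast)+
  ultimately show "f \<in> D" "AE x in M. L f x = g x"
    using cl F f(1) gL unfolding closed_operator_def by blast+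
qed

text \<open>Linearity is assumed for combinations of two functions, up to a null set each; finitely
  many null sets are still null. The empty sum rests on L 0 = 0, from the combination with both
  coefficients 0.\<close>

lemma operator_sum:
  assumes lin: "Lp_linear_operator M p D L" and fin: "finite I" and f: "\<And>i. i \<in> I \<Longrightarrow> f i \<in> D"
  shows "(\<lambda>x. \<Sum>i\<in>I. a i * f i x) \<in> D \<and> (AE x in M. L (\<lambda>x. \<Sum>i\<in>I. a i * f i x) x = (\<Sum>i\<in>I. a i * L (f i) x))"
proof -
  have l: "\<forall>f\<in>D. \<forall>g\<in>D. \<forall>a c. (\<lambda>x. a * f x + c * g x) \<in> D \<and>
        (AE x in M. L (\<lambda>x. a * f x + c * g x) x = a * L f x + c * L g x)"
    using lin unfolding Lp_linear_operator_def by (elim conjE)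
  show ?thesis
  using fin f
proof (induction I)
  case empty
  have 0: "(\<lambda>x. 0) \<in> D" using lin unfolding Lp_linear_operator_def by blast
  from l[rule_format, OF 0 0, of 0 0] show ?case using 0 by simp
next
  case (insert i I)
  then have f: "f i \<in> D" and IH: "(\<lambda>x. \<Sum>i\<in>I. a i * f i x) \<in> D" "AE x in M. L (\<lambda>x. \<Sum>i\<in>I. a i * f i x) x = (\<Sum>i\<in>I. a i * L (f i) x)"
    by auto
  note l = l[rule_format, OF f IH(1), of "a i" 1]
  have eq: "(\<lambda>x. \<Sum>i\<in>insert i I. a i * f i x) = (\<lambda>x. a i * f i x + 1 * (\<Sum>i\<in>I. a i * f i x))"
    using insert by simp
  have "AE x in M. L (\<lambda>x. \<Sum>i\<in>insert i I. a i * f i x) x = (\<Sum>i\<in>insert i I. a i * L (f i) x)"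
    using l[THEN conjunct2] IH(2) unfolding eq by eventually_elim (use insert in simp)
  then show ?case using l unfolding eq by simp
qed
qed

section \<open>Finite nets, dense sequences and finitely valued maps\<close>

lemma finite_net: "0 < e \<Longrightarrow> \<exists>k. finite k \<and> (UNIV :: 'a set) \<subseteq> (\<Union>x\<in>k. ball x e)"
proof -
  assume "0 < e"
  then have "(UNIV :: 'a set) \<subseteq> (\<Union>x\<in>UNIV. ball x e)" by auto
  then show ?thesis
    using compactE_image[OF compact_space, of UNIV "\<lambda>x. ball x e"] by (metis open_ball)
qed

lemma dense_sequence: "\<exists>d :: nat \<Rightarrow> 'a. \<forall>x e. 0 < e \<longrightarrow> (\<exists>i. dist (d i) x < e)"
proof -
  have "\<exists>k. finite k \<and> (UNIV :: 'a set) \<subseteq> (\<Union>x\<in>k. ball x (1 / (real n + 1)))" for n :: nat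
    by (rule finite_net) simp
  then obtain k where k: "\<And>n :: nat. finite (k n)" "\<And>n. (UNIV :: 'a set) \<subseteq> (\<Union>x\<in>k n. ball x (1 / (real n + 1)))" by metis
  define D where "D = (\<Union>n. k n)"
  have D: "countable D" unfolding D_def using k(1) by (intro countable_UN) (auto intro: countable_finite)
  have dn: "\<exists>z\<in>D. dist z x < e" if e: "0 < e" for x :: 'a and e
  proof -
    obtain n where "1 / real (Suc n) < e" using nat_approx_posE[OF e] by blast
    then have n: "1 / (real n + 1) < e" by (simp add: add.commute)
    obtain z where "z \<in> k n" "x \<in> ball z (1 / (real n + 1))" using k(2)[of n] by blast
    then show ?thesis using n unfolding D_def by (intro bexI[of _ z]) auto
  qed
  then have "D \<noteq> {}" using dn[OF zero_less_one] by blast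
  then have "range (from_nat_into D) = D" using D by (rule range_from_nat_into)
  then have "\<exists>i. dist (from_nat_into D i) x < e" if "0 < e" for x e using dn[OF that, of x] by (metis rangeE)
  then show ?thesis by blast
qed

text \<open>A net of balls is made disjoint by sending each point to the first ball that contains
  it. Every ball that meets Z gets its representative in Z; thus points of Z are approximated within
  Z, the set on which continuity will be available.\<close>

lemma simple_approximation:
  assumes "0 < \<delta>"
  shows "\<exists>s :: 'a \<Rightarrow> 'a. finite (range s) \<and> (\<forall>z. s -` {z} \<in> sets M) \<and> (\<forall>y. dist (s y) y < \<delta> \<and> (y \<in> Z \<longrightarrow> s y \<in> Z))"
proof -
  obtain k where k: "finite k" "(UNIV :: 'a set) \<subseteq> (\<Union>x\<in>k. ball x (\<delta> / 2))"
    using finite_net[of "\<delta> / 2"] assms by auto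
  obtain xs where xs: "set xs = k" using finite_list[OF k(1)] by blast
  define P where "P = (\<lambda>i y. i < length xs \<and> y \<in> ball (xs ! i) (\<delta> / 2))"
  define idx where "idx = (\<lambda>y. LEAST i. P i y)"
  have idx: "P (idx y) y" for y
  proof -
    obtain x where "x \<in> set xs" "y \<in> ball x (\<delta> / 2)" using k(2) xs by blast
    then have "\<exists>i. P i y" unfolding P_def by (metis in_set_conv_nth)
    then show ?thesis unfolding idx_def by (rule LeastI_ex)
  qed
  define w where "w = (\<lambda>i. if \<exists>z\<in>Z. z \<in> ball (xs ! i) (\<delta> / 2) then SOME z. z \<in> Z \<and> z \<in> ball (xs ! i) (\<delta> / 2) else xs ! i)"
  have w: "dist (xs ! i) (w i) < \<delta> / 2 \<and> ((\<exists>z\<in>Z. z \<in> ball (xs ! i) (\<delta> / 2)) \<longrightarrow> w i \<in> Z)" for i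
    using someI_ex[of "\<lambda>z. z \<in> Z \<and> z \<in> ball (xs ! i) (\<delta> / 2)"] assms unfolding w_def by auto
  have idxm: "{y. idx y = i} \<in> sets M" for i
  proof -
    have Pm: "{y. P j y} \<in> sets M" for j
    proof (cases "j < length xs")
      case True
      then have "{y. P j y} = ball (xs ! j) (\<delta> / 2)" by (auto simp: P_def)
      then show ?thesis by simp
    qed (simp add: P_def)
    have "{y. idx y = i} = {y. P i y} - (\<Union>j<i. {y. P j y})"
    proof (intro equalityI subsetI)
      fix y assume "y \<in> {y. idx y = i}"
      then show "y \<in> {y. P i y} - (\<Union>j<i. {y. P j y})"
        using idx[of y] not_less_Least[of _ "\<lambda>i. P i y"] unfolding idx_def by blast
    next
      fix y assume "y \<in> {y. P i y} - (\<Union>j<i. {y. P j y})"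
      then have "P i y" "\<And>j. P j y \<Longrightarrow> i \<le> j" by (auto simp: not_less[symmetric])
      then show "y \<in> {y. idx y = i}" unfolding idx_def by (simp add: Least_equality)
    qed
    then show ?thesis using Pm by auto
  qed
  show ?thesis
  proof (intro exI[of _ "\<lambda>y. w (idx y)"] conjI allI impI)
    have "range (\<lambda>y. w (idx y)) \<subseteq> w ` {..<length xs}" using idx by (auto simp: P_def)
    then show "finite (range (\<lambda>y. w (idx y)))" by (rule finite_subset) simp
    fix z
    have "(\<lambda>y. w (idx y)) -` {z} = (\<Union>i\<in>{i. i < length xs \<and> w i = z}. {y. idx y = i})" using idx by (auto simp: P_def)
    then show "(\<lambda>y. w (idx y)) -` {z} \<in> sets M" using idxm by auto
  next
    fix y
    have "dist (xs ! idx y) y < \<delta> / 2" using idx[of y] by (simp add: P_def)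
    then show "dist (w (idx y)) y < \<delta>" using w[of "idx y"] dist_triangle3[of "w (idx y)" y "xs ! idx y"] by linarith
    assume "y \<in> Z"
    then show "w (idx y) \<in> Z" using w[of "idx y"] idx[of y] unfolding P_def by blast
  qed
qed

text \<open>With a finitely valued map inside, the integral over y is a finite sum, through which a
  linear operator in the other variable can be moved.\<close>

lemma integral_simple_compose:
  fixes f :: "'a \<Rightarrow> real"
  assumes s: "finite (range s)" "\<And>z. s -` {z} \<in> sets M" and h: "integrable M h"
  shows "integrable M (\<lambda>y. f (s y) * h y)"
    and "(\<integral>y. f (s y) * h y \<partial>M) = (\<Sum>z\<in>range s. f z * (\<integral>y. indicator (s -` {z}) y * h y \<partial>M))"
proof -
  have eq: "f (s y) * h y = (\<Sum>z\<in>range s. f z * (indicator (s -` {z}) y * h y))" for y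
  proof -
    have "(\<Sum>z\<in>range s. f z * (indicator (s -` {z}) y * h y)) = (\<Sum>z\<in>range s. if z = s y then f (s y) * h y else 0)"
      by (intro sum.cong) (auto simp: indicator_def)
    then show ?thesis using s(1) by simp
  qed
  have i: "integrable M (\<lambda>y. indicator (s -` {z}) y * h y)" for z
    using integrable_mult_indicator[OF s(2) h, of z] by simp
  show "integrable M (\<lambda>y. f (s y) * h y)"
    unfolding eq by (intro Bochner_Integration.integrable_sum integrable_mult_right i)
  show "(\<integral>y. f (s y) * h y \<partial>M) = (\<Sum>z\<in>range s. f z * (\<integral>y. indicator (s -` {z}) y * h y \<partial>M))"
    unfolding eq by (subst Bochner_Integration.integral_sum) (auto intro!: integrable_mult_right i)
qed

lemma K_uniformly_continuous:
  assumes t: "0 < t" and e: "0 < e"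
  shows "\<exists>\<delta>>0. \<forall>x y y'. dist y y' < \<delta> \<longrightarrow> \<bar>K t x y - K t x y'\<bar> < e"
proof -
  have "uniformly_continuous_on (UNIV \<times> UNIV) (\<lambda>z. K t (fst z) (snd z))"
    using K_continuous[OF t] compact_Times[OF compact_space compact_space]
    by (intro compact_uniformly_continuous) (auto simp: case_prod_beta)
  then have "\<forall>e>0. \<exists>\<delta>>0. \<forall>z z'. dist z' z < \<delta> \<longrightarrow> dist (K t (fst z') (snd z')) (K t (fst z) (snd z)) < e"
    unfolding uniformly_continuous_on_def by (simp only: UNIV_Times_UNIV ball_UNIV)
  then obtain \<delta> where \<delta>: "0 < \<delta>" "\<And>z z'. dist z' z < \<delta> \<Longrightarrow> dist (K t (fst z') (snd z')) (K t (fst z) (snd z)) < e"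
    using e by blast
  have "\<bar>K t x y - K t x y'\<bar> < e" if "dist y y' < \<delta>" for x y y'
    using \<delta>(2)[of "(x, y)" "(x, y')"] \<delta>(2)[of "(x, y')" "(x, y)"] that by (simp add: dist_Pair_Pair dist_real_def)
  then show ?thesis using \<delta>(1) by blast
qed

end

text \<open>
  No regularity of \<open>L K\<^sub>t(\<cdot>, y)\<close>, not even measurability, is assumed in the variable \<open>y\<close>. It follows from
  the closedness of \<open>L\<close>: by outer regularity, outside of a set of small measure the functions
  \<open>L K\<^sub>t(\<cdot>, y)\<close> have a common modulus of continuity, so that they depend continuously on \<open>y\<close> by the
  Arzela-Ascoli theorem.
\<close>

locale operator_on_kernel = data_defined_space M lam \<phi> q
  for M :: "'a::metric_space measure" and lam \<phi> q +
  fixes p :: ereal and D :: "('a \<Rightarrow> real) set" and L :: "('a \<Rightarrow> real) \<Rightarrow> 'a \<Rightarrow> real"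
    and t :: real and \<Lambda> :: "'a \<Rightarrow> 'a \<Rightarrow> real" and b :: "'a \<Rightarrow> 'a \<Rightarrow> real" and B :: real
  assumes p: "1 \<le> p" and lin: "Lp_linear_operator M p D L" and cl: "closed_operator M p D L"
    and t: "0 < t" and KD: "\<And>y. (\<lambda>x. K t x y) \<in> D"
    and \<Lambda>c: "\<And>y. continuous_on UNIV (\<Lambda> y)" and \<Lambda>L: "\<And>y. AE x in M. L (\<lambda>x. K t x y) x = \<Lambda> y x"
    and \<Lambda>b: "\<And>x y. \<bar>\<Lambda> y x\<bar> \<le> b x y" and bc: "\<And>x. continuous_on UNIV (b x)" and bB: "\<And>x y. b x y \<le> B"
begin

lemma \<Lambda>B: "\<bar>\<Lambda> y x\<bar> \<le> B"
  using \<Lambda>b bB order_trans by blast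

lemma B_nonneg: "0 \<le> B"
  using \<Lambda>B order_trans[OF abs_ge_zero] by blast

text \<open>Points y whose function oscillates by at most 1 / (j + 1) over distances below 1 / (n +
  1). For fixed j these sets, whose measurability is unknown, increase to the whole space with
  n.\<close>

definition equi :: "nat \<Rightarrow> nat \<Rightarrow> 'a set" where
  "equi j n = {y. \<forall>x x'. dist x x' < 1 / real (Suc n) \<longrightarrow> \<bar>\<Lambda> y x - \<Lambda> y x'\<bar> \<le> 1 / real (Suc j)}"

lemma equi_mono: "n \<le> m \<Longrightarrow> equi j n \<subseteq> equi j m"
proof
  fix y assume "n \<le> m" and y: "y \<in> equi j n"
  then have "1 / real (Suc m) \<le> 1 / real (Suc n)" by (intro divide_left_mono) auto
  then show "y \<in> equi j m" using y unfolding equi_def by fastforce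
qed

lemma equi_exhaust: "(\<Union>n. equi j n) = UNIV"
proof -
  have "\<exists>n. y \<in> equi j n" for y
  proof -
    have "uniformly_continuous_on UNIV (\<Lambda> y)" using \<Lambda>c compact_space by (intro compact_uniformly_continuous)
    then obtain d where d: "0 < d" "\<And>x x'. dist x' x < d \<Longrightarrow> dist (\<Lambda> y x') (\<Lambda> y x) < 1 / real (Suc j)"
      unfolding uniformly_continuous_on_def by (metis UNIV_I of_nat_0_less_iff zero_less_Suc zero_less_divide_1_iff)
    obtain n where n: "1 / real (Suc n) < d" using nat_approx_posE[OF d(1)] by blast
    have "y \<in> equi j n" unfolding equi_def
    proof (intro CollectI allI impI)
      fix x x' :: 'a assume "dist x x' < 1 / real (Suc n)"
      then have "dist x x' < d" using n by linarith
      from d(2)[OF this] show "\<bar>\<Lambda> y x - \<Lambda> y x'\<bar> \<le> 1 / real (Suc j)" by (simp add: dist_real_def)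
    qed
    then show ?thesis by blast
  qed
  then show ?thesis by blast
qed

text \<open>Arzela-Ascoli: along a subsequence the values at a dense sequence converge, by
  compactness of a product of intervals, and the common moduli make the convergence uniform. The
  heat kernels at \<open>ys m\<close> converge uniformly to the one at y, so closedness of L
  identifies the limit with \<open>\<Lambda> y\<close>.\<close>

lemma subsequence_limit:
  assumes ys: "ys \<longlonglongrightarrow> y" and eq: "\<And>j. \<forall>\<^sub>F m in sequentially. ys m \<in> equi j (N j)"
  shows "\<exists>r :: nat \<Rightarrow> nat. strict_mono r \<and> uniform_limit UNIV (\<lambda>m. \<Lambda> (ys (r m))) (\<Lambda> y) sequentially"
proof -
  obtain d :: "nat \<Rightarrow> 'a" where d: "\<And>x e. 0 < e \<Longrightarrow> \<exists>i. dist (d i) x < e" using dense_sequence by blast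
  define v where "v = (\<lambda>m i. \<Lambda> (ys m) (d i))"
  have "compactin (product_topology (\<lambda>i::nat. euclidean) UNIV) (PiE UNIV (\<lambda>i. {-B..B}))"
    by (subst compactin_PiE) auto
  then have "compact (PiE (UNIV :: nat set) (\<lambda>i. {-B..B}))"
    by (simp add: euclidean_product_topology)
  then have "seq_compact (PiE (UNIV :: nat set) (\<lambda>i. {-B..B}))" by (simp add: compact_eq_seq_compact_metric)
  moreover have "v m \<in> PiE UNIV (\<lambda>i. {-B..B})" for m
    using \<Lambda>B by (auto simp: v_def abs_le_iff PiE_UNIV_domain) (metis abs_le_iff minus_le_iff)
  ultimately obtain l r where r: "strict_mono r" "(v \<circ> r) \<longlonglongrightarrow> l" unfolding seq_compact_def by metis
  have conv: "(\<lambda>m. \<Lambda> (ys (r m)) (d i)) \<longlonglongrightarrow> l i" for i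
    using continuous_on_tendsto_compose[OF continuous_on_product_coordinates[of i] r(2)] by (simp add: v_def o_def)
  have "uniformly_Cauchy_on UNIV (\<lambda>m. \<Lambda> (ys (r m)))"
    unfolding uniformly_Cauchy_on_def
  proof (intro allI impI)
    fix e :: real assume e: "0 < e"
    obtain j where j: "1 / real (Suc j) < e / 4" using nat_approx_posE[of "e/4"] e by auto
    define \<delta> where "\<delta> = 1 / real (Suc (N j))"
    have \<delta>: "0 < \<delta>" by (simp add: \<delta>_def)
    have "(UNIV :: 'a set) \<subseteq> (\<Union>i. ball (d i) \<delta>)" using d[OF \<delta>] by auto
    then obtain I where I: "finite I" "(UNIV :: 'a set) \<subseteq> (\<Union>i\<in>I. ball (d i) \<delta>)"
      using compactE_image[OF compact_space, of UNIV "\<lambda>i. ball (d i) \<delta>"] by auto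
    have "\<forall>\<^sub>F m in sequentially. ys (r m) \<in> equi j (N j)"
      using eventually_subseq[OF r(1) eq[of j]] .
    moreover have "\<forall>\<^sub>F m in sequentially. \<forall>i\<in>I. dist (\<Lambda> (ys (r m)) (d i)) (l i) < e / 8"
      using I(1) e conv by (intro eventually_ball_finite ballI tendstoD) auto
    ultimately have "\<forall>\<^sub>F m in sequentially. ys (r m) \<in> equi j (N j) \<and> (\<forall>i\<in>I. dist (\<Lambda> (ys (r m)) (d i)) (l i) < e / 8)"
      by eventually_elim auto
    then obtain m0 where m0: "\<And>m. m0 \<le> m \<Longrightarrow> ys (r m) \<in> equi j (N j)"
      "\<And>m i. m0 \<le> m \<Longrightarrow> i \<in> I \<Longrightarrow> dist (\<Lambda> (ys (r m)) (d i)) (l i) < e / 8"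
      unfolding eventually_sequentially by blast
    have "dist (\<Lambda> (ys (r m)) x) (\<Lambda> (ys (r n)) x) < e" if mn: "m0 \<le> m" "m0 \<le> n" for m n and x :: 'a
    proof -
      have "x \<in> (\<Union>i\<in>I. ball (d i) \<delta>)" using I(2) by blast
      then obtain i where i: "i \<in> I" "dist (d i) x < \<delta>" by auto
      have "\<bar>\<Lambda> (ys (r k)) (d i) - \<Lambda> (ys (r k)) x\<bar> \<le> 1 / real (Suc j)" if "m0 \<le> k" for k
        using m0(1)[OF that] i(2) unfolding equi_def \<delta>_def by blast
      from this[OF mn(1)] this[OF mn(2)] m0(2)[OF mn(1) i(1)] m0(2)[OF mn(2) i(1)] j show ?thesis
        unfolding dist_real_def by linarith
    qed
    then show "\<exists>m0. \<forall>x\<in>UNIV. \<forall>m\<ge>m0. \<forall>n\<ge>m0. dist (\<Lambda> (ys (r m)) x) (\<Lambda> (ys (r n)) x) < e" by blast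
  qed
  then obtain g where g: "uniform_limit UNIV (\<lambda>m. \<Lambda> (ys (r m))) g sequentially"
    using Cauchy_uniformly_convergent unfolding uniformly_convergent_on_def by blast
  have yr: "(\<lambda>m. ys (r m)) \<longlonglongrightarrow> y" using LIMSEQ_subseq_LIMSEQ[OF ys r(1)] by (simp add: o_def)
  have Klim: "uniform_limit UNIV (\<lambda>m x. K t x (ys (r m))) (\<lambda>x. K t x y) sequentially"
  proof (rule uniform_limitI)
    fix e :: real assume "0 < e"
    then obtain \<delta> where \<delta>: "0 < \<delta>" "\<And>x y y'. dist y y' < \<delta> \<Longrightarrow> \<bar>K t x y - K t x y'\<bar> < e"
      using K_uniformly_continuous[OF t] by blast
    show "\<forall>\<^sub>F m in sequentially. \<forall>x\<in>UNIV. dist (K t x (ys (r m))) (K t x y) < e"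
      using tendstoD[OF yr \<delta>(1)] by eventually_elim (use \<delta>(2) in \<open>auto simp: dist_real_def\<close>)
  qed
  have K_refl: "AE x in M. K t x (ys (r n)) = K t x (ys (r n))" for n by simp
  note cu = closed_operator_uniform[where F = "\<lambda>m x. K t x (ys (r m))" and F' = "\<lambda>m x. K t x (ys (r m))"
      and f = "\<lambda>x. K t x y" and G = "\<lambda>m. \<Lambda> (ys (r m))" and g = g,
      OF p lin cl KD continuous_Lp[OF p K_continuous1[OF t]] K_refl Klim \<Lambda>c \<Lambda>L g]
  have "AE x in M. L (\<lambda>x. K t x y) x = g x" "continuous_on UNIV g" by (rule cu)+
  moreover from this have "AE x in M. \<Lambda> y x = g x" using \<Lambda>L[of y] by (auto elim!: eventually_elim2)
  ultimately have "\<Lambda> y = g" using AE_continuous_eq \<Lambda>c by blast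
  then show ?thesis using r(1) g by blast
qed

text \<open>Outer measure is continuous along increasing sequences of arbitrary sets. So for each
  accuracy j one modulus can be fixed while the outer measure stays above 1 - \<epsilon>. The
  closures of the nested sets are measurable, and the points of their intersection inherit all
  moduli; compactness then gives uniform dependence on y.\<close>

lemma large_continuity_set:
  assumes \<epsilon>: "0 < \<epsilon>" "\<epsilon> \<le> 1"
  shows "\<exists>Z. closed Z \<and> 1 - \<epsilon> \<le> measure M Z \<and>
     (\<forall>e>0. \<exists>\<delta>>0. \<forall>y\<in>Z. \<forall>y'\<in>Z. dist y y' < \<delta> \<longrightarrow> (\<forall>x. \<bar>\<Lambda> y x - \<Lambda> y' x\<bar> \<le> e))"
proof -
  define a where "a = ennreal (1 - \<epsilon>)"
  \<comment> \<open>A strict lower bound on the outer measure of S passes to one of the sets that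
    increase to S; strictness is what keeps the construction going.\<close>
  define pick where "pick = (\<lambda>j S. SOME n. a < outer_measure_of M (S \<inter> equi j n))"
  have pick: "a < outer_measure_of M (S \<inter> equi j (pick j S))" if S: "a < outer_measure_of M S" for S j
  proof -
    have "(SUP n. outer_measure_of M (S \<inter> equi j n)) = outer_measure_of M (\<Union>n. S \<inter> equi j n)"
      using equi_mono by (intro SUP_outer_measure_of_incseq) (auto simp: incseq_def)
    moreover have "(\<Union>n. S \<inter> equi j n) = S" using equi_exhaust[of j] by blast
    ultimately have "a < (SUP n. outer_measure_of M (S \<inter> equi j n))" using S by simp
    then have "\<exists>n. a < outer_measure_of M (S \<inter> equi j n)" by (auto simp: less_SUP_iff)
    then show ?thesis unfolding pick_def by (rule someI_ex)
  qed
  define Bs where "Bs = rec_nat UNIV (\<lambda>j S. S \<inter> equi j (pick j S))"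
  define N where "N = (\<lambda>j. pick j (Bs j))"
  have Bs: "Bs 0 = UNIV" "\<And>j. Bs (Suc j) = Bs j \<inter> equi j (N j)" by (auto simp: Bs_def N_def)
  have Bdec: "Bs m \<subseteq> Bs j" if "j \<le> m" for j m using that by (induction rule: dec_induct) (auto simp: Bs)
  have Beq: "Bs m \<subseteq> equi j (N j)" if "Suc j \<le> m" for j m using Bdec[OF that] Bs(2) by blast
  have om: "a < outer_measure_of M (Bs j)" for j
  proof (induction j)
    case 0
    have "UNIV \<in> sets M" using sets.top[of M] by simp
    then have "outer_measure_of M UNIV = emeasure M UNIV" by (rule outer_measure_of_eq)
    then have "outer_measure_of M UNIV = 1" using emeasure_space_1 by simp
    then show ?case using \<epsilon> by (simp add: Bs a_def)
  next
    case (Suc j)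
    then show ?case unfolding Bs N_def by (rule pick)
  qed
  define Z where "Z = (\<Inter>j. closure (Bs j))"
  have Zc: "closed Z" unfolding Z_def by auto
  have Zm: "1 - \<epsilon> \<le> measure M Z"
  proof -
    have cm: "closure (Bs j) \<in> sets M" for j by (intro borel_sets_M) simp
    have "a \<le> emeasure M (closure (Bs j))" for j
      using om[of j] outer_measure_of_mono[OF closure_subset[of "Bs j"], of M] outer_measure_of_eq[OF cm[of j]] by simp
    then have "a \<le> (INF j. emeasure M (closure (Bs j)))" by (intro INF_greatest) auto
    also have "\<dots> = emeasure M Z" unfolding Z_def
      using cm Bdec by (intro INF_emeasure_decseq) (auto simp: decseq_def intro!: closure_mono subsetD[OF closure_mono[OF Bdec]])
    finally show ?thesis by (simp add: a_def emeasure_eq_measure)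
  qed
  \<comment> \<open>A point of Z is a limit of points chosen in \<open>Bs m\<close>, one for each m.
    Every modulus holds for them from some index on, and passes to the limit function.\<close>
  have Zeq: "y \<in> equi j (N j)" if y: "y \<in> Z" for y j
  proof -
    have "\<exists>z\<in>Bs m. dist z y < 1 / real (Suc m)" for m
    proof -
      have "y \<in> closure (Bs m)" using y unfolding Z_def by blast
      from this[unfolded closure_approachable, rule_format, of "1 / real (Suc m)"] show ?thesis by simp
    qed
    then obtain ys where ys: "\<And>m. ys m \<in> Bs m" "\<And>m. dist (ys m) y < 1 / real (Suc m)" by metis
    have lim: "ys \<longlonglongrightarrow> y"
    proof (rule metric_LIMSEQ_I)
      fix e :: real assume "0 < e"
      then obtain n where n: "1 / real (Suc n) < e" using nat_approx_posE by blast
      have "dist (ys m) y < e" if "n \<le> m" for m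
      proof -
        have "1 / real (Suc m) \<le> 1 / real (Suc n)" using that by (intro divide_left_mono) auto
        then show ?thesis using ys(2)[of m] n by linarith
      qed
      then show "\<exists>n0. \<forall>m\<ge>n0. dist (ys m) y < e" by blast
    qed
    have ev: "\<forall>\<^sub>F m in sequentially. ys m \<in> equi i (N i)" for i
      using eventually_ge_at_top[of "Suc i"] by eventually_elim (use Beq ys(1) in blast)
    obtain r where r: "strict_mono r" "uniform_limit UNIV (\<lambda>m. \<Lambda> (ys (r m))) (\<Lambda> y) sequentially"
      using subsequence_limit[OF lim ev] by blast
    have pt: "(\<lambda>m. \<Lambda> (ys (r m)) x) \<longlonglongrightarrow> \<Lambda> y x" for x :: 'a using tendsto_uniform_limitI[OF r(2), of x] by simp
    show ?thesis unfolding equi_def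
    proof (intro CollectI allI impI)
      fix x x' :: 'a assume x: "dist x x' < 1 / real (Suc (N j))"
      have "(\<lambda>m. \<bar>\<Lambda> (ys (r m)) x - \<Lambda> (ys (r m)) x'\<bar>) \<longlonglongrightarrow> \<bar>\<Lambda> y x - \<Lambda> y x'\<bar>" by (intro tendsto_intros pt)
      moreover have "\<forall>\<^sub>F m in sequentially. \<bar>\<Lambda> (ys (r m)) x - \<Lambda> (ys (r m)) x'\<bar> \<le> 1 / real (Suc j)"
        using eventually_subseq[OF r(1) ev[of j]] by eventually_elim (use x in \<open>auto simp: equi_def\<close>)
      ultimately show "\<bar>\<Lambda> y x - \<Lambda> y x'\<bar> \<le> 1 / real (Suc j)" by (rule tendsto_upperbound) simp
    qed
  qed
  \<comment> \<open>Otherwise two sequences in Z at vanishing distance would stay apart by e in the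
    supremum norm; but along a subsequence they have a common limit y, and both families converge
    uniformly to \<open>\<Lambda> y\<close>.\<close>
  have "\<exists>\<delta>>0. \<forall>y\<in>Z. \<forall>y'\<in>Z. dist y y' < \<delta> \<longrightarrow> (\<forall>x. \<bar>\<Lambda> y x - \<Lambda> y' x\<bar> \<le> e)" if e: "0 < e" for e
  proof (rule ccontr)
    assume "\<not> ?thesis"
    then have neg: "\<exists>y\<in>Z. \<exists>y'\<in>Z. dist y y' < \<delta> \<and> (\<exists>x. \<not> \<bar>\<Lambda> y x - \<Lambda> y' x\<bar> \<le> e)" if "0 < \<delta>" for \<delta> using that by blast
    have "\<exists>y y' x. y \<in> Z \<and> y' \<in> Z \<and> dist y y' < 1 / real (Suc m) \<and> e < \<bar>\<Lambda> y x - \<Lambda> y' x\<bar>" for m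
    proof -
      have "0 < 1 / real (Suc m)" by simp
      from neg[OF this] show ?thesis unfolding not_le by blast
    qed
    then obtain u u' x where u: "\<And>m. u m \<in> Z" "\<And>m. u' m \<in> Z" "\<And>m. dist (u m) (u' m) < 1 / real (Suc m)"
      "\<And>m. e < \<bar>\<Lambda> (u m) (x m) - \<Lambda> (u' m) (x m)\<bar>" by metis
    obtain y r1 where r1: "strict_mono r1" "(u \<circ> r1) \<longlonglongrightarrow> y"
      using compact_space unfolding compact_eq_seq_compact_metric seq_compact_def by blast
    have lim1: "(\<lambda>m. u (r1 m)) \<longlonglongrightarrow> y" using r1(2) by (simp add: o_def)
    obtain r2 where r2: "strict_mono r2" "uniform_limit UNIV (\<lambda>m. \<Lambda> (u (r1 (r2 m)))) (\<Lambda> y) sequentially"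
      using subsequence_limit[OF lim1 always_eventually[OF allI[OF Zeq[OF u(1)]]]] by blast
    have d0: "(\<lambda>m. dist (u (r1 (r2 m))) (u' (r1 (r2 m)))) \<longlonglongrightarrow> 0"
    proof (rule tendsto_sandwich[OF _ _ tendsto_const])
      have "(\<lambda>m. 1 / real (Suc m)) \<longlonglongrightarrow> 0" using LIMSEQ_inverse_real_of_nat by (simp add: inverse_eq_divide)
      from LIMSEQ_subseq_LIMSEQ[OF this strict_mono_o[OF r1(1) r2(1)]]
      show "(\<lambda>m. 1 / real (Suc (r1 (r2 m)))) \<longlonglongrightarrow> 0" by (simp add: o_def)
    qed (use u(3) in \<open>auto intro!: always_eventually less_imp_le\<close>)
    have "(\<lambda>m. u (r1 (r2 m))) \<longlonglongrightarrow> y" using LIMSEQ_subseq_LIMSEQ[OF lim1 r2(1)] by (simp add: o_def)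
    then have "(\<lambda>m. dist (u (r1 (r2 m))) y) \<longlonglongrightarrow> 0" by (rule tendsto_dist_iff[THEN iffD1])
    from tendsto_add[OF d0 this]
    have s0: "(\<lambda>m. dist (u (r1 (r2 m))) (u' (r1 (r2 m))) + dist (u (r1 (r2 m))) y) \<longlonglongrightarrow> 0" by simp
    have "(\<lambda>m. dist (u' (r1 (r2 m))) y) \<longlonglongrightarrow> 0"
      by (rule tendsto_sandwich[OF _ _ tendsto_const s0]) (auto intro!: always_eventually dist_triangle3)
    then have lim2: "(\<lambda>m. u' (r1 (r2 m))) \<longlonglongrightarrow> y" by (rule tendsto_dist_iff[THEN iffD2])
    obtain r3 where r3: "strict_mono r3" "uniform_limit UNIV (\<lambda>m. \<Lambda> (u' (r1 (r2 (r3 m))))) (\<Lambda> y) sequentially"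
      using subsequence_limit[OF lim2 always_eventually[OF allI[OF Zeq[OF u(2)]]]] by blast
    have "\<forall>\<^sub>F m in sequentially. \<forall>x\<in>UNIV. dist (\<Lambda> (u (r1 (r2 (r3 m)))) x) (\<Lambda> y x) < e / 2"
      using eventually_subseq[OF r3(1) uniform_limitD[OF r2(2), of "e/2"]] e by simp
    moreover have "\<forall>\<^sub>F m in sequentially. \<forall>x\<in>UNIV. dist (\<Lambda> (u' (r1 (r2 (r3 m)))) x) (\<Lambda> y x) < e / 2"
      using uniform_limitD[OF r3(2), of "e/2"] e by simp
    ultimately have "\<forall>\<^sub>F m in sequentially. False"
    proof eventually_elim
      case (elim m)
      have "dist (\<Lambda> (u (r1 (r2 (r3 m)))) (x (r1 (r2 (r3 m))))) (\<Lambda> y (x (r1 (r2 (r3 m))))) < e / 2"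
        "dist (\<Lambda> (u' (r1 (r2 (r3 m)))) (x (r1 (r2 (r3 m))))) (\<Lambda> y (x (r1 (r2 (r3 m))))) < e / 2"
        using elim by blast+
      then show ?case using u(4)[of "r1 (r2 (r3 m))"] unfolding dist_real_def by linarith
    qed
    then show False by simp
  qed
  with Zc Zm show ?thesis by blast
qed

text \<open>The integral is a uniform limit of finite sums over finitely valued maps
  \<open>s n\<close>, to which linearity applies. Their images form a uniform Cauchy sequence: on
  the large sets \<open>Z n\<close> the integrands are close, and elsewhere they are bounded on a
  set of small measure. Closedness of L yields the image of the integral, and the majorant passes to
  the limit since \<open>b x\<close> is continuous.\<close>

lemma operator_on_heat_integral:
  assumes h: "continuous_on UNIV h"
  shows "(\<lambda>x. \<integral>y. K t x y * h y \<partial>M) \<in> D \<and>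
    (\<exists>g. continuous_on UNIV g \<and> (AE x in M. L (\<lambda>x. \<integral>y. K t x y * h y \<partial>M) x = g x) \<and>
         (\<forall>x. \<bar>g x\<bar> \<le> (\<integral>y. b x y * \<bar>h y\<bar> \<partial>M)))"
proof -
  obtain H where H: "0 \<le> H" "\<And>y. \<bar>h y\<bar> \<le> H" using continuous_bounded[OF h] by blast
  have ih: "integrable M h" by (rule continuous_integrable[OF h])
  define e where "e = (\<lambda>n. 1 / real (Suc n))"
  have e: "0 < e n" "e n \<le> 1" for n by (auto simp: e_def)
  have e0: "e \<longlonglongrightarrow> 0" unfolding e_def using LIMSEQ_inverse_real_of_nat by (simp add: inverse_eq_divide)
  have "\<exists>Z s. Z \<in> sets M \<and> 1 - e n \<le> measure M Z \<and> finite (range s) \<and> (\<forall>z. s -` {z} \<in> sets M) \<and> (\<forall>y. dist (s y) y < e n) \<and>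
      (\<forall>y\<in>Z. \<forall>x. \<bar>\<Lambda> (s y) x - \<Lambda> y x\<bar> \<le> e n)" for n
  proof -
    obtain Z where Z: "closed Z" "1 - e n \<le> measure M Z"
      and ZZ: "\<And>e. 0 < e \<Longrightarrow> \<exists>\<delta>>0. \<forall>y\<in>Z. \<forall>y'\<in>Z. dist y y' < \<delta> \<longrightarrow> (\<forall>x. \<bar>\<Lambda> y x - \<Lambda> y' x\<bar> \<le> e)"
      using large_continuity_set[OF e] by blast
    from ZZ[OF e(1)[of n]]
    obtain \<delta> where \<delta>: "0 < \<delta>" "\<And>y y' x. y \<in> Z \<Longrightarrow> y' \<in> Z \<Longrightarrow> dist y y' < \<delta> \<Longrightarrow> \<bar>\<Lambda> y x - \<Lambda> y' x\<bar> \<le> e n" by blast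
    have "0 < min \<delta> (e n)" using \<delta>(1) e(1)[of n] by simp
    from simple_approximation[OF this, of Z]
    obtain s where s: "finite (range s)" "\<And>z. s -` {z} \<in> sets M" "\<And>y. dist (s y) y < min \<delta> (e n)" "\<And>y. y \<in> Z \<Longrightarrow> s y \<in> Z" by blast
    have "\<bar>\<Lambda> (s y) x - \<Lambda> y x\<bar> \<le> e n" if "y \<in> Z" for x y
      using \<delta>(2)[OF s(4)[OF that] that] s(3)[of y] by simp
    moreover have "dist (s y) y < e n" for y using s(3)[of y] by simp
    moreover have "Z \<in> sets M" using Z(1) by (intro borel_sets_M) simp
    ultimately show ?thesis using Z(2) s(1,2) by blast
  qed
  then obtain Z s where Zs: "\<And>n. Z n \<in> sets M" "\<And>n. 1 - e n \<le> measure M (Z n)" "\<And>n. finite (range (s n))"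
    "\<And>n z. s n -` {z} \<in> sets M" "\<And>n y. dist (s n y) y < e n" "\<And>n y x. y \<in> Z n \<Longrightarrow> \<bar>\<Lambda> (s n y) x - \<Lambda> y x\<bar> \<le> e n"
    by metis
  define w where "w = (\<lambda>n z. \<integral>y. indicator (s n -` {z}) y * h y \<partial>M)"
  define F where "F = (\<lambda>n x. \<Sum>z\<in>range (s n). w n z * K t x z)"
  define G where "G = (\<lambda>n x. \<Sum>z\<in>range (s n). w n z * \<Lambda> z x)"
  have Feq: "F n x = (\<integral>y. K t x (s n y) * h y \<partial>M)" for n x
    unfolding F_def w_def using integral_simple_compose(2)[OF Zs(3,4) ih, where f = "K t x"] by (simp add: mult.commute)
  have Geq: "G n x = (\<integral>y. \<Lambda> (s n y) x * h y \<partial>M)" for n x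
    unfolding G_def w_def using integral_simple_compose(2)[OF Zs(3,4) ih, where f = "\<lambda>z. \<Lambda> z x"] by (simp add: mult.commute)
  have Gi: "integrable M (\<lambda>y. \<Lambda> (s n y) x * h y)" for n x
    using integral_simple_compose(1)[OF Zs(3,4) ih, where f = "\<lambda>z. \<Lambda> z x"] .
  have FD: "F n \<in> D" and FL: "AE x in M. L (F n) x = G n x" for n
  proof -
    have os: "(\<lambda>x. \<Sum>z\<in>range (s n). w n z * K t x z) \<in> D \<and>
      (AE x in M. L (\<lambda>x. \<Sum>z\<in>range (s n). w n z * K t x z) x = (\<Sum>z\<in>range (s n). w n z * L (\<lambda>x. K t x z) x))"
      by (rule operator_sum[OF lin Zs(3) KD])
    then show "F n \<in> D" unfolding F_def by blast
    have "AE x in M. \<forall>z\<in>range (s n). L (\<lambda>x. K t x z) x = \<Lambda> z x" using Zs(3) \<Lambda>L by (intro AE_finite_allI) auto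
    with os[THEN conjunct2] show "AE x in M. L (F n) x = G n x" unfolding F_def G_def by eventually_elim simp
  qed
  have Gc: "continuous_on UNIV (G n)" for n unfolding G_def by (intro continuous_intros \<Lambda>c)
  have Flim: "uniform_limit UNIV F (\<lambda>x. \<integral>y. K t x y * h y \<partial>M) sequentially"
  proof (rule uniform_limitI)
    fix \<epsilon> :: real assume \<epsilon>: "0 < \<epsilon>"
    then obtain \<delta> where \<delta>: "0 < \<delta>" "\<And>x y y'. dist y y' < \<delta> \<Longrightarrow> \<bar>K t x y - K t x y'\<bar> < \<epsilon> / (H + 1)"
      using K_uniformly_continuous[OF t, of "\<epsilon> / (H + 1)"] H by auto
    have "\<forall>\<^sub>F n in sequentially. e n < \<delta>" using order_tendstoD(2)[OF e0 \<delta>(1)] .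
    then show "\<forall>\<^sub>F n in sequentially. \<forall>x\<in>UNIV. dist (F n x) (\<integral>y. K t x y * h y \<partial>M) < \<epsilon>"
    proof eventually_elim
      case (elim n)
      show ?case
      proof
        fix x
        have i1: "integrable M (\<lambda>y. K t x (s n y) * h y)" by (rule integral_simple_compose(1)[OF Zs(3,4) ih])
        have i2: "integrable M (\<lambda>y. K t x y * h y)" by (rule K_integral_sums(2)[OF t ih])
        have "dist (F n x) (\<integral>y. K t x y * h y \<partial>M) = \<bar>\<integral>y. K t x (s n y) * h y - K t x y * h y \<partial>M\<bar>"
          using i1 i2 by (simp add: dist_real_def Feq)
        also have "\<dots> \<le> (\<integral>y. \<bar>K t x (s n y) * h y - K t x y * h y\<bar> \<partial>M)"
          using integral_norm_bound[of M "\<lambda>y. K t x (s n y) * h y - K t x y * h y"] by simp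
        also have "\<dots> \<le> (\<integral>y. \<epsilon> / (H + 1) * H \<partial>M)"
        proof (rule integral_mono)
          show "\<bar>K t x (s n y) * h y - K t x y * h y\<bar> \<le> \<epsilon> / (H + 1) * H" for y
            unfolding left_diff_distrib[symmetric] abs_mult
            using \<delta>(2)[of "s n y" y x] Zs(5)[of n y] elim H \<epsilon> by (intro mult_mono) (auto intro!: less_imp_le)
        qed (use i1 i2 in auto)
        also have "\<dots> < \<epsilon>" using H \<epsilon> by (simp add: field_simps)
        finally show "dist (F n x) (\<integral>y. K t x y * h y \<partial>M) < \<epsilon>" .
      qed
    qed
  qed
  have Gdiff: "\<bar>G n x - G m x\<bar> \<le> (H * (1 + 2 * B)) * (e n + e m)" for n m x
  proof -
    have pw: "\<bar>\<Lambda> (s n y) x * h y - \<Lambda> (s m y) x * h y\<bar> \<le> H * (e n + e m + 2 * B * (indicator (- Z n) y + indicator (- Z m) y))" for y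
    proof -
      have "\<bar>\<Lambda> (s n y) x - \<Lambda> (s m y) x\<bar> \<le> e n + e m + 2 * B * (indicator (- Z n) y + indicator (- Z m) y)"
      proof (cases "y \<in> Z n \<and> y \<in> Z m")
        case True
        then show ?thesis using Zs(6)[of y n x] Zs(6)[of y m x] by (simp add: indicator_def)
      next
        case False
        then have "1 \<le> (indicator (- Z n) y + indicator (- Z m) y :: real)" by (auto simp: indicator_def)
        then have "2 * B * 1 \<le> 2 * B * (indicator (- Z n) y + indicator (- Z m) y)" using B_nonneg by (intro mult_left_mono) auto
        then show ?thesis using \<Lambda>B[of "s n y" x] \<Lambda>B[of "s m y" x] e[of n] e[of m] by linarith
      qed
      then have "\<bar>\<Lambda> (s n y) x - \<Lambda> (s m y) x\<bar> * \<bar>h y\<bar> \<le> (e n + e m + 2 * B * (indicator (- Z n) y + indicator (- Z m) y)) * H"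
        using H by (intro mult_mono) auto
      then show ?thesis unfolding left_diff_distrib[symmetric] abs_mult by (simp only: mult.commute)
    qed
    have Zc: "- Z k \<in> sets M" for k using sets.compl_sets[OF Zs(1)[of k]] by (simp add: Compl_eq_Diff_UNIV)
    have ii: "integrable M (indicator (- Z k) :: 'a \<Rightarrow> real)" for k
      using Zc[of k] by (intro integrable_real_indicator) (simp_all add: emeasure_eq_measure)
    have iw: "integrable M (\<lambda>y. H * (e n + e m + 2 * B * (indicator (- Z n) y + indicator (- Z m) y)))"
      by (intro integrable_mult_right Bochner_Integration.integrable_add integrable_const ii)
    have mc: "measure M (- Z k) \<le> e k" for k
      using prob_compl[OF Zs(1)[of k]] Zs(2)[of k] by (simp add: Compl_eq_Diff_UNIV)
    have "\<bar>G n x - G m x\<bar> = \<bar>\<integral>y. \<Lambda> (s n y) x * h y - \<Lambda> (s m y) x * h y \<partial>M\<bar>" using Gi by (simp add: Geq)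
    also have "\<dots> \<le> (\<integral>y. \<bar>\<Lambda> (s n y) x * h y - \<Lambda> (s m y) x * h y\<bar> \<partial>M)"
      using integral_norm_bound[of M "\<lambda>y. \<Lambda> (s n y) x * h y - \<Lambda> (s m y) x * h y"] by simp
    also have "\<dots> \<le> (\<integral>y. H * (e n + e m + 2 * B * (indicator (- Z n) y + indicator (- Z m) y)) \<partial>M)"
    proof (rule integral_mono)
      show "integrable M (\<lambda>y. \<bar>\<Lambda> (s n y) x * h y - \<Lambda> (s m y) x * h y\<bar>)"
        by (intro integrable_abs Bochner_Integration.integrable_diff Gi)
    qed (rule iw, rule pw)
    also have "\<dots> = H * (\<integral>y. (e n + e m) + 2 * B * (indicator (- Z n) y + indicator (- Z m) y) \<partial>M)"
      by (rule integral_mult_right_zero)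
    also have "\<dots> = H * ((e n + e m) + 2 * B * (\<integral>y. indicator (- Z n) y + indicator (- Z m) y \<partial>M))"
      by (subst Bochner_Integration.integral_add) (auto intro!: integrable_mult_right Bochner_Integration.integrable_add ii)
    also have "(\<integral>y. indicator (- Z n) y + indicator (- Z m) y \<partial>M) = measure M (- Z n) + measure M (- Z m)"
      by (subst Bochner_Integration.integral_add[OF ii ii]) (use Zc in simp)
    also have "H * ((e n + e m) + 2 * B * (measure M (- Z n) + measure M (- Z m))) \<le> H * (e n + e m + 2 * B * (e n + e m))"
      using H B_nonneg mc[of n] mc[of m] by (intro mult_left_mono add_left_mono add_mono) auto
    finally show ?thesis by (simp add: algebra_simps)
  qed
  have "uniformly_Cauchy_on UNIV G"
    unfolding uniformly_Cauchy_on_def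
  proof (intro allI impI)
    fix \<epsilon> :: real assume \<epsilon>: "0 < \<epsilon>"
    define c where "c = H * (1 + 2 * B)"
    have c: "0 \<le> c" using H B_nonneg by (simp add: c_def)
    have "(\<lambda>n. c * (e n + e n)) \<longlonglongrightarrow> c * (0 + 0)" by (intro tendsto_intros e0)
    then have "\<forall>\<^sub>F n in sequentially. c * (e n + e n) < \<epsilon>" using \<epsilon> by (intro order_tendstoD) auto
    then obtain n0 where n0: "c * (e n0 + e n0) < \<epsilon>" by (auto simp: eventually_sequentially)
    have "dist (G m x) (G n x) < \<epsilon>" if "n0 \<le> m" "n0 \<le> n" for m n x
    proof -
      have "e m \<le> e n0" "e n \<le> e n0" using that unfolding e_def by (auto intro!: divide_left_mono)
      then have "c * (e m + e n) \<le> c * (e n0 + e n0)" using c by (intro mult_left_mono add_mono)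
      then show ?thesis using Gdiff[of m x n] n0 unfolding dist_real_def c_def by linarith
    qed
    then show "\<exists>n0. \<forall>x\<in>UNIV. \<forall>m\<ge>n0. \<forall>n\<ge>n0. dist (G m x) (G n x) < \<epsilon>" by blast
  qed
  then obtain g where g: "uniform_limit UNIV G g sequentially"
    using Cauchy_uniformly_convergent unfolding uniformly_convergent_on_def by blast
  have Kc: "continuous_on UNIV (\<lambda>x. \<integral>y. K t x y * h y \<partial>M)"
  proof (rule uniform_limit_theorem[OF _ Flim])
    show "\<forall>\<^sub>F n in sequentially. continuous_on UNIV (F n)"
      unfolding F_def by (intro always_eventually allI continuous_intros K_continuous1 t)
  qed simp
  have F_refl: "AE x in M. F n x = F n x" for n by simp
  note cu = closed_operator_uniform[where F = F and F' = F and f = "\<lambda>x. \<integral>y. K t x y * h y \<partial>M" and G = G and g = g,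
      OF p lin cl FD continuous_Lp[OF p Kc] F_refl Flim Gc FL g]
  have "(\<lambda>x. \<integral>y. K t x y * h y \<partial>M) \<in> D" "AE x in M. L (\<lambda>x. \<integral>y. K t x y * h y \<partial>M) x = g x" "continuous_on UNIV g"
    by (rule cu)+
  moreover have "\<bar>g x\<bar> \<le> (\<integral>y. b x y * \<bar>h y\<bar> \<partial>M)" for x
  proof (rule tendsto_le[OF trivial_limit_sequentially])
    show "(\<lambda>n. \<bar>G n x\<bar>) \<longlonglongrightarrow> \<bar>g x\<bar>" using tendsto_uniform_limitI[OF g, of x] by (intro tendsto_rabs) simp
    have b0: "0 \<le> b x y" for y using \<Lambda>b order_trans[OF abs_ge_zero] by blast
    have bi: "integrable M (\<lambda>y. b x (s n y) * \<bar>h y\<bar>)" for n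
      by (rule integral_simple_compose(1)[OF Zs(3,4)]) (use ih in simp)
    show "(\<lambda>n. \<integral>y. b x (s n y) * \<bar>h y\<bar> \<partial>M) \<longlonglongrightarrow> (\<integral>y. b x y * \<bar>h y\<bar> \<partial>M)"
    proof (rule integral_dominated_convergence[where w = "\<lambda>y. B * \<bar>h y\<bar>"])
      show "AE y in M. (\<lambda>n. b x (s n y) * \<bar>h y\<bar>) \<longlonglongrightarrow> b x y * \<bar>h y\<bar>"
      proof (intro AE_I2 tendsto_mult_right)
        fix y
        have "(\<lambda>n. dist (s n y) y) \<longlonglongrightarrow> 0"
          by (rule tendsto_sandwich[OF _ _ tendsto_const e0]) (use Zs(5) in \<open>auto intro!: always_eventually less_imp_le\<close>)
        then have "(\<lambda>n. s n y) \<longlonglongrightarrow> y" by (rule tendsto_dist_iff[THEN iffD2])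
        then show "(\<lambda>n. b x (s n y)) \<longlonglongrightarrow> b x y"
          using bc[of x] by (auto intro: isCont_tendsto_compose simp: continuous_on_eq_continuous_at)
      qed
      show "AE y in M. norm (b x (s n y) * \<bar>h y\<bar>) \<le> B * \<bar>h y\<bar>" for n
        using b0 bB by (intro AE_I2) (auto simp: abs_mult intro!: mult_right_mono)
      show "(\<lambda>y. b x (s n y) * \<bar>h y\<bar>) \<in> borel_measurable M" for n using bi by blast
      show "(\<lambda>y. b x y * \<bar>h y\<bar>) \<in> borel_measurable M"
        by (intro continuous_measurable continuous_intros bc h)
    qed (use ih in auto)
    show "\<forall>\<^sub>F n in sequentially. \<bar>G n x\<bar> \<le> (\<integral>y. b x (s n y) * \<bar>h y\<bar> \<partial>M)"
    proof (intro always_eventually allI)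
      fix n
      have "\<bar>G n x\<bar> \<le> (\<integral>y. \<bar>\<Lambda> (s n y) x * h y\<bar> \<partial>M)"
        unfolding Geq using integral_norm_bound[of M "\<lambda>y. \<Lambda> (s n y) x * h y"] by simp
      also have "\<dots> \<le> (\<integral>y. b x (s n y) * \<bar>h y\<bar> \<partial>M)"
      proof (rule integral_mono)
        show "integrable M (\<lambda>y. \<bar>\<Lambda> (s n y) x * h y\<bar>)" by (intro integrable_abs Gi)
        show "\<bar>\<Lambda> (s n y) x * h y\<bar> \<le> b x (s n y) * \<bar>h y\<bar>" for y using \<Lambda>b by (simp add: abs_mult mult_right_mono)
      qed (rule bi)
      finally show "\<bar>G n x\<bar> \<le> (\<integral>y. b x (s n y) * \<bar>h y\<bar> \<partial>M)" .
    qed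
  qed
  ultimately show ?thesis by blast
qed

end

section \<open>Approximation in Sobolev classes\<close>

text \<open>What the interpolation argument uses, separated from its verification. With s = (lam
  k)^2 t, the multiplier \<open>W t\<close> is the product of the mask b(lam k), the dyadic window
  H(s) - H(4 s) and exp s, which undoes a heat kernel at time t. Its norm t^(\<beta>/2) is the size
  of a mask of type \<beta> at frequencies of order t^(-1/2). The number \<open>\<delta>\<close> is
  the room left by the condition on \<beta>.\<close>

locale sobolev_setup = data_defined_space M lam \<phi> q
  for M :: "'a::metric_space measure" and lam \<phi> q +
  fixes R :: nat and p :: ereal and \<beta> \<delta> CH CW :: real and b H :: "real \<Rightarrow> real" and W :: "real \<Rightarrow> real \<Rightarrow> real"
    and D :: "nat \<Rightarrow> ('a \<Rightarrow> real) set" and L :: "nat \<Rightarrow> ('a \<Rightarrow> real) \<Rightarrow> 'a \<Rightarrow> real" and ord cL c1L :: "nat \<Rightarrow> real"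
  assumes p: "1 \<le> p" and R: "1 \<le> R"
    and b_pos: "\<And>k. 0 < b (lam k)"
    and \<delta>: "0 < \<delta>" and ord: "\<And>k. k \<in> {1..R} \<Longrightarrow> 0 \<le> ord k \<and> ord k + q * recip p + \<delta> \<le> \<beta>"
    and H1: "\<And>s. 0 \<le> s \<Longrightarrow> s \<le> 1/4 \<Longrightarrow> H s = 1" and H0: "\<And>s. 1/2 \<le> s \<Longrightarrow> H s = 0"
    and CH: "0 < CH" "\<And>t h. 0 < t \<Longrightarrow> t \<le> 1 \<Longrightarrow> h \<in> Lp_space M p \<Longrightarrow> Lp_norm M p (multiplier H t h) \<le> CH * Lp_norm M p h"
    and W: "\<And>t s. 0 < t \<Longrightarrow> t \<le> 1 \<Longrightarrow> 0 \<le> s \<Longrightarrow> s < 1/2 \<Longrightarrow> W t s = exp s * (H s - H (4 * s)) * b (sqrt (s / t))"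
    and CW: "0 < CW" "\<And>t h. 0 < t \<Longrightarrow> t \<le> 1 \<Longrightarrow> h \<in> Lp_space M p \<Longrightarrow> Lp_norm M p (multiplier (W t) t h) \<le> CW * t powr (\<beta> / 2) * Lp_norm M p h"
    and lin: "\<And>k. k \<in> {1..R} \<Longrightarrow> Lp_linear_operator M p (D k) (L k)"
    and cl: "\<And>k. k \<in> {1..R} \<Longrightarrow> closed_operator M p (D k) (L k)"
    and cL: "\<And>k. k \<in> {1..R} \<Longrightarrow> 0 < cL k \<and> 0 < c1L k"
    and op: "\<And>k t h. k \<in> {1..R} \<Longrightarrow> 0 < t \<Longrightarrow> t \<le> 1 \<Longrightarrow> continuous_on UNIV h \<Longrightarrow>
       (\<lambda>x. \<integral>y. K t x y * h y \<partial>M) \<in> D k \<and>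
       (\<exists>g. continuous_on UNIV g \<and> (AE x in M. L k (\<lambda>x. \<integral>y. K t x y * h y \<partial>M) x = g x) \<and>
         (\<forall>x. \<bar>g x\<bar> \<le> (\<integral>y. cL k * t powr (- (q + ord k) / 2) * exp (- c1L k * (dist x y)\<^sup>2 / t) * \<bar>h y\<bar> \<partial>M)))"
begin

section \<open>Point values of the operators on classes\<close>

abbreviation "W_space \<equiv> sobolev_space M lam \<phi> p b"
abbreviation "coef \<equiv> fourier_coeff M \<phi>"

definition regular :: "nat \<Rightarrow> ('a \<Rightarrow> real) \<Rightarrow> bool" where
  "regular k f \<longleftrightarrow> f \<in> D k \<and> (\<exists>g. continuous_on UNIV g \<and> (AE x in M. L k f x = g x))"

text \<open>The continuous representative of L_k f, so that \<open>ev k f y\<close> is the value at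
  y in the interpolation conditions. As the representative is unique, the choice is harmless and
  depends linearly on f for \<open>regular\<close> functions.\<close>

definition ev :: "nat \<Rightarrow> ('a \<Rightarrow> real) \<Rightarrow> 'a \<Rightarrow> real" where
  "ev k f = (SOME g. continuous_on UNIV g \<and> (AE x in M. L k f x = g x))"

lemma ev_eqI: "continuous_on UNIV g \<Longrightarrow> AE x in M. L k f x = g x \<Longrightarrow> ev k f = g"
proof -
  assume g: "continuous_on UNIV g" "AE x in M. L k f x = g x"
  then have "\<exists>g. continuous_on UNIV g \<and> (AE x in M. L k f x = g x)" by blast
  from someI_ex[OF this] have "continuous_on UNIV (ev k f) \<and> (AE x in M. L k f x = ev k f x)" unfolding ev_def[symmetric] .
  moreover from this g have "AE x in M. ev k f x = g x" by (auto elim!: eventually_elim2)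
  ultimately show ?thesis using AE_continuous_eq g(1) by blast
qed

lemma regular_ev: "regular k f \<Longrightarrow> continuous_on UNIV (ev k f) \<and> (AE x in M. L k f x = ev k f x)"
  unfolding regular_def using ev_eqI by blast

lemma regular_has_value: "regular k f \<Longrightarrow> has_value_at M (L k f) y (ev k f y)"
  unfolding has_value_at_def using regular_ev by blast

lemma has_value_ev: "has_value_at M (L k f) y v \<Longrightarrow> ev k f y = v"
  unfolding has_value_at_def using ev_eqI by blast

lemma regular_combination:
  assumes k: "k \<in> {1..R}" and f: "regular k f" and g: "regular k g"
  shows "regular k (\<lambda>x. a * f x + c * g x) \<and> ev k (\<lambda>x. a * f x + c * g x) = (\<lambda>x. a * ev k f x + c * ev k g x)"
proof -
  have l: "\<forall>f\<in>D k. \<forall>g\<in>D k. \<forall>a c. (\<lambda>x. a * f x + c * g x) \<in> D k \<and>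
        (AE x in M. L k (\<lambda>x. a * f x + c * g x) x = a * L k f x + c * L k g x)"
    using lin[OF k] unfolding Lp_linear_operator_def by (elim conjE)
  have fD: "f \<in> D k" "g \<in> D k" using f g unfolding regular_def by auto
  note l = l[rule_format, OF fD, of a c]
  have c: "continuous_on UNIV (\<lambda>x. a * ev k f x + c * ev k g x)" using regular_ev[OF f] regular_ev[OF g] by (intro continuous_intros) auto
  have "AE x in M. L k (\<lambda>x. a * f x + c * g x) x = a * ev k f x + c * ev k g x"
    using l[THEN conjunct2] regular_ev[OF f, THEN conjunct2] regular_ev[OF g, THEN conjunct2] by eventually_elim simp
  then show ?thesis using l c ev_eqI[OF c] unfolding regular_def by blast
qed

lemma regular_diff:
  "k \<in> {1..R} \<Longrightarrow> regular k f \<Longrightarrow> regular k g \<Longrightarrow> regular k (\<lambda>x. f x - g x) \<and> ev k (\<lambda>x. f x - g x) = (\<lambda>x. ev k f x - ev k g x)"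
  using regular_combination[of k f g 1 "-1"] by simp

lemma regular_sum:
  assumes k: "k \<in> {1..R}" and I: "finite I" and f: "\<And>i. i \<in> I \<Longrightarrow> regular k (f i)"
  shows "regular k (\<lambda>x. \<Sum>i\<in>I. a i * f i x) \<and> ev k (\<lambda>x. \<Sum>i\<in>I. a i * f i x) = (\<lambda>x. \<Sum>i\<in>I. a i * ev k (f i) x)"
proof -
  have fD: "\<And>i. i \<in> I \<Longrightarrow> f i \<in> D k" using f unfolding regular_def by blast
  have os: "(\<lambda>x. \<Sum>i\<in>I. a i * f i x) \<in> D k \<and> (AE x in M. L k (\<lambda>x. \<Sum>i\<in>I. a i * f i x) x = (\<Sum>i\<in>I. a i * L k (f i) x))"
    by (rule operator_sum[OF lin[OF k] I fD])
  have c: "continuous_on UNIV (\<lambda>x. \<Sum>i\<in>I. a i * ev k (f i) x)" using regular_ev[OF f] by (intro continuous_intros) auto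
  have "AE x in M. \<forall>i\<in>I. L k (f i) x = ev k (f i) x" using I regular_ev[OF f] by (intro AE_finite_allI) auto
  with os[THEN conjunct2]
  have "AE x in M. L k (\<lambda>x. \<Sum>i\<in>I. a i * f i x) x = (\<Sum>i\<in>I. a i * ev k (f i) x)" by eventually_elim simp
  then show ?thesis using os[THEN conjunct1] c ev_eqI[OF c] unfolding regular_def by blast
qed

lemma regular_cong_AE:
  assumes k: "k \<in> {1..R}" and f: "regular k f" and g: "g \<in> Lp_space M p" and fg: "AE x in M. f x = g x"
  shows "regular k g \<and> ev k g = ev k f"
proof -
  have "\<forall>f\<in>D k. \<forall>g\<in>Lp_space M p. (AE x in M. f x = g x) \<longrightarrow> g \<in> D k \<and> (AE x in M. L k f x = L k g x)"
    using lin[OF k] unfolding Lp_linear_operator_def by (elim conjE)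
  from this[rule_format, OF _ g fg] f have gD: "g \<in> D k" "AE x in M. L k f x = L k g x" unfolding regular_def by auto
  have "AE x in M. L k g x = ev k f x" using gD(2) regular_ev[OF f, THEN conjunct2] by eventually_elim simp
  then show ?thesis using gD(1) regular_ev[OF f] ev_eqI unfolding regular_def by blast
qed

lemma heat_regular:
  assumes k: "k \<in> {1..R}" and t: "0 < t" "t \<le> 1" and h: "continuous_on UNIV h"
  shows "regular k (\<lambda>x. \<integral>y. K t x y * h y \<partial>M)"
    and "\<bar>ev k (\<lambda>x. \<integral>y. K t x y * h y \<partial>M) x\<bar> \<le> (\<integral>y. cL k * t powr (- (q + ord k) / 2) * exp (- c1L k * (dist x y)\<^sup>2 / t) * \<bar>h y\<bar> \<partial>M)"
proof -
  from op[OF k t h] obtain g where g: "(\<lambda>x. \<integral>y. K t x y * h y \<partial>M) \<in> D k" "continuous_on UNIV g"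
    "AE x in M. L k (\<lambda>x. \<integral>y. K t x y * h y \<partial>M) x = g x"
    "\<And>x. \<bar>g x\<bar> \<le> (\<integral>y. cL k * t powr (- (q + ord k) / 2) * exp (- c1L k * (dist x y)\<^sup>2 / t) * \<bar>h y\<bar> \<partial>M)" by blast
  show "regular k (\<lambda>x. \<integral>y. K t x y * h y \<partial>M)" unfolding regular_def using g by blast
  show "\<bar>ev k (\<lambda>x. \<integral>y. K t x y * h y \<partial>M) x\<bar> \<le> (\<integral>y. cL k * t powr (- (q + ord k) / 2) * exp (- c1L k * (dist x y)\<^sup>2 / t) * \<bar>h y\<bar> \<partial>M)"
    using ev_eqI[OF g(2,3)] g(4) by simp
qed

text \<open>An eigenfunction is the heat integral at time 1 of exp((lam j)^2) times itself, so the
  regularity of heat integrals applies.\<close>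

lemma phi_regular: "k \<in> {1..R} \<Longrightarrow> regular k (\<phi> j)"
proof -
  assume k: "k \<in> {1..R}"
  have "regular k (\<lambda>x. \<integral>y. K 1 x y * (exp ((lam j)\<^sup>2) * \<phi> j y) \<partial>M)"
    by (intro heat_regular k continuous_intros continuous_phi) auto
  moreover have "(\<integral>y. K 1 x y * (exp ((lam j)\<^sup>2) * \<phi> j y) \<partial>M) = \<phi> j x" for x
  proof -
    have "(\<integral>y. K 1 x y * (exp ((lam j)\<^sup>2) * \<phi> j y) \<partial>M) = (\<integral>y. exp ((lam j)\<^sup>2) * (K 1 x y * \<phi> j y) \<partial>M)"
      by (simp only: mult.left_commute)
    also have "\<dots> = exp ((lam j)\<^sup>2) * (decay 1 j * \<phi> j x)" by (subst integral_mult_right_zero) (simp add: K_integral_phi)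
    also have "\<dots> = \<phi> j x" by (simp add: decay_def mult_exp_exp mult.assoc[symmetric])
    finally show ?thesis .
  qed
  ultimately show ?thesis by simp
qed

lemma poly_regular:
  assumes "k \<in> {1..R}" "finite I"
  shows "regular k (\<lambda>x. \<Sum>j\<in>I. a j * \<phi> j x)" "ev k (\<lambda>x. \<Sum>j\<in>I. a j * \<phi> j x) = (\<lambda>x. \<Sum>j\<in>I. a j * ev k (\<phi> j) x)"
proof -
  have "regular k (\<lambda>x. \<Sum>j\<in>I. a j * \<phi> j x) \<and> ev k (\<lambda>x. \<Sum>j\<in>I. a j * \<phi> j x) = (\<lambda>x. \<Sum>j\<in>I. a j * ev k (\<phi> j) x)"
    by (rule regular_sum[OF assms]) (rule phi_regular[OF assms(1)])
  then show "regular k (\<lambda>x. \<Sum>j\<in>I. a j * \<phi> j x)" "ev k (\<lambda>x. \<Sum>j\<in>I. a j * \<phi> j x) = (\<lambda>x. \<Sum>j\<in>I. a j * ev k (\<phi> j) x)" by blast+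
qed

lemma multiplier_regular: "k \<in> {1..R} \<Longrightarrow> 0 < t \<Longrightarrow> regular k (multiplier g t f)"
  unfolding multiplier_def[abs_def] by (rule poly_regular(1)[OF _ finite_low_squares])

lemma multiplier_Lp: "multiplier g t h \<in> Lp_space M p"
  by (rule continuous_Lp[OF p multiplier_continuous])

lemma coef_poly: "finite I \<Longrightarrow> coef (\<lambda>x. \<Sum>j\<in>I. a j * \<phi> j x) k = (if k \<in> I then a k else 0)"
proof -
  assume I: "finite I"
  have "coef (\<lambda>x. \<Sum>j\<in>I. a j * \<phi> j x) k = (\<integral>x. (\<Sum>j\<in>I. a j * (\<phi> j x * \<phi> k x)) \<partial>M)"
    by (simp add: fourier_coeff_def sum_distrib_right mult.assoc)
  also have "\<dots> = (\<Sum>j\<in>I. a j * (\<integral>x. \<phi> j x * \<phi> k x \<partial>M))"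
    by (subst Bochner_Integration.integral_sum) auto
  also have "\<dots> = (\<Sum>j\<in>I. if j = k then a k else 0)" by (intro sum.cong) (auto simp: phi_orthonormal)
  finally show ?thesis using I by simp
qed

lemma coef_multiplier: "0 < t \<Longrightarrow> coef (multiplier g t h) k = (if (lam k)\<^sup>2 * t < 1/2 then g ((lam k)\<^sup>2 * t) * coef h k else 0)"
  unfolding multiplier_def[abs_def] by (simp only: coef_poly[OF finite_low_squares] mem_Collect_eq)

text \<open>The heat integral multiplies the k-th coefficient by exp(-s), which the factor exp s of
  \<open>W t\<close> cancels; the factor b(lam k) turns the coefficient of g into that of f.\<close>

lemma dyadic_piece:
  assumes g: "is_sobolev_deriv M lam \<phi> p b f g" and t: "0 < t" "t \<le> 1"
  shows "(\<lambda>x. multiplier H t f x - multiplier H (4 * t) f x) = (\<lambda>x. \<integral>y. K t x y * multiplier (W t) t g y \<partial>M)"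
proof
  fix x
  let ?A = "{k. (lam k)\<^sup>2 * t < 1/2}"
  have fA: "finite ?A" by (rule finite_low_squares[OF t(1)])
  have cg: "coef f k = b (lam k) * coef g k" for k using g unfolding is_sobolev_deriv_def by simp
  have "multiplier H (4 * t) f x = (\<Sum>k\<in>?A. H ((lam k)\<^sup>2 * (4 * t)) * coef f k * \<phi> k x)"
    unfolding multiplier_def
  \<comment> \<open>The sum at time 4 t runs over fewer frequencies; on the additional ones the
    cutoff at 4 s is 0.\<close>
  proof (rule sum.mono_neutral_left[OF fA])
    show "{k. (lam k)\<^sup>2 * (4 * t) < 1 / 2} \<subseteq> ?A"
    proof
      fix k assume "k \<in> {k. (lam k)\<^sup>2 * (4 * t) < 1 / 2}"
      moreover have "0 \<le> (lam k)\<^sup>2 * t" using t by simp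
      ultimately show "k \<in> ?A" by simp
    qed
    show "\<forall>i\<in>?A - {k. (lam k)\<^sup>2 * (4 * t) < 1 / 2}. H ((lam i)\<^sup>2 * (4 * t)) * coef f i * \<phi> i x = 0"
      using H0 by (auto simp: not_less)
  qed
  then have "multiplier H t f x - multiplier H (4 * t) f x = (\<Sum>k\<in>?A. (H ((lam k)\<^sup>2 * t) - H ((lam k)\<^sup>2 * (4 * t))) * coef f k * \<phi> k x)"
    unfolding multiplier_def by (simp add: sum_subtractf left_diff_distrib)
  also have "\<dots> = (\<Sum>k\<in>?A. (W t ((lam k)\<^sup>2 * t) * coef g k) * (decay t k * \<phi> k x))"
  proof (rule sum.cong[OF refl])
    fix k assume "k \<in> ?A"
    then have "W t ((lam k)\<^sup>2 * t) = exp ((lam k)\<^sup>2 * t) * (H ((lam k)\<^sup>2 * t) - H (4 * ((lam k)\<^sup>2 * t))) * b (sqrt ((lam k)\<^sup>2 * t / t))"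
      using t by (intro W) auto
    moreover have "sqrt ((lam k)\<^sup>2 * t / t) = lam k" using t lam_nonneg by simp
    moreover have "exp ((lam k)\<^sup>2 * t) * decay t k = 1" by (simp add: decay_def mult_exp_exp)
    ultimately show "(H ((lam k)\<^sup>2 * t) - H ((lam k)\<^sup>2 * (4 * t))) * coef f k * \<phi> k x = (W t ((lam k)\<^sup>2 * t) * coef g k) * (decay t k * \<phi> k x)"
      unfolding cg by (simp add: mult_ac)
  qed
  also have "\<dots> = (\<Sum>k\<in>?A. \<integral>y. (W t ((lam k)\<^sup>2 * t) * coef g k) * (K t x y * \<phi> k y) \<partial>M)"
    by (intro sum.cong refl, subst integral_mult_right_zero) (simp add: K_integral_phi[OF t(1)])
  also have "\<dots> = (\<integral>y. (\<Sum>k\<in>?A. (W t ((lam k)\<^sup>2 * t) * coef g k) * (K t x y * \<phi> k y)) \<partial>M)"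
    by (intro Bochner_Integration.integral_sum[symmetric] integrable_mult_right K_integral_sums(2) t phi_integrable)
  also have "\<dots> = (\<integral>y. K t x y * multiplier (W t) t g y \<partial>M)"
    by (intro arg_cong[where f = "integral\<^sup>L M"] ext) (simp add: multiplier_def sum_distrib_left mult_ac)
  finally show "multiplier H t f x - multiplier H (4 * t) f x = (\<integral>y. K t x y * multiplier (W t) t g y \<partial>M)" .
qed

text \<open>The weight has mass of order t^(-r/2) and maximum at most t^(-(q + r)/2). Interpolating
  between the two with exponent 1/p gives the power of t; its part t^(-q/(2p)) is the price of a
  pointwise value for a function in L^p.\<close>

lemma gauss_weight_bound:
  assumes c: "0 < c"
  shows "\<exists>C>0. \<forall>r x t h. 0 \<le> r \<longrightarrow> 0 < t \<longrightarrow> t \<le> 1 \<longrightarrow> continuous_on UNIV h \<longrightarrow>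
     (\<integral>y. t powr (- (q + r) / 2) * exp (- c * (dist x y)\<^sup>2 / t) * \<bar>h y\<bar> \<partial>M) \<le> C * t powr (- (r + q * recip p) / 2) * Lp_norm M p h"
proof -
  obtain C where C: "0 < C" "\<And>x t. 0 < t \<Longrightarrow> (\<integral>\<^sup>+y. ennreal (exp (- c * (dist x y)\<^sup>2 / t)) \<partial>M) \<le> ennreal (C * t powr (q / 2))"
    using gauss_integral[OF c] by blast
  have rp: "0 \<le> recip p" "recip p \<le> 1" using recip_bounds[OF p] by auto
  show ?thesis
  proof (rule exI[of _ "C powr (1 - recip p)"], intro conjI allI impI)
    fix r t :: real and x :: 'a and h :: "'a \<Rightarrow> real"
    assume r: "0 \<le> r" and t: "0 < t" "t \<le> 1" and h: "continuous_on UNIV h"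
    define w where "w = (\<lambda>y. t powr (- (q + r) / 2) * exp (- c * (dist x y)\<^sup>2 / t))"
    have wm[measurable]: "w \<in> borel_measurable M" unfolding w_def by measurable
    have hL: "h \<in> Lp_space M p" by (rule continuous_Lp[OF p h])
    have w0: "0 \<le> w y" "w y \<le> t powr (- (q + r) / 2)" for y
      using c t by (auto simp: w_def intro!: mult_left_le)
    have whi: "integrable M (\<lambda>y. w y * \<bar>h y\<bar>)"
      unfolding w_def using t by (intro continuous_integrable continuous_intros h) auto
    have "(\<integral>y. w y * \<bar>h y\<bar> \<partial>M) \<le> (C * t powr (- r / 2)) powr (1 - recip p) * (t powr (- (q + r) / 2)) powr recip p * Lp_norm M p h"
    proof (rule weighted_integral_le[OF p _ _ wm w0 _ Lp_bounded_norm[OF p hL] Lp_norm_nonneg[OF p hL]])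
      show "0 < C * t powr (- r / 2)" "0 < t powr (- (q + r) / 2)" using C t by auto
      have "(\<integral>\<^sup>+y. ennreal (w y) \<partial>M) = ennreal (t powr (- (q + r) / 2)) * (\<integral>\<^sup>+y. ennreal (exp (- c * (dist x y)\<^sup>2 / t)) \<partial>M)"
        unfolding w_def by (simp add: ennreal_mult nn_integral_cmult)
      also have "\<dots> \<le> ennreal (t powr (- (q + r) / 2)) * ennreal (C * t powr (q / 2))" by (intro mult_left_mono C(2) t) auto
      also have "\<dots> = ennreal (C * t powr (- r / 2))"
        using C t by (simp add: ennreal_mult[symmetric] mult.left_commute powr_add[symmetric] field_simps)
      finally show "(\<integral>\<^sup>+y. ennreal (w y) \<partial>M) \<le> ennreal (C * t powr (- r / 2))" .
      show "0 \<le> (\<integral>y. w y * \<bar>h y\<bar> \<partial>M)" using w0 by (intro integral_nonneg_AE) auto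
      show "ennreal (\<integral>y. w y * \<bar>h y\<bar> \<partial>M) \<le> (\<integral>\<^sup>+y. ennreal (w y * \<bar>h y\<bar>) \<partial>M)"
        using whi w0 by (subst nn_integral_eq_integral) auto
    qed
    also have "(C * t powr (- r / 2)) powr (1 - recip p) * (t powr (- (q + r) / 2)) powr recip p = C powr (1 - recip p) * t powr (- (r + q * recip p) / 2)"
    proof -
      have "(t powr (- r / 2)) powr (1 - recip p) * (t powr (- (q + r) / 2)) powr recip p = t powr (- (r + q * recip p) / 2)"
        unfolding powr_powr powr_add[symmetric] by (rule arg_cong[where f = "\<lambda>z. t powr z"]) (simp add: field_simps)
      then show ?thesis by (simp add: powr_mult mult.assoc)
    qed
    finally show "(\<integral>y. t powr (- (q + r) / 2) * exp (- c * (dist x y)\<^sup>2 / t) * \<bar>h y\<bar> \<partial>M) \<le> C powr (1 - recip p) * t powr (- (r + q * recip p) / 2) * Lp_norm M p h"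
      by (simp add: w_def)
  qed (use C in simp)
qed

text \<open>The multiplier \<open>W t\<close> contributes t^(\<beta>/2), the kernel of order r costs
  t^(-(r + q/p)/2), and as t <= 1 the product is at most t^(\<delta>/2). The values of the piece
  itself are the case r = 0.\<close>

lemma piece_bounds:
  "\<exists>C>0. \<forall>f g t x. is_sobolev_deriv M lam \<phi> p b f g \<longrightarrow> 0 < t \<longrightarrow> t \<le> 1 \<longrightarrow>
     \<bar>multiplier H t f x - multiplier H (4 * t) f x\<bar> \<le> C * t powr (\<delta> / 2) * Lp_norm M p g \<and>
     (\<forall>k\<in>{1..R}. \<bar>ev k (\<lambda>x. multiplier H t f x - multiplier H (4 * t) f x) x\<bar> \<le> C * t powr (\<delta> / 2) * Lp_norm M p g)"
proof -
  obtain k3 k4 where k34: "0 < k3" "0 < k4"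
    "\<And>x y t. 0 < t \<Longrightarrow> t \<le> 1 \<Longrightarrow> \<bar>K t x y\<bar> \<le> k3 * t powr (- q / 2) * exp (- k4 * (dist x y)\<^sup>2 / t)"
    using heat_kernel_bound' by blast
  obtain C0 where C0: "0 < C0" "\<And>r x t h. 0 \<le> r \<Longrightarrow> 0 < t \<Longrightarrow> t \<le> 1 \<Longrightarrow> continuous_on UNIV h \<Longrightarrow>
     (\<integral>y. t powr (- (q + r) / 2) * exp (- k4 * (dist x y)\<^sup>2 / t) * \<bar>h y\<bar> \<partial>M) \<le> C0 * t powr (- (r + q * recip p) / 2) * Lp_norm M p h"
    using gauss_weight_bound[OF k34(2)] by blast
  have "\<forall>k\<in>{1..R}. \<exists>C>0. \<forall>r x t h. 0 \<le> r \<longrightarrow> 0 < t \<longrightarrow> t \<le> 1 \<longrightarrow> continuous_on UNIV h \<longrightarrow>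
     (\<integral>y. t powr (- (q + r) / 2) * exp (- c1L k * (dist x y)\<^sup>2 / t) * \<bar>h y\<bar> \<partial>M) \<le> C * t powr (- (r + q * recip p) / 2) * Lp_norm M p h"
    using gauss_weight_bound cL by blast
  from bchoice[OF this] obtain C1 where C1': "\<forall>k\<in>{1..R}. C1 k > 0 \<and> (\<forall>r x t h. 0 \<le> r \<longrightarrow> 0 < t \<longrightarrow> t \<le> 1 \<longrightarrow> continuous_on UNIV h \<longrightarrow>
     (\<integral>y. t powr (- (q + r) / 2) * exp (- c1L k * (dist x y)\<^sup>2 / t) * \<bar>h y\<bar> \<partial>M) \<le> C1 k * t powr (- (r + q * recip p) / 2) * Lp_norm M p h)" ..
  have C1: "0 < C1 k" if "k \<in> {1..R}" for k using C1' that by blast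
  have C2: "(\<integral>y. t powr (- (q + r) / 2) * exp (- c1L k * (dist x y)\<^sup>2 / t) * \<bar>h y\<bar> \<partial>M) \<le> C1 k * t powr (- (r + q * recip p) / 2) * Lp_norm M p h"
    if "k \<in> {1..R}" "0 \<le> r" "0 < t" "t \<le> 1" "continuous_on UNIV h" for k r x t h
    using C1'[rule_format, OF that(1), THEN conjunct2, rule_format, OF that(2-5)] .
  define C where "C = k3 * C0 * CW + (\<Sum>k\<in>{1..R}. cL k * C1 k * CW)"
  have s0: "0 \<le> (\<Sum>k\<in>{1..R}. cL k * C1 k * CW)" using cL C1 CW(1) by (intro sum_nonneg) (auto intro!: mult_nonneg_nonneg less_imp_le)
  have C: "0 < C" using k34 C0(1) CW(1) s0 unfolding C_def by (intro add_pos_nonneg) auto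
  have Ck: "cL k * C1 k * CW \<le> C" if "k \<in> {1..R}" for k
  proof -
    have "cL k * C1 k * CW \<le> (\<Sum>k\<in>{1..R}. cL k * C1 k * CW)"
      using that cL C1 CW(1) by (intro member_le_sum) (auto intro!: mult_nonneg_nonneg less_imp_le)
    moreover have "0 \<le> k3 * C0 * CW" using k34 C0 CW by simp
    ultimately show ?thesis unfolding C_def by linarith
  qed
  show ?thesis
  proof (rule exI[of _ C], intro conjI allI impI ballI C)
    fix f g t and x :: 'a
    assume g: "is_sobolev_deriv M lam \<phi> p b f g" and t: "0 < t" "t \<le> (1::real)"
    have gL: "g \<in> Lp_space M p" using g unfolding is_sobolev_deriv_def by blast
    define G where "G = Lp_norm M p g"
    have G: "0 \<le> G" unfolding G_def by (rule Lp_norm_nonneg[OF p gL])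
    define h where "h = multiplier (W t) t g"
    have hc: "continuous_on UNIV h" unfolding h_def by (rule multiplier_continuous)
    have hn: "Lp_norm M p h \<le> CW * t powr (\<beta> / 2) * G" unfolding h_def G_def by (rule CW(2)[OF t gL])
    have eq: "(\<lambda>x. multiplier H t f x - multiplier H (4 * t) f x) = (\<lambda>x. \<integral>y. K t x y * h y \<partial>M)"
      unfolding h_def by (rule dyadic_piece[OF g t])
    have main: "u * (t powr (- (r + q * recip p) / 2) * Lp_norm M p h) \<le> C * t powr (\<delta> / 2) * G"
      if u: "0 \<le> u" "u * CW \<le> C" and r: "r + q * recip p + \<delta> \<le> \<beta>" for u r
    proof -
      have "u * (t powr (- (r + q * recip p) / 2) * Lp_norm M p h) \<le> u * (t powr (- (r + q * recip p) / 2) * (CW * t powr (\<beta> / 2) * G))"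
        using u hn by (intro mult_left_mono) auto
      also have "\<dots> = (u * CW) * (t powr ((\<beta> - r - q * recip p) / 2) * G)"
      proof -
        have "t powr (- (r + q * recip p) / 2) * t powr (\<beta> / 2) = t powr ((\<beta> - r - q * recip p) / 2)"
          unfolding powr_add[symmetric] by (rule arg_cong[where f = "\<lambda>z. t powr z"]) (simp add: field_simps)
        then show ?thesis by (simp add: mult_ac)
      qed
      also have "\<dots> \<le> C * (t powr (\<delta> / 2) * G)"
        using u r G t C by (intro mult_mono powr_mono') auto
      finally show ?thesis by (simp add: mult.assoc)
    qed
    show "\<bar>multiplier H t f x - multiplier H (4 * t) f x\<bar> \<le> C * t powr (\<delta> / 2) * Lp_norm M p g"
    proof -
      have i1: "integrable M (\<lambda>y. K t x y * h y)" by (intro K_integral_sums(2) t continuous_integrable hc)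
      have "\<bar>multiplier H t f x - multiplier H (4 * t) f x\<bar> = \<bar>\<integral>y. K t x y * h y \<partial>M\<bar>" using fun_cong[OF eq, of x] by simp
      also have "\<dots> \<le> (\<integral>y. \<bar>K t x y * h y\<bar> \<partial>M)" using integral_norm_bound[of M "\<lambda>y. K t x y * h y"] by simp
      also have "\<dots> \<le> (\<integral>y. k3 * (t powr (- (q + 0) / 2) * exp (- k4 * (dist x y)\<^sup>2 / t) * \<bar>h y\<bar>) \<partial>M)"
      proof (rule integral_mono)
        show "integrable M (\<lambda>y. \<bar>K t x y * h y\<bar>)" using i1 by (rule integrable_abs)
        show "integrable M (\<lambda>y. k3 * (t powr (- (q + 0) / 2) * exp (- k4 * (dist x y)\<^sup>2 / t) * \<bar>h y\<bar>))"
          using t by (intro continuous_integrable continuous_intros hc) auto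
        show "\<bar>K t x y * h y\<bar> \<le> k3 * (t powr (- (q + 0) / 2) * exp (- k4 * (dist x y)\<^sup>2 / t) * \<bar>h y\<bar>)" for y
          using mult_right_mono[OF k34(3)[OF t, of x y] abs_ge_zero[of "h y"]] by (simp add: abs_mult mult.assoc)
      qed
      also have "\<dots> = k3 * (\<integral>y. t powr (- (q + 0) / 2) * exp (- k4 * (dist x y)\<^sup>2 / t) * \<bar>h y\<bar> \<partial>M)" by (rule integral_mult_right_zero)
      also have "\<dots> \<le> k3 * (C0 * t powr (- (0 + q * recip p) / 2) * Lp_norm M p h)"
        using k34(1) by (intro mult_left_mono C0(2) t hc) auto
      also have "\<dots> = (k3 * C0) * (t powr (- (0 + q * recip p) / 2) * Lp_norm M p h)" by simp
      also have "\<dots> \<le> C * t powr (\<delta> / 2) * G"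
      proof (rule main)
        show "0 \<le> k3 * C0" using k34 C0 by simp
        show "k3 * C0 * CW \<le> C" using s0 by (simp add: C_def)
        show "0 + q * recip p + \<delta> \<le> \<beta>" using ord[of 1] R by auto
      qed
      finally show ?thesis by (simp add: G_def)
    qed
    fix k assume k: "k \<in> {1..R}"
    have "\<bar>ev k (\<lambda>x. \<integral>y. K t x y * h y \<partial>M) x\<bar> \<le> (\<integral>y. cL k * t powr (- (q + ord k) / 2) * exp (- c1L k * (dist x y)\<^sup>2 / t) * \<bar>h y\<bar> \<partial>M)"
      by (rule heat_regular(2)[OF k t hc])
    also have "\<dots> = cL k * (\<integral>y. t powr (- (q + ord k) / 2) * exp (- c1L k * (dist x y)\<^sup>2 / t) * \<bar>h y\<bar> \<partial>M)"
      by (subst integral_mult_right_zero[symmetric]) (simp add: mult.assoc)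
    also have "\<dots> \<le> cL k * (C1 k * t powr (- (ord k + q * recip p) / 2) * Lp_norm M p h)"
      using cL[OF k] ord[OF k] by (intro mult_left_mono C2 k t hc) auto
    also have "\<dots> = (cL k * C1 k) * (t powr (- (ord k + q * recip p) / 2) * Lp_norm M p h)" by simp
    also have "\<dots> \<le> C * t powr (\<delta> / 2) * G"
      using cL[OF k] C1[OF k] Ck[OF k] ord[OF k] by (intro main) auto
    finally show "\<bar>ev k (\<lambda>x. multiplier H t f x - multiplier H (4 * t) f x) x\<bar> \<le> C * t powr (\<delta> / 2) * Lp_norm M p g"
      unfolding eq by (simp add: G_def)
  qed
qed


lemma summable_dyadic: "summable (\<lambda>m. C * (t / 4 ^ Suc m) powr (\<delta> / 2))" if "0 < t" for t C :: real
proof -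
  have "(t / 4 ^ Suc m) powr (\<delta> / 2) = t powr (\<delta> / 2) * ((1/4) powr (\<delta> / 2)) ^ Suc m" for m
  proof -
    have "(t / 4 ^ Suc m) powr (\<delta> / 2) = t powr (\<delta> / 2) * ((1/4) ^ Suc m) powr (\<delta> / 2)"
    proof -
      have "t / 4 ^ Suc m = t * (1/4) ^ Suc m" by (simp add: power_one_over)
      then show ?thesis by (simp only: powr_mult)
    qed
    also have "((1/4 :: real) ^ Suc m) powr (\<delta> / 2) = ((1/4) powr (\<delta> / 2)) ^ Suc m"
    proof -
      have "((1/4 :: real) ^ Suc m) powr (\<delta> / 2) = (1/4) powr (real (Suc m) * (\<delta> / 2))"
        by (subst powr_realpow[symmetric]) (simp_all add: powr_powr)
      also have "\<dots> = ((1/4) powr (\<delta> / 2)) ^ Suc m"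
        by (subst powr_realpow[symmetric]) (simp_all add: powr_powr mult.commute)
      finally show ?thesis .
    qed
    finally show ?thesis .
  qed
  moreover have "(1/4 :: real) powr (\<delta> / 2) < 1" using powr_less_mono2[of "\<delta> / 2" "1/4" 1] \<delta> by simp
  then have "summable (\<lambda>m. ((1/4 :: real) powr (\<delta> / 2)) ^ Suc m)" by (subst summable_Suc_iff) (intro summable_geometric, simp)
  ultimately show ?thesis by (simp only:) (intro summable_mult)
qed

text \<open>The dyadic pieces are summable in the supremum norm, and so are their values under L_k.
  The uniform limit of the smoothed functions has the coefficients of f, because H = 1 near 0 makes
  each coefficient eventually exact; it thus equals f almost everywhere, and closedness transfers
  the point values.\<close>

lemma approximation_limit:
  assumes f: "f \<in> Lp_space M p" and g: "is_sobolev_deriv M lam \<phi> p b f g" and t: "0 < t" "t \<le> 1" and k: "k \<in> {1..R}"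
  shows "regular k f" and "(\<lambda>m. ev k (multiplier H (t / 4 ^ m) f) x) \<longlonglongrightarrow> ev k f x"
proof -
  from piece_bounds obtain C where C0: "0 < C" and C': "\<forall>f g t x. is_sobolev_deriv M lam \<phi> p b f g \<longrightarrow> 0 < t \<longrightarrow> t \<le> 1 \<longrightarrow>
     \<bar>multiplier H t f x - multiplier H (4 * t) f x\<bar> \<le> C * t powr (\<delta> / 2) * Lp_norm M p g \<and>
     (\<forall>k\<in>{1..R}. \<bar>ev k (\<lambda>x. multiplier H t f x - multiplier H (4 * t) f x) x\<bar> \<le> C * t powr (\<delta> / 2) * Lp_norm M p g)"
    by (elim exE conjE)
  note C = C0 C'[rule_format, THEN conjunct1] C'[rule_format, THEN conjunct2, rule_format]
  define tt where "tt = (\<lambda>m::nat. t / 4 ^ m)"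
  have tt: "0 < tt m" "tt m \<le> 1" "4 * tt (Suc m) = tt m" for m
    using t by (auto simp: tt_def divide_le_eq intro: order_trans[OF t(2)] one_le_power)
  define P where "P = (\<lambda>m. multiplier H (tt m) f)"
  define E where "E = (\<lambda>m. ev k (P m))"
  have Pr: "regular k (P m)" for m unfolding P_def by (rule multiplier_regular[OF k tt(1)])
  have Pc: "continuous_on UNIV (P m)" for m unfolding P_def by (rule multiplier_continuous)
  define A where "A = (\<lambda>m. (C * Lp_norm M p g) * (t / 4 ^ Suc m) powr (\<delta> / 2))"
  have A: "summable A" unfolding A_def by (rule summable_dyadic[OF t(1)])
  have PA: "norm (P (Suc m) x - P m x) \<le> A m" for m x
    using C(2)[OF g tt(1,2), of "Suc m" x] by (simp add: P_def tt(3) A_def tt_def mult_ac)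
  have EA: "norm (E (Suc m) x - E m x) \<le> A m" for m x
  proof -
    have "ev k (\<lambda>x. P (Suc m) x - P m x) x = E (Suc m) x - E m x"
      using regular_diff[OF k Pr Pr, of "Suc m" m] by (simp add: E_def)
    then show ?thesis using C(3)[OF g tt(1,2) k, of "Suc m" x] by (simp add: P_def tt(3) A_def tt_def mult_ac)
  qed
  have tele: "uniform_limit UNIV Q (\<lambda>x. Q 0 x + (\<Sum>m. Q (Suc m) x - Q m x)) sequentially"
    if "\<And>m x. norm (Q (Suc m) x - Q m x) \<le> A m" for Q :: "nat \<Rightarrow> 'a \<Rightarrow> real"
  proof -
    have "uniform_limit UNIV (\<lambda>n x. \<Sum>m<n. Q (Suc m) x - Q m x) (\<lambda>x. \<Sum>m. Q (Suc m) x - Q m x) sequentially"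
      by (rule Weierstrass_m_test[OF _ A]) (use that in auto)
    then have "uniform_limit UNIV (\<lambda>n x. Q 0 x + (\<Sum>m<n. Q (Suc m) x - Q m x)) (\<lambda>x. Q 0 x + (\<Sum>m. Q (Suc m) x - Q m x)) sequentially"
      by (intro uniform_limit_add uniform_limit_const)
    moreover have "Q 0 x + (\<Sum>m<n. Q (Suc m) x - Q m x) = Q n x" for n x
      using sum_lessThan_telescope[of "\<lambda>m. Q m x" n] by simp
    ultimately show ?thesis by simp
  qed
  define F where "F = (\<lambda>x. P 0 x + (\<Sum>m. P (Suc m) x - P m x))"
  define G where "G = (\<lambda>x. E 0 x + (\<Sum>m. E (Suc m) x - E m x))"
  have Flim: "uniform_limit UNIV P F sequentially" unfolding F_def by (rule tele[OF PA])
  have Glim: "uniform_limit UNIV E G sequentially" unfolding G_def by (rule tele[OF EA])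
  have Fc: "continuous_on UNIV F" by (rule uniform_limit_theorem[OF _ Flim]) (auto intro: always_eventually Pc)
  have Ec: "continuous_on UNIV (E m)" and EL: "AE x in M. L k (P m) x = E m x" for m
    unfolding E_def using regular_ev[OF Pr] by auto
  have P_refl: "AE x in M. P m x = P m x" for m by simp
  have PD: "P m \<in> D k" for m using Pr unfolding regular_def by blast
  note cu = closed_operator_uniform[where F = P and F' = P and f = F and G = E and g = G,
      OF p lin[OF k] cl[OF k] PD continuous_Lp[OF p Fc] P_refl Flim Ec EL Glim]
  have Fr: "regular k F" unfolding regular_def using cu by blast
  have evF: "ev k F = G" by (rule ev_eqI[OF cu(3,2)])
  have "AE x in M. F x - f x = 0"
  proof (rule coefficients_zero)
    have fi: "integrable M f" by (rule Lp_integrable(1)[OF p f])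
    have Fi: "integrable M F" by (rule continuous_integrable[OF Fc])
    then show "integrable M (\<lambda>x. F x - f x)" using fi by simp
    fix j
    have "(\<lambda>m. coef (P m) j) \<longlonglongrightarrow> coef F j"
    proof -
      obtain B where B: "0 \<le> B" "\<And>x. \<bar>\<phi> j x\<bar> \<le> B" using continuous_bounded[OF phi_continuous[of j]] by blast
      have "(\<lambda>m. coef (P m) j - coef F j) \<longlonglongrightarrow> 0"
      proof (rule LIMSEQ_I)
        fix e :: real assume e: "0 < e"
        obtain n0 where n0: "\<And>n x. n0 \<le> n \<Longrightarrow> dist (P n x) (F x) < e / (B + 1)"
          using uniform_limitD[OF Flim, of "e / (B + 1)"] e B unfolding eventually_sequentially by auto
        have "norm (coef (P n) j - coef F j - 0) < e" if n: "n0 \<le> n" for n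
        proof -
          have i: "integrable M (\<lambda>x. P n x * \<phi> j x)" "integrable M (\<lambda>x. F x * \<phi> j x)"
            by (intro phi_mult_integrable continuous_integrable Pc Fc)+
          have "\<bar>coef (P n) j - coef F j\<bar> = \<bar>\<integral>x. P n x * \<phi> j x - F x * \<phi> j x \<partial>M\<bar>" using i by (simp add: fourier_coeff_def)
          also have "\<dots> \<le> (\<integral>x. \<bar>P n x * \<phi> j x - F x * \<phi> j x\<bar> \<partial>M)"
            using integral_norm_bound[of M "\<lambda>x. P n x * \<phi> j x - F x * \<phi> j x"] by simp
          also have "\<dots> \<le> (\<integral>x. e / (B + 1) * B \<partial>M)"
          proof (rule integral_mono)
            show "\<bar>P n x * \<phi> j x - F x * \<phi> j x\<bar> \<le> e / (B + 1) * B" for x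
              unfolding left_diff_distrib[symmetric] abs_mult
              using n0[OF n, of x] B e by (intro mult_mono) (auto simp: dist_real_def intro: less_imp_le)
          qed (use i in auto)
          also have "\<dots> < e" using B e by (simp add: field_simps)
          finally show ?thesis by simp
        qed
        then show "\<exists>n0. \<forall>n\<ge>n0. norm (coef (P n) j - coef F j - 0) < e" by blast
      qed
      then show ?thesis by (rule LIM_zero_cancel)
    qed
    moreover have "(\<lambda>m. coef (P m) j) \<longlonglongrightarrow> coef f j"
    proof (rule tendsto_eventually)
      have "(\<lambda>m. (lam j)\<^sup>2 * (t * (1/4) ^ m)) \<longlonglongrightarrow> (lam j)\<^sup>2 * (t * 0)"
        by (intro tendsto_intros LIMSEQ_power_zero) auto
      then have "\<forall>\<^sub>F m in sequentially. (lam j)\<^sup>2 * (t * (1/4) ^ m) < 1/4" by (rule order_tendstoD) simp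
      then show "\<forall>\<^sub>F m in sequentially. coef (P m) j = coef f j"
      proof eventually_elim
        case (elim m)
        then have "(lam j)\<^sup>2 * tt m < 1/4" by (simp add: tt_def power_one_over)
        then show ?case unfolding P_def coef_multiplier[OF tt(1)] using H1[of "(lam j)\<^sup>2 * tt m"] tt(1)[of m] by simp
      qed
    qed
    ultimately have "coef F j = coef f j" by (rule LIMSEQ_unique)
    then show "coef (\<lambda>x. F x - f x) j = 0"
      using phi_mult_integrable[OF Fi, of j] phi_mult_integrable[OF fi, of j] by (simp add: fourier_coeff_def left_diff_distrib)
  qed
  then have Ff: "AE x in M. F x = f x" by eventually_elim simp
  show "regular k f" using regular_cong_AE[OF k Fr f Ff] by blast
  have "(\<lambda>m. E m x) \<longlonglongrightarrow> G x" using tendsto_uniform_limitI[OF Glim, of x] by simp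
  then show "(\<lambda>m. ev k (multiplier H (t / 4 ^ m) f) x) \<longlonglongrightarrow> ev k f x"
    using regular_cong_AE[OF k Fr f Ff] evF by (simp add: E_def P_def tt_def)
qed


section \<open>Bump functions applied to the smoothing error\<close>

lemma indicator_separated_sum:
  assumes "finite Y" "\<forall>x\<in>Y. \<forall>y\<in>Y. x \<noteq> y \<longrightarrow> \<eta> \<le> dist x (y :: 'a)"
  shows "(\<Sum>y\<in>Y. indicator (ball y (\<eta> / 2)) z :: real) \<le> 1"
proof (cases "\<exists>y\<in>Y. z \<in> ball y (\<eta> / 2)")
  case True
  then obtain y where y: "y \<in> Y" "z \<in> ball y (\<eta> / 2)" by blast
  have "x = y" if x: "x \<in> Y" "z \<in> ball x (\<eta> / 2)" for x
  proof (rule ccontr)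
    assume "x \<noteq> y"
    then have "\<eta> \<le> dist x y" using assms(2) x(1) y(1) by blast
    then show False using dist_triangle2[of x y z] x(2) y(2) by simp
  qed
  then have "(\<Sum>x\<in>Y. indicator (ball x (\<eta> / 2)) z :: real) = (\<Sum>x\<in>Y. if x = y then 1 else 0)"
    using y(2) by (intro sum.cong refl) (metis indicator_simps)
  then show ?thesis using y assms(1) by simp
next
  case False
  then have "(\<Sum>x\<in>Y. indicator (ball x (\<eta> / 2)) z :: real) = (\<Sum>x\<in>Y. 0)"
    by (intro sum.cong refl) (metis indicator_simps(2))
  then show ?thesis by simp
qed

text \<open>Schur's test for the sum over y of the indicator of the ball of radius eta / 2 around y,
  as a function of z, times the Gaussian around y, as a function of w. The balls are disjoint, so a
  row integral involves one Gaussian at most; in a column, separation bounds the sum of the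
  Gaussians, and each ball has measure at most of order eta^q.\<close>

lemma piece_residual:
  assumes k: "k \<in> {1..R}" and cb: "0 < cb"
  shows "\<exists>C>0. \<forall>Y \<eta> t f g \<Psi>. finite Y \<longrightarrow> (\<forall>x\<in>Y. \<forall>y\<in>Y. x \<noteq> y \<longrightarrow> \<eta> \<le> dist x y) \<longrightarrow> 0 < \<eta> \<longrightarrow>
     0 < t \<longrightarrow> t \<le> 1 \<longrightarrow> sqrt t \<le> \<eta> \<longrightarrow> is_sobolev_deriv M lam \<phi> p b f g \<longrightarrow>
     (\<forall>y\<in>Y. \<Psi> y \<in> borel_measurable M \<and> (AE z in M. \<bar>\<Psi> y z\<bar> \<le> cb * \<eta> powr (ord k - \<beta>) * indicator (ball y (\<eta> / 2)) z)) \<longrightarrow>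
     Lp_bounded M p (C * (sqrt t / \<eta>) powr \<delta> * Lp_norm M p g)
       (\<lambda>z. \<Sum>y\<in>Y. ev k (\<lambda>x. multiplier H t f x - multiplier H (4 * t) f x) y * \<Psi> y z)"
proof -
  have cL0: "0 < cL k" "0 < c1L k" using cL[OF k] by auto
  obtain k2 where k2: "0 < k2" "\<And>x r. 0 < r \<Longrightarrow> measure M (ball x r) \<le> k2 * r powr q" using ball_measure by blast
  obtain C1 where C1: "0 < C1" "\<And>x t. 0 < t \<Longrightarrow> (\<integral>\<^sup>+y. ennreal (exp (- c1L k * (dist x y)\<^sup>2 / t)) \<partial>M) \<le> ennreal (C1 * t powr (q / 2))"
    using gauss_integral[OF cL0(2)] by blast
  obtain C2 where C2: "0 < C2" "\<forall>(Y :: 'a set) \<eta> t w. finite Y \<longrightarrow> (\<forall>x\<in>Y. \<forall>y\<in>Y. x \<noteq> y \<longrightarrow> \<eta> \<le> dist x y) \<longrightarrow>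
     0 < t \<longrightarrow> t \<le> 1 \<longrightarrow> sqrt t \<le> \<eta> \<longrightarrow> (\<Sum>y\<in>Y. exp (- c1L k * (dist y w)\<^sup>2 / t)) \<le> C2"
    using separated_sum_bound[OF cL0(2)] by blast
  have rp: "0 \<le> recip p" "recip p \<le> 1" using recip_bounds[OF p] by auto
  define C where "C = cb * cL k * (C1 powr (1 - recip p) * (k2 * C2) powr recip p) * CW"
  have C: "0 < C" using cb cL0 C1 k2 C2(1) CW(1) by (simp add: C_def)
  show ?thesis
  proof (rule exI[of _ C], intro conjI allI impI C)
    fix Y :: "'a set" and \<eta> t :: real and f g and \<Psi> :: "'a \<Rightarrow> 'a \<Rightarrow> real"
    assume Y: "finite Y" "\<forall>x\<in>Y. \<forall>y\<in>Y. x \<noteq> y \<longrightarrow> \<eta> \<le> dist x y" and \<eta>: "0 < \<eta>" and t: "0 < t" "t \<le> 1" and st: "sqrt t \<le> \<eta>"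
      and g: "is_sobolev_deriv M lam \<phi> p b f g"
      and \<Psi>: "\<forall>y\<in>Y. \<Psi> y \<in> borel_measurable M \<and> (AE z in M. \<bar>\<Psi> y z\<bar> \<le> cb * \<eta> powr (ord k - \<beta>) * indicator (ball y (\<eta> / 2)) z)"
    have gL: "g \<in> Lp_space M p" using g unfolding is_sobolev_deriv_def by blast
    define G where "G = Lp_norm M p g"
    have G: "0 \<le> G" unfolding G_def by (rule Lp_norm_nonneg[OF p gL])
    define h where "h = multiplier (W t) t g"
    have hc: "continuous_on UNIV h" unfolding h_def by (rule multiplier_continuous)
    have hL: "h \<in> Lp_space M p" by (rule continuous_Lp[OF p hc])
    have hn: "Lp_norm M p h \<le> CW * t powr (\<beta> / 2) * G" unfolding h_def G_def by (rule CW(2)[OF t gL])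
    define e where "e = (\<lambda>y. ev k (\<lambda>x. multiplier H t f x - multiplier H (4 * t) f x) y)"
    define u where "u = cb * \<eta> powr (ord k - \<beta>)"
    define v where "v = cL k * t powr (- (q + ord k) / 2)"
    define E where "E = (\<lambda>(y::'a) (w::'a). exp (- c1L k * (dist y w)\<^sup>2 / t))"
    have uv: "0 < u" "0 < v" using cb \<eta> cL0 t by (auto simp: u_def v_def)
    have Ec: "continuous_on UNIV (E y)" for y unfolding E_def using t by (intro continuous_intros) auto
    have Em[measurable]: "E y \<in> borel_measurable M" for y by (rule continuous_measurable[OF Ec])
    have hm[measurable]: "h \<in> borel_measurable M" by (rule continuous_measurable[OF hc])
    have E0: "0 \<le> E y w" for y w by (simp add: E_def)
    have eb: "\<bar>e y\<bar> \<le> (\<integral>w. v * E y w * \<bar>h w\<bar> \<partial>M)" for y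
      unfolding e_def v_def E_def dyadic_piece[OF g t] h_def
      by (rule heat_regular(2)[OF k t multiplier_continuous])
    define kk where "kk = (\<lambda>z w. \<Sum>y\<in>Y. indicator (ball y (\<eta> / 2)) z * (u * v * E y w))"
    have kk0: "0 \<le> kk z w" for z w unfolding kk_def using uv E0 by (intro sum_nonneg) auto
    have iE: "integrable M (\<lambda>w. v * E y w * \<bar>h w\<bar>)" for y by (intro continuous_integrable continuous_intros Ec hc)
    \<comment> \<open>Bounds for rows and columns. The Schur exponents 1 - 1/p and 1/p mix t^(q/2)
      with eta^q.\<close>
    define A where "A = u * v * (C1 * t powr (q / 2))"
    define B where "B = u * v * (k2 * \<eta> powr q * C2)"
    have A: "0 < A" "0 < B" using uv C1 t k2 \<eta> C2(1) by (auto simp: A_def B_def)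
    have row: "(\<integral>\<^sup>+w. ennreal (kk z w) \<partial>M) \<le> ennreal A" for z
    proof -
      have "(\<integral>\<^sup>+w. ennreal (kk z w) \<partial>M) = (\<integral>\<^sup>+w. (\<Sum>y\<in>Y. ennreal (indicator (ball y (\<eta> / 2)) z * (u * v)) * ennreal (E y w)) \<partial>M)"
      proof (intro nn_integral_cong)
        fix w
        have "ennreal (kk z w) = (\<Sum>y\<in>Y. ennreal (indicator (ball y (\<eta> / 2)) z * (u * v * E y w)))"
          unfolding kk_def using uv E0 by (intro sum_ennreal[symmetric]) auto
        also have "\<dots> = (\<Sum>y\<in>Y. ennreal (indicator (ball y (\<eta> / 2)) z * (u * v)) * ennreal (E y w))"
          using uv E0 by (intro sum.cong refl) (simp add: ennreal_mult[symmetric] mult.assoc)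
        finally show "ennreal (kk z w) = (\<Sum>y\<in>Y. ennreal (indicator (ball y (\<eta> / 2)) z * (u * v)) * ennreal (E y w))" .
      qed
      also have "\<dots> = (\<Sum>y\<in>Y. ennreal (indicator (ball y (\<eta> / 2)) z * (u * v)) * (\<integral>\<^sup>+w. ennreal (E y w) \<partial>M))"
        by (subst nn_integral_sum) (auto simp: nn_integral_cmult)
      also have "\<dots> \<le> (\<Sum>y\<in>Y. ennreal (indicator (ball y (\<eta> / 2)) z * (u * v)) * ennreal (C1 * t powr (q / 2)))"
        unfolding E_def by (intro sum_mono mult_left_mono C1(2) t) auto
      also have "\<dots> = ennreal ((\<Sum>y\<in>Y. indicator (ball y (\<eta> / 2)) z) * A)"
      proof -
        have "ennreal ((\<Sum>y\<in>Y. indicator (ball y (\<eta> / 2)) z) * A) = ennreal (\<Sum>y\<in>Y. indicator (ball y (\<eta> / 2)) z * A)"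
          by (simp only: sum_distrib_right)
        also have "\<dots> = (\<Sum>y\<in>Y. ennreal (indicator (ball y (\<eta> / 2)) z * A))"
          using A by (intro sum_ennreal[symmetric]) auto
        also have "\<dots> = (\<Sum>y\<in>Y. ennreal (indicator (ball y (\<eta> / 2)) z * (u * v)) * ennreal (C1 * t powr (q / 2)))"
          using uv C1(1) by (intro sum.cong refl) (simp add: ennreal_mult[symmetric] A_def mult.assoc)
        finally show ?thesis ..
      qed
      also have "\<dots> \<le> ennreal (1 * A)"
        using A by (intro ennreal_leI mult_right_mono indicator_separated_sum[OF Y]) auto
      finally show ?thesis by simp
    qed
    have col: "(\<integral>\<^sup>+z. ennreal (kk z w) \<partial>M) \<le> ennreal B" for w
    proof -
      have "(\<integral>\<^sup>+z. ennreal (kk z w) \<partial>M) = (\<integral>\<^sup>+z. (\<Sum>y\<in>Y. ennreal (u * v * E y w) * indicator (ball y (\<eta> / 2)) z) \<partial>M)"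
      proof (intro nn_integral_cong)
        fix z
        have "ennreal (kk z w) = (\<Sum>y\<in>Y. ennreal (indicator (ball y (\<eta> / 2)) z * (u * v * E y w)))"
          unfolding kk_def using uv E0 by (intro sum_ennreal[symmetric]) auto
        also have "\<dots> = (\<Sum>y\<in>Y. ennreal (u * v * E y w) * indicator (ball y (\<eta> / 2)) z)"
          by (intro sum.cong refl) (auto split: split_indicator)
        finally show "ennreal (kk z w) = (\<Sum>y\<in>Y. ennreal (u * v * E y w) * indicator (ball y (\<eta> / 2)) z)" .
      qed
      also have "\<dots> = (\<Sum>y\<in>Y. ennreal (u * v * E y w) * emeasure M (ball y (\<eta> / 2)))"
        by (subst nn_integral_sum) (auto intro!: sum.cong nn_integral_cmult_indicator)
      also have "\<dots> \<le> (\<Sum>y\<in>Y. ennreal (u * v * E y w) * ennreal (k2 * \<eta> powr q))"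
      proof (intro sum_mono mult_left_mono)
        fix y
        have "measure M (ball y (\<eta> / 2)) \<le> k2 * (\<eta> / 2) powr q" using \<eta> by (intro k2) auto
        also have "\<dots> \<le> k2 * \<eta> powr q" using k2 \<eta> q_pos by (intro mult_left_mono powr_mono2) auto
        finally show "emeasure M (ball y (\<eta> / 2)) \<le> ennreal (k2 * \<eta> powr q)" by (simp add: emeasure_eq_measure ennreal_leI)
      qed auto
      also have "\<dots> = ennreal (u * v * (k2 * \<eta> powr q) * (\<Sum>y\<in>Y. E y w))"
      proof -
        have "ennreal (u * v * (k2 * \<eta> powr q) * (\<Sum>y\<in>Y. E y w)) = ennreal (\<Sum>y\<in>Y. u * v * (k2 * \<eta> powr q) * E y w)"
          by (simp only: sum_distrib_left)
        also have "\<dots> = (\<Sum>y\<in>Y. ennreal (u * v * (k2 * \<eta> powr q) * E y w))"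
          using uv E0 k2(1) by (intro sum_ennreal[symmetric]) auto
        also have "\<dots> = (\<Sum>y\<in>Y. ennreal (u * v * E y w) * ennreal (k2 * \<eta> powr q))"
        proof (intro sum.cong refl)
          fix y
          have "u * v * (k2 * \<eta> powr q) * E y w = (u * v * E y w) * (k2 * \<eta> powr q)" by (simp only: mult_ac)
          then show "ennreal (u * v * (k2 * \<eta> powr q) * E y w) = ennreal (u * v * E y w) * ennreal (k2 * \<eta> powr q)"
            using uv E0 k2(1) by (simp only: ennreal_mult mult_nonneg_nonneg less_imp_le powr_ge_zero)
        qed
        finally show ?thesis ..
      qed
      also have "\<dots> \<le> ennreal (u * v * (k2 * \<eta> powr q) * C2)"
        using uv k2 C2(2)[rule_format, OF Y(1) _ t st, of w] Y(2) unfolding E_def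
        by (intro ennreal_leI mult_left_mono) auto
      finally show ?thesis by (simp add: B_def mult.assoc)
    qed
    have bound: "Lp_bounded M p (A powr (1 - recip p) * B powr recip p * Lp_norm M p h) (\<lambda>z. \<Sum>y\<in>Y. e y * \<Psi> y z)"
    proof (rule Schur_test[OF p A, where k = kk])
      show "(\<lambda>(z, w). kk z w) \<in> borel_measurable (M \<Otimes>\<^sub>M M)" unfolding kk_def by measurable
      show "(\<lambda>z. \<Sum>y\<in>Y. e y * \<Psi> y z) \<in> borel_measurable M" using \<Psi> by (intro borel_measurable_sum borel_measurable_times) auto
      have "AE z in M. \<forall>y\<in>Y. \<bar>\<Psi> y z\<bar> \<le> u * indicator (ball y (\<eta> / 2)) z"
        using Y(1) \<Psi> unfolding u_def by (intro AE_finite_allI) auto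
      then show "AE z in M. ennreal \<bar>\<Sum>y\<in>Y. e y * \<Psi> y z\<bar> \<le> (\<integral>\<^sup>+w. ennreal (kk z w * \<bar>h w\<bar>) \<partial>M)"
      proof eventually_elim
        case (elim z)
        have "\<bar>\<Sum>y\<in>Y. e y * \<Psi> y z\<bar> \<le> (\<Sum>y\<in>Y. \<bar>e y\<bar> * \<bar>\<Psi> y z\<bar>)" by (rule order_trans[OF sum_abs]) (simp add: abs_mult)
        also have "\<dots> \<le> (\<Sum>y\<in>Y. (\<integral>w. v * E y w * \<bar>h w\<bar> \<partial>M) * (u * indicator (ball y (\<eta> / 2)) z))"
          using elim eb order_trans[OF abs_ge_zero eb] by (intro sum_mono mult_mono) auto
        also have "\<dots> = (\<Sum>y\<in>Y. \<integral>w. (u * indicator (ball y (\<eta> / 2)) z) * (v * E y w * \<bar>h w\<bar>) \<partial>M)"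
          by (intro sum.cong refl, subst integral_mult_right_zero) (rule mult.commute)
        also have "\<dots> = (\<integral>w. (\<Sum>y\<in>Y. (u * indicator (ball y (\<eta> / 2)) z) * (v * E y w * \<bar>h w\<bar>)) \<partial>M)"
          by (intro Bochner_Integration.integral_sum[symmetric] integrable_mult_right iE)
        also have "\<dots> = (\<integral>w. kk z w * \<bar>h w\<bar> \<partial>M)"
          by (intro arg_cong[where f = "integral\<^sup>L M"] ext, unfold kk_def sum_distrib_right, intro sum.cong refl) (simp only: mult_ac)
        finally have le: "\<bar>\<Sum>y\<in>Y. e y * \<Psi> y z\<bar> \<le> (\<integral>w. kk z w * \<bar>h w\<bar> \<partial>M)" .
        have "integrable M (\<lambda>w. kk z w * \<bar>h w\<bar>)"
          unfolding kk_def by (intro continuous_integrable continuous_intros Ec hc)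
        then have "(\<integral>\<^sup>+w. ennreal (kk z w * \<bar>h w\<bar>) \<partial>M) = ennreal (\<integral>w. kk z w * \<bar>h w\<bar> \<partial>M)"
          using kk0 by (intro nn_integral_eq_integral) auto
        then show ?case using le by (simp add: ennreal_leI)
      qed
    qed (use kk0 row col Lp_bounded_norm[OF p hL] Lp_norm_nonneg[OF p hL] in auto)
    have AB: "A powr (1 - recip p) * B powr recip p = u * v * (C1 powr (1 - recip p) * (k2 * C2) powr recip p) * (t powr (q * (1 - recip p) / 2) * \<eta> powr (q * recip p))"
    proof -
      have uvp: "(u * v) powr (1 - recip p) * (u * v) powr recip p = u * v"
        using uv by (simp only: powr_add[symmetric]) simp
      have "A powr (1 - recip p) = (u * v) powr (1 - recip p) * (C1 powr (1 - recip p) * t powr (q * (1 - recip p) / 2))"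
        by (simp only: A_def powr_mult powr_powr) simp
      moreover have "B powr recip p = (u * v) powr recip p * (\<eta> powr (q * recip p) * (k2 * C2) powr recip p)"
        by (simp only: B_def powr_mult powr_powr mult_ac)
      ultimately have "A powr (1 - recip p) * B powr recip p = ((u * v) powr (1 - recip p) * (u * v) powr recip p) *
          (C1 powr (1 - recip p) * t powr (q * (1 - recip p) / 2) * (\<eta> powr (q * recip p) * (k2 * C2) powr recip p))"
        by (simp only: mult_ac)
      then show ?thesis unfolding uvp by (simp only: mult_ac)
    qed
    define \<gamma> where "\<gamma> = \<beta> - ord k - q * recip p"
    have \<gamma>: "\<delta> \<le> \<gamma>" using ord[OF k] by (simp add: \<gamma>_def)
    \<comment> \<open>The powers of t combine to t^(\<gamma>/2) and those of eta to eta^(-\<gamma>),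
      so only the ratio sqrt t / eta remains.\<close>
    have pw: "\<eta> powr (ord k - \<beta>) * t powr (- (q + ord k) / 2) * (t powr (q * (1 - recip p) / 2) * \<eta> powr (q * recip p)) * t powr (\<beta> / 2) = (sqrt t / \<eta>) powr \<gamma>"
    proof -
      have "(sqrt t / \<eta>) powr \<gamma> = t powr (\<gamma> / 2) * \<eta> powr (- \<gamma>)"
        using t \<eta> by (simp add: powr_divide powr_half_sqrt[symmetric] powr_powr powr_minus_divide)
      moreover have e1: "\<eta> powr (ord k - \<beta>) * \<eta> powr (q * recip p) = \<eta> powr (- \<gamma>)"
        unfolding powr_add[symmetric] by (rule arg_cong[where f = "\<lambda>z. \<eta> powr z"]) (simp add: \<gamma>_def)
      moreover have e2: "t powr (- (q + ord k) / 2) * t powr (q * (1 - recip p) / 2) * t powr (\<beta> / 2) = t powr (\<gamma> / 2)"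
        unfolding powr_add[symmetric] by (rule arg_cong[where f = "\<lambda>z. t powr z"]) (simp add: \<gamma>_def field_simps)
      moreover have "\<eta> powr (ord k - \<beta>) * t powr (- (q + ord k) / 2) * (t powr (q * (1 - recip p) / 2) * \<eta> powr (q * recip p)) * t powr (\<beta> / 2)
        = (t powr (- (q + ord k) / 2) * t powr (q * (1 - recip p) / 2) * t powr (\<beta> / 2)) * (\<eta> powr (ord k - \<beta>) * \<eta> powr (q * recip p))"
        by (simp only: mult_ac)
      ultimately show ?thesis by (simp only:)
    qed
    have "A powr (1 - recip p) * B powr recip p * Lp_norm M p h \<le> A powr (1 - recip p) * B powr recip p * (CW * t powr (\<beta> / 2) * G)"
      using hn by (intro mult_left_mono) auto
    also have "\<dots> = C * (\<eta> powr (ord k - \<beta>) * t powr (- (q + ord k) / 2) * (t powr (q * (1 - recip p) / 2) * \<eta> powr (q * recip p)) * t powr (\<beta> / 2)) * G"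
      unfolding AB u_def v_def C_def by (simp only: mult_ac)
    also have "\<dots> = C * (sqrt t / \<eta>) powr \<gamma> * G" unfolding pw ..
    also have "\<dots> \<le> C * (sqrt t / \<eta>) powr \<delta> * G"
      using C G t \<eta> st \<gamma> by (intro mult_right_mono mult_left_mono powr_mono') auto
    finally have le: "A powr (1 - recip p) * B powr recip p * Lp_norm M p h \<le> C * (sqrt t / \<eta>) powr \<delta> * G" .
    have m: "(\<lambda>z. \<Sum>y\<in>Y. e y * \<Psi> y z) \<in> borel_measurable M" using bound unfolding Lp_bounded_def by blast
    show "Lp_bounded M p (C * (sqrt t / \<eta>) powr \<delta> * Lp_norm M p g)
       (\<lambda>z. \<Sum>y\<in>Y. ev k (\<lambda>x. multiplier H t f x - multiplier H (4 * t) f x) y * \<Psi> y z)"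
      unfolding e_def[symmetric] G_def[symmetric]
      by (rule Lp_bounded_mono[OF p bound m _ _ le]) (auto intro!: mult_nonneg_nonneg Lp_norm_nonneg[OF p hL])
  qed
qed

text \<open>The smoothing error is the sum of the pieces at times t / 4^(i + 1), whose contributions
  form a geometric series. Only the values at the finitely many points of Y have to converge along
  the partial sums, which \<open>approximation_limit\<close> provides.\<close>

lemma residual_bound:
  assumes cb: "0 < cb"
  shows "\<exists>C>0. \<forall>Y \<eta> t f g \<Psi>. finite Y \<longrightarrow> (\<forall>x\<in>Y. \<forall>y\<in>Y. x \<noteq> y \<longrightarrow> \<eta> \<le> dist x y) \<longrightarrow> 0 < \<eta> \<longrightarrow>
     0 < t \<longrightarrow> t \<le> 1 \<longrightarrow> sqrt t \<le> \<eta> \<longrightarrow> f \<in> Lp_space M p \<longrightarrow> is_sobolev_deriv M lam \<phi> p b f g \<longrightarrow>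
     (\<forall>k\<in>{1..R}. \<forall>y\<in>Y. \<Psi> k y \<in> borel_measurable M \<and> (AE z in M. \<bar>\<Psi> k y z\<bar> \<le> cb * \<eta> powr (ord k - \<beta>) * indicator (ball y (\<eta> / 2)) z)) \<longrightarrow>
     Lp_norm M p (\<lambda>z. \<Sum>k\<in>{1..R}. \<Sum>y\<in>Y. ev k (\<lambda>x. f x - multiplier H t f x) y * \<Psi> k y z) \<le> C * (sqrt t / \<eta>) powr \<delta> * Lp_norm M p g"
proof -
  have "\<forall>k\<in>{1..R}. \<exists>C>0. \<forall>Y \<eta> t f g \<Psi>. finite Y \<longrightarrow> (\<forall>x\<in>Y. \<forall>y\<in>Y. x \<noteq> y \<longrightarrow> \<eta> \<le> dist x y) \<longrightarrow> 0 < \<eta> \<longrightarrow>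
     0 < t \<longrightarrow> t \<le> 1 \<longrightarrow> sqrt t \<le> \<eta> \<longrightarrow> is_sobolev_deriv M lam \<phi> p b f g \<longrightarrow>
     (\<forall>y\<in>Y. \<Psi> y \<in> borel_measurable M \<and> (AE z in M. \<bar>\<Psi> y z\<bar> \<le> cb * \<eta> powr (ord k - \<beta>) * indicator (ball y (\<eta> / 2)) z)) \<longrightarrow>
     Lp_bounded M p (C * (sqrt t / \<eta>) powr \<delta> * Lp_norm M p g)
       (\<lambda>z. \<Sum>y\<in>Y. ev k (\<lambda>x. multiplier H t f x - multiplier H (4 * t) f x) y * \<Psi> y z)"
    by (rule ballI, rule piece_residual[OF _ cb])
  from bchoice[OF this] obtain Cp where Cp: "\<forall>k\<in>{1..R}. 0 < Cp k \<and> (\<forall>Y \<eta> t f g \<Psi>. finite Y \<longrightarrow> (\<forall>x\<in>Y. \<forall>y\<in>Y. x \<noteq> y \<longrightarrow> \<eta> \<le> dist x y) \<longrightarrow> 0 < \<eta> \<longrightarrow>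
     0 < t \<longrightarrow> t \<le> 1 \<longrightarrow> sqrt t \<le> \<eta> \<longrightarrow> is_sobolev_deriv M lam \<phi> p b f g \<longrightarrow>
     (\<forall>y\<in>Y. \<Psi> y \<in> borel_measurable M \<and> (AE z in M. \<bar>\<Psi> y z\<bar> \<le> cb * \<eta> powr (ord k - \<beta>) * indicator (ball y (\<eta> / 2)) z)) \<longrightarrow>
     Lp_bounded M p (Cp k * (sqrt t / \<eta>) powr \<delta> * Lp_norm M p g)
       (\<lambda>z. \<Sum>y\<in>Y. ev k (\<lambda>x. multiplier H t f x - multiplier H (4 * t) f x) y * \<Psi> y z))" ..
  have Cp0: "0 < Cp k" if "k \<in> {1..R}" for k using Cp that by blast
  \<comment> \<open>Dividing the time by 4 halves its square root, whence the ratio 2^(-\<delta>) of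
    consecutive pieces.\<close>
  define \<theta> where "\<theta> = (1/2 :: real) powr \<delta>"
  have \<theta>: "0 < \<theta>" "\<theta> < 1" using powr_less_mono2[of \<delta> "1/2" 1] \<delta> by (auto simp: \<theta>_def)
  define C where "C = (\<Sum>k\<in>{1..R}. Cp k) * (1 / (1 - \<theta>))"
  have "0 < (\<Sum>k\<in>{1..R}. Cp k)" using Cp0 R by (intro sum_pos) auto
  then have C: "0 < C" using \<theta> by (simp add: C_def)
  show ?thesis
  proof (rule exI[of _ C], intro conjI allI impI C)
    fix Y :: "'a set" and \<eta> t :: real and f g and \<Psi> :: "nat \<Rightarrow> 'a \<Rightarrow> 'a \<Rightarrow> real"
    assume Y: "finite Y" "\<forall>x\<in>Y. \<forall>y\<in>Y. x \<noteq> y \<longrightarrow> \<eta> \<le> dist x y" and \<eta>: "0 < \<eta>" and t: "0 < t" "t \<le> 1" and st: "sqrt t \<le> \<eta>"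
      and f: "f \<in> Lp_space M p" and g: "is_sobolev_deriv M lam \<phi> p b f g"
      and \<Psi>: "\<forall>k\<in>{1..R}. \<forall>y\<in>Y. \<Psi> k y \<in> borel_measurable M \<and> (AE z in M. \<bar>\<Psi> k y z\<bar> \<le> cb * \<eta> powr (ord k - \<beta>) * indicator (ball y (\<eta> / 2)) z)"
    have gL: "g \<in> Lp_space M p" using g unfolding is_sobolev_deriv_def by blast
    define G where "G = Lp_norm M p g"
    have G: "0 \<le> G" unfolding G_def by (rule Lp_norm_nonneg[OF p gL])
    have \<Psi>L: "\<Psi> k y \<in> Lp_space M p" if "k \<in> {1..R}" "y \<in> Y" for k y
    proof -
      have "AE z in M. \<bar>\<Psi> k y z\<bar> \<le> cb * \<eta> powr (ord k - \<beta>) * indicator (ball y (\<eta> / 2)) z" using \<Psi> that by blast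
      then have "AE z in M. \<bar>\<Psi> k y z\<bar> \<le> cb * \<eta> powr (ord k - \<beta>)"
      proof eventually_elim
        case (elim z)
        have "cb * \<eta> powr (ord k - \<beta>) * indicator (ball y (\<eta> / 2)) z \<le> cb * \<eta> powr (ord k - \<beta>) * 1"
          using cb by (intro mult_left_mono) (auto simp: indicator_def)
        then show ?case using elim by simp
      qed
      then show ?thesis using \<Psi> that cb by (intro Lp_bound(1)[OF p]) auto
    qed
    define tt where "tt = (\<lambda>m::nat. t / 4 ^ m)"
    have tt: "0 < tt m" "tt m \<le> 1" "4 * tt (Suc m) = tt m" "tt m \<le> t" for m
      using t by (auto simp: tt_def divide_le_eq intro: order_trans[OF t(2)] one_le_power)
    have stt: "sqrt (tt m) \<le> \<eta>" for m using tt(4)[of m] st real_sqrt_le_mono order_trans by blast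
    define P where "P = (\<lambda>m. multiplier H (tt m) f)"
    have Pr: "regular k (P m)" if "k \<in> {1..R}" for k m unfolding P_def by (rule multiplier_regular[OF that tt(1)])
    define e where "e = (\<lambda>k y. ev k (\<lambda>x. f x - multiplier H t f x) y)"
    define em where "em = (\<lambda>m k y. ev k (P m) y - ev k (P 0) y)"
    define F where "F = (\<lambda>m z. \<Sum>k\<in>{1..R}. \<Sum>y\<in>Y. em m k y * \<Psi> k y z)"
    define J where "J = (\<lambda>i k z. \<Sum>y\<in>Y. ev k (\<lambda>x. P (Suc i) x - P i x) y * \<Psi> k y z)"
    have JL: "J i k \<in> Lp_space M p \<and> Lp_norm M p (J i k) \<le> Cp k * ((sqrt t / \<eta>) powr \<delta> * \<theta> ^ Suc i) * G" if k: "k \<in> {1..R}" for i k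
    proof -
      have "\<forall>y\<in>Y. \<Psi> k y \<in> borel_measurable M \<and> (AE z in M. \<bar>\<Psi> k y z\<bar> \<le> cb * \<eta> powr (ord k - \<beta>) * indicator (ball y (\<eta> / 2)) z)"
        using \<Psi> k by blast
      note Ps = this
      have "Lp_bounded M p (Cp k * (sqrt (tt (Suc i)) / \<eta>) powr \<delta> * Lp_norm M p g)
         (\<lambda>z. \<Sum>y\<in>Y. ev k (\<lambda>x. multiplier H (tt (Suc i)) f x - multiplier H (4 * tt (Suc i)) f x) y * \<Psi> k y z)"
        by (rule Cp[THEN bspec, OF k, THEN conjunct2, THEN spec, THEN spec, THEN spec, THEN spec, THEN spec, THEN spec,
              THEN mp, OF Y(1), THEN mp, OF Y(2), THEN mp, OF \<eta>, THEN mp, OF tt(1), THEN mp, OF tt(2), THEN mp, OF stt, THEN mp, OF g, THEN mp, OF Ps])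
      then have "Lp_bounded M p (Cp k * (sqrt (tt (Suc i)) / \<eta>) powr \<delta> * G) (J i k)"
        unfolding J_def P_def tt(3) G_def .
      moreover have "(sqrt (tt (Suc i)) / \<eta>) powr \<delta> = (sqrt t / \<eta>) powr \<delta> * \<theta> ^ Suc i"
      proof -
        have "sqrt (4 ^ Suc i) = (2 :: real) ^ Suc i"
          by (intro real_sqrt_unique) (auto simp: power_mult_distrib[symmetric] power2_eq_square)
        then have "sqrt (tt (Suc i)) / \<eta> = (sqrt t / \<eta>) * (1/2) ^ Suc i"
          unfolding tt_def real_sqrt_divide by (simp add: power_one_over)
        moreover have "((1/2 :: real) ^ Suc i) powr \<delta> = \<theta> ^ Suc i"
        proof -
          have "((1/2 :: real) ^ Suc i) powr \<delta> = (1/2) powr (real (Suc i) * \<delta>)"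
            by (subst powr_realpow[symmetric]) (simp_all add: powr_powr)
          also have "\<dots> = \<theta> ^ Suc i"
            unfolding \<theta>_def by (subst powr_realpow[symmetric]) (simp_all add: powr_powr mult.commute)
          finally show ?thesis .
        qed
        ultimately show ?thesis by (simp only: powr_mult)
      qed
      moreover have "0 \<le> Cp k * ((sqrt t / \<eta>) powr \<delta> * \<theta> ^ Suc i) * G"
        using less_imp_le[OF Cp0[OF k]] less_imp_le[OF \<theta>(1)] G by (intro mult_nonneg_nonneg zero_le_power powr_ge_zero)
      ultimately show ?thesis using Lp_bounded_iff[OF p] by simp
    qed
    have emJ: "F m z = (\<Sum>k\<in>{1..R}. \<Sum>i<m. J i k z)" for m z
    proof -
      have "em m k y = (\<Sum>i<m. ev k (\<lambda>x. P (Suc i) x - P i x) y)" if k: "k \<in> {1..R}" for k y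
      proof -
        have "ev k (\<lambda>x. P (Suc i) x - P i x) y = ev k (P (Suc i)) y - ev k (P i) y" for i
          using regular_diff[OF k Pr[OF k] Pr[OF k], of "Suc i" i] by simp
        then show ?thesis unfolding em_def using sum_lessThan_telescope[of "\<lambda>i. ev k (P i) y" m] by simp
      qed
      then have "(\<Sum>y\<in>Y. em m k y * \<Psi> k y z) = (\<Sum>i<m. J i k z)" if "k \<in> {1..R}" for k
        unfolding J_def using that by (simp add: sum_distrib_right sum.swap[of _ Y])
      then show ?thesis unfolding F_def by (intro sum.cong) auto
    qed
    have FL: "F m \<in> Lp_space M p" and Fn: "Lp_norm M p (F m) \<le> C * (sqrt t / \<eta>) powr \<delta> * G" for m
    proof -
      have in1: "(\<lambda>z. \<Sum>i<m. J i k z) \<in> Lp_space M p \<and> Lp_norm M p (\<lambda>z. \<Sum>i<m. J i k z) \<le> Cp k * (1 / (1 - \<theta>)) * ((sqrt t / \<eta>) powr \<delta> * G)"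
        if k: "k \<in> {1..R}" for k
      proof -
        have s: "(\<lambda>z. \<Sum>i<m. J i k z) \<in> Lp_space M p \<and> Lp_norm M p (\<lambda>z. \<Sum>i<m. J i k z) \<le> (\<Sum>i<m. Lp_norm M p (J i k))"
          using JL[OF k] by (intro Lp_sum[OF p]) auto
        have "(\<Sum>i<m. Lp_norm M p (J i k)) \<le> (\<Sum>i<m. (Cp k * (sqrt t / \<eta>) powr \<delta> * G) * \<theta> ^ Suc i)"
          using JL[OF k] by (intro sum_mono) (simp add: mult_ac)
        also have "\<dots> = (Cp k * (sqrt t / \<eta>) powr \<delta> * G) * (\<Sum>i<m. \<theta> ^ Suc i)" by (simp only: sum_distrib_left)
        finally have le1: "(\<Sum>i<m. Lp_norm M p (J i k)) \<le> (Cp k * (sqrt t / \<eta>) powr \<delta> * G) * (\<Sum>i<m. \<theta> ^ Suc i)" .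
        have "(\<Sum>i<m. \<theta> ^ Suc i) \<le> 1 / (1 - \<theta>)"
        proof -
          have "(\<Sum>i<m. \<theta> ^ Suc i) \<le> (\<Sum>i<m. \<theta> ^ i)" using \<theta> by (intro sum_mono) (simp add: mult_left_le_one_le)
          also have "\<dots> = (1 - \<theta> ^ m) / (1 - \<theta>)" using \<theta> by (simp add: sum_gp_strict)
          also have "\<dots> \<le> 1 / (1 - \<theta>)" using \<theta> by (intro divide_right_mono) auto
          finally show ?thesis .
        qed
        then have "(Cp k * (sqrt t / \<eta>) powr \<delta> * G) * (\<Sum>i<m. \<theta> ^ Suc i) \<le> (Cp k * (sqrt t / \<eta>) powr \<delta> * G) * (1 / (1 - \<theta>))"
          using less_imp_le[OF Cp0[OF k]] G by (intro mult_left_mono mult_nonneg_nonneg) auto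
        also have "\<dots> = Cp k * (1 / (1 - \<theta>)) * ((sqrt t / \<eta>) powr \<delta> * G)" by (simp only: mult_ac)
        finally show ?thesis using s le1 by simp
      qed
      have "(\<lambda>z. \<Sum>k\<in>{1..R}. \<Sum>i<m. J i k z) \<in> Lp_space M p \<and> Lp_norm M p (\<lambda>z. \<Sum>k\<in>{1..R}. \<Sum>i<m. J i k z) \<le> (\<Sum>k\<in>{1..R}. Lp_norm M p (\<lambda>z. \<Sum>i<m. J i k z))"
        using in1 by (intro Lp_sum[OF p]) auto
      moreover have "(\<Sum>k\<in>{1..R}. Lp_norm M p (\<lambda>z. \<Sum>i<m. J i k z)) \<le> (\<Sum>k\<in>{1..R}. Cp k * (1 / (1 - \<theta>)) * ((sqrt t / \<eta>) powr \<delta> * G))"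
        using in1 by (intro sum_mono) blast
      moreover have "\<dots> = C * (sqrt t / \<eta>) powr \<delta> * G"
        unfolding C_def by (simp only: sum_distrib_right mult.assoc)
      moreover have "F m = (\<lambda>z. \<Sum>k\<in>{1..R}. \<Sum>i<m. J i k z)" using emJ by blast
      ultimately show "F m \<in> Lp_space M p" "Lp_norm M p (F m) \<le> C * (sqrt t / \<eta>) powr \<delta> * G" by auto
    qed
    have lim: "(\<lambda>m. em m k y) \<longlonglongrightarrow> e k y" if k: "k \<in> {1..R}" for k y
    proof -
      have "(\<lambda>m. ev k (P m) y - ev k (P 0) y) \<longlonglongrightarrow> ev k f y - ev k (P 0) y"
        unfolding P_def tt_def by (intro tendsto_diff tendsto_const approximation_limit(2)[OF f g t k])
      moreover have "e k y = ev k f y - ev k (P 0) y"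
        using regular_diff[OF k approximation_limit(1)[OF f g t k] Pr[OF k, of 0]] by (simp add: e_def P_def tt_def)
      ultimately show ?thesis by (simp add: em_def)
    qed
    define Q where "Q = (\<lambda>z. \<Sum>k\<in>{1..R}. \<Sum>y\<in>Y. e k y * \<Psi> k y z)"
    \<comment> \<open>The bump functions stay fixed as m grows, so the difference is governed by
      finitely many coefficients that tend to 0.\<close>
    define err where "err = (\<lambda>m. \<Sum>k\<in>{1..R}. \<Sum>y\<in>Y. \<bar>e k y - em m k y\<bar> * Lp_norm M p (\<Psi> k y))"
    have Qle: "Lp_norm M p Q \<le> C * (sqrt t / \<eta>) powr \<delta> * G + err m" for m
    proof -
      have d: "(\<lambda>z. \<Sum>y\<in>Y. (e k y - em m k y) * \<Psi> k y z) \<in> Lp_space M p \<and>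
         Lp_norm M p (\<lambda>z. \<Sum>y\<in>Y. (e k y - em m k y) * \<Psi> k y z) \<le> (\<Sum>y\<in>Y. \<bar>e k y - em m k y\<bar> * Lp_norm M p (\<Psi> k y))"
        if k: "k \<in> {1..R}" for k
      proof -
        have "(\<lambda>z. \<Sum>y\<in>Y. (e k y - em m k y) * \<Psi> k y z) \<in> Lp_space M p \<and>
         Lp_norm M p (\<lambda>z. \<Sum>y\<in>Y. (e k y - em m k y) * \<Psi> k y z) \<le> (\<Sum>y\<in>Y. Lp_norm M p (\<lambda>z. (e k y - em m k y) * \<Psi> k y z))"
          using Lp_cmult(1)[OF p \<Psi>L[OF k]] by (intro Lp_sum[OF p Y(1)])
        moreover have "(\<Sum>y\<in>Y. Lp_norm M p (\<lambda>z. (e k y - em m k y) * \<Psi> k y z)) \<le> (\<Sum>y\<in>Y. \<bar>e k y - em m k y\<bar> * Lp_norm M p (\<Psi> k y))"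
          using Lp_cmult(2)[OF p \<Psi>L[OF k]] by (intro sum_mono)
        ultimately show ?thesis by linarith
      qed
      define X where "X = (\<lambda>z. \<Sum>k\<in>{1..R}. \<Sum>y\<in>Y. (e k y - em m k y) * \<Psi> k y z)"
      have X: "X \<in> Lp_space M p \<and> Lp_norm M p X \<le> (\<Sum>k\<in>{1..R}. Lp_norm M p (\<lambda>z. \<Sum>y\<in>Y. (e k y - em m k y) * \<Psi> k y z))"
        unfolding X_def using d by (intro Lp_sum[OF p]) auto
      have "(\<Sum>k\<in>{1..R}. Lp_norm M p (\<lambda>z. \<Sum>y\<in>Y. (e k y - em m k y) * \<Psi> k y z)) \<le> err m"
        unfolding err_def using d by (intro sum_mono) blast
      then have Xn: "Lp_norm M p X \<le> err m" using X by linarith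
      have "Q = (\<lambda>z. F m z + X z)"
        unfolding Q_def F_def X_def sum.distrib[symmetric] by (simp add: distrib_right[symmetric])
      then have "Lp_norm M p Q \<le> Lp_norm M p (F m) + Lp_norm M p X"
        using Lp_add(2)[OF p FL X[THEN conjunct1]] by simp
      then show ?thesis using Fn[of m] Xn by linarith
    qed
    have "err \<longlonglongrightarrow> (\<Sum>k\<in>{1..R}. \<Sum>y\<in>Y. \<bar>e k y - e k y\<bar> * Lp_norm M p (\<Psi> k y))"
      unfolding err_def by (intro tendsto_sum tendsto_mult tendsto_rabs tendsto_diff tendsto_const lim)
    then have "(\<lambda>m. C * (sqrt t / \<eta>) powr \<delta> * G + err m) \<longlonglongrightarrow> C * (sqrt t / \<eta>) powr \<delta> * G + 0"
      by (intro tendsto_add tendsto_const) simp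
    then have "Lp_norm M p Q \<le> C * (sqrt t / \<eta>) powr \<delta> * G + 0"
      by (rule tendsto_lowerbound) (auto intro!: always_eventually Qle)
    then show "Lp_norm M p (\<lambda>z. \<Sum>k\<in>{1..R}. \<Sum>y\<in>Y. ev k (\<lambda>x. f x - multiplier H t f x) y * \<Psi> k y z) \<le> C * (sqrt t / \<eta>) powr \<delta> * Lp_norm M p g"
      by (simp add: Q_def e_def G_def)
  qed
qed


section \<open>Derivatives in the Sobolev class and boundedness of point values\<close>

lemma coef_combination:
  assumes I: "finite I" and f: "\<And>i. i \<in> I \<Longrightarrow> f i \<in> Lp_space M p"
  shows "coef (\<lambda>x. \<Sum>i\<in>I. a i * f i x) k = (\<Sum>i\<in>I. a i * coef (f i) k)"
proof -
  have i: "integrable M (\<lambda>x. f i x * \<phi> k x)" if "i \<in> I" for i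
    by (rule phi_mult_integrable[OF Lp_integrable(1)[OF p f[OF that]]])
  have "coef (\<lambda>x. \<Sum>i\<in>I. a i * f i x) k = (\<integral>x. (\<Sum>i\<in>I. a i * (f i x * \<phi> k x)) \<partial>M)"
    by (simp add: fourier_coeff_def sum_distrib_right mult.assoc)
  also have "\<dots> = (\<Sum>i\<in>I. \<integral>x. a i * (f i x * \<phi> k x) \<partial>M)"
    using i by (intro Bochner_Integration.integral_sum integrable_mult_right) auto
  finally show ?thesis by (simp add: fourier_coeff_def)
qed

lemma coef_diff:
  assumes f: "f \<in> Lp_space M p" and g: "g \<in> Lp_space M p"
  shows "coef (\<lambda>x. f x - g x) k = coef f k - coef g k"
  unfolding fourier_coeff_def left_diff_distrib
  by (intro Bochner_Integration.integral_diff phi_mult_integrable Lp_integrable(1)[OF p] f g)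

lemma coef_bound: "\<exists>B. 0 \<le> B \<and> (\<forall>g\<in>Lp_space M p. \<bar>coef g j\<bar> \<le> B * Lp_norm M p g)"
proof -
  obtain B where B: "0 \<le> B" "\<And>x. \<bar>\<phi> j x\<bar> \<le> B" using continuous_bounded[OF continuous_phi] by blast
  have "\<bar>coef g j\<bar> \<le> B * Lp_norm M p g" if g: "g \<in> Lp_space M p" for g
  proof -
    have gi: "integrable M g" by (rule Lp_integrable(1)[OF p g])
    have "\<bar>coef g j\<bar> \<le> (\<integral>x. \<bar>g x * \<phi> j x\<bar> \<partial>M)"
      unfolding fourier_coeff_def by (rule integral_abs_bound)
    also have "\<dots> \<le> (\<integral>x. B * \<bar>g x\<bar> \<partial>M)"
    proof (rule integral_mono)
      show "integrable M (\<lambda>x. \<bar>g x * \<phi> j x\<bar>)" by (intro integrable_abs phi_mult_integrable gi)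
      show "integrable M (\<lambda>x. B * \<bar>g x\<bar>)" by (intro integrable_mult_right integrable_abs gi)
      fix x
      show "\<bar>g x * \<phi> j x\<bar> \<le> B * \<bar>g x\<bar>"
        unfolding abs_mult using mult_right_mono[OF B(2)[of x], of "\<bar>g x\<bar>"] by (simp add: mult.commute)
    qed
    also have "\<dots> = B * (\<integral>x. \<bar>g x\<bar> \<partial>M)" by (rule integral_mult_right_zero)
    also have "\<dots> \<le> B * Lp_norm M p g" using B Lp_integrable(2)[OF p g] by (intro mult_left_mono)
    finally show ?thesis .
  qed
  then show ?thesis using B(1) by blast
qed

abbreviation "is_deriv \<equiv> is_sobolev_deriv M lam \<phi> p b"

lemma is_deriv_Lp: "is_deriv f g \<Longrightarrow> g \<in> Lp_space M p"
  by (simp add: is_sobolev_deriv_def)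

lemma is_deriv_coef: "is_deriv f g \<Longrightarrow> coef f k = b (lam k) * coef g k"
  by (simp add: is_sobolev_deriv_def)

lemma is_deriv_unique:
  assumes g: "is_deriv f g" and h: "is_deriv f h"
  shows "AE x in M. g x = h x"
proof -
  note L = is_deriv_Lp[OF g] is_deriv_Lp[OF h]
  have "coef (\<lambda>x. g x - h x) k = 0" for k
    using is_deriv_coef[OF g, of k] is_deriv_coef[OF h, of k] b_pos[of k] coef_diff[OF L] by simp
  then have "AE x in M. g x - h x = 0"
    by (rule coefficients_zero[OF Lp_integrable(1)[OF p Lp_diff(1)[OF p L]]])
  then show ?thesis by simp
qed

lemma sobolev_deriv_is: "is_deriv f g \<Longrightarrow> is_deriv f (sobolev_deriv M lam \<phi> p b f)"
  unfolding sobolev_deriv_def by (rule someI[where P = "is_deriv f"])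

lemma sobolev_norm_eq:
  assumes g: "is_deriv f g"
  shows "sobolev_norm M lam \<phi> p b f = Lp_norm M p g"
  unfolding sobolev_norm_def
  by (rule Lp_cong_AE(2)[OF p is_deriv_Lp[OF g] Lp_measurable[OF is_deriv_Lp[OF sobolev_deriv_is[OF g]]]
        is_deriv_unique[OF g sobolev_deriv_is[OF g]]])

lemma is_deriv_sum:
  assumes I: "finite I" and fg: "\<And>i. i \<in> I \<Longrightarrow> f i \<in> Lp_space M p \<and> is_deriv (f i) (g i)"
  shows "(\<lambda>x. \<Sum>i\<in>I. a i * f i x) \<in> Lp_space M p \<and> is_deriv (\<lambda>x. \<Sum>i\<in>I. a i * f i x) (\<lambda>x. \<Sum>i\<in>I. a i * g i x)"
proof -
  have L: "f i \<in> Lp_space M p" "g i \<in> Lp_space M p" if "i \<in> I" for i using fg[OF that] is_deriv_Lp by auto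
  have fL: "(\<lambda>x. \<Sum>i\<in>I. a i * f i x) \<in> Lp_space M p" by (intro Lp_sum[OF p I, THEN conjunct1] Lp_cmult(1)[OF p] L(1))
  have gL: "(\<lambda>x. \<Sum>i\<in>I. a i * g i x) \<in> Lp_space M p" by (intro Lp_sum[OF p I, THEN conjunct1] Lp_cmult(1)[OF p] L(2))
  have "b (lam k) * coef (\<lambda>x. \<Sum>i\<in>I. a i * g i x) k = coef (\<lambda>x. \<Sum>i\<in>I. a i * f i x) k" for k
  proof -
    have "b (lam k) * (a i * coef (g i) k) = a i * coef (f i) k" if "i \<in> I" for i
      using is_deriv_coef[OF fg[OF that, THEN conjunct2], of k] by simp
    then have "(\<Sum>i\<in>I. b (lam k) * (a i * coef (g i) k)) = (\<Sum>i\<in>I. a i * coef (f i) k)" by (rule sum.cong[OF refl])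
    moreover have "coef (\<lambda>x. \<Sum>i\<in>I. a i * g i x) k = (\<Sum>i\<in>I. a i * coef (g i) k)" by (rule coef_combination[OF I L(2)])
    moreover have "coef (\<lambda>x. \<Sum>i\<in>I. a i * f i x) k = (\<Sum>i\<in>I. a i * coef (f i) k)" by (rule coef_combination[OF I L(1)])
    ultimately show ?thesis by (simp only: sum_distrib_left)
  qed
  then show ?thesis using fL gL by (simp add: is_sobolev_deriv_def)
qed

lemma is_deriv_diff:
  assumes "f \<in> Lp_space M p" "is_deriv f g" "f' \<in> Lp_space M p" "is_deriv f' g'"
  shows "(\<lambda>x. f x - f' x) \<in> Lp_space M p" "is_deriv (\<lambda>x. f x - f' x) (\<lambda>x. g x - g' x)"
proof -
  note L = is_deriv_Lp[OF assms(2)] is_deriv_Lp[OF assms(4)]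
  show "(\<lambda>x. f x - f' x) \<in> Lp_space M p" by (rule Lp_diff(1)[OF p assms(1,3)])
  show "is_deriv (\<lambda>x. f x - f' x) (\<lambda>x. g x - g' x)"
    unfolding is_sobolev_deriv_def coef_diff[OF L] coef_diff[OF assms(1,3)] right_diff_distrib
    using Lp_diff(1)[OF p L] is_deriv_coef[OF assms(2)] is_deriv_coef[OF assms(4)] by simp
qed

lemma phi_Lp: "\<phi> j \<in> Lp_space M p"
  by (rule continuous_Lp[OF p continuous_phi])

lemma poly_Lp: "(\<lambda>x. \<Sum>j\<in>I. a j * \<phi> j x) \<in> Lp_space M p"
  by (intro continuous_Lp[OF p] continuous_intros continuous_phi)

lemma is_deriv_poly:
  assumes I: "finite I"
  shows "is_deriv (\<lambda>x. \<Sum>j\<in>I. (c j * b (lam j)) * \<phi> j x) (\<lambda>x. \<Sum>j\<in>I. c j * \<phi> j x)"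
  unfolding is_sobolev_deriv_def coef_poly[OF I] using poly_Lp by simp

text \<open>The low frequencies form a finite sum with coefficients controlled by the norm, and the
  dyadic pieces above them are summable. The constant depends on the point x; it serves to let the
  values of a norm-convergent iteration tend to 0 at fixed points.\<close>

lemma ev_bound:
  assumes k: "k \<in> {1..R}"
  shows "\<exists>C\<ge>0. \<forall>f g. f \<in> Lp_space M p \<longrightarrow> is_deriv f g \<longrightarrow> \<bar>ev k f x\<bar> \<le> C * Lp_norm M p g"
proof -
  from piece_bounds obtain C where C0: "0 < C" and C': "\<forall>f g t x. is_sobolev_deriv M lam \<phi> p b f g \<longrightarrow> 0 < t \<longrightarrow> t \<le> 1 \<longrightarrow>
     \<bar>multiplier H t f x - multiplier H (4 * t) f x\<bar> \<le> C * t powr (\<delta> / 2) * Lp_norm M p g \<and>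
     (\<forall>k\<in>{1..R}. \<bar>ev k (\<lambda>x. multiplier H t f x - multiplier H (4 * t) f x) x\<bar> \<le> C * t powr (\<delta> / 2) * Lp_norm M p g)"
    by (elim exE conjE)
  note C = C'[rule_format, THEN conjunct2, rule_format]
  have "\<forall>j. \<exists>B. 0 \<le> B \<and> (\<forall>g\<in>Lp_space M p. \<bar>coef g j\<bar> \<le> B * Lp_norm M p g)" using coef_bound by blast
  from choice[OF this] obtain B where B: "\<forall>j. 0 \<le> B j \<and> (\<forall>g\<in>Lp_space M p. \<bar>coef g j\<bar> \<le> B j * Lp_norm M p g)" ..
  define A where "A = (\<lambda>m. C * ((1::real) / 4 ^ Suc m) powr (\<delta> / 2))"
  have A: "summable A" unfolding A_def by (rule summable_dyadic) simp
  have A0: "0 \<le> A m" for m using C0 by (simp add: A_def)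
  define I where "I = {j. (lam j)\<^sup>2 * 1 < 1/2}"
  have I: "finite I" unfolding I_def by (rule finite_low_squares) simp
  define C1 where "C1 = (\<Sum>j\<in>I. \<bar>H ((lam j)\<^sup>2 * 1)\<bar> * b (lam j) * B j * \<bar>ev k (\<phi> j) x\<bar>)"
  have C1: "0 \<le> C1" unfolding C1_def using B b_pos by (intro sum_nonneg mult_nonneg_nonneg) (auto intro: less_imp_le)
  show ?thesis
  proof (intro exI[of _ "C1 + suminf A"] conjI allI impI)
    show "0 \<le> C1 + suminf A" using C1 suminf_nonneg[OF A A0] by simp
    fix f g assume f: "f \<in> Lp_space M p" and g: "is_deriv f g"
    define G where "G = Lp_norm M p g"
    have gL: "g \<in> Lp_space M p" by (rule is_deriv_Lp[OF g])
    have G: "0 \<le> G" unfolding G_def by (rule Lp_norm_nonneg[OF p gL])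
    define P where "P = (\<lambda>m::nat. multiplier H (1 / 4 ^ m) f)"
    have Pr: "regular k (P m)" for m unfolding P_def by (rule multiplier_regular[OF k]) simp
    have step: "\<bar>ev k (P (Suc m)) x - ev k (P m) x\<bar> \<le> A m * G" for m
    proof -
      have t: "0 < (1::real) / 4 ^ Suc m" "(1::real) / 4 ^ Suc m \<le> 1" "4 * ((1::real) / 4 ^ Suc m) = 1 / 4 ^ m"
        using one_le_power[of "4::real" "Suc m"] by (auto simp: divide_le_eq)
      have "ev k (\<lambda>x. P (Suc m) x - P m x) x = ev k (P (Suc m)) x - ev k (P m) x"
        using regular_diff[OF k Pr Pr, of "Suc m" m] by simp
      then show ?thesis using C[OF g t(1,2) k, of x] unfolding t(3) by (simp add: P_def A_def G_def)
    qed
    have b0: "\<bar>ev k (P 0) x\<bar> \<le> C1 * G"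
    proof -
      have "ev k (P 0) x = (\<Sum>j\<in>I. (H ((lam j)\<^sup>2 * 1) * coef f j) * ev k (\<phi> j) x)"
        unfolding P_def multiplier_def[abs_def] power_0 div_by_1 I_def[symmetric] using poly_regular(2)[OF k I] by simp
      also have "\<bar>\<dots>\<bar> \<le> (\<Sum>j\<in>I. \<bar>(H ((lam j)\<^sup>2 * 1) * coef f j) * ev k (\<phi> j) x\<bar>)" by (rule sum_abs)
      also have "\<dots> \<le> (\<Sum>j\<in>I. (\<bar>H ((lam j)\<^sup>2 * 1)\<bar> * b (lam j) * B j * \<bar>ev k (\<phi> j) x\<bar>) * G)"
      proof (intro sum_mono)
        fix j
        have "\<bar>coef f j\<bar> = b (lam j) * \<bar>coef g j\<bar>" using is_deriv_coef[OF g, of j] b_pos[of j] by (simp add: abs_mult)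
        also have "\<dots> \<le> b (lam j) * (B j * G)" unfolding G_def using B gL b_pos[of j] by (intro mult_left_mono) auto
        finally have "\<bar>coef f j\<bar> \<le> b (lam j) * (B j * G)" .
        from mult_right_mono[OF mult_left_mono[OF this, of "\<bar>H ((lam j)\<^sup>2 * 1)\<bar>"], of "\<bar>ev k (\<phi> j) x\<bar>"]
        show "\<bar>(H ((lam j)\<^sup>2 * 1) * coef f j) * ev k (\<phi> j) x\<bar> \<le> (\<bar>H ((lam j)\<^sup>2 * 1)\<bar> * b (lam j) * B j * \<bar>ev k (\<phi> j) x\<bar>) * G"
          by (simp add: abs_mult mult_ac)
      qed
      also have "\<dots> = C1 * G" unfolding C1_def by (rule sum_distrib_right[symmetric])
      finally show ?thesis .
    qed
    have b1: "\<bar>ev k (P m) x - ev k (P 0) x\<bar> \<le> suminf A * G" for m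
    proof -
      have "ev k (P m) x - ev k (P 0) x = (\<Sum>i<m. ev k (P (Suc i)) x - ev k (P i) x)"
        using sum_lessThan_telescope[of "\<lambda>i. ev k (P i) x" m] by simp
      also have "\<bar>\<dots>\<bar> \<le> (\<Sum>i<m. A i * G)" using step by (intro order_trans[OF sum_abs] sum_mono)
      also have "\<dots> = (\<Sum>i<m. A i) * G" by (rule sum_distrib_right[symmetric])
      also have "\<dots> \<le> suminf A * G" using A A0 G by (intro mult_right_mono sum_le_suminf) auto
      finally show ?thesis .
    qed
    have m: "\<bar>ev k (P m) x\<bar> \<le> (C1 + suminf A) * G" for m
      unfolding distrib_right using b0 b1[of m] by linarith
    have "(\<lambda>m. \<bar>ev k (P m) x\<bar>) \<longlonglongrightarrow> \<bar>ev k f x\<bar>"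
      unfolding P_def by (intro tendsto_rabs approximation_limit(2)[OF f g _ _ k]) auto
    then show "\<bar>ev k f x\<bar> \<le> (C1 + suminf A) * Lp_norm M p g"
      unfolding G_def[symmetric] by (rule tendsto_upperbound) (auto intro!: always_eventually m)
  qed
qed

section \<open>Minimization over finitely many coefficients\<close>

lemma poly_norm_lipschitz:
  assumes I: "finite I" and h: "h \<in> Lp_space M p"
  shows "Lp_norm M p (\<lambda>x. h x - (\<Sum>j\<in>I. c j * \<phi> j x)) \<le>
     Lp_norm M p (\<lambda>x. h x - (\<Sum>j\<in>I. c' j * \<phi> j x)) + (\<Sum>j\<in>I. \<bar>c' j - c j\<bar> * Lp_norm M p (\<phi> j))"
proof -
  have "(\<lambda>x. \<Sum>j\<in>I. (c' j - c j) * \<phi> j x) \<in> Lp_space M p \<and>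
     Lp_norm M p (\<lambda>x. \<Sum>j\<in>I. (c' j - c j) * \<phi> j x) \<le> (\<Sum>j\<in>I. Lp_norm M p (\<lambda>x. (c' j - c j) * \<phi> j x))"
    by (rule Lp_sum[OF p I Lp_cmult(1)[OF p phi_Lp]])
  moreover have "(\<Sum>j\<in>I. Lp_norm M p (\<lambda>x. (c' j - c j) * \<phi> j x)) \<le> (\<Sum>j\<in>I. \<bar>c' j - c j\<bar> * Lp_norm M p (\<phi> j))"
    by (intro sum_mono Lp_cmult(2)[OF p phi_Lp])
  moreover have "(\<lambda>x. h x - (\<Sum>j\<in>I. c j * \<phi> j x)) = (\<lambda>x. (h x - (\<Sum>j\<in>I. c' j * \<phi> j x)) + (\<Sum>j\<in>I. (c' j - c j) * \<phi> j x))"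
    by (simp add: left_diff_distrib sum_subtractf)
  ultimately show ?thesis
    using Lp_add(2)[OF p Lp_diff(1)[OF p h poly_Lp], of "\<lambda>x. \<Sum>j\<in>I. (c' j - c j) * \<phi> j x" c' I] by simp
qed

text \<open>The coefficient space consists of the sequences that vanish outside of I, with the
  product topology. Competitors that are no farther from h than a fixed one have bounded
  coefficients and lie in a product of compact intervals, on which the norm is continuous.\<close>

lemma minimum_attained:
  assumes I: "finite I" and \<A>: "closed \<A>" "\<A> \<noteq> {}" "\<And>c k. c \<in> \<A> \<Longrightarrow> k \<notin> I \<Longrightarrow> c k = 0" and h: "h \<in> Lp_space M p"
  shows "\<exists>c\<in>\<A>. \<forall>c'\<in>\<A>. Lp_norm M p (\<lambda>x. h x - (\<Sum>j\<in>I. c j * \<phi> j x)) \<le> Lp_norm M p (\<lambda>x. h x - (\<Sum>j\<in>I. c' j * \<phi> j x))"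
proof -
  define F where "F = (\<lambda>c :: nat \<Rightarrow> real. Lp_norm M p (\<lambda>x. h x - (\<Sum>j\<in>I. c j * \<phi> j x)))"
  have hpL: "(\<lambda>x. h x - (\<Sum>j\<in>I. c j * \<phi> j x)) \<in> Lp_space M p" for c by (rule Lp_diff(1)[OF p h poly_Lp])
  obtain c0 where c0: "c0 \<in> \<A>" using \<A>(2) by blast
  have "\<forall>j. \<exists>B. 0 \<le> B \<and> (\<forall>g\<in>Lp_space M p. \<bar>coef g j\<bar> \<le> B * Lp_norm M p g)" using coef_bound by blast
  from choice[OF this] obtain B where B: "\<forall>j. 0 \<le> B j \<and> (\<forall>g\<in>Lp_space M p. \<bar>coef g j\<bar> \<le> B j * Lp_norm M p g)" ..
  define m where "m = (\<lambda>j. B j * (Lp_norm M p h + F c0))"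
  define X where "X = PiE (UNIV :: nat set) (\<lambda>j. {- m j..m j})"
  have m0: "0 \<le> m j" for j unfolding m_def F_def using B Lp_norm_nonneg[OF p] h hpL by (auto intro!: mult_nonneg_nonneg add_nonneg_nonneg)
  have inX: "c \<in> X" if c: "c \<in> \<A>" "F c \<le> F c0" for c
  proof -
    have ck: "\<bar>c k\<bar> \<le> m k" for k
    proof (cases "k \<in> I")
      case True
      let ?q = "\<lambda>x. \<Sum>j\<in>I. c j * \<phi> j x"
      have "Lp_norm M p ?q = Lp_norm M p (\<lambda>x. h x - (h x - ?q x))" by simp
      also have "\<dots> \<le> Lp_norm M p h + F c" unfolding F_def by (rule Lp_diff(2)[OF p h hpL])
      finally have "Lp_norm M p ?q \<le> Lp_norm M p h + F c0" using c(2) by simp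
      then have "B k * Lp_norm M p ?q \<le> m k" unfolding m_def using B by (intro mult_left_mono) auto
      moreover have "\<bar>coef ?q k\<bar> \<le> B k * Lp_norm M p ?q" using B poly_Lp by blast
      moreover have "coef ?q k = c k" using coef_poly[OF I] True by simp
      ultimately show ?thesis by simp
    next
      case False then show ?thesis using \<A>(3)[OF c(1) False] m0[of k] by simp
    qed
    have "- m k \<le> c k \<and> c k \<le> m k" for k using ck[of k] by linarith
    then show ?thesis by (simp add: X_def PiE_UNIV_domain)
  qed
  have "compactin (product_topology (\<lambda>i::nat. euclidean) UNIV) X" unfolding X_def by (subst compactin_PiE) auto
  then have "compact X" by (simp add: euclidean_product_topology)
  then have cS: "compact (\<A> \<inter> X)" using \<A>(1) closed_Int_compact by blast
  have "continuous_on (\<A> \<inter> X) F"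
    unfolding continuous_on_def
  proof
    fix c
    define e where "e = (\<lambda>c'. \<Sum>j\<in>I. \<bar>c' j - c j\<bar> * Lp_norm M p (\<phi> j))"
    have "continuous_on UNIV e" unfolding e_def by (intro continuous_intros continuous_on_product_coordinates)
    then have "(e \<longlongrightarrow> e c) (at c within UNIV)" unfolding continuous_on_def by blast
    then have "(e \<longlongrightarrow> e c) (at c within \<A> \<inter> X)" by (rule tendsto_within_subset) simp
    moreover have "e c = 0" by (simp add: e_def)
    ultimately have e: "(e \<longlongrightarrow> 0) (at c within \<A> \<inter> X)" by simp
    have "((\<lambda>c'. F c' - F c) \<longlongrightarrow> 0) (at c within \<A> \<inter> X)"
    proof (rule Lim_null_comparison[OF _ e], rule always_eventually, rule allI)
      fix c'
      have "F c' \<le> F c + e c'"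
        using poly_norm_lipschitz[OF I h, of c' c] unfolding F_def e_def by (simp add: abs_minus_commute)
      moreover have "F c \<le> F c' + e c'" using poly_norm_lipschitz[OF I h, of c c'] unfolding F_def e_def .
      ultimately show "norm (F c' - F c) \<le> e c'" by (simp add: abs_le_iff)
    qed
    then show "(F \<longlongrightarrow> F c) (at c within \<A> \<inter> X)" by (rule Lim_null[THEN iffD2])
  qed
  moreover have "\<A> \<inter> X \<noteq> {}" using c0 inX by auto
  ultimately obtain c where c: "c \<in> \<A> \<inter> X" "\<forall>c'\<in>\<A> \<inter> X. F c \<le> F c'"
    using continuous_attains_inf[OF cS] by blast
  have "F c \<le> F c'" if "c' \<in> \<A>" for c'
  proof (cases "F c' \<le> F c0")
    case True then show ?thesis using c that inX by blast
  next
    case False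
    have "F c \<le> F c0" using c(2) c0 inX[OF c0] by blast
    then show ?thesis using False by linarith
  qed
  then show ?thesis using c(1) unfolding F_def by blast
qed


text \<open>
  The error of the smoothing operator is corrected with the bump functions; the correction is
  smoothed again. Both steps are iterated, and the corrections decay geometrically.
\<close>

lemma interpolating_poly:
  assumes Y: "finite Y" and t: "0 < t" "t \<le> 1" and I: "finite I" "{j. (lam j)\<^sup>2 * t < 1/2} \<subseteq> I"
    and \<psi>: "\<And>k y. k \<in> {1..R} \<Longrightarrow> y \<in> Y \<Longrightarrow> \<psi> k y \<in> Lp_space M p \<and> is_deriv (\<psi> k y) (\<Psi> k y)"
    and val: "\<And>k y i z. k \<in> {1..R} \<Longrightarrow> y \<in> Y \<Longrightarrow> i \<in> {1..R} \<Longrightarrow> z \<in> Y \<Longrightarrow> ev i (\<psi> k y) z = (if i = k \<and> z = y then 1 else 0)"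
    and contr: "\<And>f g. f \<in> Lp_space M p \<Longrightarrow> is_deriv f g \<Longrightarrow>
       Lp_norm M p (\<lambda>x. \<Sum>k\<in>{1..R}. \<Sum>y\<in>Y. ev k (\<lambda>x. f x - multiplier H t f x) y * \<Psi> k y x) \<le> 1/2 * Lp_norm M p g"
    and f: "f \<in> Lp_space M p" and g: "is_deriv f g"
  shows "\<exists>c. (\<forall>j. j \<notin> I \<longrightarrow> c j = 0) \<and>
     (\<forall>k\<in>{1..R}. \<forall>y\<in>Y. ev k (\<lambda>x. \<Sum>j\<in>I. (c j * b (lam j)) * \<phi> j x) y = ev k f y) \<and>
     Lp_norm M p (\<lambda>x. \<Sum>j\<in>I. c j * \<phi> j x) \<le> 2 * CH * Lp_norm M p g"
proof -
  define e where "e = (\<lambda>f k y. ev k (\<lambda>x. f x - multiplier H t f x) y)"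
  \<comment> \<open>One correction: the bump functions weighted with the values of the smoothing
    error, and in \<open>nd\<close> the same combination of their derivatives. The factor 1 gives
    the outer sum the form of a linear combination.\<close>
  define nx where "nx = (\<lambda>f x. \<Sum>k\<in>{1..R}. 1 * (\<Sum>y\<in>Y. e f k y * \<psi> k y x))"
  define nd where "nd = (\<lambda>f x. \<Sum>k\<in>{1..R}. 1 * (\<Sum>y\<in>Y. e f k y * \<Psi> k y x))"
  define F where "F = (\<lambda>i::nat. (nx ^^ i) f)"
  define G where "G = (\<lambda>i::nat. case i of 0 \<Rightarrow> g | Suc j \<Rightarrow> nd (F j))"
  have F_0: "F 0 = f" and F_Suc: "F (Suc i) = nx (F i)" for i by (auto simp: F_def)
  have G_0: "G 0 = g" and G_Suc: "G (Suc i) = nd (F i)" for i by (auto simp: G_def)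
  have inner: "(\<lambda>x. \<Sum>y\<in>Y. u y * \<psi> k y x) \<in> Lp_space M p \<and> is_deriv (\<lambda>x. \<Sum>y\<in>Y. u y * \<psi> k y x) (\<lambda>x. \<Sum>y\<in>Y. u y * \<Psi> k y x)"
    if k: "k \<in> {1..R}" for k u
    by (rule is_deriv_sum[OF Y \<psi>[OF k]])
  have nxd: "nx u \<in> Lp_space M p \<and> is_deriv (nx u) (nd u)" for u
    unfolding nx_def nd_def by (rule is_deriv_sum[OF _ inner]) simp
  define N where "N = Lp_norm M p g"
  have N0: "0 \<le> N" unfolding N_def by (rule Lp_norm_nonneg[OF p is_deriv_Lp[OF g]])
  have FG: "F i \<in> Lp_space M p \<and> is_deriv (F i) (G i) \<and> Lp_norm M p (G i) \<le> (1/2) ^ i * N" for i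
  proof (induction i)
    case 0 then show ?case using f g by (simp add: F_0 G_0 N_def)
  next
    case (Suc i)
    have "Lp_norm M p (nd (F i)) \<le> 1/2 * Lp_norm M p (G i)"
      using contr[of "F i" "G i"] Suc unfolding nd_def e_def by simp
    also have "\<dots> \<le> 1/2 * ((1/2) ^ i * N)" using Suc by (intro mult_left_mono) auto
    finally show ?case using nxd[of "F i"] by (simp add: F_Suc G_Suc)
  qed
  have GL: "G i \<in> Lp_space M p" for i using FG is_deriv_Lp by blast
  define A where "A = {j. (lam j)\<^sup>2 * t < 1/2}"
  have A: "finite A" unfolding A_def by (rule finite_low_squares[OF t(1)])
  have AI: "A \<subseteq> I" using I(2) by (simp add: A_def)
  define hc where "hc = (\<lambda>i j. H ((lam j)\<^sup>2 * t) * coef (G i) j)"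
  have smG: "multiplier H t (G i) = (\<lambda>x. \<Sum>j\<in>A. hc i j * \<phi> j x)" for i
    unfolding multiplier_def[abs_def] A_def hc_def ..
  have smF: "multiplier H t (F i) = (\<lambda>x. \<Sum>j\<in>A. (hc i j * b (lam j)) * \<phi> j x)" for i
    using is_deriv_coef FG unfolding multiplier_def[abs_def] A_def[symmetric] hc_def
    by (intro ext sum.cong refl) (metis mult.assoc mult.commute)
  \<comment> \<open>On Y the bump functions reproduce the values of the smoothing error of
    \<open>F i\<close>; the new function carries exactly what the smoothed part leaves
    unmatched.\<close>
  have eF: "ev k (F (Suc i)) z = ev k (F i) z - (\<Sum>j\<in>A. (hc i j * b (lam j)) * ev k (\<phi> j) z)"
    if k: "k \<in> {1..R}" and z: "z \<in> Y" for i k z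
  proof -
    have r: "regular k (\<psi> l y)" if "l \<in> {1..R}" "y \<in> Y" for l y
      using approximation_limit(1)[OF _ _ t k] \<psi>[OF that] by blast
    have s1: "regular k (\<lambda>x. \<Sum>y\<in>Y. u y * \<psi> l y x) \<and> ev k (\<lambda>x. \<Sum>y\<in>Y. u y * \<psi> l y x) = (\<lambda>x. \<Sum>y\<in>Y. u y * ev k (\<psi> l y) x)"
      if "l \<in> {1..R}" for l u by (rule regular_sum[OF k Y r[OF that]])
    have "ev k (F (Suc i)) = (\<lambda>x. \<Sum>l\<in>{1..R}. 1 * ev k (\<lambda>x. \<Sum>y\<in>Y. e (F i) l y * \<psi> l y x) x)"
      unfolding F_Suc nx_def by (rule regular_sum[OF k _ s1[THEN conjunct1], THEN conjunct2]) simp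
    then have "ev k (F (Suc i)) z = (\<Sum>l\<in>{1..R}. \<Sum>y\<in>Y. e (F i) l y * ev k (\<psi> l y) z)"
      using s1 by simp
    also have "\<dots> = (\<Sum>l\<in>{1..R}. \<Sum>y\<in>Y. if l = k then if y = z then e (F i) k z else 0 else 0)"
      using val[OF _ _ k z] by (intro sum.cong refl) auto
    also have "\<dots> = (\<Sum>l\<in>{1..R}. if l = k then (\<Sum>y\<in>Y. if y = z then e (F i) k z else 0) else 0)"
      by (intro sum.cong refl) auto
    also have "\<dots> = e (F i) k z" using k z Y by simp
    also have "\<dots> = ev k (F i) z - ev k (multiplier H t (F i)) z"
      using regular_diff[OF k approximation_limit(1)[OF _ _ t k] multiplier_regular[OF k t(1)], of "F i" "G i" H "F i"] FG[of i]
      unfolding e_def by simp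
    also have "ev k (multiplier H t (F i)) z = (\<Sum>j\<in>A. (hc i j * b (lam j)) * ev k (\<phi> j) z)"
      unfolding smF poly_regular(2)[OF k A] ..
    finally show ?thesis .
  qed
  \<comment> \<open>Coefficients of the accumulated smoothed derivatives. By telescoping, the
    corresponding polynomials miss the values of f on Y by those of \<open>F n\<close>, which tend
    to 0 with the norms of \<open>G n\<close>.\<close>
  define an where "an = (\<lambda>n j. \<Sum>i<n. hc i j)"
  have evan: "(\<Sum>j\<in>A. (an n j * b (lam j)) * ev k (\<phi> j) z) = ev k f z - ev k (F n) z"
    if k: "k \<in> {1..R}" and z: "z \<in> Y" for n k z
  proof (induction n)
    case 0 then show ?case by (simp add: an_def F_0)
  next
    case (Suc n)
    have "(\<Sum>j\<in>A. (an (Suc n) j * b (lam j)) * ev k (\<phi> j) z) =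
        (\<Sum>j\<in>A. (an n j * b (lam j)) * ev k (\<phi> j) z) + (\<Sum>j\<in>A. (hc n j * b (lam j)) * ev k (\<phi> j) z)"
      by (simp add: an_def distrib_right sum.distrib)
    then show ?case using Suc eF[OF k z, of n] by simp
  qed
  have half: "(\<Sum>i<n. (1/2) ^ i * N) \<le> 2 * N" for n
  proof -
    have "(\<Sum>i<n. (1/2::real) ^ i) \<le> 2" by (simp add: sum_gp_strict)
    then show ?thesis unfolding sum_distrib_right[symmetric] using N0 by (rule mult_right_mono)
  qed
  have norm_an: "Lp_norm M p (\<lambda>x. \<Sum>j\<in>A. an n j * \<phi> j x) \<le> 2 * CH * N" for n
  proof -
    have "(\<lambda>x. \<Sum>j\<in>A. an n j * \<phi> j x) = (\<lambda>x. \<Sum>i<n. multiplier H t (G i) x)"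
      unfolding smG an_def sum_distrib_right by (intro ext sum.swap)
    moreover have "(\<lambda>x. \<Sum>i<n. multiplier H t (G i) x) \<in> Lp_space M p \<and>
       Lp_norm M p (\<lambda>x. \<Sum>i<n. multiplier H t (G i) x) \<le> (\<Sum>i<n. Lp_norm M p (multiplier H t (G i)))"
      by (rule Lp_sum[OF p _ multiplier_Lp]) simp
    moreover have "(\<Sum>i<n. Lp_norm M p (multiplier H t (G i))) \<le> (\<Sum>i<n. CH * ((1/2) ^ i * N))"
    proof (rule sum_mono)
      fix i
      have "Lp_norm M p (multiplier H t (G i)) \<le> CH * Lp_norm M p (G i)" by (rule CH(2)[OF t GL])
      also have "\<dots> \<le> CH * ((1/2) ^ i * N)" using FG CH(1) by (intro mult_left_mono) auto
      finally show "Lp_norm M p (multiplier H t (G i)) \<le> CH * ((1/2) ^ i * N)" .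
    qed
    moreover have "(\<Sum>i<n. CH * ((1/2) ^ i * N)) \<le> CH * (2 * N)"
      unfolding sum_distrib_left[symmetric] using half CH(1) by (intro mult_left_mono) auto
    ultimately show ?thesis by simp
  qed
  define a where "a = (\<lambda>j. \<Sum>i. hc i j)"
  have lim: "(\<lambda>n. an n j) \<longlonglongrightarrow> a j" for j
  proof -
    obtain B where B: "0 \<le> B" "\<forall>g\<in>Lp_space M p. \<bar>coef g j\<bar> \<le> B * Lp_norm M p g" using coef_bound by blast
    have hb: "norm (hc i j) \<le> (\<bar>H ((lam j)\<^sup>2 * t)\<bar> * (B * N)) * (1/2) ^ i" for i
    proof -
      have "\<bar>coef (G i) j\<bar> \<le> B * Lp_norm M p (G i)" using B(2) GL by blast
      also have "\<dots> \<le> B * ((1/2) ^ i * N)" using FG B(1) by (intro mult_left_mono) auto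
      finally have "\<bar>H ((lam j)\<^sup>2 * t)\<bar> * \<bar>coef (G i) j\<bar> \<le> \<bar>H ((lam j)\<^sup>2 * t)\<bar> * (B * ((1/2) ^ i * N))"
        by (intro mult_left_mono) auto
      then show ?thesis by (simp only: hc_def abs_mult real_norm_def mult_ac)
    qed
    have "summable (\<lambda>i. (\<bar>H ((lam j)\<^sup>2 * t)\<bar> * (B * N)) * (1/2 :: real) ^ i)"
      by (intro summable_mult summable_geometric) simp
    then have "summable (\<lambda>i. hc i j)" by (rule summable_comparison_test') (rule hb)
    then show ?thesis unfolding an_def a_def by (rule summable_LIMSEQ)
  qed
  have ev0: "(\<lambda>n. ev k (F n) z) \<longlonglongrightarrow> 0" if k: "k \<in> {1..R}" for k z
  proof -
    obtain C where C: "0 \<le> C" "\<forall>f g. f \<in> Lp_space M p \<longrightarrow> is_deriv f g \<longrightarrow> \<bar>ev k f z\<bar> \<le> C * Lp_norm M p g"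
      using ev_bound[OF k, of z] by (elim exE conjE)
    show ?thesis
    proof (rule Lim_null_comparison)
      show "\<forall>\<^sub>F n in sequentially. norm (ev k (F n) z) \<le> (C * N) * (1/2) ^ n"
      proof (rule always_eventually, rule allI)
        fix n
        have "\<bar>ev k (F n) z\<bar> \<le> C * Lp_norm M p (G n)"
          by (rule C(2)[THEN spec, THEN spec, THEN mp, THEN mp]) (use FG in auto)
        also have "\<dots> \<le> C * ((1/2) ^ n * N)" using FG C(1) by (intro mult_left_mono) auto
        finally show "norm (ev k (F n) z) \<le> (C * N) * (1/2) ^ n" by (simp only: real_norm_def mult_ac)
      qed
      have "(\<lambda>n. (C * N) * (1/2 :: real) ^ n) \<longlonglongrightarrow> (C * N) * 0" by (intro tendsto_mult tendsto_const LIMSEQ_power_zero) simp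
      then show "(\<lambda>n. (C * N) * (1/2 :: real) ^ n) \<longlonglongrightarrow> 0" by simp
    qed
  qed
  have eva: "(\<Sum>j\<in>A. (a j * b (lam j)) * ev k (\<phi> j) z) = ev k f z" if k: "k \<in> {1..R}" and z: "z \<in> Y" for k z
  proof -
    have "(\<lambda>n. \<Sum>j\<in>A. (an n j * b (lam j)) * ev k (\<phi> j) z) \<longlonglongrightarrow> (\<Sum>j\<in>A. (a j * b (lam j)) * ev k (\<phi> j) z)"
      by (intro tendsto_sum tendsto_mult tendsto_const lim)
    moreover have "(\<lambda>n. ev k f z - ev k (F n) z) \<longlonglongrightarrow> ev k f z - 0" by (intro tendsto_diff tendsto_const ev0 k)
    ultimately show ?thesis using evan[OF k z] LIMSEQ_unique by simp
  qed
  have norm_a: "Lp_norm M p (\<lambda>x. \<Sum>j\<in>A. a j * \<phi> j x) \<le> 2 * CH * N"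
  proof -
    have sgn: "Lp_norm M p (\<lambda>x. 0 - u x) = Lp_norm M p u" for u :: "'a \<Rightarrow> real" by (simp add: Lp_norm_def)
    have "Lp_norm M p (\<lambda>x. \<Sum>j\<in>A. a j * \<phi> j x) \<le> 2 * CH * N + (\<Sum>j\<in>A. \<bar>an n j - a j\<bar> * Lp_norm M p (\<phi> j))" for n
      using poly_norm_lipschitz[OF A, of "\<lambda>x. 0" a "an n"] norm_an[of n] continuous_Lp[OF p, of "\<lambda>x. 0"]
      unfolding sgn by simp
    moreover have "(\<lambda>n. 2 * CH * N + (\<Sum>j\<in>A. \<bar>an n j - a j\<bar> * Lp_norm M p (\<phi> j))) \<longlonglongrightarrow> 2 * CH * N + (\<Sum>j\<in>A. \<bar>a j - a j\<bar> * Lp_norm M p (\<phi> j))"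
      by (intro tendsto_add tendsto_const tendsto_sum tendsto_mult tendsto_rabs tendsto_diff lim)
    then have "(\<lambda>n. 2 * CH * N + (\<Sum>j\<in>A. \<bar>an n j - a j\<bar> * Lp_norm M p (\<phi> j))) \<longlonglongrightarrow> 2 * CH * N" by simp
    ultimately show ?thesis by (intro tendsto_lowerbound) (auto intro!: always_eventually)
  qed
  \<comment> \<open>Padding with zeros: I may contain frequencies beyond those kept by the
    smoothing.\<close>
  define c where "c = (\<lambda>j. if j \<in> A then a j else 0)"
  have csum: "(\<Sum>j\<in>I. (c j * v j) * u j) = (\<Sum>j\<in>A. (a j * v j) * u j)" for v u :: "nat \<Rightarrow> real"
    using AI I(1) by (intro sum.mono_neutral_cong_right) (auto simp: c_def)
  show ?thesis
  proof (intro exI[of _ c] conjI ballI allI impI)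
    show "c j = 0" if "j \<notin> I" for j using that AI by (auto simp: c_def)
    show "ev k (\<lambda>x. \<Sum>j\<in>I. (c j * b (lam j)) * \<phi> j x) y = ev k f y" if "k \<in> {1..R}" "y \<in> Y" for k y
      unfolding csum poly_regular(2)[OF that(1) A] by (rule eva[OF that])
    show "Lp_norm M p (\<lambda>x. \<Sum>j\<in>I. c j * \<phi> j x) \<le> 2 * CH * Lp_norm M p g"
      using norm_a csum[of "\<lambda>_. 1"] by (simp add: N_def)
  qed
qed

text \<open>Within B the predicate is the same for functions that agree almost everywhere, so the
  choice operator returns literally the same polynomial for both.\<close>

lemma class_map_choice:
  assumes ex: "\<And>f. f \<in> V \<Longrightarrow> \<exists>Q\<in>B. X f Q"
    and cong: "\<And>f g Q. f \<in> V \<Longrightarrow> g \<in> V \<Longrightarrow> AE x in M. f x = g x \<Longrightarrow> Q \<in> B \<Longrightarrow> X f Q = X g Q"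
  shows "\<exists>P. class_map M V B P \<and> (\<forall>f\<in>V. X f (P f))"
proof -
  define P where "P = (\<lambda>f. SOME Q. Q \<in> B \<and> X f Q)"
  have P: "P f \<in> B \<and> X f (P f)" if "f \<in> V" for f
    using someI_ex[of "\<lambda>Q. Q \<in> B \<and> X f Q"] ex[OF that] unfolding P_def by blast
  have "P f = P g" if "f \<in> V" "g \<in> V" "AE x in M. f x = g x" for f g
    unfolding P_def by (rule arg_cong[where f = Eps]) (use cong[OF that] in blast)
  then have "class_map M V B P" using P unfolding class_map_def by blast
  then show ?thesis using P by blast
qed

section \<open>Interpolation conditions as linear equations for point values\<close>

lemma W_regular:
  assumes k: "k \<in> {1..R}" and f: "f \<in> W_space" shows "regular k f"
proof -
  obtain g where "f \<in> Lp_space M p" "is_deriv f g" using f unfolding sobolev_space_def by blast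
  then show ?thesis using approximation_limit(1)[OF _ _ _ _ k, of f g 1] by simp
qed

lemma regular_has_value_iff:
  assumes f: "regular k f" shows "has_value_at M (L k f) y v \<longleftrightarrow> ev k f y = v"
proof
  show "has_value_at M (L k f) y v \<Longrightarrow> ev k f y = v" by (rule has_value_ev)
  assume "ev k f y = v"
  then show "has_value_at M (L k f) y v" using regular_has_value[OF f, of y] by (rule subst)
qed

lemma interpolates_iff:
  assumes f: "f \<in> W_space"
  shows "interpolates M R D L Y f Q \<longleftrightarrow> (\<forall>k\<in>{1..R}. Q \<in> D k \<and> (\<forall>y\<in>Y. has_value_at M (L k Q) y (ev k f y)))"
proof -
  have fD: "f \<in> D k" if "k \<in> {1..R}" for k using W_regular[OF that f] unfolding regular_def by blast
  have hv: "has_value_at M (L k f) y v \<longleftrightarrow> ev k f y = v" if "k \<in> {1..R}" for k y v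
    by (rule regular_has_value_iff[OF W_regular[OF that f]])
  show ?thesis unfolding interpolates_def
  proof (intro ball_cong refl)
    fix k assume k: "k \<in> {1..R}"
    show "(Q \<in> D k \<and> f \<in> D k \<and> (\<forall>y\<in>Y. \<exists>v. has_value_at M (L k Q) y v \<and> has_value_at M (L k f) y v)) =
        (Q \<in> D k \<and> (\<forall>y\<in>Y. has_value_at M (L k Q) y (ev k f y)))"
      using fD[OF k] hv[OF k] by simp
  qed
qed

lemma interpolates_poly_iff:
  assumes f: "f \<in> W_space" and I: "finite I"
  shows "interpolates M R D L Y f (\<lambda>x. \<Sum>j\<in>I. a j * \<phi> j x) \<longleftrightarrow>
    (\<forall>k\<in>{1..R}. \<forall>y\<in>Y. ev k (\<lambda>x. \<Sum>j\<in>I. a j * \<phi> j x) y = ev k f y)"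
proof -
  have r: "regular k (\<lambda>x. \<Sum>j\<in>I. a j * \<phi> j x)" if "k \<in> {1..R}" for k by (rule poly_regular(1)[OF that I])
  have fD: "(\<lambda>x. \<Sum>j\<in>I. a j * \<phi> j x) \<in> D k" if "k \<in> {1..R}" for k using r[OF that] unfolding regular_def by blast
  have hv: "has_value_at M (L k (\<lambda>x. \<Sum>j\<in>I. a j * \<phi> j x)) y v \<longleftrightarrow> ev k (\<lambda>x. \<Sum>j\<in>I. a j * \<phi> j x) y = v"
    if "k \<in> {1..R}" for k y v
    by (rule regular_has_value_iff[OF r[OF that]])
  show ?thesis unfolding interpolates_iff[OF f]
    by (intro ball_cong refl) (simp only: fD hv simp_thms)
qed

lemma interpolates_cong:
  assumes f: "f \<in> W_space" and g: "g \<in> W_space" and fg: "AE x in M. f x = g x"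
  shows "interpolates M R D L Y f = interpolates M R D L Y g"
proof -
  have "ev k g = ev k f" if k: "k \<in> {1..R}" for k
    using regular_cong_AE[OF k W_regular[OF k f] _ fg] g unfolding sobolev_space_def by blast
  then show ?thesis by (intro ext) (simp add: interpolates_iff[OF f] interpolates_iff[OF g])
qed

lemma sobolev_norm_cong:
  assumes f: "f \<in> Lp_space M p" and g: "g \<in> Lp_space M p" and fg: "AE x in M. f x = g x"
  shows "sobolev_norm M lam \<phi> p b f = sobolev_norm M lam \<phi> p b g"
proof -
  have [measurable]: "f \<in> borel_measurable M" "g \<in> borel_measurable M" "\<phi> k \<in> borel_measurable M" for k
    using Lp_measurable[OF f] Lp_measurable[OF g] Lp_measurable[OF phi_Lp] by blast+
  have "coef f k = coef g k" for k
    unfolding fourier_coeff_def by (rule integral_cong_AE) (use fg in auto)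
  then have "coef f = coef g" by blast
  then show ?thesis unfolding sobolev_norm_def sobolev_deriv_def is_sobolev_deriv_def by simp
qed

text \<open>The coefficients are divided by the positive numbers b(lam j). In this parametrization c
  holds the coefficients of the derivative, on which the Sobolev norm is an L^p norm.\<close>

lemma diffusion_poly_form:
  assumes "T \<in> diffusion_polys lam \<phi> n"
  obtains c where "\<And>j. j \<notin> {k. lam k < n} \<Longrightarrow> c j = 0" "T = (\<lambda>x. \<Sum>j\<in>{k. lam k < n}. (c j * b (lam j)) * \<phi> j x)"
proof -
  obtain a where a: "T = (\<lambda>x. \<Sum>j\<in>{k. lam k < n}. a j * \<phi> j x)" using assms unfolding diffusion_polys_def by blast
  show thesis
  proof (rule that[of "\<lambda>j. if lam j < n then a j / b (lam j) else 0"])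
    have "a j = (if lam j < n then a j / b (lam j) else 0) * b (lam j)" if "j \<in> {k. lam k < n}" for j
      using that b_pos[of j] by simp
    then show "T = (\<lambda>x. \<Sum>j\<in>{k. lam k < n}. ((if lam j < n then a j / b (lam j) else 0) * b (lam j)) * \<phi> j x)"
      unfolding a by (intro ext sum.cong refl arg_cong2[where f = "(*)"])
  qed simp
qed

text \<open>With t = 1 / N^2 the smoothing keeps only frequencies below N. A best approximation is
  corrected by a polynomial that interpolates its error on Y, at the cost of 2 CH times that error;
  hence the constant 1 + 2 CH. The minimal norm is attained because the interpolation conditions are
  closed and, by the same polynomials, solvable.\<close>

lemma interpolation_at:
  fixes N :: nat
  assumes Y: "finite Y" and N: "0 < N" and t: "t = 1 / (real N)\<^sup>2"
    and \<psi>: "\<And>k y. k \<in> {1..R} \<Longrightarrow> y \<in> Y \<Longrightarrow> \<psi> k y \<in> Lp_space M p \<and> is_deriv (\<psi> k y) (\<Psi> k y)"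
    and val: "\<And>k y i z. k \<in> {1..R} \<Longrightarrow> y \<in> Y \<Longrightarrow> i \<in> {1..R} \<Longrightarrow> z \<in> Y \<Longrightarrow> ev i (\<psi> k y) z = (if i = k \<and> z = y then 1 else 0)"
    and contr: "\<And>f g. f \<in> Lp_space M p \<Longrightarrow> is_deriv f g \<Longrightarrow>
       Lp_norm M p (\<lambda>x. \<Sum>k\<in>{1..R}. \<Sum>y\<in>Y. ev k (\<lambda>x. f x - multiplier H t f x) y * \<Psi> k y x) \<le> 1/2 * Lp_norm M p g"
  shows "\<exists>P. class_map M W_space (diffusion_polys lam \<phi> (real N)) P \<and> (\<forall>f\<in>W_space. interpolates M R D L Y f (P f) \<and>
        sobolev_norm M lam \<phi> p b (\<lambda>x. f x - P f x)
          \<le> (1 + 2 * CH) * (INF T\<in>diffusion_polys lam \<phi> (real N). sobolev_norm M lam \<phi> p b (\<lambda>x. f x - T x)))"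
    and "\<exists>P. class_map M W_space (diffusion_polys lam \<phi> (real N)) P \<and> (\<forall>f\<in>W_space.
        is_arg_min (sobolev_norm M lam \<phi> p b)
          (\<lambda>Q. Q \<in> diffusion_polys lam \<phi> (real N) \<and> interpolates M R D L Y f Q) (P f))"
proof -
  define I where "I = {k. lam k < real N}"
  have I: "finite I" unfolding I_def by (rule finite_low_frequencies)
  define poly where "poly = (\<lambda>c x. \<Sum>j\<in>I. (c j * b (lam j)) * \<phi> j x)"
  define dpoly where "dpoly = (\<lambda>c x. \<Sum>j\<in>I. c j * \<phi> j x)"
  let ?\<Pi> = "diffusion_polys lam \<phi> (real N)"
  have poly_in: "poly c \<in> ?\<Pi>" for c
    unfolding poly_def I_def diffusion_polys_def by (intro CollectI exI[of _ "\<lambda>j. c j * b (lam j)"] conjI TrueI refl)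
  have polyL: "poly c \<in> Lp_space M p" for c unfolding poly_def by (rule poly_Lp)
  have dpolyL: "dpoly c \<in> Lp_space M p" for c unfolding dpoly_def by (rule poly_Lp)
  have polyd: "is_deriv (poly c) (dpoly c)" for c unfolding poly_def dpoly_def by (rule is_deriv_poly[OF I])
  have form: "\<exists>c. (\<forall>j. j \<notin> I \<longrightarrow> c j = 0) \<and> T = poly c" if T: "T \<in> ?\<Pi>" for T
  proof (rule diffusion_poly_form[OF T])
    fix c assume c: "\<And>j. j \<notin> {k. lam k < real N} \<Longrightarrow> c j = 0" "T = (\<lambda>x. \<Sum>j\<in>{k. lam k < real N}. (c j * b (lam j)) * \<phi> j x)"
    show ?thesis
    proof (intro exI[of _ c] conjI allI impI)
      show "c j = 0" if "j \<notin> I" for j by (rule c(1)) (use that in \<open>simp add: I_def\<close>)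
      show "T = poly c" unfolding poly_def I_def by (rule c(2))
    qed
  qed
  have N1: "1 \<le> real N" using N by simp
  have t01: "0 < t" "t \<le> 1" unfolding t using N1 one_le_power[OF N1, of 2] by (auto simp: divide_le_eq)
  have sub: "{j. (lam j)\<^sup>2 * t < 1/2} \<subseteq> I"
  proof
    fix j assume "j \<in> {j. (lam j)\<^sup>2 * t < 1/2}"
    then have "(lam j)\<^sup>2 * 2 < (real N)\<^sup>2" using N unfolding t by (simp add: divide_less_eq)
    then have "(lam j)\<^sup>2 < (real N)\<^sup>2" using zero_le_power2[of "lam j"] by linarith
    then have "lam j < real N" by (rule power2_less_imp_less) simp
    then show "j \<in> I" by (simp add: I_def)
  qed
  have ip: "\<exists>c. (\<forall>j. j \<notin> I \<longrightarrow> c j = 0) \<and> (\<forall>k\<in>{1..R}. \<forall>y\<in>Y. ev k (poly c) y = ev k f y) \<and>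
      Lp_norm M p (dpoly c) \<le> 2 * CH * Lp_norm M p g" if fg: "f \<in> Lp_space M p" "is_deriv f g" for f g
    unfolding poly_def dpoly_def by (rule interpolating_poly[OF Y t01 I sub \<psi> val contr fg])
  have itp: "interpolates M R D L Y f (poly c) \<longleftrightarrow> (\<forall>k\<in>{1..R}. \<forall>y\<in>Y. ev k (poly c) y = ev k f y)" if "f \<in> W_space" for f c
    unfolding poly_def by (rule interpolates_poly_iff[OF that I])
  have evp: "ev k (poly c) y = (\<Sum>j\<in>I. (c j * b (lam j)) * ev k (\<phi> j) y)" if "k \<in> {1..R}" for k c y
    unfolding poly_def poly_regular(2)[OF that I] ..
  define Z where "Z = {c :: nat \<Rightarrow> real. \<forall>j. j \<notin> I \<longrightarrow> c j = 0}"
  have Zc: "closed Z"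
  proof -
    have "Z = (\<Inter>j\<in>- I. {c. c j = 0})" by (auto simp: Z_def)
    moreover have "closed {c :: nat \<Rightarrow> real. c j = 0}" for j by (intro closed_Collect_eq continuous_on_product_coordinates continuous_on_const)
    ultimately show ?thesis by auto
  qed
  have Z0: "c k = 0" if "c \<in> Z" "k \<notin> I" for c k using that by (simp add: Z_def)
  show "\<exists>P. class_map M W_space ?\<Pi> P \<and> (\<forall>f\<in>W_space. interpolates M R D L Y f (P f) \<and>
        sobolev_norm M lam \<phi> p b (\<lambda>x. f x - P f x)
          \<le> (1 + 2 * CH) * (INF T\<in>?\<Pi>. sobolev_norm M lam \<phi> p b (\<lambda>x. f x - T x)))"
  proof (rule class_map_choice)
    fix f assume f: "f \<in> W_space"
    then obtain g where fL: "f \<in> Lp_space M p" and g: "is_deriv f g" unfolding sobolev_space_def by blast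
    note gL = is_deriv_Lp[OF g]
    have nrm: "sobolev_norm M lam \<phi> p b (\<lambda>x. f x - poly c x) = Lp_norm M p (\<lambda>x. g x - dpoly c x)" for c
      by (rule sobolev_norm_eq[OF is_deriv_diff(2)[OF fL g polyL polyd]])
    have "(\<lambda>_. 0) \<in> Z" by (simp add: Z_def)
    then have "Z \<noteq> {}" by blast
    have "\<exists>c\<in>Z. \<forall>c'\<in>Z. Lp_norm M p (\<lambda>x. g x - dpoly c x) \<le> Lp_norm M p (\<lambda>x. g x - dpoly c' x)"
      unfolding dpoly_def by (rule minimum_attained[of I Z g]) (fact I Zc \<open>Z \<noteq> {}\<close> Z0 gL)+
    then obtain c0 where c0: "c0 \<in> Z" and c0m: "\<forall>c'\<in>Z. Lp_norm M p (\<lambda>x. g x - dpoly c0 x) \<le> Lp_norm M p (\<lambda>x. g x - dpoly c' x)"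
      by (rule bexE)
    define r where "r = (\<lambda>x. g x - dpoly c0 x)"
    note df = is_deriv_diff[OF fL g polyL polyd, of c0]
    obtain c1 where c1: "\<forall>k\<in>{1..R}. \<forall>y\<in>Y. ev k (poly c1) y = ev k (\<lambda>x. f x - poly c0 x) y"
      "Lp_norm M p (dpoly c1) \<le> 2 * CH * Lp_norm M p r"
      using ip[OF df] unfolding r_def by blast
    define c where "c = (\<lambda>j. c0 j + c1 j)"
    have dc: "dpoly c = (\<lambda>x. dpoly c0 x + dpoly c1 x)" by (simp add: dpoly_def c_def distrib_right sum.distrib)
    have "ev k (poly c) y = ev k f y" if k: "k \<in> {1..R}" and y: "y \<in> Y" for k y
    proof -
      have "ev k (poly c) y = ev k (poly c0) y + ev k (poly c1) y"
        unfolding evp[OF k] c_def by (simp add: distrib_right sum.distrib)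
      moreover have "regular k (poly c0)" unfolding poly_def by (rule poly_regular(1)[OF k I])
      then have "ev k (\<lambda>x. f x - poly c0 x) y = ev k f y - ev k (poly c0) y"
        using regular_diff[OF k W_regular[OF k f]] by simp
      ultimately show ?thesis using c1(1) k y by simp
    qed
    then have "interpolates M R D L Y f (poly c)" using itp[OF f] by blast
    moreover have "sobolev_norm M lam \<phi> p b (\<lambda>x. f x - poly c x) \<le> (1 + 2 * CH) * (INF T\<in>?\<Pi>. sobolev_norm M lam \<phi> p b (\<lambda>x. f x - T x))"
    proof -
      have rL: "r \<in> Lp_space M p" unfolding r_def by (rule Lp_diff(1)[OF p gL dpolyL])
      have "(\<lambda>x. g x - dpoly c x) = (\<lambda>x. r x - dpoly c1 x)" unfolding dc r_def by (simp add: algebra_simps)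
      then have "sobolev_norm M lam \<phi> p b (\<lambda>x. f x - poly c x) \<le> Lp_norm M p r + Lp_norm M p (dpoly c1)"
        unfolding nrm using Lp_diff(2)[OF p rL dpolyL] by simp
      also have "\<dots> \<le> (1 + 2 * CH) * Lp_norm M p r" using c1(2) by (simp add: distrib_right)
      also have "\<dots> \<le> (1 + 2 * CH) * (INF T\<in>?\<Pi>. sobolev_norm M lam \<phi> p b (\<lambda>x. f x - T x))"
      proof (rule mult_left_mono)
        show "Lp_norm M p r \<le> (INF T\<in>?\<Pi>. sobolev_norm M lam \<phi> p b (\<lambda>x. f x - T x))"
        proof (rule cINF_greatest)
          show "?\<Pi> \<noteq> {}" using poly_in by blast
          fix T assume "T \<in> ?\<Pi>"
          from form[OF this] obtain c' where "\<forall>j. j \<notin> I \<longrightarrow> c' j = 0" and T: "T = poly c'" by blast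
          then have "c' \<in> Z" by (simp add: Z_def)
          from c0m[rule_format, OF this] show "Lp_norm M p r \<le> sobolev_norm M lam \<phi> p b (\<lambda>x. f x - T x)"
            unfolding T nrm r_def .
        qed
      qed (use CH(1) in simp)
      finally show ?thesis .
    qed
    ultimately show "\<exists>Q\<in>?\<Pi>. interpolates M R D L Y f Q \<and> sobolev_norm M lam \<phi> p b (\<lambda>x. f x - Q x)
          \<le> (1 + 2 * CH) * (INF T\<in>?\<Pi>. sobolev_norm M lam \<phi> p b (\<lambda>x. f x - T x))"
      using poly_in by blast
  next
    fix f g Q assume fg: "f \<in> W_space" "g \<in> W_space" "AE x in M. f x = g x" and Q: "Q \<in> ?\<Pi>"
    have nrm: "sobolev_norm M lam \<phi> p b (\<lambda>x. f x - T x) = sobolev_norm M lam \<phi> p b (\<lambda>x. g x - T x)" if "T \<in> ?\<Pi>" for T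
    proof (rule sobolev_norm_cong)
      have TL: "T \<in> Lp_space M p" using form[OF that] polyL by blast
      show "(\<lambda>x. f x - T x) \<in> Lp_space M p" "(\<lambda>x. g x - T x) \<in> Lp_space M p"
        using fg by (auto simp: sobolev_space_def intro!: Lp_diff(1)[OF p _ TL])
      show "AE x in M. f x - T x = g x - T x" using fg(3) by eventually_elim simp
    qed
    \<comment> \<open>The infimum depends only on the class of f, as required for choosing a map on
      classes.\<close>
    have inf_eq: "(INF T\<in>?\<Pi>. sobolev_norm M lam \<phi> p b (\<lambda>x. f x - T x)) = (INF T\<in>?\<Pi>. sobolev_norm M lam \<phi> p b (\<lambda>x. g x - T x))"
      by (rule arg_cong[where f = Inf], rule image_cong[OF refl nrm])
    show "(interpolates M R D L Y f Q \<and> sobolev_norm M lam \<phi> p b (\<lambda>x. f x - Q x)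
          \<le> (1 + 2 * CH) * (INF T\<in>?\<Pi>. sobolev_norm M lam \<phi> p b (\<lambda>x. f x - T x))) =
        (interpolates M R D L Y g Q \<and> sobolev_norm M lam \<phi> p b (\<lambda>x. g x - Q x)
          \<le> (1 + 2 * CH) * (INF T\<in>?\<Pi>. sobolev_norm M lam \<phi> p b (\<lambda>x. g x - T x)))"
      unfolding inf_eq nrm[OF Q] interpolates_cong[OF fg] ..
  qed
  show "\<exists>P. class_map M W_space ?\<Pi> P \<and> (\<forall>f\<in>W_space.
        is_arg_min (sobolev_norm M lam \<phi> p b) (\<lambda>Q. Q \<in> ?\<Pi> \<and> interpolates M R D L Y f Q) (P f))"
  proof (rule class_map_choice)
    fix f assume f: "f \<in> W_space"
    then obtain g where fL: "f \<in> Lp_space M p" and g: "is_deriv f g" unfolding sobolev_space_def by blast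
    define \<A> where "\<A> = {c\<in>Z. \<forall>k\<in>{1..R}. \<forall>y\<in>Y. ev k (poly c) y = ev k f y}"
    have "\<A> = Z \<inter> (\<Inter>k\<in>{1..R}. \<Inter>y\<in>Y. {c. (\<Sum>j\<in>I. (c j * b (lam j)) * ev k (\<phi> j) y) = ev k f y})"
      using evp by (auto simp: \<A>_def)
    moreover have "closed {c :: nat \<Rightarrow> real. (\<Sum>j\<in>I. (c j * b (lam j)) * ev k (\<phi> j) y) = ev k f y}" for k y
      by (intro closed_Collect_eq continuous_on_sum continuous_on_mult continuous_on_product_coordinates continuous_on_const)
    ultimately have \<A>c: "closed \<A>" using Zc by (simp add: closed_Int closed_INT)
    have \<A>0: "\<A> \<noteq> {}" using ip[OF fL g] unfolding \<A>_def Z_def by blast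
    have \<A>Z: "c k = 0" if "c \<in> \<A>" "k \<notin> I" for c k using that Z0 by (simp add: \<A>_def)
    have zL: "(\<lambda>x::'a. 0) \<in> Lp_space M p" by (intro continuous_Lp[OF p] continuous_intros)
    \<comment> \<open>The Sobolev norm of a polynomial is the distance of its derivative from 0, so
      attainment of the distance gives the minimal norm.\<close>
    have "\<exists>c\<in>\<A>. \<forall>c'\<in>\<A>. Lp_norm M p (\<lambda>x. 0 - dpoly c x) \<le> Lp_norm M p (\<lambda>x. 0 - dpoly c' x)"
      unfolding dpoly_def by (rule minimum_attained[of I \<A> "\<lambda>x. 0"]) (fact I \<A>c \<A>0 \<A>Z zL)+
    then obtain c where c: "c \<in> \<A>" and cm: "\<forall>c'\<in>\<A>. Lp_norm M p (\<lambda>x. 0 - dpoly c x) \<le> Lp_norm M p (\<lambda>x. 0 - dpoly c' x)"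
      by (rule bexE)
    have nrm: "sobolev_norm M lam \<phi> p b (poly c) = Lp_norm M p (\<lambda>x. 0 - dpoly c x)" for c
      unfolding sobolev_norm_eq[OF polyd] by (simp add: Lp_norm_def)
    have "\<not> (\<exists>T. (T \<in> ?\<Pi> \<and> interpolates M R D L Y f T) \<and> sobolev_norm M lam \<phi> p b T < sobolev_norm M lam \<phi> p b (poly c))"
    proof
      assume "\<exists>T. (T \<in> ?\<Pi> \<and> interpolates M R D L Y f T) \<and> sobolev_norm M lam \<phi> p b T < sobolev_norm M lam \<phi> p b (poly c)"
      then obtain T where T: "T \<in> ?\<Pi>" "interpolates M R D L Y f T" "sobolev_norm M lam \<phi> p b T < sobolev_norm M lam \<phi> p b (poly c)" by blast
      from form[OF T(1)] obtain c' where c': "\<forall>j. j \<notin> I \<longrightarrow> c' j = 0" and Tc: "T = poly c'" by blast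
      have "c' \<in> \<A>" using c' T(2) itp[OF f] unfolding Tc \<A>_def Z_def by blast
      from cm[rule_format, OF this] T(3) show False unfolding Tc nrm by simp
    qed
    moreover have "interpolates M R D L Y f (poly c)" using c itp[OF f] unfolding \<A>_def by blast
    ultimately show "\<exists>Q\<in>?\<Pi>. is_arg_min (sobolev_norm M lam \<phi> p b) (\<lambda>Q. Q \<in> ?\<Pi> \<and> interpolates M R D L Y f Q) Q"
      unfolding is_arg_min_def using poly_in by blast
  next
    fix f g Q assume fg: "f \<in> W_space" "g \<in> W_space" "AE x in M. f x = g x"
    show "is_arg_min (sobolev_norm M lam \<phi> p b) (\<lambda>Q. Q \<in> ?\<Pi> \<and> interpolates M R D L Y f Q) Q =
        is_arg_min (sobolev_norm M lam \<phi> p b) (\<lambda>Q. Q \<in> ?\<Pi> \<and> interpolates M R D L Y g Q) Q"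
      unfolding interpolates_cong[OF fg] ..
  qed
qed

end

section \<open>Masks on a dyadic window\<close>

lemma bounded_derivs_shift:
  "bounded_derivs n I C f \<Longrightarrow> (\<And>x. x \<in> J \<Longrightarrow> c + x \<in> I) \<Longrightarrow> bounded_derivs n J C (\<lambda>x. f (c + x))"
proof (induction n arbitrary: f)
  case 0 then show ?case by simp
next
  case (Suc n)
  obtain f' where f': "\<And>x. x \<in> I \<Longrightarrow> (f has_real_derivative f' x) (at x)" "bounded_derivs n I C f'"
    by (rule bounded_derivs_SucE[OF Suc.prems(1)]) blast
  show ?case
  proof (rule bounded_derivs_SucI)
    show "\<bar>f (c + x)\<bar> \<le> C" if "x \<in> J" for x by (rule bounded_derivs_bound[OF Suc.prems(1) Suc.prems(2)[OF that]])
    show "((\<lambda>x. f (c + x)) has_real_derivative f' (c + x)) (at x)" if "x \<in> J" for x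
    proof -
      have d: "((\<lambda>x. c + x) has_real_derivative 1) (at x)" by (auto intro!: derivative_eq_intros)
      from DERIV_chain2[OF f'(1)[OF Suc.prems(2)[OF that]] d] show ?thesis by simp
    qed
    show "bounded_derivs n J C (\<lambda>x. f' (c + x))" by (rule Suc.IH[OF f'(2) Suc.prems(2)])
  qed
qed

text \<open>For t > 0 the lower bound on F applies. The representation through ln t says nothing at
  t = 0, where continuity of b extends the bound from the right.\<close>

lemma mask_pos:
  assumes m: "mask_of_type S \<beta> b" and t: "0 \<le> t"
  shows "0 < b t"
proof -
  obtain F c where F: "\<forall>t>0. b t = (1 + t) powr (- \<beta>) * F (ln t)" and c: "0 < c" "\<forall>t. c \<le> F t"
    using m unfolding mask_of_type_def by blast
  have lb: "(1 + t) powr (- \<beta>) * c \<le> b t" if "0 < t" for t :: real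
    using F c that by (auto intro!: mult_left_mono)
  show ?thesis
  proof (cases "t = 0")
    case False
    then have "0 < (1 + t) powr (- \<beta>) * c" using t c(1) by simp
    then show ?thesis using lb[of t] t False by linarith
  next
    case True
    have "cont_diff (S + 1) b" using m unfolding mask_of_type_def by (elim conjE)
    then have "\<forall>k<S + 1. \<forall>x. ((deriv ^^ k) b) differentiable (at x)" unfolding cont_diff_def by (rule conjunct1)
    from this[rule_format, of 0 0] have "b differentiable (at 0)" by simp
    then have "isCont b 0" by (rule differentiable_imp_continuous_within)
    then have b0: "(b \<longlongrightarrow> b 0) (at_right 0)" unfolding isCont_def by (rule tendsto_within_subset) simp
    have "isCont (\<lambda>t. (1 + t) powr (- \<beta>) * c) 0" by (intro continuous_intros) auto
    then have "((\<lambda>t. (1 + t) powr (- \<beta>) * c) \<longlongrightarrow> (1 + 0) powr (- \<beta>) * c) (at 0)" unfolding isCont_def .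
    then have "((\<lambda>t. (1 + t) powr (- \<beta>) * c) \<longlongrightarrow> (1 + 0) powr (- \<beta>) * c) (at_right 0)" by (rule tendsto_within_subset) simp
    moreover have "\<forall>\<^sub>F t in at_right 0. (1 + t) powr (- \<beta>) * c \<le> b t"
      unfolding eventually_at_right_field using lb by (intro exI[of _ 1]) auto
    ultimately have "(1 + 0) powr (- \<beta>) * c \<le> b 0" using b0 by (intro tendsto_le[OF trivial_limit_at_right_real b0])
    then show ?thesis using c(1) True by simp
  qed
qed

text \<open>Scaling: b(sqrt (s / t)) equals t^(\<beta>/2) (sqrt t + sqrt s)^(-\<beta>) F((ln s - ln
  t) / 2). On the window s stays away from 0 and sqrt t is at most 1, and a shift of the argument
  does not affect bounds on derivatives of F; all but the power of t is therefore uniform in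
  t.\<close>

lemma mask_window:
  assumes b: "\<And>t. 0 < t \<Longrightarrow> b t = (1 + t) powr (- \<beta>) * F (ln t)"
    and F: "bounded_derivs n UNIV c F" "0 \<le> c"
    and H: "bounded_derivs n {-5<..<5} C0 H" "0 \<le> C0" "\<And>s. -5 < s \<Longrightarrow> s \<le> 1/4 \<Longrightarrow> H s = 1" "\<And>s. 1/2 \<le> s \<Longrightarrow> H s = 0"
  shows "\<exists>C>0. \<forall>t. 0 < t \<longrightarrow> t \<le> 1 \<longrightarrow> bounded_derivs n {-1<..<1} (C * t powr (\<beta> / 2))
     (\<lambda>s. if s \<le> 1/32 then 0 else exp s * (H s - H (4 * s)) * b (sqrt (s / t)))"
proof -
  \<comment> \<open>The difference of cutoffs lives on [1/16, 1/2], a closed subset of I, which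
    allows the extension by 0; J contains the square roots of the points of I.\<close>
  define I where "I = {1/32<..<1::real}"
  define J where "J = {1/10<..<2::real}"
  obtain C1 where C1: "0 \<le> C1" "bounded_derivs n {0<..<2} C1 (\<lambda>x. exp (1 * x :: real))"
    using bounded_derivs_exp[of n 0 2 1] by blast
  have e: "bounded_derivs n I C1 (\<lambda>x. exp (1 * x))"
    by (rule bounded_derivs_mono[OF C1(2)]) (auto simp: I_def)
  have H': "bounded_derivs n I C0 H" by (rule bounded_derivs_mono[OF H(1)]) (auto simp: I_def)
  have "4 * x + 0 \<in> {-5<..<5}" if "x \<in> I" for x using that by (simp add: I_def)
  from bounded_derivs_affine[OF H(1) this H(2)] obtain C2 where C2: "0 \<le> C2" "bounded_derivs n I C2 (\<lambda>x. H (4 * x + 0))" by blast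
  define CU where "CU = 2 ^ n * C1 * (C0 + 2 ^ n * \<bar>-1\<bar> * C2)"
  have CU: "0 \<le> CU" unfolding CU_def using C1(1) C2(1) H(2) by simp
  have U: "bounded_derivs n I CU (\<lambda>s. exp (1 * s) * (H s + - 1 * H (4 * s + 0)))"
    unfolding CU_def
    by (intro bounded_derivs_mult[OF e] bounded_derivs_add[OF H'] bounded_derivs_mult[OF bounded_derivs_const C2(2)])
      (use C1(1) C2(1) H(2) in auto)
  obtain C3 where C3: "0 \<le> C3" "bounded_derivs n {1/10<..<3} C3 (\<lambda>x. x powr (- \<beta>))"
    using bounded_derivs_powr[of "1/10" n 3 "- \<beta>"] by auto
  have inner: "\<exists>K\<ge>0. bounded_derivs n I K (\<lambda>s. 1/2 * s powr a)" for a
  proof -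
    obtain K where K: "0 \<le> K" "bounded_derivs n {1/32<..<1} K (\<lambda>x. x powr a)"
      using bounded_derivs_powr[of "1/32" n 1 a] by auto
    show ?thesis
      by (intro exI[of _ "2 ^ n * \<bar>1/2\<bar> * K"] conjI bounded_derivs_mult[OF bounded_derivs_const K(2)[folded I_def]])
        (use K(1) in auto)
  qed
  obtain K2 where K2: "0 \<le> K2" "\<forall>g C. 0 \<le> C \<longrightarrow> bounded_derivs n J C g \<longrightarrow> bounded_derivs n I (K2 * C) (\<lambda>s. g (s powr (1/2)))"
  proof -
    obtain K where K: "0 \<le> K" "bounded_derivs n I K (\<lambda>s. 1/2 * s powr (1/2 - 1))" using inner by blast
    have "s powr (1/2) \<in> J" if "s \<in> I" for s
    proof -
      have "(1/10)\<^sup>2 < s" using that by (simp add: I_def power2_eq_square)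
      then have "1/10 < sqrt s" by (rule real_less_rsqrt)
      moreover have "sqrt s \<le> 1" using that by (simp add: I_def)
      ultimately have "1/10 < sqrt s" "sqrt s < 2" by linarith+
      moreover have "s powr (1/2) = sqrt s" using that by (simp add: I_def powr_half_sqrt)
      ultimately show ?thesis unfolding J_def greaterThanLessThan_iff by (simp only: simp_thms)
    qed
    moreover have "((\<lambda>s. s powr (1/2)) has_real_derivative 1/2 * s powr (1/2 - 1)) (at s)" if "s \<in> I" for s
      using that by (intro has_real_derivative_powr) (simp add: I_def)
    ultimately show thesis using bounded_derivs_compose[OF _ _ K(2,1), of "\<lambda>s. s powr (1/2)" J] that by blast
  qed
  obtain K3 where K3: "0 \<le> K3" "\<forall>g C. 0 \<le> C \<longrightarrow> bounded_derivs n UNIV C g \<longrightarrow> bounded_derivs n I (K3 * C) (\<lambda>s. g (1/2 * ln s))"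
  proof -
    obtain K where K: "0 \<le> K" "bounded_derivs n I K (\<lambda>s. 1/2 * s powr (- 1))" using inner by blast
    have "((\<lambda>s. 1/2 * ln s) has_real_derivative 1/2 * s powr (- 1)) (at s)" if "s \<in> I" for s
    proof -
      have s: "0 < s" using that by (simp add: I_def)
      have "s powr (- 1) = 1 / s" using s by (simp add: powr_minus_divide)
      then show ?thesis using DERIV_cmult[OF DERIV_ln_divide[OF s], of "1/2"] by simp
    qed
    then show thesis using bounded_derivs_compose[OF _ _ K(2,1), of "\<lambda>s. 1/2 * ln s" UNIV] that by blast
  qed
  define CV where "CV = 2 ^ n * (K2 * C3) * (K3 * c)"
  have CV: "0 \<le> CV" unfolding CV_def using K2(1) K3(1) C3(1) F(2) by simp
  define C where "C = 2 ^ n * (2 ^ n * CU * CV) + 1"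
  have C: "0 < C" unfolding C_def using CU CV by (simp add: add_nonneg_pos)
  show ?thesis
  proof (rule exI[of _ C], intro conjI allI impI C)
    fix t :: real assume t: "0 < t" "t \<le> 1"
    let ?f = "\<lambda>s. if s \<le> 1/32 then 0 else exp s * (H s - H (4 * s)) * b (sqrt (s / t))"
    let ?a = "t powr (\<beta> / 2)"
    have sq: "sqrt t \<le> 1" "0 < sqrt t" using t by auto
    have "bounded_derivs n J C3 (\<lambda>u. (sqrt t + u) powr (- \<beta>))"
    proof (rule bounded_derivs_shift[OF C3(2)])
      fix u assume "u \<in> J"
      then have "1/10 < u" "u < 2" by (auto simp: J_def)
      then have "1/10 < sqrt t + u" "sqrt t + u < 3" using sq by linarith+
      then show "sqrt t + u \<in> {1/10<..<3}" unfolding greaterThanLessThan_iff by (rule conjI)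
    qed
    from K2(2)[rule_format, OF C3(1) this]
    have V1: "bounded_derivs n I (K2 * C3) (\<lambda>s. (sqrt t + s powr (1/2)) powr (- \<beta>))" .
    have "bounded_derivs n UNIV c (\<lambda>u. F (- (1/2 * ln t) + u))" by (rule bounded_derivs_shift[OF F(1)]) simp
    from K3(2)[rule_format, OF F(2) this]
    have V2: "bounded_derivs n I (K3 * c) (\<lambda>s. F (- (1/2 * ln t) + 1/2 * ln s))" .
    have V: "bounded_derivs n I CV (\<lambda>s. (sqrt t + s powr (1/2)) powr (- \<beta>) * F (- (1/2 * ln t) + 1/2 * ln s))"
      unfolding CV_def by (rule bounded_derivs_mult[OF V1 V2]) (use K2(1) K3(1) C3(1) F(2) in auto)
    have UV: "bounded_derivs n I (2 ^ n * \<bar>?a\<bar> * (2 ^ n * CU * CV))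
       (\<lambda>s. ?a * ((exp (1 * s) * (H s + - 1 * H (4 * s + 0))) * ((sqrt t + s powr (1/2)) powr (- \<beta>) * F (- (1/2 * ln t) + 1/2 * ln s))))"
      by (rule bounded_derivs_mult[OF bounded_derivs_const bounded_derivs_mult[OF U V CU CV]]) (use CU CV in auto)
    have I: "open I" by (simp add: I_def)
    have "bounded_derivs n I (2 ^ n * \<bar>?a\<bar> * (2 ^ n * CU * CV)) ?f"
    proof (rule bounded_derivs_cong[OF UV I])
      fix s assume "s \<in> I"
      then have s: "1/32 < s" "0 < s" by (auto simp: I_def)
      have "b (sqrt (s / t)) = ?a * ((sqrt t + s powr (1/2)) powr (- \<beta>) * F (- (1/2 * ln t) + 1/2 * ln s))"
      proof -
        have "b (sqrt (s / t)) = (1 + sqrt (s / t)) powr (- \<beta>) * F (ln (sqrt (s / t)))" using s t by (intro b) simp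
        moreover have "ln (sqrt (s / t)) = - (1/2 * ln t) + 1/2 * ln s" using s t by (simp add: ln_sqrt ln_div)
        moreover have "(1 + sqrt (s / t)) powr (- \<beta>) = ?a * (sqrt t + s powr (1/2)) powr (- \<beta>)"
        proof -
          have "1 + sqrt (s / t) = (sqrt t + s powr (1/2)) / sqrt t"
            using s t by (simp add: real_sqrt_divide powr_half_sqrt add_divide_distrib)
          also have "\<dots> powr (- \<beta>) = (sqrt t + s powr (1/2)) powr (- \<beta>) / sqrt t powr (- \<beta>)"
            by (rule powr_divide)
          also have "sqrt t powr (- \<beta>) = t powr (- (\<beta> / 2))"
            using t by (simp add: powr_half_sqrt[symmetric] powr_powr)
          also have "(sqrt t + s powr (1/2)) powr (- \<beta>) / t powr (- (\<beta> / 2)) = ?a * (sqrt t + s powr (1/2)) powr (- \<beta>)"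
            using t by (simp add: powr_minus_divide)
          finally show ?thesis .
        qed
        ultimately show ?thesis by (simp only: mult.assoc)
      qed
      then show "?a * ((exp (1 * s) * (H s + - 1 * H (4 * s + 0))) * ((sqrt t + s powr (1/2)) powr (- \<beta>) * F (- (1/2 * ln t) + 1/2 * ln s))) = ?f s"
        using s by (simp add: mult_ac)
    qed
    then have "bounded_derivs n UNIV (2 ^ n * \<bar>?a\<bar> * (2 ^ n * CU * CV)) ?f"
    proof (rule bounded_derivs_extend[OF _ I, where K = "{1/16..1/2}"])
      \<comment> \<open>Between 1/32 and 1/16 both cutoffs are 1, above 1/2 both are 0, and up to
        1/32 the function is 0 by definition.\<close>
      show "?f s = 0" if s: "s \<notin> {1/16..1/2}" for s
      proof (cases "s \<le> 1/32")
        case False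
        then consider "s < 1/16" | "1/2 < s" using s by force
        then have "H s = H (4 * s)"
        proof cases
          case 1 then show ?thesis using H(3)[of s] H(3)[of "4 * s"] False by simp
        next
          case 2 then show ?thesis using H(4)[of s] H(4)[of "4 * s"] by simp
        qed
        then show ?thesis by simp
      qed simp
    qed (use CU CV in \<open>auto simp: I_def\<close>)
    then show "bounded_derivs n {-1<..<1} (C * ?a) ?f"
    proof (rule bounded_derivs_mono)
      have "2 ^ n * \<bar>?a\<bar> * (2 ^ n * CU * CV) = (2 ^ n * (2 ^ n * CU * CV)) * ?a" by simp
      also have "\<dots> \<le> C * ?a" unfolding C_def by (intro mult_right_mono) auto
      finally show "2 ^ n * \<bar>?a\<bar> * (2 ^ n * CU * CV) \<le> C * ?a" .
    qed simp
  qed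
qed

text \<open>The value at each x comes from some continuous representative, possibly another one for
  every x. All of these coincide, so for each y a single continuous function satisfies the bound
  everywhere. The Gaussian majorant is continuous in y and at most its prefactor.\<close>

lemma (in data_defined_space) kernel_operator_heat:
  assumes p: "1 \<le> p" and lin: "Lp_linear_operator M p D L" and cl: "closed_operator M p D L"
    and t: "0 < t" "t \<le> 1" and c: "0 < c" "0 < c1"
    and k: "\<And>y. (\<lambda>z. K t z y) \<in> D \<and> (\<forall>x. \<exists>v. has_value_at M (L (\<lambda>z. K t z y)) x v \<and>
           \<bar>v\<bar> \<le> c * t powr (- (q + r) / 2) * exp (- c1 * (dist x y)\<^sup>2 / t))"
    and h: "continuous_on UNIV h"
  shows "(\<lambda>x. \<integral>y. K t x y * h y \<partial>M) \<in> D \<and>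
       (\<exists>g. continuous_on UNIV g \<and> (AE x in M. L (\<lambda>x. \<integral>y. K t x y * h y \<partial>M) x = g x) \<and>
         (\<forall>x. \<bar>g x\<bar> \<le> (\<integral>y. c * t powr (- (q + r) / 2) * exp (- c1 * (dist x y)\<^sup>2 / t) * \<bar>h y\<bar> \<partial>M)))"
proof -
  have "\<exists>g. continuous_on UNIV g \<and> (AE x in M. L (\<lambda>z. K t z y) x = g x) \<and>
     (\<forall>x. \<bar>g x\<bar> \<le> c * t powr (- (q + r) / 2) * exp (- c1 * (dist x y)\<^sup>2 / t))" for y
  proof -
    obtain v0 where "has_value_at M (L (\<lambda>z. K t z y)) y v0" using k[of y] by blast
    then obtain g where g: "continuous_on UNIV g" "AE x in M. L (\<lambda>z. K t z y) x = g x" unfolding has_value_at_def by blast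
    have "\<bar>g x\<bar> \<le> c * t powr (- (q + r) / 2) * exp (- c1 * (dist x y)\<^sup>2 / t)" for x
    proof -
      obtain v where v: "has_value_at M (L (\<lambda>z. K t z y)) x v" "\<bar>v\<bar> \<le> c * t powr (- (q + r) / 2) * exp (- c1 * (dist x y)\<^sup>2 / t)"
        using k[of y] by blast
      have "has_value_at M (L (\<lambda>z. K t z y)) x (g x)" unfolding has_value_at_def using g by blast
      then have "g x = v" using v(1) by (rule has_value_at_unique)
      then show ?thesis using v(2) by simp
    qed
    then show ?thesis using g by blast
  qed
  then have "\<forall>y. \<exists>g. continuous_on UNIV g \<and> (AE x in M. L (\<lambda>z. K t z y) x = g x) \<and>
     (\<forall>x. \<bar>g x\<bar> \<le> c * t powr (- (q + r) / 2) * exp (- c1 * (dist x y)\<^sup>2 / t))" by blast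
  from choice[OF this] obtain \<Lambda> where \<Lambda>: "\<forall>y. continuous_on UNIV (\<Lambda> y) \<and> (AE x in M. L (\<lambda>z. K t z y) x = \<Lambda> y x) \<and>
     (\<forall>x. \<bar>\<Lambda> y x\<bar> \<le> c * t powr (- (q + r) / 2) * exp (- c1 * (dist x y)\<^sup>2 / t))" ..
  interpret Q: operator_on_kernel M lam \<phi> q p D L t \<Lambda> "\<lambda>x y. c * t powr (- (q + r) / 2) * exp (- c1 * (dist x y)\<^sup>2 / t)" "c * t powr (- (q + r) / 2)"
  proof unfold_locales
    show "continuous_on UNIV (\<lambda>y. c * t powr (- (q + r) / 2) * exp (- c1 * (dist x y)\<^sup>2 / t))" for x
      using t by (intro continuous_intros) auto
    show "c * t powr (- (q + r) / 2) * exp (- c1 * (dist x y)\<^sup>2 / t) \<le> c * t powr (- (q + r) / 2)" for x y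
      using c t by (intro mult_right_le_one_le) auto
  qed (use p lin cl t k \<Lambda> in auto)
  show ?thesis by (rule Q.operator_on_heat_integral[OF h])
qed

section \<open>Choice of the scale\<close>

lemma min_separation_props:
  fixes Y :: "'a::metric_space set"
  assumes Y: "finite Y" "2 \<le> card Y"
  shows "0 < min_separation Y" and "\<forall>x\<in>Y. \<forall>y\<in>Y. x \<noteq> y \<longrightarrow> min_separation Y \<le> dist x y"
    and "\<exists>x y :: 'a. min_separation Y = dist x y"
proof -
  define Z where "Z = {dist x y | x y. x \<in> Y \<and> y \<in> Y \<and> x \<noteq> y}"
  have "Z \<subseteq> (\<lambda>(x, y). dist x y) ` (Y \<times> Y)" unfolding Z_def by force
  then have Z: "finite Z" using Y(1) finite_subset by blast
  have "\<not> card Y \<le> 1" using Y(2) by simp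
  then obtain x y where "x \<in> Y" "y \<in> Y" "x \<noteq> y" using Y(1) card_le_Suc0_iff_eq by (metis One_nat_def)
  then have "Z \<noteq> {}" unfolding Z_def by blast
  then have m: "min_separation Y \<in> Z" unfolding min_separation_def Z_def[symmetric] using Z by (rule Min_in[rotated])
  from m show "0 < min_separation Y" unfolding Z_def by auto
  from m show "\<exists>x y :: 'a. min_separation Y = dist x y"
    unfolding Z_def mem_Collect_eq by (elim exE conjE, intro exI)
  show "\<forall>x\<in>Y. \<forall>y\<in>Y. x \<noteq> y \<longrightarrow> min_separation Y \<le> dist x y"
    unfolding min_separation_def Z_def[symmetric] using Z by (intro ballI impI Min_le) (auto simp: Z_def)
qed

context sobolev_setup
begin

text \<open>A set that contains y and has diameter below r lies in the ball of radius r around y,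
  which turns the support condition into an indicator.\<close>

lemma bump_derivative_bound:
  assumes g: "g \<in> Lp_space M \<infinity>" "Lp_norm M \<infinity> g \<le> c" "0 \<le> c" and V: "y \<in> interior V" "bounded V" "diameter V < r"
    and g0: "AE x in M. x \<notin> V \<longrightarrow> g x = 0"
  shows "g \<in> borel_measurable M \<and> (AE z in M. \<bar>g z\<bar> \<le> c * indicator (ball y r) z)"
proof -
  have i1: "1 \<le> (\<infinity> :: ereal)" by simp
  have "Lp_bounded M \<infinity> c g" using Lp_bounded_iff[OF i1 g(3)] g(1,2) by blast
  then have "AE x in M. \<bar>g x\<bar> \<le> c" "g \<in> borel_measurable M" by (auto simp: Lp_bounded_def)
  moreover have "z \<in> ball y r" if "z \<in> V" for z
  proof -
    have "y \<in> V" using V(1) interior_subset by blast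
    then have "dist y z \<le> diameter V" using diameter_bounded_bound[OF V(2)] that by blast
    then show ?thesis using V(3) by simp
  qed
  ultimately show ?thesis using g0 by (auto elim!: eventually_elim2 simp: indicator_def)
qed

text \<open>The constants come from the cutoff, from \<open>residual_bound\<close> and from a bound
  on the distances in the space, so they are the same for all n. With N of order 1 / eta and t = 1 /
  N^2, the ratio sqrt t / eta is small enough for a contraction by 1/2.\<close>

lemma theorem_at_scale:
  fixes Y :: "nat \<Rightarrow> 'a set"
  assumes c: "0 < c" and S: "\<And>n. 1 \<le> n \<Longrightarrow> finite (Y n) \<and> 2 \<le> card (Y n)"
    and bump: "\<And>n. 1 \<le> n \<Longrightarrow> bump_functions M lam \<phi> p \<beta> b R D L ord (Y n) c"
  shows "\<exists>c>0. \<exists>c\<^sub>1>0. \<exists>c\<^sub>2>0. \<forall>n\<ge>1. \<exists>N::nat.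
    c\<^sub>1 * real N \<le> inverse (min_separation (Y n)) \<and>
    inverse (min_separation (Y n)) \<le> c\<^sub>2 * real N \<and>
    (\<exists>P. class_map M W_space (diffusion_polys lam \<phi> (real N)) P \<and>
      (\<forall>f\<in>W_space. interpolates M R D L (Y n) f (P f) \<and>
        sobolev_norm M lam \<phi> p b (\<lambda>x. f x - P f x)
          \<le> c * (INF T\<in>diffusion_polys lam \<phi> (real N). sobolev_norm M lam \<phi> p b (\<lambda>x. f x - T x)))) \<and>
    (\<exists>P. class_map M W_space (diffusion_polys lam \<phi> (real N)) P \<and>
      (\<forall>f\<in>W_space. is_arg_min (sobolev_norm M lam \<phi> p b)
          (\<lambda>Q. Q \<in> diffusion_polys lam \<phi> (real N) \<and> interpolates M R D L (Y n) f Q) (P f)))"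
proof -
  obtain C where C: "0 < C" "\<forall>Y \<eta> t f g \<Psi>. finite Y \<longrightarrow> (\<forall>x\<in>Y. \<forall>y\<in>Y. x \<noteq> y \<longrightarrow> \<eta> \<le> dist x y) \<longrightarrow> 0 < \<eta> \<longrightarrow>
     0 < t \<longrightarrow> t \<le> 1 \<longrightarrow> sqrt t \<le> \<eta> \<longrightarrow> f \<in> Lp_space M p \<longrightarrow> is_sobolev_deriv M lam \<phi> p b f g \<longrightarrow>
     (\<forall>k\<in>{1..R}. \<forall>y\<in>Y. \<Psi> k y \<in> borel_measurable M \<and> (AE z in M. \<bar>\<Psi> k y z\<bar> \<le> c * \<eta> powr (ord k - \<beta>) * indicator (ball y (\<eta> / 2)) z)) \<longrightarrow>
     Lp_norm M p (\<lambda>z. \<Sum>k\<in>{1..R}. \<Sum>y\<in>Y. ev k (\<lambda>x. f x - multiplier H t f x) y * \<Psi> k y z) \<le> C * (sqrt t / \<eta>) powr \<delta> * Lp_norm M p g"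
    using residual_bound[OF c] by (elim exE conjE)
  obtain Rd where Rd: "0 < Rd" "\<And>x y :: 'a. dist x y \<le> Rd" using bounded_space by blast
  \<comment> \<open>The ratio sqrt t / eta will be at most 1 / A, and C (1 / A)^\<delta> <= 1/2. The
    maximum with 1 ensures sqrt t <= eta and 1 / eta <= N.\<close>
  define A where "A = max 1 ((2 * C) powr (1 / \<delta>))"
  have A1: "1 \<le> A" by (simp add: A_def)
  have A2: "C * (1 / A) powr \<delta> \<le> 1/2"
  proof -
    have "2 * C = ((2 * C) powr (1 / \<delta>)) powr \<delta>" using C(1) \<delta> by (simp add: powr_powr)
    also have "\<dots> \<le> A powr \<delta>" using \<delta> by (intro powr_mono2) (auto simp: A_def)
    finally have "2 * C \<le> A powr \<delta>" .
    moreover have "0 < A powr \<delta>" using A1 by simp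
    ultimately have "C / A powr \<delta> \<le> 1/2" by (subst pos_divide_le_eq) linarith+
    moreover have "C * (1 / A) powr \<delta> = C / A powr \<delta>" by (simp add: powr_divide)
    ultimately show ?thesis by (simp only:)
  qed
  show ?thesis
  proof (rule exI[of _ "1 + 2 * CH"], rule conjI, use CH(1) in simp, rule exI[of _ "1 / (A + Rd)"], rule conjI, use A1 Rd(1) in simp,
      rule exI[of _ 1], rule conjI, simp, intro allI impI)
    fix n :: nat assume n: "1 \<le> n"
    define \<eta> where "\<eta> = min_separation (Y n)"
    have Y: "finite (Y n)" "2 \<le> card (Y n)" using S[OF n] by auto
    have \<eta>: "0 < \<eta>" and sep: "\<forall>x\<in>Y n. \<forall>y\<in>Y n. x \<noteq> y \<longrightarrow> \<eta> \<le> dist x y" and ex: "\<exists>x y :: 'a. \<eta> = dist x y"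
      unfolding \<eta>_def by (rule min_separation_props[OF Y])+
    have \<eta>R: "\<eta> \<le> Rd" using ex Rd(2) by blast
    define N where "N = nat \<lceil>A / \<eta>\<rceil>"
    have A0: "0 < A / \<eta>" using A1 \<eta> by simp
    then have "0 \<le> \<lceil>A / \<eta>\<rceil>" by simp
    then have rN: "real N = of_int \<lceil>A / \<eta>\<rceil>" by (simp add: N_def)
    have Nge: "A / \<eta> \<le> real N" unfolding rN by (rule le_of_int_ceiling)
    have Nle: "real N \<le> A / \<eta> + 1" unfolding rN by (rule of_int_ceiling_le_add_one)
    have N0: "0 < N" using Nge A0 by (cases N) auto
    define t where "t = 1 / (real N)\<^sup>2"
    have N1: "1 \<le> real N" using N0 by simp
    have t: "0 < t" "t \<le> 1" unfolding t_def using N1 one_le_power[OF N1, of 2] by (auto simp: divide_le_eq)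
    have st: "sqrt t = 1 / real N" unfolding t_def by (simp add: real_sqrt_divide)
    have stA: "sqrt t / \<eta> \<le> 1 / A"
      unfolding st using Nge \<eta> A1 N1 by (simp add: field_simps)
    moreover have "1 / A \<le> 1" using A1 by simp
    ultimately have "sqrt t / \<eta> \<le> 1" by linarith
    then have st\<eta>: "sqrt t \<le> \<eta>" using \<eta> by (simp add: divide_le_eq)
    have fac: "C * (sqrt t / \<eta>) powr \<delta> \<le> 1/2"
    proof -
      have "(sqrt t / \<eta>) powr \<delta> \<le> (1 / A) powr \<delta>" using stA \<delta> t \<eta> by (intro powr_mono2) auto
      then have "C * (sqrt t / \<eta>) powr \<delta> \<le> C * (1 / A) powr \<delta>" using C(1) by (intro mult_left_mono) auto
      then show ?thesis using A2 by linarith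
    qed
    obtain \<psi> where \<psi>: "\<forall>k\<in>{1..R}. \<forall>y\<in>Y n.
        \<psi> k y \<in> sobolev_space M lam \<phi> p b \<and>
        (\<forall>i\<in>{1..R}. \<psi> k y \<in> D i) \<and>
        (\<forall>i\<in>{1..R}. i \<noteq> k \<longrightarrow> (AE x in M. L i (\<psi> k y) x = 0)) \<and>
        (\<forall>i\<in>{1..R}. \<forall>z\<in>Y n. has_value_at M (L i (\<psi> k y)) z (if i = k \<and> z = y then 1 else 0)) \<and>
        (\<exists>V. y \<in> interior V \<and> bounded V \<and> diameter V \<le> min_separation (Y n) / 3 \<and>
           (AE x in M. x \<notin> V \<longrightarrow> \<psi> k y x = 0) \<and>
           (AE x in M. x \<notin> V \<longrightarrow> sobolev_deriv M lam \<phi> p b (\<psi> k y) x = 0)) \<and>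
        sobolev_deriv M lam \<phi> p b (\<psi> k y) \<in> Lp_space M \<infinity> \<and>
        Lp_norm M \<infinity> (sobolev_deriv M lam \<phi> p b (\<psi> k y)) \<le> c * min_separation (Y n) powr (ord k - \<beta>)"
      using bump[OF n] unfolding bump_functions_def by (rule exE)
    define \<Psi> where "\<Psi> = (\<lambda>k y. sobolev_deriv M lam \<phi> p b (\<psi> k y))"
    have d: "\<psi> k y \<in> Lp_space M p \<and> is_deriv (\<psi> k y) (\<Psi> k y)" if "k \<in> {1..R}" "y \<in> Y n" for k y
    proof -
      have "\<psi> k y \<in> W_space" using \<psi> that by blast
      then show ?thesis unfolding sobolev_space_def \<Psi>_def using sobolev_deriv_is by blast
    qed
    have val: "ev i (\<psi> k y) z = (if i = k \<and> z = y then 1 else 0)"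
      if "k \<in> {1..R}" "y \<in> Y n" "i \<in> {1..R}" "z \<in> Y n" for k y i z
      by (rule has_value_ev) (use \<psi> that in blast)
    have Ps: "\<forall>k\<in>{1..R}. \<forall>y\<in>Y n. \<Psi> k y \<in> borel_measurable M \<and> (AE z in M. \<bar>\<Psi> k y z\<bar> \<le> c * \<eta> powr (ord k - \<beta>) * indicator (ball y (\<eta> / 2)) z)"
    proof (intro ballI)
      fix k y assume ky: "k \<in> {1..R}" "y \<in> Y n"
      note P = \<psi>[THEN bspec, OF ky(1), THEN bspec, OF ky(2)]
      from P obtain V where V: "y \<in> interior V" "bounded V" "diameter V \<le> \<eta> / 3" "AE x in M. x \<notin> V \<longrightarrow> \<Psi> k y x = 0"
        unfolding \<eta>_def \<Psi>_def by blast
      have g: "\<Psi> k y \<in> Lp_space M \<infinity>" "Lp_norm M \<infinity> (\<Psi> k y) \<le> c * \<eta> powr (ord k - \<beta>)"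
        using P unfolding \<eta>_def \<Psi>_def by blast+
      show "\<Psi> k y \<in> borel_measurable M \<and> (AE z in M. \<bar>\<Psi> k y z\<bar> \<le> c * \<eta> powr (ord k - \<beta>) * indicator (ball y (\<eta> / 2)) z)"
        by (rule bump_derivative_bound[OF g _ V(1,2) _ V(4)]) (use c V(3) \<eta> in auto)
    qed
    have contr: "Lp_norm M p (\<lambda>x. \<Sum>k\<in>{1..R}. \<Sum>y\<in>Y n. ev k (\<lambda>x. f x - multiplier H t f x) y * \<Psi> k y x) \<le> 1/2 * Lp_norm M p g"
      if fg: "f \<in> Lp_space M p" "is_deriv f g" for f g
    proof -
      have "Lp_norm M p (\<lambda>x. \<Sum>k\<in>{1..R}. \<Sum>y\<in>Y n. ev k (\<lambda>x. f x - multiplier H t f x) y * \<Psi> k y x) \<le> C * (sqrt t / \<eta>) powr \<delta> * Lp_norm M p g"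
        by (rule C(2)[THEN spec, THEN spec, THEN spec, THEN spec, THEN spec, THEN spec, THEN mp, OF Y(1), THEN mp, OF sep, THEN mp, OF \<eta>,
            THEN mp, OF t(1), THEN mp, OF t(2), THEN mp, OF st\<eta>, THEN mp, OF fg(1), THEN mp, OF fg(2), THEN mp, OF Ps])
      also have "\<dots> \<le> 1/2 * Lp_norm M p g" by (rule mult_right_mono[OF fac Lp_norm_nonneg[OF p is_deriv_Lp[OF fg(2)]]])
      finally show ?thesis .
    qed
    \<comment> \<open>Rounding up adds at most 1, which is at most Rd / eta because the separation
      is itself a distance in the space.\<close>
    have low: "1 / (A + Rd) * real N \<le> inverse \<eta>"
    proof -
      have "real N \<le> (A + \<eta>) / \<eta>" using Nle \<eta> by (simp add: add_divide_distrib)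
      also have "\<dots> \<le> (A + Rd) / \<eta>" using \<eta>R \<eta> by (intro divide_right_mono) auto
      finally have "1 / (A + Rd) * real N \<le> 1 / (A + Rd) * ((A + Rd) / \<eta>)" using A1 Rd(1) by (intro mult_left_mono) auto
      also have "\<dots> = inverse \<eta>" using A1 Rd(1) by (simp add: inverse_eq_divide)
      finally show ?thesis .
    qed
    have up: "inverse \<eta> \<le> 1 * real N"
    proof -
      have "inverse \<eta> = 1 / \<eta>" by (simp add: inverse_eq_divide)
      also have "\<dots> \<le> A / \<eta>" using A1 \<eta> by (intro divide_right_mono) auto
      finally show ?thesis using Nge by simp
    qed
    show "\<exists>N::nat. 1 / (A + Rd) * real N \<le> inverse (min_separation (Y n)) \<and>
      inverse (min_separation (Y n)) \<le> 1 * real N \<and>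
      (\<exists>P. class_map M W_space (diffusion_polys lam \<phi> (real N)) P \<and>
        (\<forall>f\<in>W_space. interpolates M R D L (Y n) f (P f) \<and>
          sobolev_norm M lam \<phi> p b (\<lambda>x. f x - P f x)
            \<le> (1 + 2 * CH) * (INF T\<in>diffusion_polys lam \<phi> (real N). sobolev_norm M lam \<phi> p b (\<lambda>x. f x - T x)))) \<and>
      (\<exists>P. class_map M W_space (diffusion_polys lam \<phi> (real N)) P \<and>
        (\<forall>f\<in>W_space. is_arg_min (sobolev_norm M lam \<phi> p b)
            (\<lambda>Q. Q \<in> diffusion_polys lam \<phi> (real N) \<and> interpolates M R D L (Y n) f Q) (P f)))"
      unfolding \<eta>_def[symmetric]
      by (intro exI[of _ N] conjI low up interpolation_at[OF Y(1) N0 t_def d val contr])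
  qed
qed

end

theorem theorem2p2:
  fixes M :: "'a::metric_space measure"
    and lam :: "nat \<Rightarrow> real" and \<phi> :: "nat \<Rightarrow> 'a \<Rightarrow> real" and q :: real
    and S R :: nat and p :: ereal and \<beta> :: real and b :: "real \<Rightarrow> real"
    and D :: "nat \<Rightarrow> ('a \<Rightarrow> real) set" and L :: "nat \<Rightarrow> ('a \<Rightarrow> real) \<Rightarrow> 'a \<Rightarrow> real"
    and ord :: "nat \<Rightarrow> real" and Y :: "nat \<Rightarrow> 'a set"
  assumes "data_defined_space M lam \<phi> q"
    and "real S > q"
    and "1 \<le> p"
    and "1 \<le> R"
    and "\<And>k. k \<in> {1..R} \<Longrightarrow> 0 \<le> ord k"
    and "ereal (Max (ord ` {1..R})) + ereal q / p < ereal \<beta>"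
    and "mask_of_type S \<beta> b"
    and "\<And>n. 1 \<le> n \<Longrightarrow> finite (Y n) \<and> 2 \<le> card (Y n)"
    and "\<And>k. k \<in> {1..R} \<Longrightarrow> Lp_linear_operator M p (D k) (L k)"
    and "\<And>k. k \<in> {1..R} \<Longrightarrow> closed_operator M p (D k) (L k)"
    and "\<And>k. k \<in> {1..R} \<Longrightarrow> local_operator M (D k) (L k)"
    and "\<And>k. k \<in> {1..R} \<Longrightarrow> kernel_bound_operator M lam \<phi> q (D k) (L k) (ord k)"
    and "\<exists>c>0. \<forall>n\<ge>1. bump_functions M lam \<phi> p \<beta> b R D L ord (Y n) c"
  shows "\<exists>c>0. \<exists>c\<^sub>1>0. \<exists>c\<^sub>2>0. \<forall>n\<ge>1. \<exists>N::nat.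
    c\<^sub>1 * real N \<le> inverse (min_separation (Y n)) \<and>
    inverse (min_separation (Y n)) \<le> c\<^sub>2 * real N \<and>
    (\<exists>P. class_map M (sobolev_space M lam \<phi> p b) (diffusion_polys lam \<phi> (real N)) P \<and>
      (\<forall>f\<in>sobolev_space M lam \<phi> p b.
        interpolates M R D L (Y n) f (P f) \<and>
        sobolev_norm M lam \<phi> p b (\<lambda>x. f x - P f x)
          \<le> c * (INF T\<in>diffusion_polys lam \<phi> (real N). sobolev_norm M lam \<phi> p b (\<lambda>x. f x - T x)))) \<and>
    (\<exists>P. class_map M (sobolev_space M lam \<phi> p b) (diffusion_polys lam \<phi> (real N)) P \<and>
      (\<forall>f\<in>sobolev_space M lam \<phi> p b.
        is_arg_min (sobolev_norm M lam \<phi> p b)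
          (\<lambda>Q. Q \<in> diffusion_polys lam \<phi> (real N) \<and> interpolates M R D L (Y n) f Q) (P f)))"
proof -
  interpret data_defined_space M lam \<phi> q by (rule assms(1))
  note p = assms(3)
  obtain F c0 where F: "\<forall>t>0. b t = (1 + t) powr (- \<beta>) * F (ln t)" "cont_diff (S + 1) F"
    "0 < c0" "\<forall>k\<le>S + 1. \<forall>t. \<bar>(deriv ^^ k) F t\<bar> \<le> c0"
    using assms(7) unfolding mask_of_type_def by blast
  have Fb: "bounded_derivs (S + 1) UNIV c0 F"
    using F(2,4) unfolding cont_diff_def by (intro bounded_derivs_iterated_deriv) auto
  obtain H C0 where H: "0 \<le> C0" "bounded_derivs (S + 1) {-5<..<5} C0 H" "\<forall>s\<in>{-5<..1/4}. H s = 1" "\<forall>s\<ge>1/2. H s = 0"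
    using cutoff_exists[of "S + 1"] by blast
  \<comment> \<open>For 0 <= s <= 1/32 both cutoffs are 1 and their difference is 0; the case
    distinction extends this value to negative s, where the multiplier estimate also asks for
    bounded derivatives.\<close>
  define W where "W = (\<lambda>t s. if s \<le> 1/32 then 0 else exp s * (H s - H (4 * s)) * b (sqrt (s / t)))"
  obtain Cw where Cw: "0 < Cw" "\<And>t. 0 < t \<Longrightarrow> t \<le> 1 \<Longrightarrow> bounded_derivs (S + 1) {-1<..<1} (Cw * t powr (\<beta> / 2)) (W t)"
    using mask_window[of b \<beta> F "S + 1" c0 C0 H] F(1,3) Fb H unfolding W_def by auto
  obtain B where B: "0 < B" "\<forall>p g C t h. 1 \<le> p \<longrightarrow> 0 < C \<longrightarrow> 0 < t \<longrightarrow> t \<le> 1 \<longrightarrow> bounded_derivs (S + 1) {-1<..<1} C g \<longrightarrow> (\<forall>s\<ge>1/2. g s = 0) \<longrightarrow>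
     h \<in> Lp_space M p \<longrightarrow> multiplier g t h \<in> Lp_space M p \<and> Lp_norm M p (multiplier g t h) \<le> B * C * Lp_norm M p h"
    using multiplier_Lp_bound[OF assms(2)] by (elim exE conjE)
  \<comment> \<open>The bound C0 may be 0, while \<open>multiplier_Lp_bound\<close> takes a positive
    one; hence C0 + 1.\<close>
  have CHb: "Lp_norm M p (multiplier H t h) \<le> B * (C0 + 1) * Lp_norm M p h" if "0 < t" "t \<le> 1" "h \<in> Lp_space M p" for t h
  proof -
    have "bounded_derivs (S + 1) {-1<..<1} (C0 + 1) H" by (rule bounded_derivs_mono[OF H(2)]) auto
    moreover have "0 < C0 + 1" using H(1) by simp
    ultimately show ?thesis using B(2) p that H(4) by blast
  qed
  have CWb: "Lp_norm M p (multiplier (W t) t h) \<le> (B * Cw) * t powr (\<beta> / 2) * Lp_norm M p h" if t: "0 < t" "t \<le> 1" and h: "h \<in> Lp_space M p" for t h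
  proof -
    have "\<forall>s\<ge>1/2. W t s = 0" using H(4) by (auto simp: W_def)
    moreover have "0 < Cw * t powr (\<beta> / 2)" using Cw(1) t by simp
    ultimately have "Lp_norm M p (multiplier (W t) t h) \<le> B * (Cw * t powr (\<beta> / 2)) * Lp_norm M p h"
      using B(2) p t h Cw(2)[OF t] by blast
    then show ?thesis by (simp only: mult.assoc)
  qed
  \<comment> \<open>The gap in the strict inequality for \<beta>. The quotient of q by infinity is 0
    there, in agreement with \<open>recip\<close>.\<close>
  define \<delta> where "\<delta> = \<beta> - Max (ord ` {1..R}) - q * recip p"
  have \<delta>: "0 < \<delta>"
    using p
  proof (cases rule: exponent_cases)
    case 1 then show ?thesis using assms(6) by (simp add: \<delta>_def)
  next
    case (2 r) then show ?thesis using assms(6) by (simp add: \<delta>_def)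
  qed
  have ordb: "0 \<le> ord k \<and> ord k + q * recip p + \<delta> \<le> \<beta>" if "k \<in> {1..R}" for k
  proof -
    have "ord k \<le> Max (ord ` {1..R})" using that by (intro Max_ge) auto
    then show ?thesis using assms(5)[OF that] by (simp add: \<delta>_def)
  qed
  have "\<forall>k\<in>{1..R}. \<exists>c. 0 < c \<and> (\<exists>c1>0. \<forall>t y. 0 < t \<and> t \<le> 1 \<longrightarrow>
        (\<lambda>z. K t z y) \<in> D k \<and> (\<forall>x. \<exists>v. has_value_at M (L k (\<lambda>z. K t z y)) x v \<and>
           \<bar>v\<bar> \<le> c * t powr (- (q + ord k) / 2) * exp (- c1 * (dist x y)\<^sup>2 / t)))"
    using assms(12) unfolding kernel_bound_operator_def by blast
  from bchoice[OF this] obtain cL where cL: "\<forall>k\<in>{1..R}. 0 < cL k \<and> (\<exists>c1>0. \<forall>t y. 0 < t \<and> t \<le> 1 \<longrightarrow>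
        (\<lambda>z. K t z y) \<in> D k \<and> (\<forall>x. \<exists>v. has_value_at M (L k (\<lambda>z. K t z y)) x v \<and>
           \<bar>v\<bar> \<le> cL k * t powr (- (q + ord k) / 2) * exp (- c1 * (dist x y)\<^sup>2 / t)))" ..
  then have "\<forall>k\<in>{1..R}. \<exists>c1. 0 < c1 \<and> (\<forall>t y. 0 < t \<and> t \<le> 1 \<longrightarrow>
        (\<lambda>z. K t z y) \<in> D k \<and> (\<forall>x. \<exists>v. has_value_at M (L k (\<lambda>z. K t z y)) x v \<and>
           \<bar>v\<bar> \<le> cL k * t powr (- (q + ord k) / 2) * exp (- c1 * (dist x y)\<^sup>2 / t)))" by blast
  from bchoice[OF this] obtain c1L where c1L: "\<forall>k\<in>{1..R}. 0 < c1L k \<and> (\<forall>t y. 0 < t \<and> t \<le> 1 \<longrightarrow>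
        (\<lambda>z. K t z y) \<in> D k \<and> (\<forall>x. \<exists>v. has_value_at M (L k (\<lambda>z. K t z y)) x v \<and>
           \<bar>v\<bar> \<le> cL k * t powr (- (q + ord k) / 2) * exp (- c1L k * (dist x y)\<^sup>2 / t)))" ..
  have cpos: "0 < cL k \<and> 0 < c1L k" if "k \<in> {1..R}" for k using cL c1L that by blast
  have lam0: "0 \<le> lam k" for k using lam_mono lam_0 by (metis le0 monoD)
  \<comment> \<open>The two multiplier constants are B times a bound on derivatives: of H for the
    smoothing, and of \<open>W t\<close> for the dyadic pieces, where the factor t^(\<beta>/2) is
    kept apart.\<close>
  interpret sobolev_setup M lam \<phi> q R p \<beta> \<delta> "B * (C0 + 1)" "B * Cw" b H W D L ord cL c1L
  proof (unfold_locales, goal_cases)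
    case (3 k) show ?case by (rule mask_pos[OF assms(7) lam0])
  next
    case (10 t s)
    have "H s - H (4 * s) = 0" if "s \<le> 1/32" using that 10 H(3) by simp
    then show ?case by (simp add: W_def)
  next
    case (16 k t h)
    have "(\<lambda>z. K t z y) \<in> D k \<and> (\<forall>x. \<exists>v. has_value_at M (L k (\<lambda>z. K t z y)) x v \<and>
           \<bar>v\<bar> \<le> cL k * t powr (- (q + ord k) / 2) * exp (- c1L k * (dist x y)\<^sup>2 / t))" for y
      using c1L 16(1-3) by blast
    from kernel_operator_heat[OF p assms(9,10)[OF 16(1)] 16(2,3) cpos[OF 16(1), THEN conjunct1] cpos[OF 16(1), THEN conjunct2] this 16(4)]
    show ?case .
  qed (use p assms(4) \<delta> ordb H B(1) Cw(1) CHb CWb assms(9,10) cpos in auto)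
  obtain c where c: "0 < c" "\<forall>n\<ge>1. bump_functions M lam \<phi> p \<beta> b R D L ord (Y n) c" using assms(13) by blast
  show ?thesis by (rule theorem_at_scale[OF c(1) assms(8)]) (use c(2) in auto)
qed

end
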